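(* For all integers $a,b\ge0$, $$\zeta^\star(\{2\}^a,4,\{2\}^b)=S_1+S_2+S_3,$$ where (all summation variables run over integers $\ge0$) \begin{align*} S_1={}&\sum_{p+q=a}8\,\zeta(\overline{2q})\zeta(2b+2,2p+2)-\sum_{r+s=b}8\,\delta_{a>0}\,\zeta(\overline{2s})\zeta(2a+1,2r+3)\\ &-\sum_{2u+i+j=2a+2b}2\bigg(\frac1{2^i}\binom{i+1}{2b+1}+\frac1{2^j}\binom{j+1}{2a+1-2u}\bigg)\zeta(\overline{2u})\zeta(i+2,j+2), \end{align*} \begin{align*} S_2={}&\sum_{\substack{p+q=a\\ r+s=b-1}}\bigg(\frac1{2^{2q+2s}}\zeta(2q+2s+3)-8\,\zeta(\overline{2s+2q+3})\bigg)\binom{2+2q+2s}{1+2s}\zeta(2r+3)\zeta(\overline{2p})\\ &+\sum_{u+v+w=a-1}8\binom{2w+2b+2}{2b+1}\zeta(2u+3)\zeta(\overline{2v})\zeta(\overline{2b+2w+3})\\ &-\sum_{p+q=a-2}8\,\zeta(2p+3)\zeta(2q+3)\zeta(\overline{2b+2})+\sum_{r+s=b}8\,\zeta(2a+1)\zeta(2r+3)\zeta(\overline{2s})\\ &+\sum_{u+v+w=b-1}4\,\delta_{a=0}\,\zeta(2u+3)\zeta(2v+3)\zeta(\overline{2w})\\ &+\sum_{\substack{p+q=a-1\\ r+s=b+1}}8\binom{2q+2s}{2s}\zeta(\overline{2r})\zeta(2p+3)\zeta(2q+2s+1)\\ &-\sum_{u+v+w=b}8\binom{2a+2v}{2v}\zeta(\overline{2u})\zeta(2w+3)\zeta(2a+2v+1),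 \end{align*} \begin{align*} S_3={}&-\sum_{\substack{i+j=2a\\ r+s=2b+2}}3\zeta(2)\frac{(-1)^rE_{i+r}E_{j+s}}{i!\,j!\,r!\,s!}\Big(\frac{\mathrm i\pi}2\Big)^{2a+2b+2}\\ &+\sum_{\substack{i+j=2a\\ r+s+2t=2b}}3\zeta(2)\frac{(-1)^rE_{i+r}E_{j+s}}{i!\,j!\,r!\,s!}\Big(\frac{\mathrm i\pi}2\Big)^{2a+2b-2t}\zeta(2t+2)\\ &+2\,\zeta(\overline{2a+2b+4})+\sum_{p+q=a+1}\frac4{2^{2p+2b}}\binom{2p+2b}{2b+1}\zeta(2p+2b+2)\zeta(\overline{2q})\\ &+\sum_{u+v+w=a}8\binom{2u+2b+1}{2b+1}\zeta(\overline{2w})\zeta(2v+2)\zeta(\overline{2u+2b+2})\\ &+\sum_{r+s=b+1}4\bigg(\binom{2a+2r+1}{2a+1}-\binom{2a+2r+1}{2r+1}\bigg)\zeta(2a+2r+2)\zeta(\overline{2s})\\ &-\sum_{r+s=b+1}4\,\zeta(2a+2r+2)\zeta(\overline{2s})-\sum_{u+v+w=b}4\,\delta_{a=0}\,\zeta(2u+2)\zeta(2v+2)\zeta(\overline{2w})\\ &+\sum_{r+s=b+1}8\,\delta_{a=0}\,\zeta(2r+2)\zeta(\overline{2s})-8\,\delta_{a=0}\,\zeta(2)\zeta(\overline{2b+2}). \end{align*}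
   Context: For positive integers $k_i$ with $k_d\ge2$: $\zeta(k_1,\dots,k_d)=\sum_{0<n_1<\cdots<n_d}n_1^{-k_1}\cdots n_d^{-k_d}$ (multiple zeta value) and $\zeta^\star(k_1,\dots,k_d)=\sum_{0<n_1\le\cdots\le n_d}n_1^{-k_1}\cdots n_d^{-k_d}$ (multiple zeta star value); $\{2\}^m$ denotes $2$ repeated $m$ times. In the formula, $\zeta(\overline n)$ is shorthand for $-(1-2^{1-n})\zeta(n)$, with the conventions $\zeta(0)=\zeta(\overline0)=-\tfrac12$ and $\zeta(1)=0$. $E_n$ is the $n$-th Euler number, $\operatorname{sech}(t)=\sum_{n\ge0}\frac{E_n}{n!}t^n$. $\delta_{P}$ is $1$ if the condition $P$ holds and $0$ otherwise. Here $\mathrm i=\sqrt{-1}$ in powers of $\mathrm i\pi/2$, while $i$ elsewhere is a summation index. Empty sums are $0$, and $\binom nk=0$ for $k<0$ or $k>n$ ($n\ge0$). *)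

theory Defs
  imports "HOL-Analysis.Analysis"
begin

definition mzv :: "nat list \<Rightarrow> real" where
  "mzv ks = (\<Sum>\<^sub>\<infinity>ns \<in> {ns. length ns = length ks \<and> sorted_wrt (<) ns \<and> (\<forall>n\<in>set ns. 0 < n)}.
     \<Prod>i<length ks. 1 / real (ns ! i) ^ (ks ! i))"

definition mzsv :: "nat list \<Rightarrow> real" where
  "mzsv ks = (\<Sum>\<^sub>\<infinity>ns \<in> {ns. length ns = length ks \<and> sorted_wrt (\<le>) ns \<and> (\<forall>n\<in>set ns. 0 < n)}.
     \<Prod>i<length ks. 1 / real (ns ! i) ^ (ks ! i))"

(* The values at 0 and 1 are conventions; the value at 1 regularises the divergent series to 0. *)
definition zt :: "nat \<Rightarrow> real" where
  "zt n = (if n = 0 then - 1 / 2 else if n = 1 then 0 else mzv [n])"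

(* Barred argument; at n = 0 the formula gives zt 0 = - 1 / 2, in accordance with the convention. *)
definition ztbar :: "nat \<Rightarrow> real" where
  "ztbar n = - (1 - 2 powi (1 - int n)) * zt n"

lemma ztbar_0: "ztbar 0 = - 1 / 2"
  by (simp add: ztbar_def zt_def)

(* Euler numbers as the coefficients of sech t = 2 / (exp t + exp (- t)) (so E 2 = - 1, E 4 = 5). *)
definition euler_number :: "nat \<Rightarrow> real" where
  "euler_number n = fact n * fps_nth (inverse (fps_const (1 / 2) * (fps_exp 1 + fps_exp (- 1)))) n"

lemma sech_has_fps_expansion:
  "(\<lambda>t::real. 1 / cosh t) has_fps_expansion Abs_fps (\<lambda>n. euler_number n / fact n)"
proof -
  have "(\<lambda>t::real. inverse ((1 / 2) * (exp (1 * t) + exp (- 1 * t)))) has_fps_expansion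
      inverse (fps_const (1 / 2) * (fps_exp 1 + fps_exp (- 1)))"
    by (intro has_fps_expansion_inverse has_fps_expansion_mult has_fps_expansion_add
        has_fps_expansion_const has_fps_expansion_exp) simp
  moreover have "inverse (fps_const (1 / 2) * (fps_exp 1 + fps_exp (- 1)))
      = Abs_fps (\<lambda>n. euler_number n / fact n)"
    by (simp add: euler_number_def fps_eq_iff)
  ultimately show ?thesis
    by (simp add: cosh_def inverse_eq_divide)
qed

(* Binomial coefficient with an integer lower index, zero if that index is negative. *)
definition binom :: "nat \<Rightarrow> int \<Rightarrow> nat" where
  "binom n k = (if k < 0 then 0 else n choose nat k)"

(* In the sums below an index condition such as p + q = a - 1 is written p + q + 1 = a, so that
   natural-number subtraction does not truncate and the sum is empty when a = 0. *)

definition S1 :: "nat \<Rightarrow> nat \<Rightarrow> real" where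
  "S1 a b =
     (\<Sum>(p, q) \<in> {(p, q). p + q = a}. 8 * ztbar (2 * q) * mzv [2 * b + 2, 2 * p + 2])
   - (\<Sum>(r, s) \<in> {(r, s). r + s = b}. 8 * of_bool (a > 0) * ztbar (2 * s) * mzv [2 * a + 1, 2 * r + 3])
   - (\<Sum>(u, i, j) \<in> {(u, i, j). 2 * u + i + j = 2 * a + 2 * b}.
        2 * (1 / 2 ^ i * real (binom (i + 1) (2 * int b + 1))
             + 1 / 2 ^ j * real (binom (j + 1) (2 * int a + 1 - 2 * int u)))
          * ztbar (2 * u) * mzv [i + 2, j + 2])"

definition S2 :: "nat \<Rightarrow> nat \<Rightarrow> real" where
  "S2 a b =
     (\<Sum>(p, q, r, s) \<in> {(p, q, r, s). p + q = a \<and> r + s + 1 = b}.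
        (1 / 2 ^ (2 * q + 2 * s) * zt (2 * q + 2 * s + 3) - 8 * ztbar (2 * s + 2 * q + 3))
          * real ((2 + 2 * q + 2 * s) choose (1 + 2 * s)) * zt (2 * r + 3) * ztbar (2 * p))
   + (\<Sum>(u, v, w) \<in> {(u, v, w). u + v + w + 1 = a}.
        8 * real ((2 * w + 2 * b + 2) choose (2 * b + 1)) * zt (2 * u + 3) * ztbar (2 * v) * ztbar (2 * b + 2 * w + 3))
   - (\<Sum>(p, q) \<in> {(p, q). p + q + 2 = a}. 8 * zt (2 * p + 3) * zt (2 * q + 3) * ztbar (2 * b + 2))
   + (\<Sum>(r, s) \<in> {(r, s). r + s = b}. 8 * zt (2 * a + 1) * zt (2 * r + 3) * ztbar (2 * s))
   + (\<Sum>(u, v, w) \<in> {(u, v, w). u + v + w + 1 = b}.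
        4 * of_bool (a = 0) * zt (2 * u + 3) * zt (2 * v + 3) * ztbar (2 * w))
   + (\<Sum>(p, q, r, s) \<in> {(p, q, r, s). p + q + 1 = a \<and> r + s = b + 1}.
        8 * real ((2 * q + 2 * s) choose (2 * s)) * ztbar (2 * r) * zt (2 * p + 3) * zt (2 * q + 2 * s + 1))
   - (\<Sum>(u, v, w) \<in> {(u, v, w). u + v + w = b}.
        8 * real ((2 * a + 2 * v) choose (2 * v)) * ztbar (2 * u) * zt (2 * w + 3) * zt (2 * a + 2 * v + 1))"

(* Complex-valued, because of the powers of \<i> * pi / 2. *)
definition S3 :: "nat \<Rightarrow> nat \<Rightarrow> complex" where
  "S3 a b =
   - (\<Sum>(i, j, r, s) \<in> {(i, j, r, s). i + j = 2 * a \<and> r + s = 2 * b + 2}.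
        3 * of_real (zt 2)
          * of_real ((- 1) ^ r * euler_number (i + r) * euler_number (j + s)
                     / (fact i * fact j * fact r * fact s))
          * (\<i> * of_real pi / 2) ^ (2 * a + 2 * b + 2))
   + (\<Sum>(i, j, r, s, t) \<in> {(i, j, r, s, t). i + j = 2 * a \<and> r + s + 2 * t = 2 * b}.
        3 * of_real (zt 2)
          * of_real ((- 1) ^ r * euler_number (i + r) * euler_number (j + s)
                     / (fact i * fact j * fact r * fact s))
          * (\<i> * of_real pi / 2) ^ (2 * a + 2 * b - 2 * t) * of_real (zt (2 * t + 2)))
   + of_real (
       2 * ztbar (2 * a + 2 * b + 4)
     + (\<Sum>(p, q) \<in> {(p, q). p + q = a + 1}.
          4 / 2 ^ (2 * p + 2 * b) * real ((2 * p + 2 * b) choose (2 * b + 1)) * zt (2 * p + 2 * b + 2) * ztbar (2 * q))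
     + (\<Sum>(u, v, w) \<in> {(u, v, w). u + v + w = a}.
          8 * real ((2 * u + 2 * b + 1) choose (2 * b + 1)) * ztbar (2 * w) * zt (2 * v + 2) * ztbar (2 * u + 2 * b + 2))
     + (\<Sum>(r, s) \<in> {(r, s). r + s = b + 1}.
          4 * (real ((2 * a + 2 * r + 1) choose (2 * a + 1)) - real ((2 * a + 2 * r + 1) choose (2 * r + 1)))
            * zt (2 * a + 2 * r + 2) * ztbar (2 * s))
     - (\<Sum>(r, s) \<in> {(r, s). r + s = b + 1}. 4 * zt (2 * a + 2 * r + 2) * ztbar (2 * s))
     - (\<Sum>(u, v, w) \<in> {(u, v, w). u + v + w = b}.
          4 * of_bool (a = 0) * zt (2 * u + 2) * zt (2 * v + 2) * ztbar (2 * w))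
     + (\<Sum>(r, s) \<in> {(r, s). r + s = b + 1}. 8 * of_bool (a = 0) * zt (2 * r + 2) * ztbar (2 * s))
     - 8 * of_bool (a = 0) * zt 2 * ztbar (2 * b + 2))"

end

theory Submission
  imports Defs "HOL-Analysis.Analysis" "HOL-Real_Asymp.Real_Asymp"
begin

text \<open>
  Both sides are compared through their generating functions in \<open>x\<close> and \<open>y\<close>, the coefficient of
  \<open>x\<^sup>2\<^sup>a y\<^sup>2\<^sup>b\<close> being the value at \<open>(a, b)\<close>. Connected sums with the kernel \<open>n!\<^sup>2 / ((n - k)! (n + k)!)\<close>
  turn the star sums into a resolvent \<open>\<Sum> k V\<^sub>k / (k\<^sup>2 - x\<^sup>2)\<close> of an alternating sequence defined by tails of
  tails; shifting \<open>x\<close> by integers and expanding in partial fractions evaluates it by cotangents, cosecants,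
  the function \<open>A(t) = \<Sum> t\<^sup>2 / (n (n\<^sup>2 - t\<^sup>2))\<close> and double sums over \<open>m < n\<close>. On the right-hand side every piece
  is a convolution of power series. The terms containing \<open>A\<close> and the double sums cancel, and what remains is a
  combination of two trigonometric identities, rational in the half angles. Double power series that agree
  for all small \<open>0 < y < x\<close> have equal coefficients.
\<close>

section \<open>Unconditional sums\<close>

text \<open>The obstacle is the entry 4. The tails of the twos alone form a product, but the fourth
  power leaves two extra factors 1/n, which have to be carried from n to k through the kernel. Each
  transport yields a relation V(n) - V(n+1) = v(n) + v(n+1), hence alternating signs and
  half-weighted sums \<open>star_sum\<close>. A single transport is resolved by summing the shift
  relation over the translates z = N + x. With two transports the summand is again a resolvent, now
  divided by N + x, and a summation by parts along the translates is needed. Its boundary term pairs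
  the divergent partial sums of 1/(n + x) with the resolvent at N + x, so decay faster than 1/sqrt N
  has to be proved; this dictates the majorant \<open>dker\<close>. Adding the expansions at x and
  -x removes the resolvent of the intermediate sequence. The range 0 < y < x < 1/4 keeps x, y, x + y
  and x - y away from the integers, and 1/4 is small enough for the crude bounds: 3 x^2 < 1 for the
  generating series, |x| (1 + |N - p|) <= |p - N - x| for the resolvents.\<close>

lemma summable_on_bigo_inverse_square:
  fixes f :: "nat \<Rightarrow> real"
  assumes "f \<in> O(\<lambda>n. 1 / real n ^ 2)"
  shows "f summable_on A"
proof -
  have "summable (\<lambda>n. 1 / real n ^ 2)"
    using inverse_power_summable[of 2, where ?'a = real] by (simp add: divide_inverse power_inverse)
  moreover have "(\<lambda>n. norm (f n)) \<in> O(\<lambda>n. 1 / real n ^ 2)"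
    using assms by simp
  ultimately have "summable (\<lambda>n. norm (f n))"
    by (intro summable_comparison_test_bigo[where f = "\<lambda>n. norm (f n)" and g = "\<lambda>n. 1 / real n ^ 2"]) simp_all
  hence "f summable_on UNIV"
    by (intro norm_summable_imp_summable_on)
  thus ?thesis by (rule summable_on_subset) simp
qed

lemma smallo_1_iff_tendsto_0:
  fixes f :: "nat \<Rightarrow> real"
  shows "f \<in> o(\<lambda>_. 1) \<longleftrightarrow> f \<longlonglongrightarrow> 0"
proof
  assume "f \<in> o(\<lambda>_. 1)"
  from smalloD_tendsto[OF this] show "f \<longlonglongrightarrow> 0" by simp
next
  assume "f \<longlonglongrightarrow> 0"
  thus "f \<in> o(\<lambda>_. 1)" by (intro smalloI_tendsto) simp_all
qed

lemma has_sum_atLeast_1_iff: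
  fixes f :: "nat \<Rightarrow> 'a :: {comm_monoid_add, topological_space}"
  shows "(f has_sum s) {1..} \<longleftrightarrow> ((\<lambda>n. f (Suc n)) has_sum s) UNIV"
proof -
  have "range Suc = {1..}" by (auto simp: image_iff Suc_le_eq gr0_conv_Suc)
  thus ?thesis using has_sum_reindex[of Suc UNIV f s] by (simp add: o_def)
qed

lemma has_sum_of_sums:
  fixes f :: "nat \<Rightarrow> real"
  assumes "f summable_on {1..}" and "(\<lambda>n. f (Suc n)) sums s"
  shows "(f has_sum s) {1..}"
proof -
  have *: "(f has_sum infsum f {1..}) {1..}" using assms(1) by simp
  hence "((\<lambda>n. f (Suc n)) has_sum infsum f {1..}) UNIV" by (simp only: has_sum_atLeast_1_iff)
  hence "(\<lambda>n. f (Suc n)) sums infsum f {1..}" by (rule has_sum_imp_sums)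
  with assms(2) have "s = infsum f {1..}" by (rule sums_unique2)
  thus ?thesis using * by simp
qed

lemma has_sum_telescope:
  fixes g :: "nat \<Rightarrow> real"
  assumes "g \<longlonglongrightarrow> 0" and "(\<lambda>n. g n - g (Suc n)) summable_on {1..}"
  shows "((\<lambda>n. g n - g (Suc n)) has_sum g 1) {1..}"
proof (rule has_sum_of_sums[OF assms(2)])
  have "(\<lambda>n. g (Suc n)) \<longlonglongrightarrow> 0" using assms(1) by (simp add: filterlim_sequentially_Suc)
  from telescope_sums'[OF this] show "(\<lambda>n. g (Suc n) - g (Suc (Suc n))) sums g 1" by simp
qed

lemma has_sum_tail_tendsto_0:
  fixes f :: "nat \<Rightarrow> real"
  assumes "f summable_on {1..}"
  shows "f \<longlonglongrightarrow> 0"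
proof -
  have "(f has_sum infsum f {1..}) {1..}" using assms by simp
  hence "((\<lambda>n. f (Suc n)) has_sum infsum f {1..}) UNIV" by (simp only: has_sum_atLeast_1_iff)
  hence "(\<lambda>n. f (Suc n)) sums infsum f {1..}" by (rule has_sum_imp_sums)
  hence "(\<lambda>n. f (Suc n)) \<longlonglongrightarrow> 0" using summable_LIMSEQ_zero sums_summable by blast
  thus ?thesis by (simp add: filterlim_sequentially_Suc)
qed

text \<open>Twice the partial sum with its last term at half weight. This is the weight produced by
  summation by parts when V(n) - V(n+1) = v(n) + v(n+1): if V + v tends to 0, then V(n) = v(n) + 2
  v(n+1) + 2 v(n+2) + ..., so v(m) is met twice by each r(n) with n < m and once by r(m).\<close>

definition star_sum :: "(nat \<Rightarrow> real) \<Rightarrow> nat \<Rightarrow> real" where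
  "star_sum f N = 2 * (\<Sum>n\<in>{1..<N}. f n) + f N"

lemma star_sum_1 [simp]: "star_sum f (Suc 0) = f 1"
  by (simp add: star_sum_def)

lemma star_sum_Suc: "N \<ge> 1 \<Longrightarrow> star_sum f (Suc N) = star_sum f N + f N + f (Suc N)"
  by (simp add: star_sum_def)

lemma star_sum_alt: "N \<ge> 1 \<Longrightarrow> star_sum f N = 2 * (\<Sum>n\<in>{1..N}. f n) - f N"
proof -
  assume "N \<ge> 1"
  hence "{1..N} = insert N {1..<N}" by auto
  thus ?thesis by (simp add: star_sum_def)
qed

lemma star_sum_add: "star_sum (\<lambda>n. f n + g n) N = star_sum f N + star_sum g N"
  by (simp add: star_sum_def sum.distrib algebra_simps)

lemma star_sum_cmult: "star_sum (\<lambda>n. c * f n) N = c * star_sum f N"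
  by (simp add: star_sum_def sum_distrib_left algebra_simps)

lemma star_sum_cong: "(\<And>n. 1 \<le> n \<Longrightarrow> n \<le> N \<Longrightarrow> f n = g n) \<Longrightarrow> N \<ge> 1 \<Longrightarrow> star_sum f N = star_sum g N"
  by (simp add: star_sum_def)

text \<open>Summation by parts. The finite identity \<open>fin\<close> is exact, and
  \<open>lim\<close> kills its boundary term. Summability of r(n) V(n) is a separate hypothesis
  because a limit of partial sums alone does not give an unconditional sum.\<close>

lemma abel_star:
  fixes V v r :: "nat \<Rightarrow> real"
  assumes step: "\<And>n. n \<ge> 1 \<Longrightarrow> V n - V (Suc n) = v n + v (Suc n)"
    and lim: "(\<lambda>K. (\<Sum>n\<in>{1..K}. r n) * (V (Suc K) + v (Suc K))) \<longlonglongrightarrow> 0"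
    and S: "((\<lambda>n. v n * star_sum r n) has_sum S) {1..}"
    and "(\<lambda>n. r n * V n) summable_on {1..}"
  shows "((\<lambda>n. r n * V n) has_sum S) {1..}"
proof (rule has_sum_of_sums[OF assms(4)])
  have fin: "(\<Sum>n\<in>{1..K}. r n * V n) = (\<Sum>n\<in>{1..K}. r n) * (V (Suc K) + v (Suc K))
      + (\<Sum>n\<in>{1..K}. v n * star_sum r n)" for K
  proof (induction K)
    case (Suc K)
    define s where "s = (\<Sum>n\<in>{1..K}. r n)"
    have st: "star_sum r (Suc K) = 2 * s + r (Suc K)"
      by (simp add: star_sum_def s_def atLeastLessThanSuc_atLeastAtMost)
    have s': "sum r {Suc 0..K} = s" by (simp add: s_def)
    have "V (Suc K) = V (Suc (Suc K)) + v (Suc K) + v (Suc (Suc K))"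
      using step[of "Suc K"] by simp
    thus ?case using Suc by (simp add: st s' algebra_simps)
  qed simp
  have "(\<lambda>n. v (Suc n) * star_sum r (Suc n)) sums S"
    using S by (intro has_sum_imp_sums) (simp only: has_sum_atLeast_1_iff)
  hence "(\<lambda>K. \<Sum>n<K. v (Suc n) * star_sum r (Suc n)) \<longlonglongrightarrow> S" by (simp add: sums_def)
  moreover have reindex: "(\<Sum>n<K. f (Suc n)) = (\<Sum>n\<in>{1..K}. f n)" for K and f :: "nat \<Rightarrow> real"
    by (rule sum.reindex_bij_witness[of _ "\<lambda>n. n - 1" Suc]) auto
  ultimately have "(\<lambda>K. \<Sum>n\<in>{1..K}. v n * star_sum r n) \<longlonglongrightarrow> S"
    using reindex[of "\<lambda>n. v n * star_sum r n"] by simp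
  from tendsto_add[OF lim this] have "(\<lambda>K. \<Sum>n\<in>{1..K}. r n * V n) \<longlonglongrightarrow> 0 + S"
    by (simp only: fin)
  hence "(\<lambda>K. \<Sum>n<K. r (Suc n) * V (Suc n)) \<longlonglongrightarrow> S"
    using reindex[of "\<lambda>n. r n * V n"] by simp
  thus "(\<lambda>n. r (Suc n) * V (Suc n)) sums S" by (simp add: sums_def)
qed

text \<open>Up to the factor 2/|x| a majorant of sqrt N / (p |p^2 - (N + x)^2|): the factor p + N +
  x of the difference of squares absorbs sqrt N and leaves a square root, while |p - N - x| is
  replaced by 1 + |N - p|, which does not degenerate at N = p.\<close>

definition dker :: "nat \<Rightarrow> nat \<Rightarrow> real" where
  "dker N p = 1 / ((1 + \<bar>real N - real p\<bar>) * real p * sqrt (real p + real N))"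

lemma dker_nonneg: "dker N p \<ge> 0"
  by (simp add: dker_def)

text \<open>Since 1 + |N - p| and p are both at most p + N, the square root is at least the product
  of their fourth roots. Both then carry the exponent -5/4, below -1, and the majorant is a product
  of two convergent series, in |N - p| and in p.\<close>

lemma dker_le:
  assumes "p \<ge> 1" "N \<ge> 1"
  shows "dker N p \<le> (1 + \<bar>real N - real p\<bar>) powr (-5/4) * real p powr (-5/4)"
proof -
  define a where "a = 1 + \<bar>real N - real p\<bar>"
  define s where "s = real p + real N"
  have a: "a \<ge> 1" "a \<le> s" "real p \<le> s" "s > 0" using assms by (auto simp: a_def s_def abs_if)
  have "a powr (1/4) * real p powr (1/4) \<le> s powr (1/4) * s powr (1/4)"
    using a assms by (intro mult_mono powr_mono2) auto
  also have "\<dots> = s powr (1/2)" by (simp add: powr_add[symmetric])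
  also have "\<dots> = sqrt s" using a by (simp add: powr_half_sqrt)
  finally have le: "a powr (1/4) * real p powr (1/4) \<le> sqrt s" .
  have "dker N p = 1 / (a * real p * sqrt s)" by (simp add: dker_def a_def s_def)
  also have "\<dots> \<le> 1 / (a * real p * (a powr (1/4) * real p powr (1/4)))"
    using le a assms by (intro divide_left_mono mult_left_mono mult_pos_pos) auto
  also have "a * real p * (a powr (1/4) * real p powr (1/4)) = a powr (5/4) * real p powr (5/4)"
  proof -
    have "a powr (5/4) = a * a powr (1/4)" "real p powr (5/4) = real p * real p powr (1/4)"
      using a assms powr_add[of a 1 "1/4"] powr_add[of "real p" 1 "1/4"] by auto
    thus ?thesis by simp
  qed
  also have "1 / (a powr (5/4) * real p powr (5/4)) = a powr (-5/4) * real p powr (-5/4)"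
    by (simp add: powr_minus_divide)
  finally show ?thesis by (simp add: a_def)
qed

lemma dker_summable: "(\<lambda>(N, p). dker N p) summable_on {1..} \<times> {1..}"
proof -
  define f where "f = (\<lambda>n::nat. (1 + real n) powr (-5/4))"
  define g where "g = (\<lambda>n::nat. real n powr (-5/4))"
  have g: "g summable_on UNIV"
    unfolding g_def by (intro summable_nonneg_imp_summable_on) (auto simp: summable_real_powr_iff)
  have "(\<lambda>n. f n) summable_on UNIV"
  proof -
    have "summable (\<lambda>n. g (Suc n))" using g summable_on_imp_summable summable_Suc_iff by blast
    hence "summable f" by (simp add: f_def g_def)
    thus ?thesis by (intro summable_nonneg_imp_summable_on) (auto simp: f_def)
  qed
  hence fg: "(\<lambda>(r, p). f r * g p) summable_on UNIV \<times> UNIV"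
    using g by (intro summable_on_SigmaI[where g = "\<lambda>r. f r * infsum g UNIV"])
      (auto intro!: has_sum_cmult_right summable_on_cmult_left simp: f_def g_def)
  \<comment> \<open>The variable |N - p| replaces N. The cases N >= p and N < p are separated
    because (|N - p|, p) determines (N, p) only within each of them.\<close>
  have half1: "(\<lambda>(N, p). dker N p) summable_on {(N, p). p \<ge> 1 \<and> N \<ge> p}"
  proof (rule summable_on_comparison_test)
    have "(\<lambda>(r, p). f r * g p) summable_on (\<lambda>(N, p). (N - p, p)) ` {(N, p). p \<ge> 1 \<and> N \<ge> p}"
      by (rule summable_on_subset[OF fg]) auto
    moreover have "inj_on (\<lambda>(N, p). (N - p, p)) {(N :: nat, p). p \<ge> 1 \<and> N \<ge> p}"
      by (auto simp: inj_on_def)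
    ultimately show "(\<lambda>(r, p). f r * g p) \<circ> (\<lambda>(N, p). (N - p, p)) summable_on {(N, p). p \<ge> 1 \<and> N \<ge> p}"
      by (simp add: summable_on_reindex)
  next
    fix np :: "nat \<times> nat" assume "np \<in> {(N, p). p \<ge> 1 \<and> N \<ge> p}"
    thus "(case np of (N, p) \<Rightarrow> dker N p) \<le> ((\<lambda>(r, p). f r * g p) \<circ> (\<lambda>(N, p). (N - p, p))) np"
      using dker_le[of "snd np" "fst np"] by (auto simp: f_def g_def of_nat_diff split: prod.splits)
  qed (auto simp: dker_nonneg)
  have half2: "(\<lambda>(N, p). dker N p) summable_on {(N, p). N \<ge> 1 \<and> N < p}"
  proof (rule summable_on_comparison_test)
    have "(\<lambda>(r, p). f r * g p) summable_on (\<lambda>(N, p). (p - N, p)) ` {(N, p). N \<ge> 1 \<and> N < p}"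
      by (rule summable_on_subset[OF fg]) auto
    moreover have "inj_on (\<lambda>(N, p). (p - N, p)) {(N :: nat, p). N \<ge> 1 \<and> N < p}"
      by (auto simp: inj_on_def)
    ultimately show "(\<lambda>(r, p). f r * g p) \<circ> (\<lambda>(N, p). (p - N, p)) summable_on {(N, p). N \<ge> 1 \<and> N < p}"
      by (simp add: summable_on_reindex)
  next
    fix np :: "nat \<times> nat" assume "np \<in> {(N, p). N \<ge> 1 \<and> N < p}"
    thus "(case np of (N, p) \<Rightarrow> dker N p) \<le> ((\<lambda>(r, p). f r * g p) \<circ> (\<lambda>(N, p). (p - N, p))) np"
      using dker_le[of "snd np" "fst np"] by (auto simp: f_def g_def of_nat_diff split: prod.splits)
  qed (auto simp: dker_nonneg)
  have "(\<lambda>(N, p). dker N p) summable_on {(N, p). p \<ge> 1 \<and> N \<ge> p} \<union> {(N, p). N \<ge> 1 \<and> N < p}"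
    by (rule summable_on_union[OF half1 half2])
  thus ?thesis by (rule summable_on_subset) auto
qed

text \<open>The inner sums are the terms of a convergent series.\<close>

lemma dker_inner_tendsto_0: "(\<lambda>N. \<Sum>\<^sub>\<infinity>p\<in>{1..}. dker N p) \<longlonglongrightarrow> 0"
  using summable_on_Sigma_banach[OF dker_summable] by (intro has_sum_tail_tendsto_0) simp

lemma dker_inner_summable: "N \<ge> 1 \<Longrightarrow> dker N summable_on {1..}"
  using summable_on_SigmaD1[of "\<lambda>N p. dker N p" "{1..}" "\<lambda>_. {1..}" N] dker_summable
  by (auto simp: case_prod_unfold)

lemma shifted_square_diff_lower:
  fixes x :: real
  assumes "p \<ge> 1" "N \<ge> 1" "\<bar>x\<bar> \<le> 1/4"
  shows "\<bar>x\<bar> * (1 + \<bar>real N - real p\<bar>) * (real p + real N) / 2 \<le> \<bar>real p ^ 2 - (real N + x) ^ 2\<bar>"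
proof -
  \<comment> \<open>On the diagonal the distance is exactly |x|; off it |N - p| >= 1, and |x| <= 1/4
    leaves enough room.\<close>
  have 1: "\<bar>x\<bar> * (1 + \<bar>real N - real p\<bar>) \<le> \<bar>real p - (real N + x)\<bar>"
  proof (cases "N = p")
    case False
    define d where "d = \<bar>real N - real p\<bar>"
    have d: "d \<ge> 1" using False unfolding d_def by linarith
    have "\<bar>x\<bar> * (1 + d) \<le> 1/4 * (1 + d)" using assms d by (intro mult_right_mono) auto
    also have "\<dots> \<le> d - \<bar>x\<bar>" using d assms(3) by (simp add: field_simps)
    also have "\<dots> \<le> \<bar>real p - (real N + x)\<bar>" unfolding d_def by linarith
    finally show ?thesis by (simp add: d_def)
  qed auto
  have "real p \<ge> 1" "real N \<ge> 1" using assms by auto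
  moreover have "- x \<le> 1 / 4" using assms(3) by (simp add: abs_le_iff)
  ultimately have 2: "(real p + real N) / 2 \<le> \<bar>real p + (real N + x)\<bar>"
    by (simp add: field_simps)
  have "\<bar>x\<bar> * (1 + \<bar>real N - real p\<bar>) * ((real p + real N) / 2)
      \<le> \<bar>real p - (real N + x)\<bar> * \<bar>real p + (real N + x)\<bar>"
    by (intro mult_mono 1 2) auto
  also have "\<dots> = \<bar>real p ^ 2 - (real N + x) ^ 2\<bar>"
    by (simp add: abs_mult[symmetric] power2_eq_square algebra_simps)
  finally show ?thesis by simp
qed

lemma inverse_shifted_square_diff_le:
  fixes x :: real
  assumes "p \<ge> 1" "N \<ge> 1" "\<bar>x\<bar> \<le> 1/4" "x \<noteq> 0"
  shows "sqrt (real N) / (real p * \<bar>real p ^ 2 - (real N + x) ^ 2\<bar>) \<le> 2 / \<bar>x\<bar> * dker N p"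
proof -
  define s where "s = real p + real N"
  have s: "s > 0" using assms by (simp add: s_def)
  have pos: "0 < \<bar>x\<bar> * (1 + \<bar>real N - real p\<bar>) * s / 2"
    using assms s by simp
  hence "sqrt (real N) / (real p * \<bar>real p ^ 2 - (real N + x) ^ 2\<bar>)
      \<le> sqrt s / (real p * (\<bar>x\<bar> * (1 + \<bar>real N - real p\<bar>) * s / 2))"
    using shifted_square_diff_lower[OF assms(1-3)] assms(1)
    by (intro frac_le mult_left_mono mult_pos_pos) (auto simp: s_def)
  also have "\<dots> = 2 / \<bar>x\<bar> * (sqrt s / s / ((1 + \<bar>real N - real p\<bar>) * real p))" by (simp add: field_simps)
  also have "sqrt s / s = 1 / sqrt s" using s by (simp add: divide_simps)
  finally show ?thesis by (simp add: dker_def s_def field_simps)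
qed

lemma inverse_shifted_square_diff_le':
  fixes x :: real
  assumes "p \<ge> 1" "N \<ge> 1" "\<bar>x\<bar> \<le> 1/4" "x \<noteq> 0"
  shows "1 / (real p * \<bar>real p ^ 2 - (real N + x) ^ 2\<bar>) \<le> 2 / \<bar>x\<bar> * dker N p"
proof -
  have "1 / (real p * \<bar>real p ^ 2 - (real N + x) ^ 2\<bar>) \<le> sqrt (real N) / (real p * \<bar>real p ^ 2 - (real N + x) ^ 2\<bar>)"
    using assms by (intro divide_right_mono) auto
  also have "\<dots> \<le> 2 / \<bar>x\<bar> * dker N p" by (rule inverse_shifted_square_diff_le) fact+
  finally show ?thesis .
qed

lemma has_sum_fubini:
  fixes f :: "nat \<Rightarrow> nat \<Rightarrow> real"
  assumes "(\<lambda>(n, p). f n p) summable_on A \<times> B"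
    and "\<And>n. n \<in> A \<Longrightarrow> (f n has_sum g n) B"
    and "\<And>p. p \<in> B \<Longrightarrow> ((\<lambda>n. f n p) has_sum h p) A"
  obtains S where "(g has_sum S) A" "(h has_sum S) B"
proof -
  define S where "S = infsum (\<lambda>(n, p). f n p) (A \<times> B)"
  have S: "((\<lambda>(n, p). f n p) has_sum S) (A \<times> B)" using assms(1) by (simp add: S_def)
  have 1: "(g has_sum S) A"
    by (rule has_sum_SigmaD[OF S]) (use assms(2) in auto)
  have "((\<lambda>(p, n). f n p) has_sum S) (B \<times> A)"
    using has_sum_swap[of "\<lambda>(n, p). f n p" A B S] S by (auto simp: case_prod_unfold)
  hence "(h has_sum S) B"
    by (rule has_sum_SigmaD) (use assms(3) in auto)
  with 1 show ?thesis by (rule that)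
qed

section \<open>Partial fractions\<close>

text \<open>In terms of the digamma function, -(psi(1 + t) + psi(1 - t))/2 - gamma. For |t| < 1 its
  power series is the sum of zeta(2 i + 3) t^(2 i + 2).\<close>

definition Afun :: "real \<Rightarrow> real" where
  "Afun t = (\<Sum>\<^sub>\<infinity>n\<in>{1..}. t ^ 2 / (real n * (real n ^ 2 - t ^ 2)))"

text \<open>The alternating companion of \<open>Afun\<close>: the even n contribute Afun(t/2)/2, and
  twice the even part minus the whole attaches the sign (-1)^n to every term.\<close>

definition Abar :: "real \<Rightarrow> real" where
  "Abar t = Afun (t / 2) - Afun t"

lemma Afun_minus [simp]: "Afun (- t) = Afun t"
  by (simp add: Afun_def)

lemma Abar_minus [simp]: "Abar (- t) = Abar t"
  by (simp add: Abar_def)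

lemma Afun_has_sum: "((\<lambda>n. t ^ 2 / (real n * (real n ^ 2 - t ^ 2))) has_sum Afun t) {1..}"
  unfolding Afun_def by (rule has_sum_infsum, rule summable_on_bigo_inverse_square) real_asymp

lemma non_Ints_neq:
  fixes t :: real
  assumes "t \<notin> \<int>"
  shows "real n - t \<noteq> 0" "real n + t \<noteq> 0" "real n ^ 2 - t ^ 2 \<noteq> 0"
proof -
  show 1: "real n - t \<noteq> 0" using assms by auto
  show 2: "real n + t \<noteq> 0"
  proof
    assume "real n + t = 0"
    hence "t = - real n" by simp
    thus False using assms by simp
  qed
  have "real n ^ 2 - t ^ 2 = (real n - t) * (real n + t)" by (simp add: power2_eq_square algebra_simps)
  thus "real n ^ 2 - t ^ 2 \<noteq> 0" using 1 2 by simp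
qed

lemma non_Ints_nonzero: "t \<notin> \<int> \<Longrightarrow> t \<noteq> 0" for t :: real
  by auto

lemma has_sum_diff:
  fixes f g :: "'a \<Rightarrow> real"
  assumes "(f has_sum a) A" "(g has_sum b) A"
  shows "((\<lambda>x. f x - g x) has_sum (a - b)) A"
  using has_sum_add[OF assms(1) has_sum_uminusI[OF assms(2)]] by simp

lemma non_Ints_add_nat [simp]:
  fixes t :: real
  shows "real n + t \<notin> \<int> \<longleftrightarrow> t \<notin> \<int>" "t + real n \<notin> \<int> \<longleftrightarrow> t \<notin> \<int>" "real n - t \<notin> \<int> \<longleftrightarrow> t \<notin> \<int>"
proof -
  show 1: "real n + t \<notin> \<int> \<longleftrightarrow> t \<notin> \<int>"
    using Ints_diff[of "real n + t" "real n"] Ints_add[of "real n" t] by auto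
  thus "t + real n \<notin> \<int> \<longleftrightarrow> t \<notin> \<int>" by (simp add: add.commute)
  show "real n - t \<notin> \<int> \<longleftrightarrow> t \<notin> \<int>"
    using Ints_diff[of "real n" "real n - t"] Ints_diff[of "real n" t] by auto
qed

lemma Afun_term:
  fixes t :: real
  assumes "t \<notin> \<int>" "n \<ge> 1"
  shows "t ^ 2 / (real n * (real n ^ 2 - t ^ 2)) = (1 / (real n - t) + 1 / (real n + t)) / 2 - 1 / real n"
proof -
  have "real n ^ 2 - t ^ 2 = (real n - t) * (real n + t)" by (simp add: power2_eq_square algebra_simps)
  thus ?thesis using non_Ints_neq[OF assms(1), of n] assms(2)
    by (simp add: divide_simps) (simp add: power2_eq_square algebra_simps)
qed

lemma Afun_term':
  fixes t :: real
  assumes "t \<notin> \<int>" "n \<ge> 1"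
  shows "t ^ 2 / (real n * (real n ^ 2 - t ^ 2)) = real n / (real n ^ 2 - t ^ 2) - 1 / real n"
  using non_Ints_neq[OF assms(1), of n] assms(2)
    by (simp add: divide_simps) (simp add: power2_eq_square algebra_simps)

text \<open>After partial fractions the terms at t and t + 1 consist of the same shifted inverses,
  so their difference telescopes.\<close>

lemma Afun_shift:
  assumes "t \<notin> \<int>"
  shows "Afun t - Afun (t + 1) = (1 / t + 1 / (t + 1)) / 2"
proof -
  have t1: "t + 1 \<notin> \<int>" using non_Ints_add_nat(2)[of t 1] assms by simp
  define g where "g = (\<lambda>n. (1 / (real n + t) - 1 / (real n - 1 - t)) / 2)"
  have "((\<lambda>n. t ^ 2 / (real n * (real n ^ 2 - t ^ 2)) - (t+1) ^ 2 / (real n * (real n ^ 2 - (t+1) ^ 2)))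
      has_sum (Afun t - Afun (t + 1))) {1..}"
    by (intro has_sum_diff Afun_has_sum)
  also have "?this \<longleftrightarrow> ((\<lambda>n. g n - g (Suc n)) has_sum (Afun t - Afun (t + 1))) {1..}"
  proof (intro has_sum_cong)
    fix n :: nat assume "n \<in> {1..}"
    hence n: "n \<ge> 1" by simp
    show "t ^ 2 / (real n * (real n ^ 2 - t ^ 2)) - (t+1) ^ 2 / (real n * (real n ^ 2 - (t+1) ^ 2)) = g n - g (Suc n)"
      unfolding Afun_term[OF assms n] Afun_term[OF t1 n] g_def by (simp add: field_simps)
  qed
  finally have *: "((\<lambda>n. g n - g (Suc n)) has_sum (Afun t - Afun (t + 1))) {1..}" .
  moreover have "g \<longlonglongrightarrow> 0" unfolding g_def by real_asymp
  ultimately have "Afun t - Afun (t + 1) = g 1"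
    using has_sum_telescope[of g] has_sum_unique has_sum_imp_summable by blast
  thus ?thesis using non_Ints_nonzero[OF assms] by (simp add: g_def field_simps)
qed

text \<open>Passing from N to N + 1 adds two neighbouring values of 1/(n + x) to
  \<open>star_sum\<close>, which is what \<open>Afun_shift\<close> gives for a unit translation. The
  term 1/x comes from the starting value at N = 1.\<close>

lemma star_sum_shifted_inverse:
  assumes "x \<notin> \<int>" "N \<ge> 1"
  shows "star_sum (\<lambda>n. 1 / (real n + x)) N = 2 * Afun x - 2 * Afun (real N + x) - 1 / x"
  using assms(2)
proof (induction N rule: nat_induct_at_least)
  case base
  have "2 * (Afun x - Afun (1 + x)) = 1 / x + 1 / (1 + x)"
    using Afun_shift[OF assms(1)] by (simp add: add.commute)
  thus ?case by simp
next
  case (Suc N)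
  have "Afun (real N + x) - Afun (real N + x + 1) = (1 / (real N + x) + 1 / (real N + x + 1)) / 2"
    by (rule Afun_shift) (use assms in simp)
  hence "2 * Afun (real N + x) - 2 * Afun (real (Suc N) + x) = 1 / (real N + x) + 1 / (real (Suc N) + x)"
    by (simp add: add_ac)
  thus ?case using Suc by (simp add: star_sum_Suc)
qed

lemma Afun_diff_has_sum:
  assumes "y \<notin> \<int>" "t \<notin> \<int>"
  shows "((\<lambda>p. real p * (y ^ 2 - t ^ 2) / ((real p ^ 2 - y ^ 2) * (real p ^ 2 - t ^ 2)))
           has_sum (Afun y - Afun t)) {1..}"
proof -
  have "((\<lambda>n. y ^ 2 / (real n * (real n ^ 2 - y ^ 2)) - t ^ 2 / (real n * (real n ^ 2 - t ^ 2)))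
      has_sum (Afun y - Afun t)) {1..}"
    by (intro has_sum_diff Afun_has_sum)
  also have "?this \<longleftrightarrow> ?thesis"
  proof (intro has_sum_cong)
    fix n :: nat assume "n \<in> {1..}"
    thus "y ^ 2 / (real n * (real n ^ 2 - y ^ 2)) - t ^ 2 / (real n * (real n ^ 2 - t ^ 2)) =
        real n * (y ^ 2 - t ^ 2) / ((real n ^ 2 - y ^ 2) * (real n ^ 2 - t ^ 2))"
      using non_Ints_neq[OF assms(1), of n] non_Ints_neq[OF assms(2), of n]
      by (simp add: Afun_term' assms divide_simps) (simp add: power2_eq_square algebra_simps)
  qed
  finally show ?thesis .
qed

lemma has_sum_alternating:
  fixes f :: "nat \<Rightarrow> real"
  assumes "(f has_sum a) {1..}" "((\<lambda>n. f (2 * n)) has_sum b) {1..}"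
  shows "((\<lambda>n. (- 1) ^ n * f n) has_sum (2 * b - a)) {1..}"
proof -
  have "((\<lambda>n. of_bool (even n) * f n) has_sum b) {1..}"
  proof -
    have "(f has_sum b) ((\<lambda>n. 2 * n) ` {1..})"
      using assms(2) by (subst has_sum_reindex) (auto simp: inj_on_def o_def)
    also have "?this \<longleftrightarrow> ?thesis"
    proof (rule has_sum_cong_neutral)
      fix n assume "n \<in> {1..} - (\<lambda>n. 2 * n) ` {1::nat..}"
      hence "odd n" by (auto simp: image_iff elim!: evenE)
      thus "of_bool (even n) * f n = 0" by simp
    qed (auto simp: even_mult_iff)
    finally show ?thesis .
  qed
  from has_sum_diff[OF has_sum_cmult_right[OF this, of 2] assms(1)]
  show ?thesis by (rule has_sum_cong[THEN iffD1, rotated]) auto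
qed

lemma Abar_has_sum:
  assumes "t \<notin> \<int>"
  shows "((\<lambda>n. (- 1) ^ n * (t ^ 2 / (real n * (real n ^ 2 - t ^ 2)))) has_sum Abar t) {1..}"
proof -
  have "((\<lambda>n. t ^ 2 / (real (2 * n) * (real (2 * n) ^ 2 - t ^ 2))) has_sum (Afun (t / 2) / 2)) {1..}"
  proof -
    have "((\<lambda>n. (1 / 2) * ((t / 2) ^ 2 / (real n * (real n ^ 2 - (t / 2) ^ 2)))) has_sum (1 / 2 * Afun (t / 2))) {1..}"
      by (intro has_sum_cmult_right Afun_has_sum)
    moreover have "t ^ 2 / (real (2 * n) * (real (2 * n) ^ 2 - t ^ 2)) =
        (1 / 2) * ((t / 2) ^ 2 / (real n * (real n ^ 2 - (t / 2) ^ 2)))" if "n \<ge> 1" for n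
      using that non_Ints_neq[OF assms, of "2 * n"] by (simp add: divide_simps)
    ultimately show ?thesis by (subst has_sum_cong) auto
  qed
  from has_sum_alternating[OF Afun_has_sum this] show ?thesis by (simp add: Abar_def)
qed

text \<open>Two arguments are compared because \<open>Abar t + Abar (t + 1)\<close> alone contains
  the alternating series of 2/n, hence log 2; this constant drops out of the difference.\<close>

lemma Abar_diff_shift:
  assumes t: "t \<notin> \<int>" and s: "s \<notin> \<int>"
  shows "(Abar t - Abar s) + (Abar (t + 1) - Abar (s + 1)) = (1 / t - 1 / s) / 2 - (1 / (t + 1) - 1 / (s + 1)) / 2"
proof -
  have t1: "t + 1 \<notin> \<int>" and s1: "s + 1 \<notin> \<int>"
    using non_Ints_add_nat(2)[of t 1] non_Ints_add_nat(2)[of s 1] assms by auto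
  define a where "a = (\<lambda>n. (1 / (real n - t) - 1 / (real n - s)) / 2)"
  define b where "b = (\<lambda>n. (1 / (real n + t) - 1 / (real n + s)) / 2)"
  \<comment> \<open>For n >= 1 the index n - 1 is a true predecessor, and a(0) inside g(1) produces
    the terms 1/t and 1/s.\<close>
  define g where "g = (\<lambda>n. (- 1) ^ n * (a (n - 1) + b n))"
  have "((\<lambda>n. ((- 1) ^ n * (t ^ 2 / (real n * (real n ^ 2 - t ^ 2))) - (- 1) ^ n * (s ^ 2 / (real n * (real n ^ 2 - s ^ 2))))
        + ((- 1) ^ n * ((t + 1) ^ 2 / (real n * (real n ^ 2 - (t + 1) ^ 2))) - (- 1) ^ n * ((s + 1) ^ 2 / (real n * (real n ^ 2 - (s + 1) ^ 2)))))
      has_sum ((Abar t - Abar s) + (Abar (t + 1) - Abar (s + 1)))) {1..}"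
    by (intro has_sum_add has_sum_diff Abar_has_sum t s t1 s1)
  also have "?this \<longleftrightarrow> ((\<lambda>n. g n - g (Suc n)) has_sum ((Abar t - Abar s) + (Abar (t + 1) - Abar (s + 1)))) {1..}"
  proof (intro has_sum_cong)
    fix n :: nat assume "n \<in> {1..}"
    hence n: "n \<ge> 1" "real (n - 1) = real n - 1" by (auto simp: of_nat_diff)
    show "(- 1) ^ n * (t ^ 2 / (real n * (real n ^ 2 - t ^ 2))) - (- 1) ^ n * (s ^ 2 / (real n * (real n ^ 2 - s ^ 2)))
        + ((- 1) ^ n * ((t + 1) ^ 2 / (real n * (real n ^ 2 - (t + 1) ^ 2))) - (- 1) ^ n * ((s + 1) ^ 2 / (real n * (real n ^ 2 - (s + 1) ^ 2))))
        = g n - g (Suc n)"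
      unfolding Afun_term[OF t n(1)] Afun_term[OF t1 n(1)] Afun_term[OF s n(1)] Afun_term[OF s1 n(1)]
        g_def a_def b_def n(2) by (simp add: algebra_simps add_divide_distrib diff_divide_distrib)
  qed
  finally have *: "((\<lambda>n. g n - g (Suc n)) has_sum ((Abar t - Abar s) + (Abar (t + 1) - Abar (s + 1)))) {1..}" .
  moreover have "g \<longlonglongrightarrow> 0"
  proof (rule tendsto_rabs_zero_cancel)
    have "(\<lambda>n. \<bar>a (n - 1) + b n\<bar>) \<longlonglongrightarrow> 0"
    proof (rule tendsto_rabs_zero, rule LIMSEQ_imp_Suc)
      show "(\<lambda>n. a (Suc n - 1) + b (Suc n)) \<longlonglongrightarrow> 0" unfolding a_def b_def by simp real_asymp
    qed
    thus "(\<lambda>n. \<bar>g n\<bar>) \<longlonglongrightarrow> 0" by (simp add: g_def abs_mult power_abs)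
  qed
  ultimately have "(Abar t - Abar s) + (Abar (t + 1) - Abar (s + 1)) = g 1"
    using has_sum_telescope[of g] has_sum_unique has_sum_imp_summable by blast
  also have "g 1 = (1 / t - 1 / s) / 2 - (1 / (t + 1) - 1 / (s + 1)) / 2"
    by (simp add: g_def a_def b_def field_simps)
  finally show ?thesis .
qed

text \<open>Take t = p + x and s = p - x in \<open>Abar_diff_shift\<close>. The sign (-1)^p turns
  its relation between a sum of neighbours into one between their difference, which is the recursion
  of \<open>star_sum\<close>.\<close>

lemma Abar_diff_star_sum:
  assumes "x \<notin> \<int>" "p \<ge> 1"
  shows "(- 1) ^ p * (Abar (real p + x) - Abar (real p - x)) =
           - (2 / x + star_sum (\<lambda>M. (- 1) ^ M * (1 / (real M + x) - 1 / (real M - x))) p) / 2"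
  using assms(2)
proof (induction p rule: nat_induct_at_least)
  case base
  have "Abar (1 + x) - Abar (1 - x) = (1 / x + 1 / x) / 2 - (1 / (1 + x) - 1 / (1 - x)) / 2"
    using Abar_diff_shift[of x "-x"] assms(1) minus_in_Ints_iff[of x] by (simp add: add.commute)
  thus ?case by (simp add: field_simps)
next
  case (Suc p)
  have "(Abar (real p + x) - Abar (real p - x)) + (Abar (real p + x + 1) - Abar (real p - x + 1)) =
      (1 / (real p + x) - 1 / (real p - x)) / 2 - (1 / (real p + x + 1) - 1 / (real p - x + 1)) / 2"
    by (rule Abar_diff_shift) (use assms in auto)
  moreover define D D' where "D = Abar (real p + x) - Abar (real p - x)"
    and "D' = Abar (real (Suc p) + x) - Abar (real (Suc p) - x)"
  moreover define u u' where "u = 1 / (real p + x) - 1 / (real p - x)"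
    and "u' = 1 / (real (Suc p) + x) - 1 / (real (Suc p) - x)"
  moreover have "real (Suc p) + x = real p + x + 1" "real (Suc p) - x = real p - x + 1" by auto
  ultimately have "D + D' = u / 2 - u' / 2" by (simp only:)
  hence D': "D' = u / 2 - u' / 2 - D" by simp
  have "(- 1) ^ Suc p * D' = (- 1) ^ p * D - ((- 1) ^ p * u + (- 1) ^ Suc p * u') / 2"
    unfolding D' by (simp add: algebra_simps add_divide_distrib diff_divide_distrib)
  thus ?case using Suc
    by (simp only: star_sum_Suc D_def[symmetric] D'_def[symmetric] u_def[symmetric] u'_def[symmetric])
       (simp add: field_simps)
qed

text \<open>Logarithmic differentiation of the reflection formula Gamma(z) Gamma(1 - z) = pi /
  sin(pi z) gives psi(1 - z) - psi(z) = pi cot(pi z); the series of the digamma function at 1 + z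
  and 1 - z then yields the partial fractions. The complex plane enters through the reflection
  formula.\<close>

lemma cot_has_sum:
  assumes "t \<notin> \<int>"
  shows "((\<lambda>n. 2 * t / (real n ^ 2 - t ^ 2)) has_sum (1 / t - pi * cot (pi * t))) {1..}"
proof -
  define z where "z = complex_of_real t"
  have z: "z \<notin> \<int>" using assms by (simp add: z_def)
  have z1: "1 - z \<notin> \<int>" using z Ints_diff[of 1 "1 - z"] by auto
  have np: "w \<notin> \<int>\<^sub>\<le>\<^sub>0" if "w \<notin> \<int>" for w :: complex using that nonpos_Ints_Int by blast
  have sz: "sin (of_real pi * z) \<noteq> 0"
    using z by (auto simp: sin_eq_0 Ints_def)
  have "((\<lambda>w. Gamma w * Gamma (1 - w)) has_field_derivative
      Gamma z * Digamma z * Gamma (1 - z) - Gamma z * (Gamma (1 - z) * Digamma (1 - z))) (at z)"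
    using np[OF z] np[OF z1] by (auto intro!: derivative_eq_intros)
  moreover have "((\<lambda>w. of_real pi / sin (of_real pi * w)) has_field_derivative
      - (of_real pi * (cos (of_real pi * z) * of_real pi)) / (sin (of_real pi * z) ^ 2)) (at z)"
    using sz by (auto intro!: derivative_eq_intros simp: power2_eq_square)
  ultimately have "Gamma z * Digamma z * Gamma (1 - z) - Gamma z * (Gamma (1 - z) * Digamma (1 - z)) =
      - (of_real pi * (cos (of_real pi * z) * of_real pi)) / (sin (of_real pi * z) ^ 2)"
    unfolding Gamma_reflection_complex by (rule DERIV_unique)
  hence "(Gamma z * Gamma (1 - z)) * (Digamma z - Digamma (1 - z)) =
      - (of_real pi * (cos (of_real pi * z) * of_real pi)) / (sin (of_real pi * z) ^ 2)"
    by (simp add: algebra_simps)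
  then have *: "Digamma z - Digamma (1 - z) = - of_real pi * cot (of_real pi * z)"
  proof -
    assume *: "Gamma z * Gamma (1 - z) * (Digamma z - Digamma (1 - z)) =
      - (of_real pi * (cos (of_real pi * z) * of_real pi)) / (sin (of_real pi * z) ^ 2)"
    define S where "S = sin (of_real pi * z)"
    define C where "C = cos (of_real pi * z)"
    from * have "of_real pi / S * (Digamma z - Digamma (1 - z)) = of_real pi / S * (- of_real pi * (C / S))"
      unfolding Gamma_reflection_complex S_def[symmetric] C_def[symmetric]
      by (simp add: power2_eq_square mult_ac)
    moreover have "of_real pi / S \<noteq> 0" using sz by (simp add: S_def)
    ultimately have "Digamma z - Digamma (1 - z) = - of_real pi * (C / S)"
      using mult_left_cancel by blast
    thus ?thesis by (simp add: cot_def S_def C_def)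
  qed
  have 1: "(\<lambda>k. inverse (of_nat (Suc k)) - inverse (w + of_nat k)) sums (Digamma w + euler_mascheroni)"
    if "w \<noteq> 0" for w :: complex
    using summable_sums[OF summable_Digamma[OF that]] by (simp add: Digamma_def)
  have z10: "z + 1 \<noteq> 0" "1 - z \<noteq> 0" "z \<noteq> 0"
    using z1 non_Ints_neq(2)[OF assms, of 1] non_Ints_nonzero[OF assms]
    by (auto simp: z_def complex_eq_iff)
  have D: "Digamma (z + 1) - Digamma (1 - z) = 1 / z - of_real pi * cot (of_real pi * z)"
    using * Digamma_plus1[OF z10(3)] by (simp add: algebra_simps)
  have "(\<lambda>k. (inverse (of_nat (Suc k)) - inverse ((z + 1) + of_nat k)) - (inverse (of_nat (Suc k)) - inverse ((1 - z) + of_nat k)))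
      sums ((Digamma (z + 1) + euler_mascheroni) - (Digamma (1 - z) + euler_mascheroni))"
    by (intro sums_diff 1 z10)
  also have "(Digamma (z + 1) + euler_mascheroni) - (Digamma (1 - z) + euler_mascheroni) =
      1 / z - of_real pi * cot (of_real pi * z)"
    using D by simp
  also have "(\<lambda>k. (inverse (of_nat (Suc k)) - inverse ((z + 1) + of_nat k)) - (inverse (of_nat (Suc k)) - inverse ((1 - z) + of_nat k)))
      = (\<lambda>k. complex_of_real (2 * t / (real (Suc k) ^ 2 - t ^ 2)))"
  proof
    fix k
    have nz: "real (Suc k) - t \<noteq> 0" "real (Suc k) + t \<noteq> 0" "real (Suc k) ^ 2 - t ^ 2 \<noteq> 0"
      using non_Ints_neq[OF assms, of "Suc k"] by auto
    have "(inverse (of_nat (Suc k)) - inverse ((z + 1) + of_nat k)) - (inverse (of_nat (Suc k)) - inverse ((1 - z) + of_nat k))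
       = complex_of_real (1 / (real (Suc k) - t) - 1 / (real (Suc k) + t))"
      by (simp add: z_def inverse_eq_divide add_ac)
    also have "1 / (real (Suc k) - t) - 1 / (real (Suc k) + t) = 2 * t / (real (Suc k) ^ 2 - t ^ 2)"
      using nz by (simp add: divide_simps del: of_nat_Suc) (simp add: algebra_simps power2_eq_square del: of_nat_Suc)
    finally show "(inverse (of_nat (Suc k)) - inverse ((z + 1) + of_nat k)) - (inverse (of_nat (Suc k)) - inverse ((1 - z) + of_nat k))
       = complex_of_real (2 * t / (real (Suc k) ^ 2 - t ^ 2))" .
  qed
  also have "1 / z - of_real pi * cot (of_real pi * z) = complex_of_real (1 / t - pi * cot (pi * t))"
    by (simp add: z_def cot_def flip: sin_of_real cos_of_real)
  finally have "(\<lambda>k. 2 * t / (real (Suc k) ^ 2 - t ^ 2)) sums (1 / t - pi * cot (pi * t))"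
    by (simp only: sums_of_real_iff)
  moreover have "(\<lambda>n. 2 * t / (real n ^ 2 - t ^ 2)) summable_on {1..}"
    by (rule summable_on_bigo_inverse_square) real_asymp
  ultimately show ?thesis by (rule has_sum_of_sums[rotated])
qed

text \<open>From the cotangent series at t and t/2, by cot u - cot(2 u) = 1 / sin(2 u).\<close>

lemma csc_has_sum:
  assumes "t \<notin> \<int>"
  shows "((\<lambda>n. (- 1) ^ n * (2 * t / (real n ^ 2 - t ^ 2))) has_sum (1 / t - pi / sin (pi * t))) {1..}"
proof -
  have t2: "t / 2 \<notin> \<int>" using assms Ints_mult[of 2 "t / 2"] by auto
  have "((\<lambda>n. 2 * t / (real (2 * n) ^ 2 - t ^ 2)) has_sum ((1 / (t / 2) - pi * cot (pi * (t / 2))) / 2)) {1..}"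
  proof -
    have "((\<lambda>n. (1 / 2) * (2 * (t / 2) / (real n ^ 2 - (t / 2) ^ 2))) has_sum
        (1 / 2 * (1 / (t / 2) - pi * cot (pi * (t / 2))))) {1..}"
      by (intro has_sum_cmult_right cot_has_sum t2)
    moreover have "2 * t / (real (2 * n) ^ 2 - t ^ 2) =
        (1 / 2) * (2 * (t / 2) / (real n ^ 2 - (t / 2) ^ 2))" for n
      using non_Ints_neq[OF assms, of "2 * n"] by (simp add: divide_simps)
    ultimately show ?thesis by simp
  qed
  from has_sum_alternating[OF cot_has_sum[OF assms] this]
  have "((\<lambda>n. (- 1) ^ n * (2 * t / (real n ^ 2 - t ^ 2))) has_sum
    (2 * ((1 / (t / 2) - pi * cot (pi * (t / 2))) / 2) - (1 / t - pi * cot (pi * t)))) {1..}" by simp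
  also have "2 * ((1 / (t / 2) - pi * cot (pi * (t / 2))) / 2) - (1 / t - pi * cot (pi * t)) =
      1 / t - pi * (cot (pi * (t / 2)) - cot (pi * t))"
    by (simp add: field_simps)
  also have "cot (pi * (t / 2)) - cot (pi * t) = 1 / sin (pi * t)"
  proof -
    define u where "u = pi * (t / 2)"
    have "sin (pi * t) \<noteq> 0"
    proof
      assume "sin (pi * t) = 0"
      then obtain i :: int where "pi * t = of_int i * pi" by (auto simp: sin_zero_iff_int2)
      hence "t = of_int i" by simp
      thus False using assms by simp
    qed
    hence nz: "sin (2 * u) \<noteq> 0" by (simp add: u_def)
    hence "sin u \<noteq> 0" "cos u \<noteq> 0" by (auto simp: sin_double)
    moreover have "cot u - cot (2 * u) = cos u / sin u - (cos u ^ 2 - sin u ^ 2) / (2 * sin u * cos u)"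
      by (simp only: cot_def sin_double cos_double)
    moreover have "1 / sin (2 * u) = (sin u ^ 2 + cos u ^ 2) / (2 * sin u * cos u)"
      by (simp add: sin_double)
    moreover have "c / s - (c ^ 2 - s ^ 2) / (2 * s * c) = (s ^ 2 + c ^ 2) / (2 * s * c)"
      if "s \<noteq> 0" "c \<noteq> 0" for s c :: real
      using that by (simp add: divide_simps) (simp add: power2_eq_square algebra_simps)
    from this[OF calculation(1,2)]
    have "cos u / sin u - (cos u ^ 2 - sin u ^ 2) / (2 * sin u * cos u) = (sin u ^ 2 + cos u ^ 2) / (2 * sin u * cos u)" .
    ultimately have "cot u - cot (2 * u) = 1 / sin (2 * u)"
      by (simp only:)
    thus ?thesis by (simp add: u_def)
  qed
  finally show ?thesis by simp
qed

section \<open>The resolvent of an alternating sequence\<close>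

definition theta :: "real \<Rightarrow> real" where
  "theta t = pi / sin (pi * t)"

lemma theta_minus [simp]: "theta (- t) = - theta t"
  by (simp add: theta_def)

lemma theta_add_nat: "theta (real n + t) = (- 1) ^ n * theta t"
proof -
  have "sin (pi * (real n + t)) = (- 1) ^ n * sin (pi * t)"
    by (simp add: sin_add algebra_simps)
  thus ?thesis by (simp add: theta_def) (cases "even n"; simp)
qed

definition resolvent :: "(nat \<Rightarrow> real) \<Rightarrow> real \<Rightarrow> real" where
  "resolvent V z = (\<Sum>\<^sub>\<infinity>k\<in>{1..}. real k * V k / (real k ^ 2 - z ^ 2))"

text \<open>What a summation by parts makes of \<open>resolvent\<close>: the star sum of the
  difference of the kernels k/(k^2 - z^2) at z and z + 1 is the present kernel at z plus the one at
  z + 1.\<close>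

definition resolvent_step :: "(nat \<Rightarrow> real) \<Rightarrow> real \<Rightarrow> real" where
  "resolvent_step v z = (1 / z) * (\<Sum>\<^sub>\<infinity>k\<in>{1..}. real k ^ 2 * v k / (real k ^ 2 - z ^ 2))"

lemma resolvent_minus [simp]: "resolvent V (- z) = resolvent V z"
  by (simp add: resolvent_def)

lemma resolvent_step_minus [simp]: "resolvent_step v (- z) = - resolvent_step v z"
  by (simp add: resolvent_step_def)

lemma resolvent_has_sum:
  assumes "V \<in> O(\<lambda>n. 1 / real n ^ 2)"
  shows "((\<lambda>k. real k * V k / (real k ^ 2 - z ^ 2)) has_sum resolvent V z) {1..}"
  unfolding resolvent_def
proof (rule has_sum_infsum, rule summable_on_bigo_inverse_square)
  have "(\<lambda>k. (real k / (real k ^ 2 - z ^ 2)) * V k) \<in> O(\<lambda>n. 1 * (1 / real n ^ 2))"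
    by (intro landau_o.big.mult assms) real_asymp
  thus "(\<lambda>k. real k * V k / (real k ^ 2 - z ^ 2)) \<in> O(\<lambda>n. 1 / real n ^ 2)" by simp
qed

lemma resolvent_step_has_sum:
  assumes "v \<in> O(\<lambda>n. 1 / real n ^ 2)"
  shows "((\<lambda>k. real k ^ 2 * v k / (z * (real k ^ 2 - z ^ 2))) has_sum resolvent_step v z) {1..}"
proof -
  have "(\<lambda>k. (real k ^ 2 / (real k ^ 2 - z ^ 2)) * v k) \<in> O(\<lambda>n. 1 * (1 / real n ^ 2))"
    by (intro landau_o.big.mult assms) real_asymp
  hence "(\<lambda>k. real k ^ 2 * v k / (real k ^ 2 - z ^ 2)) summable_on {1..}"
    by (intro summable_on_bigo_inverse_square) simp
  hence "((\<lambda>k. real k ^ 2 * v k / (real k ^ 2 - z ^ 2)) has_sum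
     (\<Sum>\<^sub>\<infinity>k\<in>{1..}. real k ^ 2 * v k / (real k ^ 2 - z ^ 2))) {1..}" by simp
  from has_sum_cmult_right[OF this, of "1 / z"] show ?thesis
    by (simp add: resolvent_step_def)
qed

text \<open>In partial fractions everything is a combination of 1/(k - z), 1/(k + z) and their
  translates. As (k + 1) - (z + 1) = k - z, consecutive terms overlap and the induction
  closes.\<close>

lemma star_sum_resolvent_kernel:
  fixes z :: real
  assumes "z \<notin> \<int>" "m \<ge> 1"
  shows "star_sum (\<lambda>k. real k / (real k ^ 2 - z ^ 2) - real k / (real k ^ 2 - (z + 1) ^ 2)) m =
    real m ^ 2 / (z * (real m ^ 2 - z ^ 2)) + real m ^ 2 / ((z + 1) * (real m ^ 2 - (z + 1) ^ 2))"
proof -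
  have z1: "z + 1 \<notin> \<int>" using non_Ints_add_nat(2)[of z 1] assms by simp
  have pf: "real k / (real k ^ 2 - w ^ 2) = (1 / (real k - w) + 1 / (real k + w)) / 2" if "w \<notin> \<int>" for w k
  proof -
    have "real k ^ 2 - w ^ 2 = (real k - w) * (real k + w)" by (simp add: power2_eq_square algebra_simps)
    thus ?thesis using non_Ints_neq[OF that, of k] by (simp add: divide_simps)
  qed
  have pf2: "real k ^ 2 / (w * (real k ^ 2 - w ^ 2)) = 1 / w + (1 / (real k - w) - 1 / (real k + w)) / 2" if "w \<notin> \<int>" for w k
  proof -
    have "real k ^ 2 - w ^ 2 = (real k - w) * (real k + w)" by (simp add: power2_eq_square algebra_simps)
    thus ?thesis using non_Ints_neq[OF that, of k] non_Ints_nonzero[OF that]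
      by (simp add: divide_simps) (simp add: power2_eq_square algebra_simps)
  qed
  show ?thesis using assms(2)
  proof (induction m rule: nat_induct_at_least)
    case base
    have e: "real 1 - (z + 1) = - z" "real 1 + (z + 1) = 2 + z" by auto
    have h: "2 / (2 + z * 2) = 1 / (1 + z)"
      using non_Ints_nonzero[OF z1] by (simp add: divide_simps)
    show ?case
      unfolding One_nat_def[symmetric] star_sum_1[unfolded One_nat_def[symmetric]]
        pf[OF assms(1)] pf[OF z1] pf2[OF assms(1)] pf2[OF z1] e
      by (simp add: algebra_simps add_divide_distrib diff_divide_distrib h)
  next
    case (Suc m)
    have e: "real (Suc m) - (z + 1) = real m - z" "real m + (z + 1) = real (Suc m) + z" by auto
    show ?case
      unfolding star_sum_Suc[OF Suc.hyps] Suc.IH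
      unfolding pf[OF assms(1)] pf[OF z1] pf2[OF assms(1)] pf2[OF z1] e
      by (simp add: algebra_simps add_divide_distrib diff_divide_distrib)
  qed
qed

text \<open>An application of \<open>abel_star\<close> with r the difference of the two kernels. The
  partial sums of r are bounded by the closed form of their star sum, so the boundary term vanishes
  together with V and v.\<close>

lemma resolvent_shift:
  fixes V v :: "nat \<Rightarrow> real"
  assumes step: "\<And>n. n \<ge> 1 \<Longrightarrow> V n - V (Suc n) = v n + v (Suc n)"
    and V: "V \<in> O(\<lambda>n. 1 / real n ^ 2)" and v: "v \<in> O(\<lambda>n. 1 / real n ^ 2)" and z: "z \<notin> \<int>"
  shows "resolvent V z - resolvent V (z + 1) = resolvent_step v z + resolvent_step v (z + 1)"
proof -
  define r where "r = (\<lambda>k. real k / (real k ^ 2 - z ^ 2) - real k / (real k ^ 2 - (z + 1) ^ 2))"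
  have st: "star_sum r m = real m ^ 2 / (z * (real m ^ 2 - z ^ 2)) + real m ^ 2 / ((z + 1) * (real m ^ 2 - (z + 1) ^ 2))"
    if "m \<ge> 1" for m unfolding r_def by (rule star_sum_resolvent_kernel[OF z that])
  have rV: "((\<lambda>k. r k * V k) has_sum (resolvent V z - resolvent V (z + 1))) {1..}"
    using has_sum_diff[OF resolvent_has_sum[OF V, of z] resolvent_has_sum[OF V, of "z + 1"]]
    by (simp add: r_def algebra_simps)
  have "((\<lambda>k. v k * star_sum r k) has_sum (resolvent_step v z + resolvent_step v (z + 1))) {1..}"
  proof -
    have "((\<lambda>k. real k ^ 2 * v k / (z * (real k ^ 2 - z ^ 2)) + real k ^ 2 * v k / ((z + 1) * (real k ^ 2 - (z + 1) ^ 2)))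
      has_sum (resolvent_step v z + resolvent_step v (z + 1))) {1..}"
      by (intro has_sum_add resolvent_step_has_sum v)
    also have "?this \<longleftrightarrow> ?thesis"
      by (intro has_sum_cong) (simp add: st algebra_simps)
    finally show ?thesis .
  qed
  moreover have "(\<lambda>K. (\<Sum>n\<in>{1..K}. r n) * (V (Suc K) + v (Suc K))) \<longlonglongrightarrow> 0"
  proof -
    have "(\<lambda>K. (\<Sum>n\<in>{1..K}. r n)) \<in> O(\<lambda>_. 1)"
    proof -
      \<comment> \<open>Reading \<open>star_sum_alt\<close> backwards, the plain partial sum is half
        of the star sum plus the last term, and both are bounded.\<close>
      have "(\<lambda>m. (real m ^ 2 / (z * (real m ^ 2 - z ^ 2)) + real m ^ 2 / ((z + 1) * (real m ^ 2 - (z + 1) ^ 2)) + r m) / 2) \<in> O(\<lambda>_. 1)"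
      proof -
        have 1: "(\<lambda>m. real m ^ 2 / (w * (real m ^ 2 - w ^ 2))) \<in> O(\<lambda>_. 1)" for w :: real
        proof -
          have "(\<lambda>m. real m ^ 2 / (real m ^ 2 - w ^ 2)) \<in> O(\<lambda>_. 1)" by real_asymp
          hence "(\<lambda>m. (1 / w) * (real m ^ 2 / (real m ^ 2 - w ^ 2))) \<in> O(\<lambda>_. 1)"
            by (intro landau_o.big.mult_in_1) simp_all
          thus ?thesis by simp
        qed
        have 2: "(\<lambda>m. real m / (real m ^ 2 - w ^ 2)) \<in> O(\<lambda>_. 1)" for w :: real by real_asymp
        show ?thesis unfolding r_def
          by (simp, intro sum_in_bigo 1 2)
      qed
      moreover have "eventually (\<lambda>m. (real m ^ 2 / (z * (real m ^ 2 - z ^ 2)) + real m ^ 2 / ((z + 1) * (real m ^ 2 - (z + 1) ^ 2)) + r m) / 2 = (\<Sum>n\<in>{1..m}. r n)) at_top"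
        using eventually_ge_at_top[of 1] by eventually_elim (use star_sum_alt st in fastforce)
      ultimately show ?thesis by (rule landau_o.big.in_cong[THEN iffD1, rotated])
    qed
    moreover have "(\<lambda>K. V (Suc K) + v (Suc K)) \<longlonglongrightarrow> 0"
    proof -
      have t: "f \<longlonglongrightarrow> 0" if "f \<in> O(\<lambda>n. 1 / real n ^ 2)" for f :: "nat \<Rightarrow> real"
      proof -
        have "(\<lambda>n. 1 / real n ^ 2) \<in> o(\<lambda>_. 1 :: real)" by real_asymp
        with that have "f \<in> o(\<lambda>_. 1)" by (rule landau_o.big_small_trans)
        thus ?thesis by (simp add: smallo_1_iff_tendsto_0)
      qed
      have "(\<lambda>n. V n + v n) \<longlonglongrightarrow> 0 + 0" by (intro tendsto_add t V v)
      thus ?thesis by (simp add: filterlim_sequentially_Suc[of "\<lambda>n. V n + v n"])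
    qed
    hence "(\<lambda>K. V (Suc K) + v (Suc K)) \<in> o(\<lambda>_. 1)" by (simp add: smallo_1_iff_tendsto_0)
    ultimately have "(\<lambda>K. (\<Sum>n\<in>{1..K}. r n) * (V (Suc K) + v (Suc K))) \<in> o(\<lambda>_. 1 * 1)"
      by (rule landau_o.big_small_mult)
    thus ?thesis by (simp add: smallo_1_iff_tendsto_0)
  qed
  ultimately have "((\<lambda>n. r n * V n) has_sum (resolvent_step v z + resolvent_step v (z + 1))) {1..}"
    using has_sum_imp_summable[OF rV] step by (intro abel_star[where V = V and v = v]) auto
  from has_sum_unique[OF rV this] show ?thesis .
qed

lemma resolvent_bound:
  assumes V: "\<And>n. n \<ge> 1 \<Longrightarrow> \<bar>V n\<bar> \<le> C / real n ^ 2" and C: "C \<ge> 0" and x: "x \<noteq> 0" "\<bar>x\<bar> \<le> 1 / 4" and N: "N \<ge> 1"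
  shows "sqrt (real N) * \<bar>resolvent V (real N + x)\<bar> \<le> 2 * C / \<bar>x\<bar> * (\<Sum>\<^sub>\<infinity>p\<in>{1..}. dker N p)"
proof -
  have "norm (\<Sum>\<^sub>\<infinity>k\<in>{1..}. sqrt (real N) * (real k * V k / (real k ^ 2 - (real N + x) ^ 2))) \<le> (\<Sum>\<^sub>\<infinity>k\<in>{1..}. 2 * C / \<bar>x\<bar> * dker N k)"
  proof (rule norm_infsum_le)
    have "V \<in> O(\<lambda>n. 1 / real n ^ 2)"
      by (rule bigoI[of _ C]) (use V in \<open>auto intro!: eventually_sequentiallyI[of 1]\<close>)
    thus "((\<lambda>k. sqrt (real N) * (real k * V k / (real k ^ 2 - (real N + x) ^ 2))) has_sum
        (\<Sum>\<^sub>\<infinity>k\<in>{1..}. sqrt (real N) * (real k * V k / (real k ^ 2 - (real N + x) ^ 2)))) {1..}"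
      by (intro has_sum_infsum summable_on_cmult_right has_sum_imp_summable[OF resolvent_has_sum])
    show "((\<lambda>k. 2 * C / \<bar>x\<bar> * dker N k) has_sum (\<Sum>\<^sub>\<infinity>k\<in>{1..}. 2 * C / \<bar>x\<bar> * dker N k)) {1..}"
      by (intro has_sum_infsum summable_on_cmult_right dker_inner_summable N)
  next
    fix k :: nat assume k: "k \<in> {1..}"
    have "norm (sqrt (real N) * (real k * V k / (real k ^ 2 - (real N + x) ^ 2))) =
        sqrt (real N) * (real k * \<bar>V k\<bar> / \<bar>real k ^ 2 - (real N + x) ^ 2\<bar>)" by (simp add: abs_mult)
    also have "\<dots> \<le> sqrt (real N) * (real k * (C / real k ^ 2) / \<bar>real k ^ 2 - (real N + x) ^ 2\<bar>)"
      using V[of k] k by (intro mult_left_mono divide_right_mono) auto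
    also have "\<dots> = C * (sqrt (real N) / (real k * \<bar>real k ^ 2 - (real N + x) ^ 2\<bar>))"
      using k by (simp add: power2_eq_square)
    also have "\<dots> \<le> C * (2 / \<bar>x\<bar> * dker N k)"
      using k x N C by (intro mult_left_mono inverse_shifted_square_diff_le) auto
    also have "C * (2 / \<bar>x\<bar> * dker N k) = 2 * C / \<bar>x\<bar> * dker N k" by simp
    finally show "norm (sqrt (real N) * (real k * V k / (real k ^ 2 - (real N + x) ^ 2))) \<le> 2 * C / \<bar>x\<bar> * dker N k" .
  qed
  thus ?thesis unfolding resolvent_def infsum_cmult_right' by (simp add: abs_mult)
qed

text \<open>The weight sqrt N is calibrated to \<open>sum_shifted_inverse_le_sqrt\<close>: in a
  later boundary term the resolvent multiplies partial sums of 1/(n + x).\<close>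

lemma resolvent_sqrt_tendsto_0:
  assumes V: "\<And>n. n \<ge> 1 \<Longrightarrow> \<bar>V n\<bar> \<le> C / real n ^ 2" and C: "C \<ge> 0" and x: "x \<noteq> 0" "\<bar>x\<bar> \<le> 1 / 4"
  shows "(\<lambda>N. sqrt (real N) * resolvent V (real N + x)) \<longlonglongrightarrow> 0"
proof (rule Lim_null_comparison)
  show "\<forall>\<^sub>F N in sequentially. norm (sqrt (real N) * resolvent V (real N + x)) \<le> 2 * C / \<bar>x\<bar> * (\<Sum>\<^sub>\<infinity>p\<in>{1..}. dker N p)"
    using eventually_ge_at_top[of 1] by eventually_elim (use resolvent_bound[OF V C x] in \<open>simp add: abs_mult\<close>)
  show "(\<lambda>N. 2 * C / \<bar>x\<bar> * (\<Sum>\<^sub>\<infinity>p\<in>{1..}. dker N p)) \<longlonglongrightarrow> 0"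
    by (rule tendsto_mult_right_zero[OF dker_inner_tendsto_0])
qed

lemma resolvent_tendsto_0:
  assumes "\<And>n. n \<ge> 1 \<Longrightarrow> \<bar>V n\<bar> \<le> C / real n ^ 2" "C \<ge> 0" "x \<noteq> 0" "\<bar>x\<bar> \<le> 1 / 4"
  shows "(\<lambda>N. resolvent V (real N + x)) \<longlonglongrightarrow> 0"
proof (rule Lim_null_comparison)
  show "\<forall>\<^sub>F N in sequentially. norm (resolvent V (real N + x)) \<le> \<bar>sqrt (real N) * resolvent V (real N + x)\<bar>"
    using eventually_ge_at_top[of 1]
  proof eventually_elim
    case (elim N)
    hence "1 * \<bar>resolvent V (real N + x)\<bar> \<le> sqrt (real N) * \<bar>resolvent V (real N + x)\<bar>"
      by (intro mult_right_mono) auto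
    thus ?case by (simp add: abs_mult)
  qed
  show "(\<lambda>N. \<bar>sqrt (real N) * resolvent V (real N + x)\<bar>) \<longlonglongrightarrow> 0"
    by (rule tendsto_rabs_zero, rule resolvent_sqrt_tendsto_0) fact+
qed

lemma resolvent_div_summable:
  assumes V: "\<And>n. n \<ge> 1 \<Longrightarrow> \<bar>V n\<bar> \<le> C / real n ^ 2" and C: "C \<ge> 0" and x: "x \<noteq> 0" "\<bar>x\<bar> \<le> 1 / 4"
  shows "(\<lambda>N. resolvent V (real N + x) / (real N + x)) summable_on {1..}"
proof (rule abs_summable_summable, rule summable_on_comparison_test)
  show "(\<lambda>N. 2 * (2 * C / \<bar>x\<bar> * (\<Sum>\<^sub>\<infinity>p\<in>{1..}. dker N p))) summable_on {1..}"
    using summable_on_Sigma_banach[OF dker_summable] by (intro summable_on_cmult_right) simp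
next
  fix N :: nat assume N: "N \<in> {1..}"
  hence N1: "real N \<ge> 1" by simp
  have "- x \<le> 1 / 4" using x(2) by (simp add: abs_le_iff)
  hence d: "1 / 2 \<le> real N + x" using N1 by simp
  have "norm (resolvent V (real N + x) / (real N + x)) = \<bar>resolvent V (real N + x)\<bar> / (real N + x)"
    using d by simp
  also have "\<dots> \<le> \<bar>resolvent V (real N + x)\<bar> / (1 / 2)"
    using d by (intro divide_left_mono) auto
  also have "\<dots> \<le> 2 * (sqrt (real N) * \<bar>resolvent V (real N + x)\<bar>)"
    using mult_right_mono[of 1 "sqrt (real N)" "\<bar>resolvent V (real N + x)\<bar>"] N1 by simp
  also have "\<dots> \<le> 2 * (2 * C / \<bar>x\<bar> * (\<Sum>\<^sub>\<infinity>p\<in>{1..}. dker N p))"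
    using resolvent_bound[OF V C x, of N] N by simp
  finally show "norm (resolvent V (real N + x) / (real N + x)) \<le> 2 * (2 * C / \<bar>x\<bar> * (\<Sum>\<^sub>\<infinity>p\<in>{1..}. dker N p))" .
qed auto

text \<open>Telescoping \<open>resolvent_shift\<close> along x, x + 1, x + 2, ... gives
  \<open>resolvent V x\<close> = s(0) + 2 s(1) + 2 s(2) + ... with s(N) the step function at N + x,
  because the resolvent tends to 0 along the translates.\<close>

lemma resolvent_expand:
  fixes V v :: "nat \<Rightarrow> real"
  assumes step: "\<And>n. n \<ge> 1 \<Longrightarrow> V n - V (Suc n) = v n + v (Suc n)"
    and V: "\<And>n. n \<ge> 1 \<Longrightarrow> \<bar>V n\<bar> \<le> C / real n ^ 2" and C: "C \<ge> 0"
    and v: "v \<in> O(\<lambda>n. 1 / real n ^ 2)" and x: "x \<noteq> 0" "\<bar>x\<bar> \<le> 1 / 4"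
    and s: "(\<lambda>N. resolvent_step v (real N + x)) summable_on {1..}"
  shows "((\<lambda>N. resolvent_step v (real N + x)) has_sum (resolvent V x - resolvent_step v x) / 2) {1..}"
proof -
  have xi: "x \<notin> \<int>"
  proof
    assume "x \<in> \<int>"
    then obtain i :: int where "x = of_int i" by (auto elim: Ints_cases)
    with x have "i \<noteq> 0" "\<bar>i\<bar> < 1" by auto
    thus False by simp
  qed
  have VO: "V \<in> O(\<lambda>n. 1 / real n ^ 2)"
    by (rule bigoI[of _ C]) (use V in \<open>auto intro!: eventually_sequentiallyI[of 1]\<close>)
  have sh: "resolvent V (real N + x) - resolvent V (real (Suc N) + x) =
      resolvent_step v (real N + x) + resolvent_step v (real (Suc N) + x)" for N
    using resolvent_shift[OF step VO v, of "real N + x"] xi by (simp add: add_ac)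
  define S where "S = (\<Sum>\<^sub>\<infinity>N\<in>{1..}. resolvent_step v (real N + x))"
  have S: "((\<lambda>N. resolvent_step v (real N + x)) has_sum S) {1..}" using s by (simp add: S_def)
  hence "((\<lambda>N. resolvent_step v (real (Suc N) + x)) has_sum S) UNIV"
    by (subst (asm) has_sum_atLeast_1_iff)
  hence S1: "(\<lambda>N. resolvent_step v (real (Suc N) + x)) sums S" by (rule has_sum_imp_sums)
  hence S0: "(\<lambda>N. resolvent_step v (real N + x)) sums (S + resolvent_step v x)"
    using sums_Suc[of "\<lambda>N. resolvent_step v (real N + x)" S] by simp
  have "(\<lambda>N. resolvent V (real N + x) - resolvent V (real (Suc N) + x)) sums (resolvent V (real 0 + x) - 0)"
    by (rule telescope_sums'[OF resolvent_tendsto_0[OF V C x]])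
  moreover have "(\<lambda>N. resolvent V (real N + x) - resolvent V (real (Suc N) + x)) sums (S + resolvent_step v x + S)"
    unfolding sh by (intro sums_add S0 S1)
  ultimately have "resolvent V x = S + resolvent_step v x + S"
    using sums_unique2 by fastforce
  hence "S = (resolvent V x - resolvent_step v x) / 2" by simp
  from S[unfolded this] show ?thesis .
qed

lemma non_Ints_of_small:
  fixes x :: real
  assumes "x \<noteq> 0" "\<bar>x\<bar> < 1"
  shows "x \<notin> \<int>"
proof
  assume "x \<in> \<int>"
  then obtain i :: int where "x = of_int i" by (auto elim: Ints_cases)
  with assms have "i \<noteq> 0" "\<bar>i\<bar> < 1" by auto
  thus False by simp
qed

text \<open>The true order is logarithmic; the square root has an elementary induction based on sqrt
  K <= s - 1/(2 s) for s = sqrt(K + 1).\<close>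

lemma sum_shifted_inverse_le_sqrt:
  fixes x :: real
  assumes "\<bar>x\<bar> \<le> 1 / 4"
  shows "(\<Sum>n\<in>{1..K}. 1 / (real n + x)) \<le> 4 * sqrt (real K)" "(\<Sum>n\<in>{1..K}. 1 / (real n + x)) \<ge> 0"
proof -
  have x: "x \<ge> - 1 / 4" using assms by (simp add: abs_le_iff)
  show "(\<Sum>n\<in>{1..K}. 1 / (real n + x)) \<le> 4 * sqrt (real K)"
  proof (induction K)
    case (Suc K)
    define s where "s = sqrt (real (Suc K))"
    have s: "s \<ge> 1" "s ^ 2 = real (Suc K)" by (auto simp: s_def)
    have "sqrt (real K) \<le> s - 1 / (2 * s)"
    proof (rule real_le_lsqrt)
      have "1 / (2 * s) \<le> s" using s mult_mono[of 1 s 1 s] by (simp add: field_simps)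
      thus "0 \<le> s - 1 / (2 * s)" by simp
      have "(s - 1 / (2 * s)) ^ 2 = s ^ 2 - 1 + (1 / (2 * s)) ^ 2"
        using s by (simp add: power2_diff)
      thus "real K \<le> (s - 1 / (2 * s)) ^ 2" using s by simp
    qed
    hence 1: "4 * sqrt (real K) \<le> 4 * s - 2 / s" by simp
    have "1 / (real (Suc K) + x) \<le> 1 / (real (Suc K) / 2)"
      using x by (intro divide_left_mono) auto
    also have "\<dots> = 2 / (s * s)" using s by (simp add: power2_eq_square)
    also have "\<dots> \<le> 2 / (s * 1)" using s by (intro divide_left_mono mult_left_mono) auto
    finally have "1 / (real (Suc K) + x) \<le> 2 / s" by simp
    thus ?case using Suc 1 by (simp add: s_def)
  qed simp
  show "(\<Sum>n\<in>{1..K}. 1 / (real n + x)) \<ge> 0"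
    using x by (intro sum_nonneg) auto
qed

lemma summable_on_bigo_three_halves:
  fixes f :: "nat \<Rightarrow> real"
  assumes "f \<in> O(\<lambda>n. real n powr (- 3 / 2))"
  shows "f summable_on A"
proof -
  have "summable (\<lambda>n. real n powr (- 3 / 2))" by (simp add: summable_real_powr_iff)
  moreover have "(\<lambda>n. norm (f n)) \<in> O(\<lambda>n. real n powr (- 3 / 2))"
    using assms by simp
  ultimately have "summable (\<lambda>n. norm (f n))"
    by (intro summable_comparison_test_bigo[where f = "\<lambda>n. norm (f n)" and g = "\<lambda>n. real n powr (- 3 / 2)"]) simp_all
  hence "f summable_on UNIV"
    by (intro norm_summable_imp_summable_on)
  thus ?thesis by (rule summable_on_subset) simp
qed

lemma star_sum_resolvent_eq_Afun:
  assumes "x \<notin> \<int>" "p \<ge> 1"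
  shows "star_sum (\<lambda>k. real k / (real k ^ 2 - x ^ 2)) p = 2 * Afun x - Afun (real p + x) - Afun (real p - x)"
proof -
  have "star_sum (\<lambda>k. real k / (real k ^ 2 - x ^ 2)) p =
      star_sum (\<lambda>k. (1 / 2) * (1 / (real k + x) + 1 / (real k + (- x)))) p"
  proof (rule star_sum_cong)
    fix n
    have "real n ^ 2 - x ^ 2 = (real n - x) * (real n + x)" by (simp add: power2_eq_square algebra_simps)
    thus "real n / (real n ^ 2 - x ^ 2) = (1 / 2) * (1 / (real n + x) + 1 / (real n + (- x)))"
      using non_Ints_neq[OF assms(1), of n] by (simp add: divide_simps)
  qed fact
  also have "\<dots> = (star_sum (\<lambda>k. 1 / (real k + x)) p + star_sum (\<lambda>k. 1 / (real k + (- x))) p) / 2"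
    unfolding star_sum_cmult star_sum_add by simp
  also have "\<dots> = 2 * Afun x - Afun (real p + x) - Afun (real p - x)"
    using star_sum_shifted_inverse[OF assms] star_sum_shifted_inverse[of "- x" p] assms minus_in_Ints_iff[of x]
    by simp
  finally show ?thesis .
qed

lemma alternating_bigo_iff:
  fixes f g :: "nat \<Rightarrow> real"
  shows "(\<lambda>n. (- 1) ^ n * f n) \<in> O(g) \<longleftrightarrow> f \<in> O(g)"
proof -
  have "(\<lambda>n. norm ((- 1) ^ n * f n)) = (\<lambda>n. norm (f n))" by (simp add: abs_mult power_abs)
  thus ?thesis
    using landau_o.big.norm_iff[of f _ g] landau_o.big.norm_iff[of "\<lambda>n. (- 1) ^ n * f n" _ g] by metis
qed

lemma alternating_inverse_bigo:
  "(\<lambda>n. (- 1) ^ n / (real n ^ 2 - y ^ 2)) \<in> O(\<lambda>n. 1 / real n ^ 2)"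
proof -
  have "(\<lambda>n. 1 / (real n ^ 2 - y ^ 2)) \<in> O(\<lambda>n. 1 / real n ^ 2)" by real_asymp
  thus ?thesis using alternating_bigo_iff[of "\<lambda>n. 1 / (real n ^ 2 - y ^ 2)"] by simp
qed

text \<open>Two iterated tails: \<open>\<mu>\<close> comes from the alternating sequence (-1)^n/(n^2
  - y^2), and V from \<mu>(n)/n, both through the relation treated in \<open>abel_star\<close>. The
  connected sums will supply an instance.\<close>

locale kernel_pair =
  fixes x y :: real and \<mu> V :: "nat \<Rightarrow> real"
  assumes xy: "0 < y" "y < x" "x < 1 / 4"
    and mu_step: "\<And>n. n \<ge> 1 \<Longrightarrow> \<mu> n - \<mu> (Suc n) = (- 1) ^ n / (real n ^ 2 - y ^ 2) + (- 1) ^ Suc n / (real (Suc n) ^ 2 - y ^ 2)"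
    and V_step: "\<And>n. n \<ge> 1 \<Longrightarrow> V n - V (Suc n) = \<mu> n / real n + \<mu> (Suc n) / real (Suc n)"
    and mu_bound: "\<And>n. n \<ge> 1 \<Longrightarrow> \<bar>\<mu> n\<bar> \<le> 2 / real n ^ 2"
    and V_bound: "\<And>n. n \<ge> 1 \<Longrightarrow> \<bar>V n\<bar> \<le> 2 / real n ^ 2"
begin

lemma non_Ints: "x \<notin> \<int>" "y \<notin> \<int>" "x + y \<notin> \<int>" "x - y \<notin> \<int>" "- x \<notin> \<int>"
  using xy by (intro non_Ints_of_small; simp)+

lemma denoms:
  "real n + x \<noteq> 0" "real n - x \<noteq> 0" "real n + x - y \<noteq> 0" "real n + x + y \<noteq> 0"
  "real n - x - y \<noteq> 0" "real n - x + y \<noteq> 0" "real n - y \<noteq> 0" "real n + y \<noteq> 0"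
  "(real n + x) ^ 2 - y ^ 2 \<noteq> 0" "(real n - x) ^ 2 - y ^ 2 \<noteq> 0"
proof -
  show 1: "real n + x \<noteq> 0" "real n - x \<noteq> 0" "real n + x - y \<noteq> 0" "real n + x + y \<noteq> 0"
    "real n - x - y \<noteq> 0" "real n - x + y \<noteq> 0" "real n - y \<noteq> 0" "real n + y \<noteq> 0"
    using non_Ints_neq(1,2)[OF non_Ints(1), of n] non_Ints_neq(1,2)[OF non_Ints(2), of n]
      non_Ints_neq(1,2)[OF non_Ints(3), of n] non_Ints_neq(1,2)[OF non_Ints(4), of n]
    by (auto simp: algebra_simps)
  have "(real n + x) ^ 2 - y ^ 2 = (real n + x - y) * (real n + x + y)"
     "(real n - x) ^ 2 - y ^ 2 = (real n - x - y) * (real n - x + y)"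
    by (simp_all add: power2_eq_square algebra_simps)
  thus "(real n + x) ^ 2 - y ^ 2 \<noteq> 0" "(real n - x) ^ 2 - y ^ 2 \<noteq> 0" using 1 by simp_all
qed

text \<open>Twice the \<open>resolvent_step\<close> of the alternating sequence (-1)^n/(n^2 - y^2),
  evaluated by two cosecant series.\<close>

definition W :: "real \<Rightarrow> real" where
  "W t = (y * theta y - t * theta t) / (t * (t ^ 2 - y ^ 2))"

lemma mu_bigo: "\<mu> \<in> O(\<lambda>n. 1 / real n ^ 2)"
  by (rule bigoI[of _ 2]) (use mu_bound in \<open>auto intro!: eventually_sequentiallyI[of 1]\<close>)

lemma resolvent_step_alternating:
  assumes "z \<notin> \<int>" "z ^ 2 \<noteq> y ^ 2"
  shows "resolvent_step (\<lambda>n. (- 1) ^ n / (real n ^ 2 - y ^ 2)) z = W z / 2"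
proof -
  have "((\<lambda>k. (1 / (z * (y ^ 2 - z ^ 2))) * ((y / 2) * ((- 1) ^ k * (2 * y / (real k ^ 2 - y ^ 2))) - (z / 2) * ((- 1) ^ k * (2 * z / (real k ^ 2 - z ^ 2)))))
     has_sum (1 / (z * (y ^ 2 - z ^ 2))) * ((y / 2) * (1 / y - theta y) - (z / 2) * (1 / z - theta z))) {1..}"
    unfolding theta_def by (intro has_sum_cmult_right has_sum_diff csc_has_sum assms non_Ints)
  also have "(1 / (z * (y ^ 2 - z ^ 2))) * ((y / 2) * (1 / y - theta y) - (z / 2) * (1 / z - theta z)) = W z / 2"
    using assms xy non_Ints_nonzero[OF assms(1)] by (simp add: W_def divide_simps) (simp add: algebra_simps)
  finally have *: "((\<lambda>k. (1 / (z * (y ^ 2 - z ^ 2))) * ((y / 2) * ((- 1) ^ k * (2 * y / (real k ^ 2 - y ^ 2))) - (z / 2) * ((- 1) ^ k * (2 * z / (real k ^ 2 - z ^ 2)))))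
     has_sum W z / 2) {1..}" .
  have v: "(\<lambda>n. (- 1) ^ n / (real n ^ 2 - y ^ 2)) \<in> O(\<lambda>n. 1 / real n ^ 2)"
    by (rule alternating_inverse_bigo)
  have "((\<lambda>k. real k ^ 2 * ((- 1) ^ k / (real k ^ 2 - y ^ 2)) / (z * (real k ^ 2 - z ^ 2))) has_sum
      resolvent_step (\<lambda>n. (- 1) ^ n / (real n ^ 2 - y ^ 2)) z) {1..}"
    by (rule resolvent_step_has_sum[OF v])
  also have "?this \<longleftrightarrow> ((\<lambda>k. (1 / (z * (y ^ 2 - z ^ 2))) * ((y / 2) * ((- 1) ^ k * (2 * y / (real k ^ 2 - y ^ 2))) - (z / 2) * ((- 1) ^ k * (2 * z / (real k ^ 2 - z ^ 2)))))
     has_sum resolvent_step (\<lambda>n. (- 1) ^ n / (real n ^ 2 - y ^ 2)) z) {1..}"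
  proof (intro has_sum_cong)
    fix k :: nat
    show "real k ^ 2 * ((- 1) ^ k / (real k ^ 2 - y ^ 2)) / (z * (real k ^ 2 - z ^ 2)) =
      (1 / (z * (y ^ 2 - z ^ 2))) * ((y / 2) * ((- 1) ^ k * (2 * y / (real k ^ 2 - y ^ 2))) - (z / 2) * ((- 1) ^ k * (2 * z / (real k ^ 2 - z ^ 2))))"
      using non_Ints_neq(3)[OF assms(1), of k] non_Ints_neq(3)[OF non_Ints(2), of k] assms non_Ints_nonzero[OF assms(1)]
      by (simp add: divide_simps) (simp add: power2_eq_square algebra_simps)
  qed
  finally show ?thesis using * has_sum_unique by blast
qed

lemma resolvent_step_mu: "resolvent_step (\<lambda>n. \<mu> n / real n) z = resolvent \<mu> z / z"
proof -
  have "(\<Sum>\<^sub>\<infinity>k\<in>{1..}. real k ^ 2 * (\<mu> k / real k) / (real k ^ 2 - z ^ 2)) = resolvent \<mu> z"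
    unfolding resolvent_def by (intro infsum_cong) (simp add: power2_eq_square)
  thus ?thesis by (simp add: resolvent_step_def)
qed

text \<open>This is \<open>resolvent_expand\<close> for V and \<mu>(n)/n: dividing by n turns the
  step function into the resolvent of \<open>\<mu>\<close> over its argument.\<close>

lemma first_expansion:
  assumes s: "s = x \<or> s = - x"
  shows "((\<lambda>N. resolvent \<mu> (real N + s) / (real N + s)) has_sum (resolvent V s - resolvent \<mu> s / s) / 2) {1..}"
proof -
  have s': "s \<noteq> 0" "\<bar>s\<bar> \<le> 1 / 4" using s xy by auto
  have "(\<lambda>n. (1 / real n) * \<mu> n) \<in> O(\<lambda>n. 1 * (1 / real n ^ 2))"
    by (intro landau_o.big.mult mu_bigo) real_asymp
  hence v: "(\<lambda>n. \<mu> n / real n) \<in> O(\<lambda>n. 1 / real n ^ 2)" by simp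
  have "((\<lambda>N. resolvent_step (\<lambda>n. \<mu> n / real n) (real N + s)) has_sum (resolvent V s - resolvent_step (\<lambda>n. \<mu> n / real n) s) / 2) {1..}"
    by (rule resolvent_expand[OF V_step V_bound _ v s'], assumption+)
       (use resolvent_div_summable[OF mu_bound _ s'] in \<open>simp_all add: resolvent_step_mu\<close>)
  thus ?thesis by (simp only: resolvent_step_mu)
qed

lemma theta_shift:
  assumes s: "s = x \<or> s = - x"
  shows "theta (real N + s) = (- 1) ^ N * theta s"
  by (rule theta_add_nat)

text \<open>On the translates theta only changes sign, so t theta(t) grows no faster than t and one
  factor of the cubic denominator is lost.\<close>

lemma W_bigo:
  assumes s: "s = x \<or> s = - x"
  shows "(\<lambda>N. W (real N + s)) \<in> O(\<lambda>N. 1 / real N ^ 2)"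
proof -
  have e: "W (real N + s) = y * theta y * (1 / ((real N + s) * ((real N + s) ^ 2 - y ^ 2)))
      - theta s * ((- 1) ^ N * (1 / ((real N + s) ^ 2 - y ^ 2)))" for N
  proof -
    define t where "t = real N + s"
    have nz: "t \<noteq> 0" "t ^ 2 - y ^ 2 \<noteq> 0" using denoms[of N] s by (auto simp: t_def)
    have "theta t = (- 1) ^ N * theta s" unfolding t_def by (rule theta_shift[OF s])
    thus ?thesis unfolding t_def[symmetric] using nz(1) by (simp add: W_def diff_divide_distrib)
  qed
  have 1: "(\<lambda>N. 1 / ((real N + s) * ((real N + s) ^ 2 - y ^ 2))) \<in> O(\<lambda>N. 1 / real N ^ 2)" by real_asymp
  have 2: "(\<lambda>N. (- 1) ^ N * (1 / ((real N + s) ^ 2 - y ^ 2))) \<in> O(\<lambda>N. 1 / real N ^ 2)"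
    unfolding alternating_bigo_iff by real_asymp
  have "(\<lambda>N. y * theta y * (1 / ((real N + s) * ((real N + s) ^ 2 - y ^ 2)))) \<in> O(\<lambda>N. 1 * (1 / real N ^ 2))"
    by (intro landau_o.big.mult 1) simp
  moreover have "(\<lambda>N. theta s * ((- 1) ^ N * (1 / ((real N + s) ^ 2 - y ^ 2)))) \<in> O(\<lambda>N. 1 * (1 / real N ^ 2))"
    by (intro landau_o.big.mult 2) simp
  ultimately show ?thesis unfolding e by (intro sum_in_bigo) simp_all
qed

lemma sum_bigo_sqrt:
  assumes s: "s = x \<or> s = - x"
  shows "(\<lambda>K. \<Sum>n\<in>{1..K}. 1 / (real n + s)) \<in> O(\<lambda>K. sqrt (real K))"
proof (rule bigoI[of _ 4], rule always_eventually, rule allI)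
  fix K
  have "\<bar>s\<bar> \<le> 1 / 4" using s xy by auto
  from sum_shifted_inverse_le_sqrt[OF this, of K]
  show "norm (\<Sum>n\<in>{1..K}. 1 / (real n + s)) \<le> 4 * norm (sqrt (real K))" by simp
qed

lemma W_star_summable:
  assumes s: "s = x \<or> s = - x"
  shows "(\<lambda>N. W (real N + s) * star_sum (\<lambda>n. 1 / (real n + s)) N) summable_on {1..}"
proof (rule summable_on_bigo_three_halves)
  have "(\<lambda>N. 2 * (\<Sum>n\<in>{1..N}. 1 / (real n + s)) - 1 / (real N + s)) \<in> O(\<lambda>N. sqrt (real N))"
  proof (rule sum_in_bigo)
    show "(\<lambda>N. 2 * (\<Sum>n\<in>{1..N}. 1 / (real n + s))) \<in> O(\<lambda>N. sqrt (real N))"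
      using sum_bigo_sqrt[OF s] by simp
    show "(\<lambda>N. 1 / (real N + s)) \<in> O(\<lambda>N. sqrt (real N))" by real_asymp
  qed
  moreover have "eventually (\<lambda>N. 2 * (\<Sum>n\<in>{1..N}. 1 / (real n + s)) - 1 / (real N + s) = star_sum (\<lambda>n. 1 / (real n + s)) N) at_top"
    using eventually_ge_at_top[of 1] by eventually_elim (simp add: star_sum_alt)
  ultimately have "(\<lambda>N. star_sum (\<lambda>n. 1 / (real n + s)) N) \<in> O(\<lambda>N. sqrt (real N))"
    by (rule landau_o.big.in_cong[THEN iffD1, rotated])
  hence "(\<lambda>N. W (real N + s) * star_sum (\<lambda>n. 1 / (real n + s)) N) \<in> O(\<lambda>N. 1 / real N ^ 2 * sqrt (real N))"
    by (intro landau_o.big.mult W_bigo s)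
  also have "(\<lambda>N. 1 / real N ^ 2 * sqrt (real N)) \<in> O(\<lambda>N. real N powr (- 3 / 2))" by real_asymp
  finally show "(\<lambda>N. W (real N + s) * star_sum (\<lambda>n. 1 / (real n + s)) N) \<in> O(\<lambda>N. real N powr (- 3 / 2))" .
qed

text \<open>Summation by parts along the translates. By \<open>resolvent_shift\<close> the values of
  the resolvent of \<open>\<mu>\<close> at n + s satisfy the hypothesis of \<open>abel_star\<close>
  with v(n) = W(n + s)/2; the weights are r(n) = 1/(n + s). Comparison with
  \<open>first_expansion\<close> identifies the sum.\<close>

lemma second_expansion:
  assumes s: "s = x \<or> s = - x"
  shows "((\<lambda>N. W (real N + s) * star_sum (\<lambda>n. 1 / (real n + s)) N) has_sum (resolvent V s - resolvent \<mu> s / s)) {1..}"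
proof -
  define S where "S = (\<Sum>\<^sub>\<infinity>N\<in>{1..}. W (real N + s) * star_sum (\<lambda>n. 1 / (real n + s)) N)"
  have S: "((\<lambda>N. W (real N + s) * star_sum (\<lambda>n. 1 / (real n + s)) N) has_sum S) {1..}"
    using W_star_summable[OF s] by (simp add: S_def)
  have s': "s \<noteq> 0" "\<bar>s\<bar> \<le> 1 / 4" using s xy by auto
  have "((\<lambda>n. (1 / (real n + s)) * resolvent \<mu> (real n + s)) has_sum (S / 2)) {1..}"
  proof (rule abel_star[where v = "\<lambda>n. W (real n + s) / 2"])
    fix n :: nat
    have v: "(\<lambda>n. (- 1) ^ n / (real n ^ 2 - y ^ 2)) \<in> O(\<lambda>n. 1 / real n ^ 2)"
      by (rule alternating_inverse_bigo)
    have ni: "real n + s \<notin> \<int>" for n using s non_Ints by auto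
    have sq: "(real n + s) ^ 2 \<noteq> y ^ 2" for n using s denoms[of n] by auto
    have "resolvent \<mu> (real n + s) - resolvent \<mu> (real n + s + 1) =
       resolvent_step (\<lambda>n. (- 1) ^ n / (real n ^ 2 - y ^ 2)) (real n + s) + resolvent_step (\<lambda>n. (- 1) ^ n / (real n ^ 2 - y ^ 2)) (real n + s + 1)"
      by (rule resolvent_shift[OF mu_step mu_bigo v ni])
    moreover have "real n + s + 1 = real (Suc n) + s" by simp
    ultimately show "resolvent \<mu> (real n + s) - resolvent \<mu> (real (Suc n) + s) = W (real n + s) / 2 + W (real (Suc n) + s) / 2"
      using resolvent_step_alternating[OF ni sq] by (simp only:)
  next
    have "((\<lambda>N. (1 / 2) * (W (real N + s) * star_sum (\<lambda>n. 1 / (real n + s)) N)) has_sum (1 / 2) * S) {1..}"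
      by (rule has_sum_cmult_right[OF S])
    thus "((\<lambda>N. W (real N + s) / 2 * star_sum (\<lambda>n. 1 / (real n + s)) N) has_sum S / 2) {1..}" by simp
  next
    show "(\<lambda>n. 1 / (real n + s) * resolvent \<mu> (real n + s)) summable_on {1..}"
      using has_sum_imp_summable[OF first_expansion[OF s]] by simp
  next
    \<comment> \<open>The boundary term: its second factor is o(1/sqrt K), while the partial sums of
      1/(n + s) are O(sqrt K).\<close>
    have "(\<lambda>K. sqrt (real K) * (resolvent \<mu> (real K + s) + W (real K + s) / 2)) \<longlonglongrightarrow> 0"
    proof -
      have "(\<lambda>K. sqrt (real K) * W (real K + s)) \<in> O(\<lambda>K. sqrt (real K) * (1 / real K ^ 2))"
        by (intro landau_o.big.mult W_bigo s) simp
      also have "(\<lambda>K. sqrt (real K) * (1 / real K ^ 2)) \<in> o(\<lambda>_. 1)" by real_asymp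
      finally have "(\<lambda>K. sqrt (real K) * W (real K + s)) \<longlonglongrightarrow> 0" by (simp add: smallo_1_iff_tendsto_0)
      moreover have "(\<lambda>K. sqrt (real K) * resolvent \<mu> (real K + s)) \<longlonglongrightarrow> 0"
        by (rule resolvent_sqrt_tendsto_0[OF mu_bound _ s']) auto
      ultimately have "(\<lambda>K. sqrt (real K) * resolvent \<mu> (real K + s) + (1 / 2) * (sqrt (real K) * W (real K + s))) \<longlonglongrightarrow> 0 + (1 / 2) * 0"
        by (intro tendsto_intros)
      thus ?thesis by (simp add: algebra_simps)
    qed
    hence "(\<lambda>K. sqrt (real (Suc K)) * (resolvent \<mu> (real (Suc K) + s) + W (real (Suc K) + s) / 2)) \<longlonglongrightarrow> 0"
      by (rule LIMSEQ_Suc)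
    hence "(\<lambda>K. sqrt (real (Suc K)) * (resolvent \<mu> (real (Suc K) + s) + W (real (Suc K) + s) / 2)) \<in> o(\<lambda>_. 1)"
      by (simp add: smallo_1_iff_tendsto_0)
    moreover have "(\<lambda>K. (\<Sum>n\<in>{1..K}. 1 / (real n + s)) / sqrt (real (Suc K))) \<in> O(\<lambda>_. 1)"
    proof -
      have "(\<lambda>K. (\<Sum>n\<in>{1..K}. 1 / (real n + s)) * (1 / sqrt (real (Suc K)))) \<in> O(\<lambda>K. sqrt (real K) * (1 / sqrt (real (Suc K))))"
        by (intro landau_o.big.mult sum_bigo_sqrt s) simp
      also have "(\<lambda>K. sqrt (real K) * (1 / sqrt (real (Suc K)))) \<in> O(\<lambda>_. 1)" by real_asymp
      finally show ?thesis by simp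
    qed
    ultimately have "(\<lambda>K. (\<Sum>n\<in>{1..K}. 1 / (real n + s)) / sqrt (real (Suc K)) * (sqrt (real (Suc K)) * (resolvent \<mu> (real (Suc K) + s) + W (real (Suc K) + s) / 2))) \<in> o(\<lambda>_. 1 * 1)"
      by (intro landau_o.big_small_mult)
    hence "(\<lambda>K. (\<Sum>n\<in>{1..K}. 1 / (real n + s)) * (resolvent \<mu> (real (Suc K) + s) + W (real (Suc K) + s) / 2)) \<in> o(\<lambda>_. 1)"
      by simp
    thus "(\<lambda>K. (\<Sum>n\<in>{1..K}. 1 / (real n + s)) * (resolvent \<mu> (real (Suc K) + s) + W (real (Suc K) + s) / 2)) \<longlonglongrightarrow> 0"
      by (simp add: smallo_1_iff_tendsto_0)
  qed
  hence "((\<lambda>n. resolvent \<mu> (real n + s) / (real n + s)) has_sum (S / 2)) {1..}" by simp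
  from has_sum_unique[OF this first_expansion[OF s]] have "S = resolvent V s - resolvent \<mu> s / s" by simp
  with S show ?thesis by simp
qed

end

section \<open>Evaluation of the expansion at x and -x\<close>

context kernel_pair
begin

lemma Afun_terms:
  assumes n: "n \<ge> 1"
  shows "x ^ 2 / (real n * (real n ^ 2 - x ^ 2)) = (1 / (real n - x) + 1 / (real n + x)) / 2 - 1 / real n"
    and "(x + y) ^ 2 / (real n * (real n ^ 2 - (x + y) ^ 2)) = (1 / (real n - x - y) + 1 / (real n + x + y)) / 2 - 1 / real n"
    and "(x - y) ^ 2 / (real n * (real n ^ 2 - (x - y) ^ 2)) = (1 / (real n - x + y) + 1 / (real n + x - y)) / 2 - 1 / real n"
  using Afun_term[OF non_Ints(1) n] Afun_term[OF non_Ints(3) n] Afun_term[OF non_Ints(4) n]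
  by (simp_all add: algebra_simps)

lemma cot_terms:
  "2 * x / (real n ^ 2 - x ^ 2) = 1 / (real n - x) - 1 / (real n + x)"
  "2 * (x + y) / (real n ^ 2 - (x + y) ^ 2) = 1 / (real n - x - y) - 1 / (real n + x + y)"
  "2 * (x - y) / (real n ^ 2 - (x - y) ^ 2) = 1 / (real n - x + y) - 1 / (real n + x - y)"
proof -
  have *: "2 * t / (real n ^ 2 - t ^ 2) = 1 / (real n - t) - 1 / (real n + t)" if "t \<notin> \<int>" for t
  proof -
    have "real n ^ 2 - t ^ 2 = (real n - t) * (real n + t)" by (simp add: power2_eq_square algebra_simps)
    thus ?thesis using non_Ints_neq[OF that, of n] by (simp add: divide_simps)
  qed
  show "2 * x / (real n ^ 2 - x ^ 2) = 1 / (real n - x) - 1 / (real n + x)"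
    "2 * (x + y) / (real n ^ 2 - (x + y) ^ 2) = 1 / (real n - x - y) - 1 / (real n + x + y)"
    "2 * (x - y) / (real n ^ 2 - (x - y) ^ 2) = 1 / (real n - x + y) - 1 / (real n + x - y)"
    using *[OF non_Ints(1)] *[OF non_Ints(3)] *[OF non_Ints(4)] by (simp_all add: algebra_simps)
qed

text \<open>Partial fractions with poles 0, y and -y. The value theta(t) multiplies only the
  difference of the poles at y and -y, so along the translates this part becomes an alternating
  sum.\<close>

lemma W_split:
  assumes "t \<noteq> 0" "t - y \<noteq> 0" "t + y \<noteq> 0"
  shows "W t = theta y / y * ((1 / (t - y) + 1 / (t + y)) / 2 - 1 / t) - theta t / (2 * y) * (1 / (t - y) - 1 / (t + y))"
proof -
  have "t ^ 2 - y ^ 2 = (t - y) * (t + y)" by (simp add: power2_eq_square algebra_simps)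
  thus ?thesis using assms xy
    by (simp add: W_def divide_simps) (simp add: power2_eq_square algebra_simps)
qed

lemma W_plus:
  assumes n: "n \<ge> 1"
  shows "W (real n + x) = theta y / y * ((1 / (real n + x - y) + 1 / (real n + x + y)) / 2 - 1 / (real n + x))
       - (- 1) ^ n * (theta x / (2 * y) * (1 / (real n + x - y) - 1 / (real n + x + y)))"
    and "W (real n - x) = theta y / y * ((1 / (real n - x - y) + 1 / (real n - x + y)) / 2 - 1 / (real n - x))
       + (- 1) ^ n * (theta x / (2 * y) * (1 / (real n - x - y) - 1 / (real n - x + y)))"
proof -
  have th: "theta (real n + x) = (- 1) ^ n * theta x" "theta (real n - x) = - ((- 1) ^ n * theta x)"
    using theta_add_nat[of n x] theta_add_nat[of n "- x"] by simp_all
  show "W (real n + x) = theta y / y * ((1 / (real n + x - y) + 1 / (real n + x + y)) / 2 - 1 / (real n + x))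
       - (- 1) ^ n * (theta x / (2 * y) * (1 / (real n + x - y) - 1 / (real n + x + y)))"
    using W_split[of "real n + x"] denoms[of n] by (simp add: th)
  show "W (real n - x) = theta y / y * ((1 / (real n - x - y) + 1 / (real n - x + y)) / 2 - 1 / (real n - x))
       + (- 1) ^ n * (theta x / (2 * y) * (1 / (real n - x - y) - 1 / (real n - x + y)))"
    using W_split[of "real n - x"] denoms[of n] by (simp add: th)
qed

text \<open>The sum over n >= 1 of W(n + x) + W(n - x); \<open>w_minus\<close> is the sum of W(n +
  x) - W(n - x). Adding the translates leads to \<open>Afun\<close> and \<open>Abar\<close>,
  subtracting them to cotangents and cosecants.\<close>

definition w_plus :: real where
  "w_plus = (theta y * (Afun (x + y) + Afun (x - y) - 2 * Afun x) + theta x * (Abar (x + y) - Abar (x - y))) / y"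

definition w_minus :: real where
  "w_minus = theta y / y * (1 / x - pi * cot (pi * x) - (1 / (x + y) - pi * cot (pi * (x + y))) / 2
      - (1 / (x - y) - pi * cot (pi * (x - y))) / 2)
    - theta x / (2 * y) * ((1 / (x + y) - theta (x + y)) - (1 / (x - y) - theta (x - y)))"

lemma w_plus_has_sum: "((\<lambda>n. W (real n + x) + W (real n - x)) has_sum w_plus) {1..}"
proof -
  let ?A = "\<lambda>t n. t ^ 2 / (real n * (real n ^ 2 - t ^ 2))"
  have "((\<lambda>n. theta y / y * (?A (x + y) n + ?A (x - y) n - 2 * ?A x n) +
       theta x / y * ((- 1) ^ n * ?A (x + y) n - (- 1) ^ n * ?A (x - y) n)) has_sum
     (theta y / y * (Afun (x + y) + Afun (x - y) - 2 * Afun x) + theta x / y * (Abar (x + y) - Abar (x - y)))) {1..}"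
    by (intro has_sum_add has_sum_diff has_sum_cmult_right Afun_has_sum Abar_has_sum non_Ints)
  also have "?this \<longleftrightarrow> ((\<lambda>n. W (real n + x) + W (real n - x)) has_sum
     (theta y / y * (Afun (x + y) + Afun (x - y) - 2 * Afun x) + theta x / y * (Abar (x + y) - Abar (x - y)))) {1..}"
  proof (rule has_sum_cong)
    fix n :: nat assume "n \<in> {1..}"
    hence n: "n \<ge> 1" by simp
    define e where "e = (- 1 :: real) ^ n"
    define ty tx where "ty = theta y / y" and "tx = theta x / y"
    have 2: "theta x / (2 * y) = tx / 2" by (simp add: tx_def)
    define i j where "i = 1 / (real n + x)" and "j = 1 / (real n - x)"
    show "theta y / y * (?A (x + y) n + ?A (x - y) n - 2 * ?A x n) +
       theta x / y * ((- 1) ^ n * ?A (x + y) n - (- 1) ^ n * ?A (x - y) n) = W (real n + x) + W (real n - x)"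
      unfolding Afun_terms[OF n] W_plus[OF n] e_def[symmetric] 2 ty_def[symmetric] tx_def[symmetric]
        i_def[symmetric] j_def[symmetric]
      by (simp add: field_simps)
  qed
  finally show ?thesis by (simp add: w_plus_def add_divide_distrib)
qed

lemma w_minus_has_sum: "((\<lambda>n. W (real n + x) - W (real n - x)) has_sum w_minus) {1..}"
proof -
  let ?C = "\<lambda>t n. 2 * t / (real n ^ 2 - t ^ 2)"
  have "((\<lambda>n. theta y / y * (?C x n - (1 / 2) * ?C (x + y) n - (1 / 2) * ?C (x - y) n) -
       theta x / (2 * y) * ((- 1) ^ n * ?C (x + y) n - (- 1) ^ n * ?C (x - y) n)) has_sum
     (theta y / y * (1 / x - pi * cot (pi * x) - (1 / 2) * (1 / (x + y) - pi * cot (pi * (x + y)))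
        - (1 / 2) * (1 / (x - y) - pi * cot (pi * (x - y)))) -
      theta x / (2 * y) * ((1 / (x + y) - pi / sin (pi * (x + y))) - (1 / (x - y) - pi / sin (pi * (x - y)))))) {1..}"
    by (intro has_sum_diff has_sum_cmult_right cot_has_sum csc_has_sum non_Ints)
  also have "theta y / y * (1 / x - pi * cot (pi * x) - (1 / 2) * (1 / (x + y) - pi * cot (pi * (x + y)))
        - (1 / 2) * (1 / (x - y) - pi * cot (pi * (x - y)))) -
      theta x / (2 * y) * ((1 / (x + y) - pi / sin (pi * (x + y))) - (1 / (x - y) - pi / sin (pi * (x - y)))) = w_minus"
    by (simp add: w_minus_def theta_def)
  finally have "((\<lambda>n. theta y / y * (?C x n - (1 / 2) * ?C (x + y) n - (1 / 2) * ?C (x - y) n) -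
       theta x / (2 * y) * ((- 1) ^ n * ?C (x + y) n - (- 1) ^ n * ?C (x - y) n)) has_sum w_minus) {1..}" .
  also have "?this \<longleftrightarrow> ?thesis"
  proof (rule has_sum_cong)
    fix n :: nat assume "n \<in> {1..}"
    hence n: "n \<ge> 1" by simp
    define e where "e = (- 1 :: real) ^ n"
    define ty tx where "ty = theta y / y" and "tx = theta x / (2 * y)"
    show "theta y / y * (?C x n - (1 / 2) * ?C (x + y) n - (1 / 2) * ?C (x - y) n) -
       theta x / (2 * y) * ((- 1) ^ n * ?C (x + y) n - (- 1) ^ n * ?C (x - y) n) = W (real n + x) - W (real n - x)"
      unfolding cot_terms W_plus[OF n] e_def[symmetric] ty_def[symmetric] tx_def[symmetric]
      by (simp add: algebra_simps add_divide_distrib diff_divide_distrib)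
  qed
  finally show ?thesis .
qed

text \<open>The summand over p of W(t) (Afun y - Afun t), see \<open>dterm_has_sum\<close>; the
  factor t^2 - y^2 in the denominator of W has cancelled.\<close>

definition dterm :: "real \<Rightarrow> nat \<Rightarrow> real" where
  "dterm t p = - (y * theta y - t * theta t) / t * (real p / ((real p ^ 2 - y ^ 2) * (real p ^ 2 - t ^ 2)))"

lemma dterm_has_sum:
  assumes "t \<notin> \<int>" "t ^ 2 - y ^ 2 \<noteq> 0"
  shows "((\<lambda>p. dterm t p) has_sum (W t * (Afun y - Afun t))) {1..}"
proof -
  have "((\<lambda>p. W t * (real p * (y ^ 2 - t ^ 2) / ((real p ^ 2 - y ^ 2) * (real p ^ 2 - t ^ 2)))) has_sum (W t * (Afun y - Afun t))) {1..}"
    by (intro has_sum_cmult_right Afun_diff_has_sum assms non_Ints)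
  also have "(\<lambda>p. W t * (real p * (y ^ 2 - t ^ 2) / ((real p ^ 2 - y ^ 2) * (real p ^ 2 - t ^ 2)))) = dterm t"
  proof
    fix p
    define q where "q = real p / ((real p ^ 2 - y ^ 2) * (real p ^ 2 - t ^ 2))"
    have "W t * (y ^ 2 - t ^ 2) = - (y * theta y - t * theta t) / t"
      using assms non_Ints_nonzero[OF assms(1)] by (simp add: W_def divide_simps) (simp add: algebra_simps)
    hence "W t * (y ^ 2 - t ^ 2) * q = - (y * theta y - t * theta t) / t * q" by simp
    moreover have "W t * (real p * (y ^ 2 - t ^ 2) / ((real p ^ 2 - y ^ 2) * (real p ^ 2 - t ^ 2))) = W t * (y ^ 2 - t ^ 2) * q"
      by (simp add: q_def)
    ultimately show "W t * (real p * (y ^ 2 - t ^ 2) / ((real p ^ 2 - y ^ 2) * (real p ^ 2 - t ^ 2))) = dterm t p"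
      by (simp only: dterm_def q_def)
  qed
  finally show ?thesis .
qed

text \<open>The numerator over t is bounded since |theta t| = |theta x|, and the remaining factor is
  of the form majorised by \<open>dker\<close>; this makes the double sum over n and p absolutely
  convergent.\<close>

lemma dterm_bound:
  assumes s: "s = x \<or> s = - x" and p: "p \<ge> 1" and n: "n \<ge> 1"
  shows "\<bar>dterm (real n + s) p\<bar> \<le> (2 * \<bar>y * theta y\<bar> + \<bar>theta x\<bar>) * 2 * (2 / x) * dker n p"
proof -
  define t where "t = real n + s"
  have t: "t \<ge> 1 / 2" using s n xy by (auto simp: t_def)
  have "theta t = (- 1) ^ n * theta s" unfolding t_def by (rule theta_shift[OF s])
  hence th: "\<bar>theta t\<bar> = \<bar>theta x\<bar>" using s by (auto simp: abs_mult power_abs)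
  have "\<bar>- (y * theta y - t * theta t) / t\<bar> = \<bar>theta t - y * theta y / t\<bar>"
    using t by (simp add: field_simps)
  also have "\<dots> \<le> \<bar>theta t\<bar> + \<bar>y * theta y\<bar> / t" using t abs_triangle_ineq4[of "theta t" "y * theta y / t"] by simp
  also have "\<bar>y * theta y\<bar> / t \<le> \<bar>y * theta y\<bar> / (1 / 2)" using t by (intro divide_left_mono) auto
  finally have 1: "\<bar>- (y * theta y - t * theta t) / t\<bar> \<le> 2 * \<bar>y * theta y\<bar> + \<bar>theta x\<bar>" using th by simp
  have p2: "real p ^ 2 \<ge> 1" using p by simp
  have "y * y \<le> 1 / 4 * (1 / 4)" using xy by (intro mult_mono) auto
  hence y2: "y ^ 2 \<le> 1 / 2" by (simp add: power2_eq_square)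
  have ge: "real p ^ 2 - y ^ 2 \<ge> real p ^ 2 / 2" using p2 y2 by simp
  hence pos: "real p ^ 2 - y ^ 2 > 0" using p2 by linarith
  have "real p / (real p ^ 2 - y ^ 2) \<le> real p / (real p ^ 2 / 2)"
    using ge p pos by (intro divide_left_mono) auto
  moreover have "real p / (real p ^ 2 / 2) = 2 / real p" using p by (simp add: power2_eq_square)
  ultimately have 2: "real p / (real p ^ 2 - y ^ 2) \<le> 2 / real p" by (simp only:)
  have "\<bar>real p / ((real p ^ 2 - y ^ 2) * (real p ^ 2 - t ^ 2))\<bar> = real p / (real p ^ 2 - y ^ 2) * (1 / \<bar>real p ^ 2 - t ^ 2\<bar>)"
    using pos by (simp add: abs_mult)
  also have "\<dots> \<le> 2 / real p * (1 / \<bar>real p ^ 2 - t ^ 2\<bar>)"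
    by (intro mult_right_mono 2) auto
  also have "\<dots> = 2 * (1 / (real p * \<bar>real p ^ 2 - t ^ 2\<bar>))" by simp
  also have "\<dots> \<le> 2 * (2 / \<bar>s\<bar> * dker n p)" unfolding t_def
    by (intro mult_left_mono inverse_shifted_square_diff_le' p n) (use s xy in auto)
  finally have 3: "\<bar>real p / ((real p ^ 2 - y ^ 2) * (real p ^ 2 - t ^ 2))\<bar> \<le> 2 * (2 / \<bar>s\<bar> * dker n p)" .
  have "\<bar>dterm t p\<bar> = \<bar>- (y * theta y - t * theta t) / t\<bar> * \<bar>real p / ((real p ^ 2 - y ^ 2) * (real p ^ 2 - t ^ 2))\<bar>"
    unfolding dterm_def abs_mult by simp
  also have "\<dots> \<le> (2 * \<bar>y * theta y\<bar> + \<bar>theta x\<bar>) * (2 * (2 / \<bar>s\<bar> * dker n p))"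
    by (intro mult_mono 1 3) auto
  also have "\<bar>s\<bar> = x" using s xy by auto
  finally show ?thesis by (simp add: t_def mult_ac)
qed

definition kap :: "nat \<Rightarrow> real" where
  "kap p = star_sum (\<lambda>k. real k / (real k ^ 2 - x ^ 2)) p"

definition altstar :: "nat \<Rightarrow> real" where
  "altstar p = 2 / x - 2 * x * star_sum (\<lambda>k. (- 1) ^ k / (real k ^ 2 - x ^ 2)) p"

text \<open>Minus twice the sum over n of \<open>dterm\<close> at n + x and n - x for fixed p, see
  \<open>dterm_column\<close>.\<close>

definition fterm :: "nat \<Rightarrow> real" where
  "fterm p = 2 * y * theta y * kap p / (real p * (real p ^ 2 - y ^ 2)) + theta x * (- 1) ^ p * altstar p / (real p ^ 2 - y ^ 2)"

lemma altstar_eq: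
  assumes "p \<ge> 1"
  shows "(- 1) ^ p * (Abar (real p + x) - Abar (real p - x)) = - altstar p / 2"
proof -
  have "star_sum (\<lambda>M. (- 1) ^ M * (1 / (real M + x) - 1 / (real M - x))) p =
      star_sum (\<lambda>k. (- 2 * x) * ((- 1) ^ k / (real k ^ 2 - x ^ 2))) p"
  proof (rule star_sum_cong)
    fix n
    have "1 / (real n + x) - 1 / (real n - x) = - (2 * x / (real n ^ 2 - x ^ 2))"
      using cot_terms(1)[of n] by simp
    thus "(- 1) ^ n * (1 / (real n + x) - 1 / (real n - x)) = (- 2 * x) * ((- 1) ^ n / (real n ^ 2 - x ^ 2))"
      by simp
  qed fact
  also have "\<dots> = (- 2 * x) * star_sum (\<lambda>k. (- 1) ^ k / (real k ^ 2 - x ^ 2)) p"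
    by (rule star_sum_cmult)
  finally show ?thesis using Abar_diff_star_sum[OF non_Ints(1) assms] by (simp add: altstar_def)
qed

text \<open>For fixed p the partial fractions in t have poles at 0, p and -p. Summed over t = n + x
  and t = n - x they give \<open>Afun\<close> at x, p + x, p - x and \<open>Abar\<close> at p + x, p
  - x. These combinations are finite star sums by \<open>star_sum_resolvent_eq_Afun\<close> and
  \<open>altstar_eq\<close>.\<close>

lemma dterm_column:
  assumes p: "p \<ge> 1"
  shows "((\<lambda>n. dterm (real n + x) p + dterm (real n - x) p) has_sum (- fterm p / 2)) {1..}"
proof -
  let ?A = "\<lambda>t n. t ^ 2 / (real n * (real n ^ 2 - t ^ 2))"
  define c where "c = real p / (real p ^ 2 - y ^ 2)"
  have pp: "real p ^ 2 - y ^ 2 \<noteq> 0" using non_Ints_neq(3)[OF non_Ints(2)] .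
  have ni: "real p + x \<notin> \<int>" "real p - x \<notin> \<int>" using non_Ints by auto
  have "((\<lambda>n. (- c * (y * theta y / real p ^ 2)) * (2 * ?A x n - ?A (real p + x) n - ?A (real p - x) n)
      + (c * (theta x / real p)) * ((- 1) ^ n * ?A (real p + x) n - (- 1) ^ n * ?A (real p - x) n)) has_sum
     ((- c * (y * theta y / real p ^ 2)) * (2 * Afun x - Afun (real p + x) - Afun (real p - x))
      + (c * (theta x / real p)) * (Abar (real p + x) - Abar (real p - x)))) {1..}"
    by (intro has_sum_add has_sum_diff has_sum_cmult_right Afun_has_sum Abar_has_sum ni)
  also have "?this \<longleftrightarrow> ((\<lambda>n. dterm (real n + x) p + dterm (real n - x) p) has_sum
     ((- c * (y * theta y / real p ^ 2)) * (2 * Afun x - Afun (real p + x) - Afun (real p - x))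
      + (c * (theta x / real p)) * (Abar (real p + x) - Abar (real p - x)))) {1..}"
  proof (rule has_sum_cong)
    fix n :: nat assume "n \<in> {1..}"
    hence n: "n \<ge> 1" by simp
    define e where "e = (- 1 :: real) ^ n"
    have th: "theta (real n + x) = e * theta x" "theta (real n - x) = - (e * theta x)"
      using theta_add_nat[of n x] theta_add_nat[of n "- x"] by (simp_all add: e_def)
    have d: "dterm t p = (- c * (y * theta y / real p ^ 2)) * (1 / t - 1 / (t - real p) / 2 - 1 / (t + real p) / 2)
         + (c * (1 / real p)) * theta t * (1 / (t + real p) - 1 / (t - real p)) / 2"
      if "t \<noteq> 0" "t - real p \<noteq> 0" "t + real p \<noteq> 0" for t
    proof -
      have f: "real p ^ 2 - t ^ 2 = - ((t - real p) * (t + real p))" by (simp add: power2_eq_square algebra_simps)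
      have r0: "real p \<noteq> 0" using p by simp
      have "dterm t p = c * (- (y * theta y) * (1 / (t * (real p ^ 2 - t ^ 2))) + theta t * (1 / (real p ^ 2 - t ^ 2)))"
        using that by (simp add: dterm_def c_def f divide_simps) (simp add: algebra_simps)
      moreover have "1 / (t * (real p ^ 2 - t ^ 2)) = (1 / t - 1 / (t - real p) / 2 - 1 / (t + real p) / 2) / real p ^ 2"
        using that r0 unfolding f by (simp add: divide_simps) (simp add: power2_eq_square algebra_simps)
      moreover have "1 / (real p ^ 2 - t ^ 2) = (1 / (t + real p) - 1 / (t - real p)) / (2 * real p)"
        using that r0 unfolding f by (simp add: divide_simps)
      ultimately have "dterm t p = c * (- (y * theta y) * ((1 / t - 1 / (t - real p) / 2 - 1 / (t + real p) / 2) / real p ^ 2)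
          + theta t * ((1 / (t + real p) - 1 / (t - real p)) / (2 * real p)))"
        by (simp only:)
      moreover define i1 i2 i3 P2 where "i1 = 1 / t" "i2 = 1 / (t - real p)" "i3 = 1 / (t + real p)" "P2 = real p ^ 2"
      ultimately show ?thesis by (simp add: algebra_simps add_divide_distrib diff_divide_distrib)
    qed
    have nz: "real n + x \<noteq> 0" "real n + x - real p \<noteq> 0" "real n + x + real p \<noteq> 0"
      "real n - x \<noteq> 0" "real n - x - real p \<noteq> 0" "real n - x + real p \<noteq> 0"
      using non_Ints_neq(1,2)[OF non_Ints(1), of n] non_Ints_neq(1,2)[OF ni(1), of n] non_Ints_neq(1,2)[OF ni(2), of n]
      by (auto simp: algebra_simps)
    have e1: "real n - (real p + x) = real n - x - real p" "real n + (real p + x) = real n + x + real p"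
      "real n - (real p - x) = real n + x - real p" "real n + (real p - x) = real n - x + real p" by auto
    define ty tx where "ty = c * (y * theta y / real p ^ 2)" and "tx = c * (theta x / real p)"
    have tx: "c * (1 / real p) * (e * theta x) = e * tx" "c * (1 / real p) * (- (e * theta x)) = - e * tx"
      by (simp_all add: tx_def)
    define i j where "i = 1 / (real n + x)" and "j = 1 / (real n - x)"
    have m: "- c * (y * theta y / real p ^ 2) = - ty" by (simp add: ty_def)
    show "(- c * (y * theta y / real p ^ 2)) * (2 * ?A x n - ?A (real p + x) n - ?A (real p - x) n)
      + (c * (theta x / real p)) * ((- 1) ^ n * ?A (real p + x) n - (- 1) ^ n * ?A (real p - x) n)
      = dterm (real n + x) p + dterm (real n - x) p"
      unfolding d[OF nz(1-3)] d[OF nz(4-6)] Afun_term[OF non_Ints(1) n] Afun_term[OF ni(1) n] Afun_term[OF ni(2) n] th tx e1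
        e_def[symmetric] m tx_def[symmetric] i_def[symmetric] j_def[symmetric]
      by (simp add: algebra_simps add_divide_distrib diff_divide_distrib)
  qed
  also have "(- c * (y * theta y / real p ^ 2)) * (2 * Afun x - Afun (real p + x) - Afun (real p - x))
      + (c * (theta x / real p)) * (Abar (real p + x) - Abar (real p - x)) = - fterm p / 2"
  proof -
    have k: "2 * Afun x - Afun (real p + x) - Afun (real p - x) = kap p"
      unfolding kap_def using star_sum_resolvent_eq_Afun[OF non_Ints(1) p] by simp
    have "(- 1 :: real) ^ p * (- 1) ^ p = 1" by (simp add: power_mult_distrib[symmetric])
    hence "Abar (real p + x) - Abar (real p - x) = (- 1) ^ p * ((- 1) ^ p * (Abar (real p + x) - Abar (real p - x)))"
      by (simp add: mult.assoc[symmetric])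
    hence a: "Abar (real p + x) - Abar (real p - x) = - ((- 1) ^ p * altstar p / 2)"
      using altstar_eq[OF p] by simp
    have r0: "real p \<noteq> 0" using p by simp
    show ?thesis unfolding k a c_def fterm_def using r0 pp
      by (simp add: divide_simps) (simp add: power2_eq_square algebra_simps)
  qed
  finally show ?thesis .
qed

text \<open>Add \<open>second_expansion\<close> at x and -x: the resolvent of V is even, that of
  \<open>\<mu>\<close> divided by s is odd, so 2 \<open>resolvent V x\<close> survives. The star
  sums of 1/(n + x) and 1/(n - x) are 2 Afun x - 2 Afun(n + x) - 1/x and 2 Afun x - 2 Afun(n - x) +
  1/x. Inserting Afun y splits off \<open>w_plus\<close>, and what is left is the double sum over
  \<open>dterm\<close>.\<close>

theorem resolvent_V_eq:
  obtains S where "(fterm has_sum S) {1..}"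
    and "- 2 * resolvent V x = - 2 * (Afun x - Afun y) * w_plus + S + w_minus / x"
proof -
  have summ: "(\<lambda>(n, p). dterm (real n + s) p) summable_on {1..} \<times> {1..}" if s: "s = x \<or> s = - x" for s
  proof (rule abs_summable_summable, rule summable_on_comparison_test)
    show "(\<lambda>z. (2 * \<bar>y * theta y\<bar> + \<bar>theta x\<bar>) * 2 * (2 / x) * (case z of (n, p) \<Rightarrow> dker n p)) summable_on {1..} \<times> {1..}"
      by (intro summable_on_cmult_right dker_summable)
  qed (use dterm_bound[OF s] in auto)
  have "(\<lambda>z. (case z of (n, p) \<Rightarrow> dterm (real n + x) p) + (case z of (n, p) \<Rightarrow> dterm (real n + (- x)) p)) summable_on {1..} \<times> {1..}"
    by (intro summable_on_add summ) auto
  hence "(\<lambda>(n, p). dterm (real n + x) p + dterm (real n - x) p) summable_on {1..} \<times> {1..}"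
    by (simp add: case_prod_unfold)
  \<comment> \<open>The interchange of the two summations: D is the sum over n of the row sums and
    the sum over p of the column sums.\<close>
  then obtain D where D1: "((\<lambda>n. W (real n + x) * (Afun y - Afun (real n + x)) + W (real n - x) * (Afun y - Afun (real n - x))) has_sum D) {1..}"
    and D2: "((\<lambda>p. - fterm p / 2) has_sum D) {1..}"
  proof (rule has_sum_fubini)
    fix n :: nat assume "n \<in> {1..}"
    show "((\<lambda>p. dterm (real n + x) p + dterm (real n - x) p) has_sum
        (W (real n + x) * (Afun y - Afun (real n + x)) + W (real n - x) * (Afun y - Afun (real n - x)))) {1..}"
      by (intro has_sum_add dterm_has_sum denoms) (use non_Ints in auto)
  next
    fix p :: nat assume "p \<in> {1..}"
    thus "((\<lambda>n. dterm (real n + x) p + dterm (real n - x) p) has_sum (- fterm p / 2)) {1..}"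
      by (intro dterm_column) auto
  qed
  have "((\<lambda>p. (- 2) * (- fterm p / 2)) has_sum (- 2) * D) {1..}" by (rule has_sum_cmult_right[OF D2])
  hence f: "(fterm has_sum (- 2 * D)) {1..}" by simp
  have p: "((\<lambda>N. W (real N + x) * star_sum (\<lambda>n. 1 / (real n + x)) N + W (real N + (- x)) * star_sum (\<lambda>n. 1 / (real n + (- x))) N)
      has_sum ((resolvent V x - resolvent \<mu> x / x) + (resolvent V (- x) - resolvent \<mu> (- x) / (- x)))) {1..}"
    by (intro has_sum_add second_expansion) auto
  have q: "((\<lambda>n. 2 * (Afun x - Afun y) * (W (real n + x) + W (real n - x))
     + 2 * (W (real n + x) * (Afun y - Afun (real n + x)) + W (real n - x) * (Afun y - Afun (real n - x)))
     - 1 / x * (W (real n + x) - W (real n - x))) has_sum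
     (2 * (Afun x - Afun y) * w_plus + 2 * D - 1 / x * w_minus)) {1..}"
    by (intro has_sum_add has_sum_diff has_sum_cmult_right w_plus_has_sum w_minus_has_sum D1)
  also have "?this \<longleftrightarrow> ((\<lambda>N. W (real N + x) * star_sum (\<lambda>n. 1 / (real n + x)) N + W (real N + (- x)) * star_sum (\<lambda>n. 1 / (real n + (- x))) N)
    has_sum (2 * (Afun x - Afun y) * w_plus + 2 * D - 1 / x * w_minus)) {1..}"
  proof (rule has_sum_cong)
    fix n :: nat assume "n \<in> {1..}"
    hence n: "n \<ge> 1" by simp
    show "2 * (Afun x - Afun y) * (W (real n + x) + W (real n - x))
     + 2 * (W (real n + x) * (Afun y - Afun (real n + x)) + W (real n - x) * (Afun y - Afun (real n - x)))
     - 1 / x * (W (real n + x) - W (real n - x)) =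
      W (real n + x) * star_sum (\<lambda>n. 1 / (real n + x)) n + W (real n + (- x)) * star_sum (\<lambda>n. 1 / (real n + (- x))) n"
      unfolding star_sum_shifted_inverse[OF non_Ints(1) n] star_sum_shifted_inverse[OF non_Ints(5) n]
      by (simp add: algebra_simps)
  qed
  finally have "2 * resolvent V x = 2 * (Afun x - Afun y) * w_plus + 2 * D - 1 / x * w_minus"
    using has_sum_unique[OF p] by fastforce
  hence "- 2 * resolvent V x = - 2 * (Afun x - Afun y) * w_plus + (- 2 * D) + w_minus / x"
    by (simp add: algebra_simps)
  with f show ?thesis by (rule that)
qed

end

section \<open>Connected sums\<close>

text \<open>The ratio of the binomial coefficients (2 n over n - k) and (2 n over n). Extending it
  by 0 to k > n keeps the transport relations valid across the boundary k = n and makes truncated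
  subtraction harmless.\<close>

definition conn :: "nat \<Rightarrow> nat \<Rightarrow> real" where
  "conn n k = (if k \<le> n then fact n ^ 2 / (fact (n - k) * fact (n + k)) else 0)"

lemma conn_nonneg: "conn n k \<ge> 0"
  by (simp add: conn_def)

lemma conn_gt [simp]: "k > n \<Longrightarrow> conn n k = 0"
  by (simp add: conn_def)

lemma conn_0 [simp]: "conn n 0 = 1"
  by (simp add: conn_def power2_eq_square)

lemma conn_Suc_right:
  assumes "k \<le> n"
  shows "(real n + real k + 1) * conn n (Suc k) = (real n - real k) * conn n k"
proof (cases "k = n")
  case False
  then obtain d where d: "n = k + Suc d" using assms less_imp_Suc_add[of k n] by auto
  show ?thesis
    by (simp add: conn_def d divide_simps del: fact_Suc) (simp add: algebra_simps fact_reduce del: fact_Suc; simp add: algebra_simps)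
qed simp

lemma conn_Suc_left:
  assumes "k \<le> Suc n"
  shows "(real (Suc n) ^ 2 - real k ^ 2) * conn (Suc n) k = real (Suc n) ^ 2 * conn n k"
proof (cases "k = Suc n")
  case False
  then obtain d where d: "n = k + d" using assms less_eqE[of k n] by auto
  have "real (Suc n) ^ 2 - real k ^ 2 = real (Suc d) * real (Suc n + k)"
    by (simp add: d power2_eq_square algebra_simps)
  moreover have "conn (Suc n) k = (real (Suc n) * fact n) ^ 2 / ((real (Suc d) * fact d) * (real (Suc n + k) * fact (n + k)))"
    by (simp add: conn_def d)
  moreover have "conn n k = fact n ^ 2 / (fact d * fact (n + k))"
    by (simp add: conn_def d)
  ultimately show ?thesis by (simp only: power_mult_distrib) (simp add: field_simps del: of_nat_Suc)
qed simp

text \<open>The first transport relation: it trades k^2/n^2 for a difference in n. Its companion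
  \<open>conn_transport_1\<close> trades a single 1/n for a difference in k, at the price of a sum
  of two neighbouring terms, which is where the alternating signs originate.\<close>

lemma conn_transport_2:
  assumes "n \<ge> 1"
  shows "real k ^ 2 * (conn n k / real n ^ 2) = conn n k - conn (n - 1) k"
proof -
  obtain m where m: "n = Suc m" using assms by (cases n) auto
  show ?thesis
  proof (cases "k \<le> Suc m")
    case True
    have "real n ^ 2 * conn (n - 1) k = real n ^ 2 * conn n k - real k ^ 2 * conn n k"
      using conn_Suc_left[OF True] by (simp add: m algebra_simps)
    thus ?thesis using assms by (simp add: field_simps)
  qed (simp add: m)
qed

lemma conn_transport_1:
  assumes "n \<ge> 1"
  shows "real k * (conn n k / real n) + real (Suc k) * (conn n (Suc k) / real n) = conn n k - conn n (Suc k)"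
proof (cases "k \<le> n")
  case True
  have c: "conn n (Suc k) = (real n - real k) * conn n k / (real n + real k + 1)"
    using conn_Suc_right[OF True] by (simp add: field_simps add_nonneg_eq_0_iff)
  have "real n + real k + 1 \<noteq> 0" by (simp add: add_nonneg_eq_0_iff)
  thus ?thesis unfolding c using assms by (simp add: divide_simps) (simp add: algebra_simps)
qed simp

lemma conn_tendsto_1: "(\<lambda>n. conn n k) \<longlonglongrightarrow> 1"
proof (induction k)
  case (Suc k)
  have "(\<lambda>n. (real n - real k) / (real n + real k + 1)) \<longlonglongrightarrow> 1" by real_asymp
  from tendsto_mult[OF this Suc] have "(\<lambda>n. (real n - real k) / (real n + real k + 1) * conn n k) \<longlonglongrightarrow> 1" by simp
  moreover have "eventually (\<lambda>n. (real n - real k) / (real n + real k + 1) * conn n k = conn n (Suc k)) at_top"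
    using eventually_ge_at_top[of k]
  proof eventually_elim
    case (elim n)
    thus ?case using conn_Suc_right[of k n] by (simp add: field_simps add_nonneg_eq_0_iff)
  qed
  ultimately show ?case by (rule Lim_transform_eventually)
qed simp

text \<open>Extended symmetrically to -n <= k <= n the sum is a multiple of (1 - 1)^(2 n) = 0, and
  the term k = 0 is 1. The proof telescopes instead, with s(k) = (-1)^k conn n k (n - k)/n, for
  which s(k) - s(k - 1) is twice the k-th summand.\<close>

lemma alternating_conn_sum:
  assumes "n \<ge> 1"
  shows "(\<Sum>k\<in>{1..n}. (- 1) ^ k * conn n k) = - 1 / 2"
proof -
  define s where "s = (\<lambda>k. (- 1) ^ k * (conn n k * (real n - real k) / real n))"
  have "(\<Sum>k\<in>{1..m}. (- 1) ^ k * conn n k) = (s m - s 0) / 2" if "m \<le> n" for m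
    using that
  proof (induction m)
    case (Suc m)
    have "conn n m * (real n - real m) = (real n + real m + 1) * conn n (Suc m)"
      using conn_Suc_right[of m n] Suc.prems by simp
    hence "s m = - ((- 1) ^ Suc m * (conn n (Suc m) * (real n + real (Suc m)) / real n))"
      by (simp add: s_def mult_ac)
    hence "s (Suc m) - s m = (- 1) ^ Suc m * (conn n (Suc m) * (real n - real (Suc m)) / real n + conn n (Suc m) * (real n + real (Suc m)) / real n)"
      by (simp add: s_def algebra_simps)
    also have "conn n (Suc m) * (real n - real (Suc m)) / real n + conn n (Suc m) * (real n + real (Suc m)) / real n = 2 * conn n (Suc m)"
      using assms by (simp add: field_simps)
    finally have "s (Suc m) - s m = 2 * ((- 1) ^ Suc m * conn n (Suc m))" by simp
    thus ?case using Suc by simp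
  qed simp
  from this[of n] show ?thesis using assms by (simp add: s_def)
qed

text \<open>By \<open>conn_transport_2\<close> the factor k^2 yields the difference of the previous
  sums at n and n - 1, both -1/2. At n = 1 the second sum would be empty.\<close>

lemma alternating_conn_sum_square:
  assumes "n \<ge> 2"
  shows "(\<Sum>k\<in>{1..n}. (- 1) ^ k * (real k ^ 2 * conn n k)) = 0"
proof -
  have "(\<Sum>k\<in>{1..n}. (- 1) ^ k * (real k ^ 2 * conn n k)) = (\<Sum>k\<in>{1..n}. real n ^ 2 * ((- 1) ^ k * conn n k) - real n ^ 2 * ((- 1) ^ k * conn (n - 1) k))"
  proof (rule sum.cong)
    fix k
    have "real k ^ 2 * conn n k = real n ^ 2 * (conn n k - conn (n - 1) k)"
      using conn_transport_2[of n k] assms by (simp add: field_simps)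
    thus "(- 1) ^ k * (real k ^ 2 * conn n k) = real n ^ 2 * ((- 1) ^ k * conn n k) - real n ^ 2 * ((- 1) ^ k * conn (n - 1) k)"
      by (simp only:) (simp add: algebra_simps)
  qed simp
  also have "\<dots> = real n ^ 2 * (\<Sum>k\<in>{1..n}. (- 1) ^ k * conn n k) - real n ^ 2 * (\<Sum>k\<in>{1..n}. (- 1) ^ k * conn (n - 1) k)"
    by (simp add: sum_subtractf sum_distrib_left)
  also have "(\<Sum>k\<in>{1..n}. (- 1) ^ k * conn (n - 1) k) = (\<Sum>k\<in>{1..n-1}. (- 1) ^ k * conn (n - 1) k)"
    by (rule sum.mono_neutral_right) auto
  finally show ?thesis using alternating_conn_sum[of n] alternating_conn_sum[of "n - 1"] assms by simp
qed

text \<open>The product of 1/(1 - x^2/m^2) over 1 <= m <= n, written as its partial fraction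
  expansion in x; at n = 0 the empty product is 1 whereas the sum would be 0.\<close>

definition pfrac :: "real \<Rightarrow> nat \<Rightarrow> real" where
  "pfrac x n = (if n = 0 then 1 else \<Sum>k\<in>{1..n}. - 2 * (- 1) ^ k * (real k ^ 2 / (real k ^ 2 - x ^ 2)) * conn n k)"

lemma pfrac_rec:
  assumes x: "x \<notin> \<int>" and n: "n \<ge> 1"
  shows "pfrac x n * (1 - x ^ 2 / real n ^ 2) = pfrac x (n - 1)"
proof -
  define w where "w = (\<lambda>k. - 2 * (- 1) ^ k * (real k ^ 2 / (real k ^ 2 - x ^ 2)))"
  define R where "R = (\<lambda>n. \<Sum>k\<in>{1..n}. w k * conn n k)"
  define Z where "Z = (\<Sum>k\<in>{1..n}. (- 1) ^ k * (real k ^ 2 * conn n k))"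
  have "R (n - 1) = (\<Sum>k\<in>{1..n}. w k * conn (n - 1) k)"
    unfolding R_def by (rule sum.mono_neutral_left) auto
  hence "R n - R (n - 1) = (\<Sum>k\<in>{1..n}. w k * (conn n k - conn (n - 1) k))"
    by (simp add: R_def sum_subtractf algebra_simps)
  also have "\<dots> = (\<Sum>k\<in>{1..n}. (x ^ 2 / real n ^ 2) * (w k * conn n k) - (2 / real n ^ 2) * ((- 1) ^ k * (real k ^ 2 * conn n k)))"
  proof (rule sum.cong)
    fix k
    have nz: "real k ^ 2 - x ^ 2 \<noteq> 0" using non_Ints_neq(3)[OF x] .
    have "w k * real k ^ 2 = x ^ 2 * w k - 2 * (- 1) ^ k * real k ^ 2"
      using nz by (simp add: w_def divide_simps) (simp add: power2_eq_square algebra_simps)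
    hence "w k * real k ^ 2 * (conn n k / real n ^ 2) = (x ^ 2 * w k - 2 * (- 1) ^ k * real k ^ 2) * (conn n k / real n ^ 2)" by simp
    moreover have "w k * (conn n k - conn (n - 1) k) = w k * real k ^ 2 * (conn n k / real n ^ 2)"
      by (simp only: mult.assoc conn_transport_2[OF n])
    ultimately have "w k * (conn n k - conn (n - 1) k) = (x ^ 2 * w k - 2 * (- 1) ^ k * real k ^ 2) * (conn n k / real n ^ 2)"
      by (simp only:)
    also have "\<dots> = (x ^ 2 / real n ^ 2) * (w k * conn n k) - (2 / real n ^ 2) * ((- 1) ^ k * (real k ^ 2 * conn n k))"
      by (simp add: algebra_simps diff_divide_distrib)
    finally show "w k * (conn n k - conn (n - 1) k) = (x ^ 2 / real n ^ 2) * (w k * conn n k) - (2 / real n ^ 2) * ((- 1) ^ k * (real k ^ 2 * conn n k))" .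
  qed simp
  also have "\<dots> = (x ^ 2 / real n ^ 2) * R n - (2 / real n ^ 2) * Z"
    by (simp add: R_def Z_def sum_subtractf sum_distrib_left)
  finally have eq: "R n * (1 - x ^ 2 / real n ^ 2) = R (n - 1) - (2 / real n ^ 2) * Z"
    by (simp add: algebra_simps)
  have p: "pfrac x m = R m" if "m \<noteq> 0" for m using that by (simp add: pfrac_def R_def w_def)
  show ?thesis
  \<comment> \<open>At n = 1 the sum Z is -1/2 instead of 0. This supplies exactly the value 1 of
    \<open>pfrac x 0\<close>, for R 0 is 0.\<close>
  proof (cases "n = 1")
    case True
    have "conn 1 1 = 1 / 2" by (simp add: conn_def)
    hence "Z = - 1 / 2" "R (n - 1) = 0" by (simp_all add: Z_def R_def True)
    thus ?thesis using eq p[of n] n by (simp add: True pfrac_def[of x 0])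
  next
    case False
    hence "Z = 0" unfolding Z_def using n by (intro alternating_conn_sum_square) auto
    thus ?thesis using eq p[of n] p[of "n - 1"] n False by simp
  qed
qed

lemma pfrac_bounds:
  assumes x: "0 < x" "x < 1 / 4"
  shows "0 < pfrac x n" "pfrac x n \<le> 3"
proof -
  have xi: "x \<notin> \<int>" using x by (intro non_Ints_of_small) auto
  have "x * x \<le> 1 / 4 * (1 / 4)" using x by (intro mult_mono) auto
  hence x2: "x ^ 2 \<le> 1 / 16" by (simp add: power2_eq_square)
  \<comment> \<open>The correction 1/n is what the induction consumes: the factor 1/(1 - x^2/m^2)
    with m = n + 1 adds at most 6 x^2/m^2, and this is below 1/n - 1/m. For n = 0 the bound is the
    exact value 1.\<close>
  have "0 < pfrac x n \<and> pfrac x n \<le> 3 - (if n = 0 then 2 else 1 / real n)"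
  proof (induction n)
    case 0
    show ?case by (simp add: pfrac_def)
  next
    case (Suc n)
    define m where "m = real (Suc n)"
    have m: "m \<ge> 1" by (simp add: m_def)
    have m2: "m ^ 2 \<ge> 1" using m by simp
    define d where "d = x ^ 2 / m ^ 2"
    have d: "0 \<le> d" by (simp add: d_def)
    have dm: "d \<le> 1 / 16 / m ^ 2" unfolding d_def by (rule divide_right_mono[OF x2]) simp
    have d2: "d \<le> 1 / 16"
    proof -
      have "1 / 16 / m ^ 2 \<le> 1 / 16 / 1" using m2 by (intro divide_left_mono) auto
      thus ?thesis using dm by simp
    qed
    have eq: "pfrac x (Suc n) * (1 - d) = pfrac x n"
      using pfrac_rec[OF xi, of "Suc n"] by (simp add: d_def m_def)
    hence e2: "pfrac x (Suc n) = pfrac x n / (1 - d)" using d2 by (simp add: field_simps)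
    have pos: "0 < pfrac x (Suc n)" unfolding e2 using Suc d2 by simp
    have "1 / (1 - d) \<le> 1 + 2 * d"
    proof -
      have "d * d \<le> d * (1 / 2)" using d d2 by (intro mult_left_mono) auto
      hence "1 \<le> (1 + 2 * d) * (1 - d)" by (simp add: algebra_simps)
      thus ?thesis using d2 by (simp add: divide_simps)
    qed
    hence "pfrac x n * (1 / (1 - d)) \<le> pfrac x n * (1 + 2 * d)"
      using Suc by (intro mult_left_mono) auto
    hence le: "pfrac x (Suc n) \<le> pfrac x n * (1 + 2 * d)" by (simp add: e2)
    show ?case
    proof (cases "n = 0")
      case True
      have "pfrac x (Suc n) \<le> 1 * (1 + 2 * d)" using le True by (simp add: pfrac_def[of x 0])
      thus ?thesis using pos d2 True by simp
    next
      case False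
      define l where "l = real n"
      have l: "l \<ge> 1" "m = l + 1" using False by (auto simp: l_def m_def)
      have "pfrac x n * (1 + 2 * d) \<le> (3 - 1 / l) * (1 + 2 * d)"
        using Suc False d by (intro mult_right_mono) (auto simp: l_def)
      also have "\<dots> \<le> 3 - 1 / l + 6 * d"
      proof -
        define q where "q = 1 / l * d"
        have "0 \<le> q" using l d by (simp add: q_def)
        moreover have "(3 - 1 / l) * (1 + 2 * d) = 3 - 1 / l + 6 * d - 2 * q" by (simp add: q_def algebra_simps)
        ultimately show ?thesis by linarith
      qed
      also have "\<dots> \<le> 3 - 1 / m"
      proof -
        have "6 * d \<le> 6 / 16 * (1 / m ^ 2)" using dm by simp
        also have "\<dots> \<le> 1 * (1 / m ^ 2)" by (intro mult_right_mono) auto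
        also have "\<dots> = 1 / m ^ 2" by simp
        also have "\<dots> \<le> 1 / (l * m)" using l m by (intro divide_left_mono) (auto simp: power2_eq_square)
        also have "\<dots> = 1 / l - 1 / m" using l by (simp add: field_simps)
        finally show ?thesis by simp
      qed
      finally show ?thesis using le pos False by (simp add: m_def)
    qed
  qed
  thus "0 < pfrac x n" "pfrac x n \<le> 3" by (auto split: if_splits intro: order_trans)
qed

text \<open>The hypotheses determine Q n as the product of 1/(1 - y^2/m^2) over m >= n, the
  generating function in y^2 of the tails of the star values of {2}^b.\<close>

locale connected =
  fixes y :: real and Q :: "nat \<Rightarrow> real"
  assumes y: "0 < y" "y < 1 / 4"
    and Q_step: "\<And>n. n \<ge> 1 \<Longrightarrow> Q n - Q (Suc n) = y ^ 2 / real n ^ 2 * Q n"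
    and Q_lim: "Q \<longlonglongrightarrow> 1"
    and Q_nonneg: "\<And>n. n \<ge> 1 \<Longrightarrow> Q n \<ge> 0"
begin

text \<open>The connected sum with 2 + j powers of 1/n still on the side of n. Its value at j = 0 is
  elementary, \<open>G_step\<close> raises j by one, and the exponent 4 is reached at j = 2.\<close>

definition G :: "nat \<Rightarrow> nat \<Rightarrow> real" where
  "G j k = (\<Sum>\<^sub>\<infinity>n\<in>{1..}. conn n k * Q n / real n ^ (2 + j))"

lemma y2: "y ^ 2 \<le> 1 / 16"
proof -
  have "y * y \<le> 1 / 4 * (1 / 4)" using y by (intro mult_mono) auto
  thus ?thesis by (simp add: power2_eq_square)
qed

lemma k2y2: "k \<ge> 1 \<Longrightarrow> real k ^ 2 - y ^ 2 \<ge> real k ^ 2 / 2" "k \<ge> 1 \<Longrightarrow> real k ^ 2 - y ^ 2 > 0"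
proof -
  assume "k \<ge> 1"
  hence "real k ^ 2 \<ge> 1" by simp
  thus "real k ^ 2 - y ^ 2 \<ge> real k ^ 2 / 2" "real k ^ 2 - y ^ 2 > 0" using y2 by linarith+
qed

text \<open>The sequence t(n) = conn (n - 1) k Q n telescopes: varying the kernel contributes
  k^2/n^2 by \<open>conn_transport_2\<close>, varying Q contributes -y^2/n^2. It starts at 0 because
  k >= 1, and it tends to 1.\<close>

lemma G_0_has_sum:
  assumes k: "k \<ge> 1"
  shows "((\<lambda>n. conn n k * Q n / real n ^ 2) has_sum 1 / (real k ^ 2 - y ^ 2)) {1..}"
proof -
  define t where "t = (\<lambda>n. conn (n - 1) k * Q n)"
  have "(\<lambda>n. conn n k * Q (Suc n)) \<longlonglongrightarrow> 1 * 1"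
    by (intro tendsto_mult conn_tendsto_1 LIMSEQ_Suc Q_lim)
  hence "(\<lambda>n. t (Suc n)) \<longlonglongrightarrow> 1" by (simp add: t_def)
  from telescope_sums[OF this] have "(\<lambda>n. t (Suc (Suc n)) - t (Suc n)) sums (1 - t 1)" by simp
  moreover have "t 1 = 0" using k by (simp add: t_def)
  moreover have "t (Suc n) - t n = (real k ^ 2 - y ^ 2) * (conn n k * Q n / real n ^ 2)" if "n \<ge> 1" for n
  proof -
    have "t (Suc n) - t n = (conn n k - conn (n - 1) k) * Q n - conn n k * (Q n - Q (Suc n))"
      by (simp add: t_def algebra_simps)
    also have "\<dots> = (real k ^ 2 - y ^ 2) * (conn n k * Q n / real n ^ 2)"
      unfolding Q_step[OF that] conn_transport_2[OF that, symmetric] by (simp add: algebra_simps diff_divide_distrib)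
    finally show ?thesis .
  qed
  ultimately have "(\<lambda>n. (real k ^ 2 - y ^ 2) * (conn (Suc n) k * Q (Suc n) / real (Suc n) ^ 2)) sums 1" by simp
  from sums_mult[OF this, of "1 / (real k ^ 2 - y ^ 2)"]
  have "(\<lambda>n. conn (Suc n) k * Q (Suc n) / real (Suc n) ^ 2) sums (1 / (real k ^ 2 - y ^ 2))"
    using k2y2(2)[OF k] by (simp del: of_nat_Suc)
  hence "((\<lambda>n. conn (Suc n) k * Q (Suc n) / real (Suc n) ^ 2) has_sum (1 / (real k ^ 2 - y ^ 2))) UNIV"
    by (rule sums_nonneg_imp_has_sum) (simp add: conn_nonneg Q_nonneg)
  thus ?thesis by (subst has_sum_atLeast_1_iff)
qed

text \<open>The kernel vanishes for n < k, so each additional factor 1/n is at most 1/k.\<close>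

lemma G_summand_le:
  assumes "k \<ge> 1" "n \<ge> 1"
  shows "conn n k * Q n / real n ^ (2 + j) \<le> 1 / real k ^ j * (conn n k * Q n / real n ^ 2)"
proof (cases "k \<le> n")
  case True
  have "real k ^ j \<le> real n ^ j" using True by (intro power_mono) auto
  hence "1 / real n ^ j \<le> 1 / real k ^ j" using assms by (intro divide_left_mono) auto
  hence "1 / real n ^ j * (conn n k * Q n / real n ^ 2) \<le> 1 / real k ^ j * (conn n k * Q n / real n ^ 2)"
    using Q_nonneg[OF assms(2)]
    by (intro mult_right_mono divide_nonneg_nonneg mult_nonneg_nonneg conn_nonneg) simp_all
  moreover have "conn n k * Q n / real n ^ (2 + j) = 1 / real n ^ j * (conn n k * Q n / real n ^ 2)"
    unfolding power_add by simp
  ultimately show ?thesis by (simp only:)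
qed simp

lemma G_has_sum:
  assumes k: "k \<ge> 1"
  shows "((\<lambda>n. conn n k * Q n / real n ^ (2 + j)) has_sum G j k) {1..}"
  unfolding G_def
proof (rule has_sum_infsum, rule summable_on_comparison_test)
  show "(\<lambda>n. 1 / real k ^ j * (conn n k * Q n / real n ^ 2)) summable_on {1..}"
    by (intro summable_on_cmult_right has_sum_imp_summable[OF G_0_has_sum] k)
qed (use G_summand_le k in \<open>auto simp: conn_nonneg Q_nonneg\<close>)

lemma G_0: "k \<ge> 1 \<Longrightarrow> G 0 k = 1 / (real k ^ 2 - y ^ 2)"
  using has_sum_unique[OF G_has_sum[of k 0] ] G_0_has_sum[of k] by simp

lemma G_bounds:
  assumes k: "k \<ge> 1"
  shows "0 \<le> G j k" "G j k \<le> 1 / real k ^ j * (2 / real k ^ 2)"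
proof -
  show "0 \<le> G j k" unfolding G_def by (intro infsum_nonneg) (simp add: conn_nonneg Q_nonneg)
  have "G j k \<le> 1 / real k ^ j * (1 / (real k ^ 2 - y ^ 2))"
    by (rule has_sum_mono[OF G_has_sum[OF k] has_sum_cmult_right[OF G_0_has_sum[OF k]]])
       (use G_summand_le k in auto)
  also have "\<dots> \<le> 1 / real k ^ j * (1 / (real k ^ 2 / 2))"
    using k2y2[OF k] k by (intro divide_left_mono mult_left_mono) auto
  finally show "G j k \<le> 1 / real k ^ j * (2 / real k ^ 2)" by simp
qed

lemma G_step:
  assumes k: "k \<ge> 1"
  shows "real k * G (Suc j) k + real (Suc k) * G (Suc j) (Suc k) = G j k - G j (Suc k)"
proof -
  have "((\<lambda>n. real k * (conn n k * Q n / real n ^ (2 + Suc j)) + real (Suc k) * (conn n (Suc k) * Q n / real n ^ (2 + Suc j)))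
      has_sum (real k * G (Suc j) k + real (Suc k) * G (Suc j) (Suc k))) {1..}"
    using k by (intro has_sum_add has_sum_cmult_right G_has_sum) auto
  also have "?this \<longleftrightarrow> ((\<lambda>n. conn n k * Q n / real n ^ (2 + j) - conn n (Suc k) * Q n / real n ^ (2 + j))
      has_sum (real k * G (Suc j) k + real (Suc k) * G (Suc j) (Suc k))) {1..}"
  proof (rule has_sum_cong)
    fix n :: nat assume "n \<in> {1..}"
    hence n: "n \<ge> 1" by simp
    define c where "c = Q n / real n ^ (2 + j)"
    have "(real k * (conn n k / real n) + real (Suc k) * (conn n (Suc k) / real n)) * c = (conn n k - conn n (Suc k)) * c"
      by (simp only: conn_transport_1[OF n])
    moreover have "real i * (conn n i * Q n / real n ^ (2 + Suc j)) = real i * (conn n i / real n) * c"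
      "conn n i * Q n / real n ^ (2 + j) = conn n i * c" for i
      by (simp_all add: c_def)
    ultimately show "real k * (conn n k * Q n / real n ^ (2 + Suc j)) + real (Suc k) * (conn n (Suc k) * Q n / real n ^ (2 + Suc j)) =
       conn n k * Q n / real n ^ (2 + j) - conn n (Suc k) * Q n / real n ^ (2 + j)"
      by (simp only: distrib_right left_diff_distrib)
  qed
  finally show ?thesis
    using has_sum_unique has_sum_diff[OF G_has_sum[OF k, of j] G_has_sum[of "Suc k" j]] by fastforce
qed

text \<open>The sign (-1)^k exchanges sums and differences of neighbours in \<open>G_step\<close>
  and so puts the recursion into the form of \<open>kernel_pair\<close>; the factor k is the weight
  that G carries there.\<close>

definition \<mu> :: "nat \<Rightarrow> real" where "\<mu> k = (- 1) ^ k * (real k * G 1 k)"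
definition V :: "nat \<Rightarrow> real" where "V k = (- 1) ^ k * (real k * G 2 k)"

lemma kernel_pair:
  assumes x: "y < x" "x < 1 / 4"
  shows "kernel_pair x y \<mu> V"
proof
  fix n :: nat assume n: "n \<ge> 1"
  show "\<mu> n - \<mu> (Suc n) = (- 1) ^ n / (real n ^ 2 - y ^ 2) + (- 1) ^ Suc n / (real (Suc n) ^ 2 - y ^ 2)"
  proof -
    have "\<mu> n - \<mu> (Suc n) = (- 1) ^ n * (real n * G (Suc 0) n + real (Suc n) * G (Suc 0) (Suc n))"
      by (simp add: \<mu>_def algebra_simps)
    also have "\<dots> = (- 1) ^ n * (1 / (real n ^ 2 - y ^ 2) - 1 / (real (Suc n) ^ 2 - y ^ 2))"
      unfolding G_step[OF n] using G_0[of n] G_0[of "Suc n"] n by simp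
    finally show ?thesis by (simp add: algebra_simps)
  qed
  show "V n - V (Suc n) = \<mu> n / real n + \<mu> (Suc n) / real (Suc n)"
  proof -
    have "V n - V (Suc n) = (- 1) ^ n * (real n * G (Suc 1) n + real (Suc n) * G (Suc 1) (Suc n))"
      by (simp add: V_def algebra_simps numeral_2_eq_2)
    also have "\<dots> = (- 1) ^ n * (G 1 n - G 1 (Suc n))"
      unfolding G_step[OF n] ..
    finally show ?thesis using n by (simp add: \<mu>_def algebra_simps del: of_nat_Suc)
  qed
  have "\<bar>\<mu> n\<bar> = real n * G 1 n" using G_bounds(1)[OF n, of 1] by (simp add: \<mu>_def abs_mult power_abs)
  also have "\<dots> \<le> real n * (1 / real n ^ 1 * (2 / real n ^ 2))" by (intro mult_left_mono G_bounds n) auto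
  also have "\<dots> = 2 / real n ^ 2" using n by simp
  finally show "\<bar>\<mu> n\<bar> \<le> 2 / real n ^ 2" .
  have "\<bar>V n\<bar> = real n * G 2 n" using G_bounds(1)[OF n, of 2] by (simp add: V_def abs_mult power_abs)
  also have "\<dots> \<le> real n * (1 / real n ^ 2 * (2 / real n ^ 2))" by (intro mult_left_mono G_bounds n) auto
  also have "\<dots> = 1 / real n * (2 / real n ^ 2)" using n by (simp add: power2_eq_square)
  also have "\<dots> \<le> 1 * (2 / real n ^ 2)" using n by (intro mult_right_mono) auto
  finally show "\<bar>V n\<bar> \<le> 2 / real n ^ 2" by simp
qed (use y x in auto)

text \<open>Expand \<open>pfrac\<close> in the kernel \<open>conn\<close> and sum over n first. What
  remains is the series of -2 (-1)^k k^2/(k^2 - x^2) against G 2 k, and k G 2 k with its sign is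
  V.\<close>

lemma connected_sum_eq:
  assumes x: "y < x" "x < 1 / 4"
  shows "((\<lambda>n. pfrac x n * Q n / real n ^ 4) has_sum (- 2 * resolvent V x)) {1..}"
proof -
  have xi: "x \<notin> \<int>" using x y by (intro non_Ints_of_small) auto
  interpret kernel_pair x y \<mu> V by (rule kernel_pair[OF x])
  define w where "w = (\<lambda>k. - 2 * (- 1) ^ k * (real k ^ 2 / (real k ^ 2 - x ^ 2)))"
  have "x * x \<le> 1 / 4 * (1 / 4)" using x y by (intro mult_mono) auto
  hence x2: "x ^ 2 \<le> 1 / 16" by (simp add: power2_eq_square)
  have w: "\<bar>w k\<bar> \<le> 4" if "k \<ge> 1" for k
  proof -
    have "real k ^ 2 \<ge> 1" using that by simp
    hence "real k ^ 2 - x ^ 2 \<ge> real k ^ 2 / 2" "real k ^ 2 - x ^ 2 > 0" using x2 by linarith+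
    thus ?thesis by (simp add: w_def abs_mult power_abs divide_simps)
  qed
  have summ: "(\<lambda>(k, n). w k * (conn n k * Q n / real n ^ 4)) summable_on {1..} \<times> {1..}"
  proof (rule abs_summable_summable, rule summable_on_comparison_test)
    have "(\<lambda>k. 4 * G 2 k) summable_on {1..}"
    proof (intro summable_on_cmult_right summable_on_bigo_inverse_square bigoI[of _ 2] eventually_sequentiallyI[of 1])
      fix k :: nat assume k: "1 \<le> k"
      have "G 2 k \<le> 1 / real k ^ 2 * (2 / real k ^ 2)" by (rule G_bounds[OF k])
      also have "\<dots> \<le> 1 * (2 / real k ^ 2)" using k by (intro mult_right_mono) auto
      finally show "norm (G 2 k) \<le> 2 * norm (1 / real k ^ 2)" using G_bounds(1)[OF k, of 2] by simp
    qed
    moreover have "((\<lambda>n. 4 * (conn n k * Q n / real n ^ 4)) has_sum 4 * G 2 k) {1..}" if "k \<in> {1..}" for k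
      using has_sum_cmult_right[OF G_has_sum[of k 2], of 4] that by simp
    ultimately show "(\<lambda>(k, n). 4 * (conn n k * Q n / real n ^ 4)) summable_on {1..} \<times> {1..}"
      by (intro summable_on_SigmaI[where g = "\<lambda>k. 4 * G 2 k"]) (auto simp: conn_nonneg Q_nonneg)
  next
    fix z :: "nat \<times> nat" assume z: "z \<in> {1..} \<times> {1..}"
    obtain k n where kn: "z = (k, n)" by (cases z)
    have "\<bar>w k\<bar> * (conn n k * Q n / real n ^ 4) \<le> 4 * (conn n k * Q n / real n ^ 4)"
      using w[of k] z kn by (intro mult_right_mono) (auto simp: conn_nonneg Q_nonneg)
    thus "norm (case z of (k, n) \<Rightarrow> w k * (conn n k * Q n / real n ^ 4)) \<le> (case z of (k, n) \<Rightarrow> 4 * (conn n k * Q n / real n ^ 4))"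
      using z kn by (simp add: abs_mult conn_nonneg Q_nonneg)
  qed auto
  obtain S where S1: "((\<lambda>k. w k * G 2 k) has_sum S) {1..}" and S2: "((\<lambda>n. pfrac x n * Q n / real n ^ 4) has_sum S) {1..}"
  proof (rule has_sum_fubini[OF summ])
    fix k :: nat assume "k \<in> {1..}"
    thus "((\<lambda>n. w k * (conn n k * Q n / real n ^ 4)) has_sum w k * G 2 k) {1..}"
      using has_sum_cmult_right[OF G_has_sum[of k 2], of "w k"] by simp
  next
    fix n :: nat assume n: "n \<in> {1..}"
    have "((\<lambda>k. w k * (conn n k * Q n / real n ^ 4)) has_sum (\<Sum>k\<in>{1..n}. w k * (conn n k * Q n / real n ^ 4))) {1..}"
      by (rule has_sum_finite_neutralI) auto
    also have "(\<Sum>k\<in>{1..n}. w k * (conn n k * Q n / real n ^ 4)) = pfrac x n * Q n / real n ^ 4"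
    proof -
      have "pfrac x n = (\<Sum>k\<in>{1..n}. w k * conn n k)" using n by (simp add: pfrac_def w_def)
      thus ?thesis by (simp add: sum_distrib_right sum_divide_distrib mult.assoc)
    qed
    finally show "((\<lambda>k. w k * (conn n k * Q n / real n ^ 4)) has_sum pfrac x n * Q n / real n ^ 4) {1..}" .
  qed
  have "V \<in> O(\<lambda>n. 1 / real n ^ 2)"
    by (rule bigoI[of _ 2]) (use V_bound in \<open>auto intro!: eventually_sequentiallyI[of 1]\<close>)
  from has_sum_cmult_right[OF resolvent_has_sum[OF this, of x], of "- 2"]
  have "((\<lambda>k. w k * G 2 k) has_sum (- 2 * resolvent V x)) {1..}"
    by (simp add: w_def V_def power2_eq_square mult_ac)
  from has_sum_unique[OF this S1] S2 show ?thesis by simp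
qed

end

section \<open>The generating function of the multiple zeta star values\<close>

text \<open>The lower bound n is the parameter of the recursion: removing the head m of a list
  leaves a list with lower bound m.\<close>

definition sorted_lists :: "nat \<Rightarrow> nat \<Rightarrow> nat list set" where
  "sorted_lists n d = {ns. length ns = d \<and> sorted_wrt (\<le>) ns \<and> (\<forall>m\<in>set ns. n \<le> m)}"

definition list_weight :: "nat list \<Rightarrow> nat list \<Rightarrow> real" where
  "list_weight ks ns = (\<Prod>i<length ks. 1 / real (ns ! i) ^ (ks ! i))"

lemma mzsv_eq_sorted_lists: "mzsv ks = infsum (list_weight ks) (sorted_lists 1 (length ks))"
proof -
  have "sorted_lists 1 (length ks) = {ns. length ns = length ks \<and> sorted_wrt (\<le>) ns \<and> (\<forall>n\<in>set ns. 0 < n)}"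
    by (auto simp: sorted_lists_def Suc_le_eq)
  thus ?thesis by (simp add: mzsv_def list_weight_def[abs_def])
qed

lemma sorted_lists_0 [simp]: "sorted_lists n 0 = {[]}"
  by (auto simp: sorted_lists_def)

lemma sorted_lists_Suc:
  "sorted_lists n (Suc d) = (\<lambda>(m, ns). m # ns) ` (SIGMA m:{n..}. sorted_lists m d)"
proof (intro equalityI subsetI)
  fix l assume l: "l \<in> sorted_lists n (Suc d)"
  then obtain m ns where "l = m # ns" by (auto simp: sorted_lists_def length_Suc_conv)
  thus "l \<in> (\<lambda>(m, ns). m # ns) ` (SIGMA m:{n..}. sorted_lists m d)"
    using l by (auto simp: sorted_lists_def image_iff)
qed (fastforce simp: sorted_lists_def)

lemma list_weight_Cons: "list_weight (k # ks) (m # ns) = 1 / real m ^ k * list_weight ks ns"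
  by (simp add: list_weight_def prod.lessThan_Suc_shift del: prod.lessThan_Suc)

lemma list_weight_nonneg: "list_weight ks ns \<ge> 0"
  by (auto simp: list_weight_def intro!: prod_nonneg)

lemma list_weight_has_sum_Cons:
  assumes "\<And>m. m \<ge> n \<Longrightarrow> (list_weight ks has_sum g m) (sorted_lists m (length ks))"
    and "((\<lambda>m. g m / real m ^ k) has_sum S) {n..}"
  shows "(list_weight (k # ks) has_sum S) (sorted_lists n (length (k # ks)))"
proof -
  have inner: "((\<lambda>ns. list_weight (k # ks) (m # ns)) has_sum g m / real m ^ k) (sorted_lists m (length ks))" if "m \<in> {n..}" for m
    using has_sum_cmult_right[OF assms(1)[of m], of "1 / real m ^ k"] that by (simp add: list_weight_Cons)
  have "(\<lambda>(m, ns). list_weight (k # ks) (m # ns)) summable_on (SIGMA m:{n..}. sorted_lists m (length ks))"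
    using assms(2) by (intro summable_on_SigmaI[OF _ has_sum_imp_summable]) (use inner in \<open>auto simp: list_weight_nonneg\<close>)
  hence "((\<lambda>(m, ns). list_weight (k # ks) (m # ns)) has_sum S) (SIGMA m:{n..}. sorted_lists m (length ks))"
    by (intro has_sum_SigmaI[OF _ assms(2)]) (use inner in auto)
  moreover have "inj_on (\<lambda>(m, ns). m # ns) (SIGMA m:{n..}. sorted_lists m (length ks))"
    by (auto simp: inj_on_def)
  ultimately show ?thesis
    by (simp add: sorted_lists_Suc has_sum_reindex o_def case_prod_unfold)
qed

definition tau :: "nat \<Rightarrow> real" where
  "tau n = (\<Sum>\<^sub>\<infinity>m\<in>{n..}. 1 / real m ^ 2)"

lemma inverse_square_summable: "(\<lambda>m. 1 / real m ^ 2) summable_on A"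
  by (rule summable_on_bigo_inverse_square) simp

lemma tau_has_sum: "((\<lambda>m. 1 / real m ^ 2) has_sum tau n) {n..}"
  unfolding tau_def by (intro has_sum_infsum inverse_square_summable)

lemma tau_Suc: "tau n = 1 / real n ^ 2 + tau (Suc n)"
proof -
  have "((\<lambda>m. 1 / real m ^ 2) has_sum (1 / real n ^ 2 + tau (Suc n))) (insert n {Suc n..})"
    by (rule has_sum_insert) (use tau_has_sum in auto)
  moreover have "insert n {Suc n..} = {n..}" by auto
  ultimately show ?thesis using has_sum_unique[OF tau_has_sum[of n]] by simp
qed

text \<open>Crude, but 3 x^2 < 1 for x < 1/4, and this is what makes the double generating series
  converge.\<close>

lemma tau_le_3: "n \<ge> 1 \<Longrightarrow> tau n \<le> 3"
proof -
  assume n: "n \<ge> 1"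
  have "tau n \<le> tau 1"
    using n by (intro has_sum_mono2[OF tau_has_sum tau_has_sum]) auto
  also have "tau 1 = pi ^ 2 / 6"
  proof -
    have "(\<lambda>m. 1 / real (Suc m) ^ 2) sums (pi ^ 2 / 6)"
      using inverse_squares_sums by (simp add: add.commute)
    hence "((\<lambda>m. 1 / real m ^ 2) has_sum pi ^ 2 / 6) {1..}"
      by (intro has_sum_of_sums inverse_square_summable)
    thus ?thesis using has_sum_unique[OF tau_has_sum[of 1]] by simp
  qed
  also have "pi * pi \<le> 4 * 4" using pi_less_4 pi_gt_zero by (intro mult_mono) auto
  hence "pi ^ 2 / 6 \<le> 3" by (simp add: power2_eq_square)
  finally show "tau n \<le> 3" .
qed

lemma tau_tendsto_0: "tau \<longlonglongrightarrow> 0"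
proof -
  have "(\<Sum>m<n. 1 / real m ^ 2) = tau 0 - tau n" for n
  proof (induction n)
    case (Suc n)
    thus ?case using tau_Suc[of n] by simp
  qed simp
  moreover have "(\<lambda>m. 1 / real m ^ 2) sums tau 0"
    by (rule has_sum_imp_sums) (use tau_has_sum[of 0] in \<open>simp add: atLeast_0\<close>)
  ultimately have "(\<lambda>n. tau 0 - tau n) \<longlonglongrightarrow> tau 0" by (simp add: sums_def)
  from tendsto_diff[OF tendsto_const[of "tau 0"] this] show ?thesis by simp
qed

text \<open>Tails of the star values of {2}^b, all summation variables being at least n;
  \<open>zsum\<close> is the same for {2}^a, 4, {2}^b.\<close>

fun hsum :: "nat \<Rightarrow> nat \<Rightarrow> real" where
  "hsum 0 n = 1"
| "hsum (Suc b) n = (\<Sum>\<^sub>\<infinity>m\<in>{n..}. hsum b m / real m ^ 2)"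

fun zsum :: "nat \<Rightarrow> nat \<Rightarrow> nat \<Rightarrow> real" where
  "zsum 0 b n = (\<Sum>\<^sub>\<infinity>m\<in>{n..}. hsum b m / real m ^ 4)"
| "zsum (Suc a) b n = (\<Sum>\<^sub>\<infinity>m\<in>{n..}. zsum a b m / real m ^ 2)"

text \<open>One induction for all the claims, as summability at each level rests on the bound of the
  level before. The factor \<open>tau n\<close> records the decay in n that is needed for the limit
  of \<open>Qgf\<close>.\<close>

lemma hsum_aux:
  "n \<ge> 1 \<Longrightarrow> 0 \<le> hsum b n \<and> hsum b n \<le> 3 ^ b \<and>
     ((\<lambda>m. hsum b m / real m ^ 2) has_sum hsum (Suc b) n) {n..} \<and> hsum (Suc b) n \<le> 3 ^ b * tau n"
proof (induction b arbitrary: n)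
  case 0
  thus ?case using tau_has_sum[of n] by (simp add: tau_def)
next
  case (Suc b)
  have le: "hsum (Suc b) n \<le> 3 ^ Suc b" if "n \<ge> 1" for n
  proof -
    have "hsum (Suc b) n \<le> 3 ^ b * tau n" using Suc.IH[OF that] by simp
    also have "\<dots> \<le> 3 ^ b * 3" using tau_le_3[OF that] by (intro mult_left_mono) auto
    finally show ?thesis by simp
  qed
  have nn: "0 \<le> hsum (Suc b) n" if "n \<ge> 1" for n
    using Suc.IH that by (simp, intro infsum_nonneg) auto
  have bound: "hsum (Suc b) m / real m ^ 2 \<le> 3 ^ Suc b * (1 / real m ^ 2)" if "m \<ge> 1" for m
    using divide_right_mono[OF le[OF that], of "real m ^ 2"] by simp
  have hs: "((\<lambda>m. hsum (Suc b) m / real m ^ 2) has_sum hsum (Suc (Suc b)) n) {n..}"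
    unfolding hsum.simps(2)[of "Suc b"]
  proof (rule has_sum_infsum, rule summable_on_comparison_test)
    show "(\<lambda>m. 3 ^ Suc b * (1 / real m ^ 2)) summable_on {n..}"
      by (intro summable_on_cmult_right inverse_square_summable)
  qed (use bound nn Suc.prems in \<open>auto simp del: hsum.simps power_Suc\<close>)
  have "hsum (Suc (Suc b)) n \<le> 3 ^ Suc b * tau n"
    by (rule has_sum_mono[OF hs has_sum_cmult_right[OF tau_has_sum]])
       (use bound Suc.prems in \<open>auto simp del: hsum.simps power_Suc\<close>)
  with hs le[OF Suc.prems] nn[OF Suc.prems] show ?case by blast
qed

lemma zsum_aux:
  "n \<ge> 1 \<Longrightarrow> 0 \<le> zsum a b n \<and> zsum a b n \<le> 3 ^ (a + b) * tau n \<and>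
     ((\<lambda>m. hsum b m / real m ^ 4) has_sum zsum 0 b n) {n..} \<and>
     ((\<lambda>m. zsum a b m / real m ^ 2) has_sum zsum (Suc a) b n) {n..}"
proof (induction a arbitrary: n)
  case 0
  have bound0: "hsum b m / real m ^ 4 \<le> 3 ^ b * (1 / real m ^ 2)" if m: "m \<ge> 1" for m
  proof -
    have "hsum b m / real m ^ 4 = hsum b m / real m ^ 2 * (1 / real m ^ 2)" by (simp add: power_add[symmetric])
    also have "\<dots> \<le> 3 ^ b / 1 * (1 / real m ^ 2)"
      using hsum_aux[OF m, of b] m by (intro mult_right_mono frac_le) auto
    finally show ?thesis by simp
  qed
  have hs0: "((\<lambda>m. hsum b m / real m ^ 4) has_sum zsum 0 b n) {n..}" if "n \<ge> 1" for n
    unfolding zsum.simps(1)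
  proof (rule has_sum_infsum, rule summable_on_comparison_test)
    show "(\<lambda>m. 3 ^ b * (1 / real m ^ 2)) summable_on {n..}"
      by (intro summable_on_cmult_right inverse_square_summable)
  qed (use bound0 hsum_aux that in auto)
  have le0: "zsum 0 b n \<le> 3 ^ b * tau n" if "n \<ge> 1" for n
    by (rule has_sum_mono[OF hs0[OF that] has_sum_cmult_right[OF tau_has_sum]]) (use bound0 that in auto)
  have nn0: "0 \<le> zsum 0 b n" if "n \<ge> 1" for n
    by (rule has_sum_nonneg[OF hs0[OF that]]) (use hsum_aux that in auto)
  have bound: "zsum 0 b m / real m ^ 2 \<le> 3 ^ b * 3 * (1 / real m ^ 2)" if m: "m \<ge> 1" for m
  proof -
    have "zsum 0 b m \<le> 3 ^ b * tau m" by (rule le0[OF m])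
    also have "\<dots> \<le> 3 ^ b * 3" using tau_le_3[OF m] by (intro mult_left_mono) auto
    finally show ?thesis using divide_right_mono[of "zsum 0 b m" "3 ^ b * 3" "real m ^ 2"] by simp
  qed
  have "((\<lambda>m. zsum 0 b m / real m ^ 2) has_sum zsum (Suc 0) b n) {n..}" unfolding zsum.simps(2)[of 0]
  proof (rule has_sum_infsum, rule summable_on_comparison_test)
    show "(\<lambda>m. 3 ^ b * 3 * (1 / real m ^ 2)) summable_on {n..}"
      by (intro summable_on_cmult_right inverse_square_summable)
  qed (use bound nn0 0 in \<open>auto simp del: zsum.simps\<close>)
  with hs0[OF 0] le0[OF 0] nn0[OF 0] show ?case by (simp only: add_0 simp_thms)
next
  case (Suc a)
  have hs: "((\<lambda>m. zsum a b m / real m ^ 2) has_sum zsum (Suc a) b n) {n..}" if "n \<ge> 1" for n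
    using Suc.IH[OF that] by blast
  have bound1: "zsum a b m / real m ^ 2 \<le> 3 ^ (Suc a + b) * (1 / real m ^ 2)" if m: "m \<ge> 1" for m
  proof -
    have "zsum a b m \<le> 3 ^ (a + b) * tau m" using Suc.IH[OF m] by blast
    also have "\<dots> \<le> 3 ^ (a + b) * 3" using tau_le_3[OF m] by (intro mult_left_mono) auto
    also have "\<dots> = 3 ^ (Suc a + b)" by simp
    finally show ?thesis using divide_right_mono[of "zsum a b m" "3 ^ (Suc a + b)" "real m ^ 2"] by simp
  qed
  have le: "zsum (Suc a) b n \<le> 3 ^ (Suc a + b) * tau n" if "n \<ge> 1" for n
    by (rule has_sum_mono[OF hs[OF that] has_sum_cmult_right[OF tau_has_sum]]) (use bound1 that in auto)
  have nn: "0 \<le> zsum (Suc a) b n" if "n \<ge> 1" for n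
    by (rule has_sum_nonneg[OF hs[OF that]]) (use Suc.IH that in auto)
  have bound: "zsum (Suc a) b m / real m ^ 2 \<le> 3 ^ (Suc a + b) * 3 * (1 / real m ^ 2)" if m: "m \<ge> 1" for m
  proof -
    have "zsum (Suc a) b m \<le> 3 ^ (Suc a + b) * tau m" by (rule le[OF m])
    also have "\<dots> \<le> 3 ^ (Suc a + b) * 3" using tau_le_3[OF m] by (intro mult_left_mono) auto
    finally show ?thesis using divide_right_mono[of "zsum (Suc a) b m" "3 ^ (Suc a + b) * 3" "real m ^ 2"] by simp
  qed
  have "((\<lambda>m. zsum (Suc a) b m / real m ^ 2) has_sum zsum (Suc (Suc a)) b n) {n..}" unfolding zsum.simps(2)[of "Suc a"]
  proof (rule has_sum_infsum, rule summable_on_comparison_test)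
    show "(\<lambda>m. 3 ^ (Suc a + b) * 3 * (1 / real m ^ 2)) summable_on {n..}"
      by (intro summable_on_cmult_right inverse_square_summable)
  qed (use bound nn Suc.prems in \<open>auto simp del: zsum.simps power_Suc\<close>)
  moreover have "((\<lambda>m. hsum b m / real m ^ 4) has_sum zsum 0 b n) {n..}" using Suc.IH[OF Suc.prems] by blast
  ultimately show ?case using le[OF Suc.prems] nn[OF Suc.prems] by blast
qed

lemma hsum_has_sum: "n \<ge> 1 \<Longrightarrow> ((\<lambda>m. hsum b m / real m ^ 2) has_sum hsum (Suc b) n) {n..}"
  and hsum_le: "n \<ge> 1 \<Longrightarrow> hsum b n \<le> 3 ^ b" "n \<ge> 1 \<Longrightarrow> hsum (Suc b) n \<le> 3 ^ b * tau n"
  and hsum_nonneg: "n \<ge> 1 \<Longrightarrow> 0 \<le> hsum b n"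
  using hsum_aux[of n b] by blast+

lemma zsum_has_sum:
    "n \<ge> 1 \<Longrightarrow> ((\<lambda>m. hsum b m / real m ^ 4) has_sum zsum 0 b n) {n..}"
    "n \<ge> 1 \<Longrightarrow> ((\<lambda>m. zsum a b m / real m ^ 2) has_sum zsum (Suc a) b n) {n..}"
  and zsum_le: "n \<ge> 1 \<Longrightarrow> zsum a b n \<le> 3 ^ (a + b) * tau n"
  and zsum_nonneg: "n \<ge> 1 \<Longrightarrow> 0 \<le> zsum a b n"
  using zsum_aux[of n a b] by blast+

declare hsum.simps(2) [simp del] zsum.simps [simp del]

lemma list_weight_2s_has_sum:
  assumes "n \<ge> 1"
  shows "(list_weight (replicate b 2) has_sum hsum b n) (sorted_lists n b)"
  using assms
proof (induction b arbitrary: n)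
  case 0
  have "list_weight [] = (\<lambda>_. 1)" by (simp add: list_weight_def fun_eq_iff)
  thus ?case by (simp add: has_sum_finiteI)
next
  case (Suc b)
  have "(list_weight (2 # replicate b 2) has_sum hsum (Suc b) n) (sorted_lists n (length ((2::nat) # replicate b 2)))"
    by (rule list_weight_has_sum_Cons[where g = "hsum b"]) (use Suc hsum_has_sum in auto)
  thus ?case by simp
qed

lemma list_weight_4_has_sum:
  assumes "n \<ge> 1"
  shows "(list_weight (replicate a 2 @ [4] @ replicate b 2) has_sum zsum a b n) (sorted_lists n (length (replicate a (2::nat) @ [4] @ replicate b 2)))"
  using assms
proof (induction a arbitrary: n)
  case 0
  have "(list_weight (4 # replicate b 2) has_sum zsum 0 b n) (sorted_lists n (length (4 # replicate b (2::nat))))"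
    by (rule list_weight_has_sum_Cons[where g = "hsum b"]) (use 0 zsum_has_sum(1) list_weight_2s_has_sum in auto)
  thus ?case by simp
next
  case (Suc a)
  have "(list_weight (2 # (replicate a 2 @ [4] @ replicate b 2)) has_sum zsum (Suc a) b n)
      (sorted_lists n (length (2 # (replicate a (2::nat) @ [4] @ replicate b 2))))"
    by (rule list_weight_has_sum_Cons[where g = "zsum a b"]) (use Suc zsum_has_sum(2) in auto)
  thus ?case by simp
qed

lemma mzsv_eq_zsum: "mzsv (replicate a 2 @ [4] @ replicate b 2) = zsum a b 1"
  unfolding mzsv_eq_sorted_lists by (rule infsumI, rule list_weight_4_has_sum) simp

lemma has_sum_split_first:
  fixes f :: "nat \<Rightarrow> real"
  assumes "((\<lambda>n. f (Suc n)) has_sum A) UNIV"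
  shows "(f has_sum (f 0 + A)) UNIV"
proof -
  have "(f has_sum A) {1..}" using assms by (subst has_sum_atLeast_1_iff)
  hence "(f has_sum (f 0 + A)) (insert 0 {1..})" by (intro has_sum_insert) auto
  moreover have "insert 0 {1::nat..} = UNIV" by auto
  ultimately show ?thesis by simp
qed

lemma has_sum_split_first_row:
  fixes f :: "nat \<Rightarrow> nat \<Rightarrow> real"
  assumes "((\<lambda>b. f 0 b) has_sum A) UNIV" "((\<lambda>(a, b). f (Suc a) b) has_sum B) UNIV"
  shows "((\<lambda>(a, b). f a b) has_sum (A + B)) UNIV"
proof -
  have "((\<lambda>(a, b). f a b) has_sum A) (range (Pair (0::nat)))"
    using assms(1) by (subst has_sum_reindex) (auto simp: o_def inj_on_def)
  moreover have "((\<lambda>(a, b). f a b) has_sum B) (range (\<lambda>(a, b). (Suc a, b)))"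
    using assms(2) by (subst has_sum_reindex) (auto simp: o_def inj_on_def case_prod_unfold)
  moreover have "range (Pair (0::nat)) \<inter> range (\<lambda>(a, b :: nat). (Suc a, b)) = {}" by auto
  ultimately have "((\<lambda>(a, b). f a b) has_sum (A + B)) (range (Pair (0::nat)) \<union> range (\<lambda>(a, b). (Suc a, b)))"
    by (intro has_sum_Un_disjoint)
  moreover have "range (Pair (0::nat)) \<union> range (\<lambda>(a, b :: nat). (Suc a, b)) = UNIV"
  proof (intro equalityI subsetI)
    fix z :: "nat \<times> nat" assume "z \<in> UNIV"
    show "z \<in> range (Pair (0::nat)) \<union> range (\<lambda>(a, b :: nat). (Suc a, b))"
      by (cases z, cases "fst z") (auto simp: image_iff)
  qed auto
  ultimately show ?thesis by simp
qed

lemma has_sum_geometric_pair: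
  fixes u v :: real
  assumes "0 \<le> u" "u < 1" "0 \<le> v" "v < 1"
  shows "((\<lambda>(a, b). u ^ a * v ^ b) has_sum (1 / (1 - u) * (1 / (1 - v)))) UNIV"
proof -
  have g: "((\<lambda>n. w ^ n) has_sum (1 / (1 - w))) UNIV" if "0 \<le> w" "w < 1" for w :: real
    by (rule sums_nonneg_imp_has_sum) (use geometric_sums[of w] that in auto)
  have inner: "((\<lambda>b. u ^ a * v ^ b) has_sum u ^ a * (1 / (1 - v))) UNIV" for a
    by (intro has_sum_cmult_right g assms)
  have outer: "((\<lambda>a. u ^ a * (1 / (1 - v))) has_sum 1 / (1 - u) * (1 / (1 - v))) UNIV"
    by (intro has_sum_cmult_left g assms)
  have "(\<lambda>(a, b). u ^ a * v ^ b) summable_on UNIV \<times> UNIV"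
    by (rule summable_on_SigmaI[where g = "\<lambda>a. u ^ a * (1 / (1 - v))"])
       (use assms inner has_sum_imp_summable[OF outer] in auto)
  hence "((\<lambda>(a, b). u ^ a * v ^ b) has_sum (1 / (1 - u) * (1 / (1 - v)))) (UNIV \<times> UNIV)"
    by (intro has_sum_SigmaI[where g = "\<lambda>a. u ^ a * (1 / (1 - v))"])
       (use inner outer in auto)
  thus ?thesis by simp
qed

locale gen_vars =
  fixes x y :: real
  assumes xy: "0 < y" "y < x" "x < 1 / 4"
begin

lemma sq: "0 \<le> 3 * x ^ 2" "3 * x ^ 2 < 1" "0 \<le> 3 * y ^ 2" "3 * y ^ 2 < 1"
proof -
  have "x * x \<le> 1 / 4 * (1 / 4)" "y * y \<le> 1 / 4 * (1 / 4)" using xy by (intro mult_mono; simp)+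
  thus "0 \<le> 3 * x ^ 2" "3 * x ^ 2 < 1" "0 \<le> 3 * y ^ 2" "3 * y ^ 2 < 1"
    by (auto simp: power2_eq_square)
qed

definition Qgf :: "nat \<Rightarrow> real" where
  "Qgf n = (\<Sum>\<^sub>\<infinity>b. hsum b n * y ^ (2 * b))"

definition Tgf :: "nat \<Rightarrow> real" where
  "Tgf n = (\<Sum>\<^sub>\<infinity>(a, b). zsum a b n * x ^ (2 * a) * y ^ (2 * b))"

lemma geo_y: "((\<lambda>b. (3 * y ^ 2) ^ b) has_sum (1 / (1 - 3 * y ^ 2))) UNIV"
  by (rule sums_nonneg_imp_has_sum) (use geometric_sums[of "3 * y ^ 2"] sq in auto)

lemma geo_xy: "((\<lambda>(a, b). (3 * x ^ 2) ^ a * (3 * y ^ 2) ^ b) has_sum (1 / (1 - 3 * x ^ 2) * (1 / (1 - 3 * y ^ 2)))) UNIV"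
  by (rule has_sum_geometric_pair) (use sq in auto)

lemma Qgf_has_sum: "n \<ge> 1 \<Longrightarrow> ((\<lambda>b. hsum b n * y ^ (2 * b)) has_sum Qgf n) UNIV"
  unfolding Qgf_def
proof (rule has_sum_infsum, rule summable_on_comparison_test[OF has_sum_imp_summable[OF geo_y]])
  fix b assume n: "n \<ge> 1"
  have "hsum b n * y ^ (2 * b) \<le> 3 ^ b * y ^ (2 * b)" using hsum_le[OF n, of b] xy by (intro mult_right_mono) auto
  thus "hsum b n * y ^ (2 * b) \<le> (3 * y ^ 2) ^ b" by (simp add: power_mult_distrib power_mult)
  show "0 \<le> hsum b n * y ^ (2 * b)" using hsum_nonneg[OF n, of b] xy by auto
qed

lemma zsum_term:
  assumes n: "n \<ge> 1"
  shows "0 \<le> zsum a b n * x ^ (2 * a) * y ^ (2 * b)"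
    "zsum a b n * x ^ (2 * a) * y ^ (2 * b) \<le> tau n * ((3 * x ^ 2) ^ a * (3 * y ^ 2) ^ b)"
proof -
  show "0 \<le> zsum a b n * x ^ (2 * a) * y ^ (2 * b)" using zsum_nonneg[OF n, of a b] xy by auto
  have "zsum a b n * (x ^ (2 * a) * y ^ (2 * b)) \<le> 3 ^ (a + b) * tau n * (x ^ (2 * a) * y ^ (2 * b))"
    using zsum_le[OF n, of a b] xy by (intro mult_right_mono) auto
  moreover have "(3 * x ^ 2) ^ a = 3 ^ a * x ^ (2 * a)" "(3 * y ^ 2) ^ b = 3 ^ b * y ^ (2 * b)"
    by (simp_all only: power_mult_distrib power_mult)
  ultimately show "zsum a b n * x ^ (2 * a) * y ^ (2 * b) \<le> tau n * ((3 * x ^ 2) ^ a * (3 * y ^ 2) ^ b)"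
    by (simp add: power_add mult_ac)
qed

lemma Tgf_has_sum: "n \<ge> 1 \<Longrightarrow> ((\<lambda>(a, b). zsum a b n * x ^ (2 * a) * y ^ (2 * b)) has_sum Tgf n) UNIV"
  unfolding Tgf_def
proof (rule has_sum_infsum, rule summable_on_comparison_test)
  show "(\<lambda>z. tau n * (case z of (a, b) \<Rightarrow> (3 * x ^ 2) ^ a * (3 * y ^ 2) ^ b)) summable_on UNIV"
    by (intro summable_on_cmult_right has_sum_imp_summable[OF geo_xy])
qed (use zsum_term in auto)

lemma Tgf_bounds:
  assumes n: "n \<ge> 1"
  shows "0 \<le> Tgf n" "Tgf n \<le> tau n * (1 / (1 - 3 * x ^ 2) * (1 / (1 - 3 * y ^ 2)))"
proof -
  show "0 \<le> Tgf n" by (rule has_sum_nonneg[OF Tgf_has_sum[OF n]]) (use zsum_term[OF n] in auto)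
  show "Tgf n \<le> tau n * (1 / (1 - 3 * x ^ 2) * (1 / (1 - 3 * y ^ 2)))"
    by (rule has_sum_mono[OF Tgf_has_sum[OF n] has_sum_cmult_right[OF geo_xy]]) (use zsum_term[OF n] in auto)
qed

lemma has_sum_tail_diff:
  fixes f :: "nat \<Rightarrow> real"
  assumes "(f has_sum A) {n..}" "(f has_sum B) {Suc n..}"
  shows "A - B = f n"
proof -
  have "(f has_sum (f n + B)) (insert n {Suc n..})" by (rule has_sum_insert) (use assms in auto)
  moreover have "insert n {Suc n..} = {n..}" by auto
  ultimately show ?thesis using has_sum_unique[OF assms(1)] by simp
qed

lemma hsum_diff: "n \<ge> 1 \<Longrightarrow> hsum (Suc b) n - hsum (Suc b) (Suc n) = hsum b n / real n ^ 2"
  by (rule has_sum_tail_diff[OF hsum_has_sum hsum_has_sum]) auto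

lemma zsum_diff:
  "n \<ge> 1 \<Longrightarrow> zsum 0 b n - zsum 0 b (Suc n) = hsum b n / real n ^ 4"
  "n \<ge> 1 \<Longrightarrow> zsum (Suc a) b n - zsum (Suc a) b (Suc n) = zsum a b n / real n ^ 2"
proof -
  assume n: "n \<ge> 1"
  show "zsum 0 b n - zsum 0 b (Suc n) = hsum b n / real n ^ 4"
    by (rule has_sum_tail_diff[OF zsum_has_sum(1) zsum_has_sum(1)]) (use n in auto)
  show "zsum (Suc a) b n - zsum (Suc a) b (Suc n) = zsum a b n / real n ^ 2"
    by (rule has_sum_tail_diff[OF zsum_has_sum(2) zsum_has_sum(2)]) (use n in auto)
qed

text \<open>The recursion of \<open>hsum\<close> in n lowers b by one; multiplied by y^(2 b) this
  costs a factor y^2. The constant term b = 0 does not depend on n.\<close>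

lemma Qgf_step:
  assumes n: "n \<ge> 1"
  shows "Qgf n - Qgf (Suc n) = y ^ 2 / real n ^ 2 * Qgf n"
proof -
  have 1: "((\<lambda>b. hsum b n * y ^ (2 * b) - hsum b (Suc n) * y ^ (2 * b)) has_sum (Qgf n - Qgf (Suc n))) UNIV"
    using n by (intro has_sum_diff Qgf_has_sum) auto
  have "((\<lambda>b. y ^ 2 / real n ^ 2 * (hsum b n * y ^ (2 * b))) has_sum y ^ 2 / real n ^ 2 * Qgf n) UNIV"
    using n by (intro has_sum_cmult_right Qgf_has_sum) auto
  moreover have "y ^ 2 / real n ^ 2 * (hsum b n * y ^ (2 * b)) = hsum (Suc b) n * y ^ (2 * Suc b) - hsum (Suc b) (Suc n) * y ^ (2 * Suc b)" for b
  proof -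
    have "hsum (Suc b) n * y ^ (2 * Suc b) - hsum (Suc b) (Suc n) * y ^ (2 * Suc b) = (hsum b n / real n ^ 2) * y ^ (2 * Suc b)"
      by (simp only: left_diff_distrib[symmetric] hsum_diff[OF n])
    thus ?thesis by (simp add: power2_eq_square)
  qed
  ultimately have "((\<lambda>b. hsum (Suc b) n * y ^ (2 * Suc b) - hsum (Suc b) (Suc n) * y ^ (2 * Suc b)) has_sum y ^ 2 / real n ^ 2 * Qgf n) UNIV"
    by (simp only:)
  from has_sum_split_first[OF this] have "((\<lambda>b. hsum b n * y ^ (2 * b) - hsum b (Suc n) * y ^ (2 * b)) has_sum y ^ 2 / real n ^ 2 * Qgf n) UNIV"
    by simp
  from has_sum_unique[OF 1 this] show ?thesis .
qed

lemma Qgf_tendsto_1: "Qgf \<longlonglongrightarrow> 1"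
proof -
  have le: "1 \<le> Qgf n \<and> Qgf n \<le> 1 + y ^ 2 * (1 / (1 - 3 * y ^ 2)) * tau n" if n: "n \<ge> 1" for n
  proof -
    have "((\<lambda>b. hsum (Suc b) n * y ^ (2 * Suc b)) has_sum (\<Sum>\<^sub>\<infinity>b. hsum (Suc b) n * y ^ (2 * Suc b))) UNIV"
    proof (rule has_sum_infsum)
      have "(\<lambda>b. hsum b n * y ^ (2 * b)) summable_on {1..}"
        by (rule summable_on_subset[OF has_sum_imp_summable[OF Qgf_has_sum[OF n]]]) simp
      then obtain s where "((\<lambda>b. hsum b n * y ^ (2 * b)) has_sum s) {1..}" by (auto simp: summable_on_def)
      thus "(\<lambda>b. hsum (Suc b) n * y ^ (2 * Suc b)) summable_on UNIV"
        by (subst (asm) has_sum_atLeast_1_iff) (rule has_sum_imp_summable)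
    qed
    note s = this
    from has_sum_split_first[OF s] have "Qgf n = 1 + (\<Sum>\<^sub>\<infinity>b. hsum (Suc b) n * y ^ (2 * Suc b))"
      using has_sum_unique[OF Qgf_has_sum[OF n]] by simp
    moreover have "(\<Sum>\<^sub>\<infinity>b. hsum (Suc b) n * y ^ (2 * Suc b)) \<le> y ^ 2 * tau n * (1 / (1 - 3 * y ^ 2))"
    proof (rule has_sum_mono[OF s has_sum_cmult_right[OF geo_y]])
      fix b
      have "hsum (Suc b) n * y ^ (2 * Suc b) \<le> 3 ^ b * tau n * y ^ (2 * Suc b)"
        using hsum_le[OF n, of b] xy by (intro mult_right_mono) auto
      thus "hsum (Suc b) n * y ^ (2 * Suc b) \<le> y ^ 2 * tau n * (3 * y ^ 2) ^ b"
        by (simp add: power_mult_distrib power_mult power2_eq_square mult_ac)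
    qed
    moreover have "0 \<le> (\<Sum>\<^sub>\<infinity>b. hsum (Suc b) n * y ^ (2 * Suc b))"
      by (rule infsum_nonneg) (use hsum_nonneg[OF n] xy in auto)
    ultimately show ?thesis by (simp add: mult_ac)
  qed
  show ?thesis
  proof (rule tendsto_sandwich)
    show "\<forall>\<^sub>F n in sequentially. 1 \<le> Qgf n"
      using eventually_ge_at_top[of 1] by eventually_elim (use le in auto)
    show "\<forall>\<^sub>F n in sequentially. Qgf n \<le> 1 + y ^ 2 * (1 / (1 - 3 * y ^ 2)) * tau n"
      using eventually_ge_at_top[of 1] by eventually_elim (use le in auto)
    have "(\<lambda>n. 1 + y ^ 2 * (1 / (1 - 3 * y ^ 2)) * tau n) \<longlonglongrightarrow> 1 + y ^ 2 * (1 / (1 - 3 * y ^ 2)) * 0"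
      by (intro tendsto_intros tau_tendsto_0)
    thus "(\<lambda>n. 1 + y ^ 2 * (1 / (1 - 3 * y ^ 2)) * tau n) \<longlonglongrightarrow> 1" by simp
  qed simp
qed

lemma Qgf_nonneg: "n \<ge> 1 \<Longrightarrow> Qgf n \<ge> 0"
  by (rule has_sum_nonneg[OF Qgf_has_sum]) (use hsum_nonneg[of n] xy in auto)

text \<open>The row a = 0, where the outermost entry is the 4, gives the inhomogeneous term; the
  rows a >= 1 reproduce the series itself with a factor x^2/n^2.\<close>

lemma Tgf_step:
  assumes n: "n \<ge> 1"
  shows "Tgf n - Tgf (Suc n) = Qgf n / real n ^ 4 + x ^ 2 / real n ^ 2 * Tgf n"
proof -
  define f where "f = (\<lambda>a b. (zsum a b n - zsum a b (Suc n)) * x ^ (2 * a) * y ^ (2 * b))"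
  have "((\<lambda>z. (case z of (a, b) \<Rightarrow> zsum a b n * x ^ (2 * a) * y ^ (2 * b)) - (case z of (a, b) \<Rightarrow> zsum a b (Suc n) * x ^ (2 * a) * y ^ (2 * b))) has_sum (Tgf n - Tgf (Suc n))) UNIV"
    using n by (intro has_sum_diff Tgf_has_sum) auto
  hence 1: "((\<lambda>(a, b). f a b) has_sum (Tgf n - Tgf (Suc n))) UNIV"
    by (simp add: f_def case_prod_unfold algebra_simps)
  have "((\<lambda>b. 1 / real n ^ 4 * (hsum b n * y ^ (2 * b))) has_sum (1 / real n ^ 4 * Qgf n)) UNIV"
    using n by (intro has_sum_cmult_right Qgf_has_sum) auto
  moreover have "f 0 b = 1 / real n ^ 4 * (hsum b n * y ^ (2 * b))" for b
    unfolding f_def zsum_diff(1)[OF n] by simp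
  ultimately have f0: "((\<lambda>b. f 0 b) has_sum (1 / real n ^ 4 * Qgf n)) UNIV" by (simp only:)
  have "((\<lambda>z. x ^ 2 / real n ^ 2 * (case z of (a, b) \<Rightarrow> zsum a b n * x ^ (2 * a) * y ^ (2 * b))) has_sum (x ^ 2 / real n ^ 2 * Tgf n)) UNIV"
    using n by (intro has_sum_cmult_right Tgf_has_sum) auto
  moreover have "f (Suc a) b = x ^ 2 / real n ^ 2 * (zsum a b n * x ^ (2 * a) * y ^ (2 * b))" for a b
    unfolding f_def zsum_diff(2)[OF n] by (simp add: power2_eq_square)
  ultimately have f1: "((\<lambda>(a, b). f (Suc a) b) has_sum (x ^ 2 / real n ^ 2 * Tgf n)) UNIV"
    by (simp only: case_prod_unfold)
  from has_sum_unique[OF 1 has_sum_split_first_row[OF f0 f1]] show ?thesis by simp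
qed

sublocale connected y Qgf
  by unfold_locales (use xy Qgf_step Qgf_tendsto_1 Qgf_nonneg in auto)

sublocale kernel_pair x y \<mu> V
  by (rule kernel_pair) (use xy in auto)

text \<open>A first-order linear recurrence in n with integrating factor
  \<open>pfrac x (n - 1)\<close>: by \<open>pfrac_rec\<close> it absorbs 1 - x^2/n^2, and the
  product telescopes to the connected sum. Since \<open>pfrac\<close> stays bounded and
  \<open>Tgf\<close> is dominated by \<open>tau\<close>, nothing is left at infinity.\<close>

lemma Tgf_1_eq: "Tgf 1 = - 2 * resolvent V x"
proof -
  have xi: "x \<notin> \<int>" using xy by (intro non_Ints_of_small) auto
  have p: "0 < pfrac x n" "pfrac x n \<le> 3" for n using pfrac_bounds[of x n] xy by auto
  define g where "g = (\<lambda>n. pfrac x (n - 1) * Tgf n)"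
  have c: "((\<lambda>n. pfrac x n * Qgf n / real n ^ 4) has_sum (- 2 * resolvent V x)) {1..}"
    by (rule connected_sum_eq) (use xy in auto)
  have st: "g n - g (Suc n) = pfrac x n * Qgf n / real n ^ 4" if n: "n \<ge> 1" for n
  proof -
    have "pfrac x (n - 1) = pfrac x n * (1 - x ^ 2 / real n ^ 2)" using pfrac_rec[OF xi n] by simp
    hence "g n - g (Suc n) = pfrac x n * (1 - x ^ 2 / real n ^ 2) * Tgf n - pfrac x n * Tgf (Suc n)"
      by (simp only: g_def diff_Suc_1)
    hence "g n - g (Suc n) = pfrac x n * ((1 - x ^ 2 / real n ^ 2) * Tgf n - Tgf (Suc n))"
      by (simp add: right_diff_distrib mult.assoc)
    also have "(1 - x ^ 2 / real n ^ 2) * Tgf n - Tgf (Suc n) = Qgf n / real n ^ 4"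
      using Tgf_step[OF n] by (simp add: algebra_simps)
    finally show ?thesis by simp
  qed
  have c': "((\<lambda>n. g n - g (Suc n)) has_sum (- 2 * resolvent V x)) {1..}"
    using c by (rule has_sum_cong[THEN iffD1, rotated]) (simp add: st)
  have "g \<longlonglongrightarrow> 0"
  proof (rule Lim_null_comparison)
    define K where "K = 1 / (1 - 3 * x ^ 2) * (1 / (1 - 3 * y ^ 2))"
    show "\<forall>\<^sub>F n in sequentially. norm (g n) \<le> 3 * (tau n * K)"
      using eventually_ge_at_top[of 1]
    proof eventually_elim
      case (elim n)
      have "norm (g n) = pfrac x (n - 1) * Tgf n"
        using p(1)[of "n - 1"] Tgf_bounds(1)[OF elim] by (simp add: g_def abs_mult)
      also have "\<dots> \<le> 3 * (tau n * K)"
        using p[of "n - 1"] Tgf_bounds[OF elim] by (intro mult_mono) (auto simp: K_def)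
      finally show ?case .
    qed
    have "(\<lambda>n. 3 * (tau n * K)) \<longlonglongrightarrow> 3 * (0 * K)" by (intro tendsto_intros tau_tendsto_0)
    thus "(\<lambda>n. 3 * (tau n * K)) \<longlonglongrightarrow> 0" by simp
  qed
  from has_sum_telescope[OF this has_sum_imp_summable[OF c']] c' have "g 1 = - 2 * resolvent V x"
    using has_sum_unique by blast
  thus ?thesis by (simp add: g_def pfrac_def[of x 0])
qed

lemma mzsv_has_sum:
  "((\<lambda>(a, b). mzsv (replicate a 2 @ [4] @ replicate b 2) * x ^ (2 * a) * y ^ (2 * b)) has_sum (- 2 * resolvent V x)) UNIV"
  unfolding mzsv_eq_zsum Tgf_1_eq[symmetric] by (rule Tgf_has_sum) simp

end

section \<open>Harmonic sums\<close>

text \<open>This is -psi(1 - t) - gamma. Its even part is \<open>Afun\<close>, its odd part half of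
  1/t - pi cot(pi t).\<close>

definition afun :: "real \<Rightarrow> real" where
  "afun t = (\<Sum>\<^sub>\<infinity>n\<in>{1..}. 1 / (real n - t) - 1 / real n)"

lemma afun_has_sum: "((\<lambda>n. 1 / (real n - t) - 1 / real n) has_sum afun t) {1..}"
  unfolding afun_def by (rule has_sum_infsum, rule summable_on_bigo_inverse_square) real_asymp

lemma afun_add_minus:
  assumes "t \<notin> \<int>"
  shows "afun t + afun (- t) = 2 * Afun t"
proof -
  have "((\<lambda>n. (1 / (real n - t) - 1 / real n) + (1 / (real n - (- t)) - 1 / real n)) has_sum (afun t + afun (- t))) {1..}"
    by (intro has_sum_add afun_has_sum)
  also have "?this \<longleftrightarrow> ((\<lambda>n. 2 * (t ^ 2 / (real n * (real n ^ 2 - t ^ 2)))) has_sum (afun t + afun (- t))) {1..}"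
  proof (rule has_sum_cong)
    fix n :: nat assume "n \<in> {1..}"
    hence n: "n \<ge> 1" by simp
    show "(1 / (real n - t) - 1 / real n) + (1 / (real n - (- t)) - 1 / real n) = 2 * (t ^ 2 / (real n * (real n ^ 2 - t ^ 2)))"
      unfolding Afun_term[OF assms n] by (simp add: field_simps)
  qed
  finally show ?thesis using has_sum_unique has_sum_cmult_right[OF Afun_has_sum[of t], of 2] by blast
qed

lemma inverse_diff_eq:
  fixes t :: real
  assumes "t \<notin> \<int>"
  shows "2 * t / (real n ^ 2 - t ^ 2) = 1 / (real n - t) - 1 / (real n + t)"
proof -
  have "real n ^ 2 - t ^ 2 = (real n - t) * (real n + t)" by (simp add: power2_eq_square algebra_simps)
  thus ?thesis using non_Ints_neq[OF assms, of n] by (simp add: divide_simps)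
qed

lemma afun_diff_minus:
  assumes "t \<notin> \<int>"
  shows "afun t - afun (- t) = 1 / t - pi * cot (pi * t)"
proof -
  have "((\<lambda>n. (1 / (real n - t) - 1 / real n) - (1 / (real n - (- t)) - 1 / real n)) has_sum (afun t - afun (- t))) {1..}"
    by (intro has_sum_diff afun_has_sum)
  also have "?this \<longleftrightarrow> ((\<lambda>n. 2 * t / (real n ^ 2 - t ^ 2)) has_sum (afun t - afun (- t))) {1..}"
    by (rule has_sum_cong) (simp add: inverse_diff_eq assms)
  finally show ?thesis using has_sum_unique cot_has_sum[OF assms] by blast
qed

lemma small_denom:
  fixes t :: real
  assumes "\<bar>t\<bar> \<le> 1 / 4" "n \<ge> 1"
  shows "real n - t \<ge> real n / 2" "real n - t > 0"
proof -
  have "t \<le> 1 / 4" using assms by (simp add: abs_le_iff)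
  moreover have "real n \<ge> 1" using assms by simp
  ultimately show "real n - t \<ge> real n / 2" "real n - t > 0" by simp_all
qed

lemma shifted_harmonic_has_sum:
  assumes t: "\<bar>t\<bar> \<le> 1 / 4" and r: "r \<ge> 1"
  shows "((\<lambda>k. 1 / real k - 1 / (real k + (real r - t))) has_sum ((\<Sum>j\<in>{1..r}. 1 / (real j - t)) - afun t)) {1..}"
proof -
  have tel: "((\<lambda>k. 1 / (real k - t) - 1 / (real k + real r - t)) has_sum (\<Sum>j\<in>{1..r}. 1 / (real j - t))) {1..}"
  proof (induction r)
    case (Suc r)
    have "((\<lambda>k. 1 / (real k + real r - t) - 1 / (real (Suc k) + real r - t)) has_sum (1 / (real 1 + real r - t))) {1..}"
      by (rule has_sum_telescope, real_asymp, rule summable_on_bigo_inverse_square, simp, real_asymp)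
    from has_sum_add[OF Suc this] show ?case by (simp add: add_ac)
  qed simp
  have "((\<lambda>k. (1 / (real k - t) - 1 / (real k + real r - t)) - (1 / (real k - t) - 1 / real k)) has_sum
     ((\<Sum>j\<in>{1..r}. 1 / (real j - t)) - afun t)) {1..}"
    by (intro has_sum_diff tel afun_has_sum)
  thus ?thesis by (simp add: add_diff_eq)
qed

lemma double_harmonic_summable:
  assumes t: "\<bar>t\<bar> \<le> 1 / 4"
  shows "(\<lambda>(k, r). 1 / real k * (1 / (real (k + r) - t) - 1 / real (k + r))) summable_on {1..} \<times> {1..}"
proof (rule abs_summable_summable, rule summable_on_comparison_test)
  have g: "(\<lambda>n. real n powr (- 3 / 2)) summable_on {1..}"
    by (intro summable_on_bigo_three_halves) simp
  have "(\<lambda>(k, r). real k powr (- 3 / 2) * real r powr (- 3 / 2)) summable_on {1..} \<times> {1..}"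
    using g by (intro summable_on_SigmaI[where g = "\<lambda>k. real k powr (- 3 / 2) * (\<Sum>\<^sub>\<infinity>r\<in>{1..}. real r powr (- 3 / 2))"])
      (auto intro!: has_sum_cmult_right summable_on_cmult_left)
  thus "(\<lambda>(k, r). real k powr (- 3 / 2) * real r powr (- 3 / 2)) summable_on {1..} \<times> {1..}" .
next
  fix z :: "nat \<times> nat" assume z: "z \<in> {1..} \<times> {1..}"
  obtain k r where kr: "z = (k, r)" by (cases z)
  with z have k: "k \<ge> 1" and r: "r \<ge> 1" by auto
  define p where "p = real (k + r)"
  have p: "p \<ge> real k" "p \<ge> real r" "p > 0" using k r by (auto simp: p_def)
  have d: "p - t \<ge> p / 2" "p - t > 0" using small_denom[OF t, of "k + r"] k by (auto simp: p_def)
  have t1: "\<bar>t\<bar> \<le> 1 / 2" using t by simp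
  have "1 / (p - t) - 1 / p = t / ((p - t) * p)" using d p by (simp add: field_simps)
  hence "\<bar>1 / (p - t) - 1 / p\<bar> = \<bar>t\<bar> / ((p - t) * p)" using d p by (simp add: abs_mult)
  also have "\<dots> \<le> (1 / 2) / (p / 2 * p)" using d p t1 by (intro frac_le mult_right_mono) auto
  also have "\<dots> = 1 / (p * p)" by simp
  finally have 1: "\<bar>1 / (p - t) - 1 / p\<bar> \<le> 1 / (p * p)" .
  \<comment> \<open>The square of k + r is distributed as k^(1/2) r^(3/2), so that together with 1/k
    both variables receive the exponent 3/2.\<close>
  have "real k powr (1/2) * real r powr (3/2) \<le> p powr (1/2) * p powr (3/2)"
    using p by (intro mult_mono powr_mono2) auto
  also have "\<dots> = p * p" using p powr_add[of p "1/2" "3/2"] by (simp add: power2_eq_square)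
  finally have "1 / (p * p) \<le> 1 / (real k powr (1/2) * real r powr (3/2))"
    using k r p by (intro divide_left_mono) auto
  with 1 have "1 / real k * \<bar>1 / (p - t) - 1 / p\<bar> \<le> 1 / real k * (1 / (real k powr (1/2) * real r powr (3/2)))"
    by (intro mult_left_mono) auto
  also have "\<dots> = 1 / (real k powr (3/2)) * (1 / real r powr (3/2))"
    using powr_add[of "real k" 1 "1/2"] k by simp
  also have "\<dots> = real k powr (- 3 / 2) * real r powr (- 3 / 2)" by (simp add: powr_minus_divide)
  finally show "norm (case z of (k, r) \<Rightarrow> 1 / real k * (1 / (real (k + r) - t) - 1 / real (k + r))) \<le>
     (case z of (k, r) \<Rightarrow> real k powr (- 3 / 2) * real r powr (- 3 / 2))"
    by (simp add: kr p_def abs_mult)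
qed auto

lemma inverse_square_shift_summable: "(\<lambda>r. 1 / (real r - t) ^ 2) summable_on A" for t :: real
  by (rule summable_on_bigo_inverse_square) real_asymp

text \<open>The double series over k, r >= 1 of (1/(k + r - t) - 1/(k + r))/k is summed in two ways.
  Grouped by p = k + r it is the series in question. For fixed r it is a combination of partial sums
  of 1/(j - t) and 1/j, and the sum over r follows from the identity that twice a sum of s(r) d(r),
  with s the partial sums of d, is the square of the total plus the sum of squares.\<close>

lemma alpha_harmonic_has_sum:
  assumes t: "\<bar>t\<bar> \<le> 1 / 4"
  shows "((\<lambda>p. (1 / (real p - t) - 1 / real p) * (\<Sum>k\<in>{1..<p}. 1 / real k)) has_sum
     (- (afun t ^ 2) / 2 + ((\<Sum>\<^sub>\<infinity>r\<in>{1..}. 1 / (real r - t) ^ 2) - pi ^ 2 / 6) / 2)) {1..}"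
proof -
  define D where "D = (\<Sum>\<^sub>\<infinity>r\<in>{1..}. 1 / (real r - t) ^ 2)"
  define s where "s = (\<lambda>r. \<Sum>j\<in>{1..r}. 1 / (real j - t))"
  define h where "h = (\<lambda>r. \<Sum>j\<in>{1..r}. 1 / real j)"
  define f where "f = (\<lambda>k r. 1 / real k * (1 / (real (k + r) - t) - 1 / real (k + r)))"
  define E where "E = infsum (\<lambda>(k, r). f k r) ({1..} \<times> {1..})"
  have E: "((\<lambda>(k, r). f k r) has_sum E) ({1..} \<times> {1..})"
    using double_harmonic_summable[OF t] by (simp add: E_def f_def)
  have a0: "afun 0 = 0" by (simp add: afun_def)
  have row: "((\<lambda>k. f k r) has_sum ((s r - afun t) / (real r - t) - h r / real r)) {1..}" if r: "r \<ge> 1" for r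
  proof -
    have rt: "real r - t > 0" using small_denom[OF t r] by simp
    have 1: "((\<lambda>k. 1 / real k - 1 / (real k + (real r - t))) has_sum (s r - afun t)) {1..}"
      unfolding s_def by (rule shifted_harmonic_has_sum[OF t r])
    have 2: "((\<lambda>k. 1 / real k - 1 / (real k + (real r - 0))) has_sum (h r - afun 0)) {1..}"
      using shifted_harmonic_has_sum[of 0 r] r by (simp add: h_def)
    have "((\<lambda>k. 1 / (real r - t) * (1 / real k - 1 / (real k + (real r - t))) - 1 / real r * (1 / real k - 1 / (real k + (real r - 0)))) has_sum
      (1 / (real r - t) * (s r - afun t) - 1 / real r * (h r - afun 0))) {1..}"
      by (intro has_sum_diff has_sum_cmult_right 1 2)
    also have "?this \<longleftrightarrow> ((\<lambda>k. f k r) has_sum (1 / (real r - t) * (s r - afun t) - 1 / real r * (h r - afun 0))) {1..}"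
    proof (rule has_sum_cong)
      fix k :: nat assume "k \<in> {1..}"
      hence k: "real k > 0" by simp
      have e: "1 / d * (1 / real k - 1 / (real k + d)) = 1 / real k * (1 / (real k + d))" if "d > 0" for d
        using that k by (simp add: field_simps add_nonneg_eq_0_iff)
      show "1 / (real r - t) * (1 / real k - 1 / (real k + (real r - t))) - 1 / real r * (1 / real k - 1 / (real k + (real r - 0))) = f k r"
        using e[OF rt] e[of "real r"] r by (simp add: f_def right_diff_distrib add_diff_eq)
    qed
    finally show ?thesis by (simp add: a0)
  qed
  have "((\<lambda>(r, k). f k r) has_sum E) ({1..} \<times> {1..})"
    using has_sum_swap[of "\<lambda>(k, r). f k r" "{1..}" "{1..}" E] E by (auto simp: case_prod_unfold)
  hence rsum: "((\<lambda>r. (s r - afun t) / (real r - t) - h r / real r) has_sum E) {1..}"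
    by (rule has_sum_SigmaD) (use row in auto)
  have col: "((\<lambda>p. (1 / (real p - t) - 1 / real p) * (\<Sum>k\<in>{1..<p}. 1 / real k)) has_sum E) {1..}"
  proof -
    have inj: "inj_on (\<lambda>(k, r). (k + r, k)) ({1::nat..} \<times> {1..})" by (auto simp: inj_on_def)
    have img: "(\<lambda>(k, r). (k + r, k)) ` ({1::nat..} \<times> {1..}) = (SIGMA p:{1..}. {1..<p})"
    proof (intro equalityI subsetI)
      fix z assume "z \<in> (SIGMA p:{1::nat..}. {1..<p})"
      then obtain p k where z: "z = (p, k)" "1 \<le> k" "k < p" by auto
      hence "z = (\<lambda>(k, r). (k + r, k)) (k, p - k)" "(k, p - k) \<in> {1..} \<times> {1..}" by auto
      thus "z \<in> (\<lambda>(k, r). (k + r, k)) ` ({1..} \<times> {1..})" by blast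
    qed auto
    define F where "F = (\<lambda>(p, k). 1 / real k * (1 / (real p - t) - 1 / real p))"
    have "F \<circ> (\<lambda>(k, r). (k + r, k)) = (\<lambda>(k, r). f k r)" by (auto simp: F_def f_def fun_eq_iff)
    hence "(F has_sum E) (SIGMA p:{1..}. {1..<p})"
      using E has_sum_reindex[OF inj, of F E] img by simp
    hence "((\<lambda>p. \<Sum>k\<in>{1..<p}. F (p, k)) has_sum E) {1..}"
      by (rule has_sum_SigmaD) auto
    thus ?thesis by (simp add: F_def sum_distrib_right mult.commute)
  qed
  have sq: "(\<Sum>r\<in>{1..R}. (\<Sum>j\<in>{1..r}. d j) * d r) = ((\<Sum>r\<in>{1..R}. d r) ^ 2 + (\<Sum>r\<in>{1..R}. d r ^ 2)) / 2" for d :: "nat \<Rightarrow> real" and R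
    by (induction R) (simp_all add: power2_eq_square algebra_simps add_divide_distrib)
  \<comment> \<open>Arranged so that only the convergent quantity s - h is squared; the divergent s
    R is multiplied by the error s - h - afun t.\<close>
  have part: "(\<Sum>r\<in>{1..R}. (s r - afun t) / (real r - t) - h r / real r) =
     ((s R - h R) - afun t) * s R - (s R - h R) ^ 2 / 2 + ((\<Sum>r\<in>{1..R}. 1 / (real r - t) ^ 2) - (\<Sum>r\<in>{1..R}. 1 / real r ^ 2)) / 2" for R
  proof -
    have "(\<Sum>r\<in>{1..R}. (s r - afun t) / (real r - t) - h r / real r) =
       (\<Sum>r\<in>{1..R}. s r * (1 / (real r - t))) - afun t * s R - (\<Sum>r\<in>{1..R}. h r * (1 / real r))"
      by (simp add: s_def sum_subtractf sum_distrib_left diff_divide_distrib)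
    also have "(\<Sum>r\<in>{1..R}. s r * (1 / (real r - t))) = (s R ^ 2 + (\<Sum>r\<in>{1..R}. (1 / (real r - t)) ^ 2)) / 2"
      unfolding s_def by (rule sq)
    also have "(\<Sum>r\<in>{1..R}. h r * (1 / real r)) = (h R ^ 2 + (\<Sum>r\<in>{1..R}. (1 / real r) ^ 2)) / 2"
      unfolding h_def by (rule sq)
    finally show ?thesis by (simp add: power_one_over power_divide algebra_simps power2_eq_square add_divide_distrib diff_divide_distrib)
  qed
  have sums_lim: "(\<lambda>R. \<Sum>r\<in>{1..R}. g r) \<longlonglongrightarrow> G" if "(g has_sum G) {1..}" for g :: "nat \<Rightarrow> real" and G
  proof -
    have "(\<lambda>n. g (Suc n)) sums G" using that by (intro has_sum_imp_sums) (simp only: has_sum_atLeast_1_iff)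
    moreover have "(\<Sum>n<K. g (Suc n)) = (\<Sum>n\<in>{1..K}. g n)" for K
      by (rule sum.reindex_bij_witness[of _ "\<lambda>n. n - 1" Suc]) auto
    ultimately show ?thesis by (simp add: sums_def)
  qed
  have e_sum: "s R - h R = (\<Sum>r\<in>{1..R}. 1 / (real r - t) - 1 / real r)" for R
    by (simp add: s_def h_def sum_subtractf)
  have e_lim: "(\<lambda>R. s R - h R) \<longlonglongrightarrow> afun t"
    unfolding e_sum by (rule sums_lim[OF afun_has_sum])
  have z2: "((\<lambda>r. 1 / real r ^ 2) has_sum pi ^ 2 / 6) {1..}"
  proof (rule has_sum_of_sums)
    show "(\<lambda>r. 1 / real r ^ 2) summable_on {1..}" by (rule summable_on_bigo_inverse_square) simp
    show "(\<lambda>n. 1 / real (Suc n) ^ 2) sums (pi ^ 2 / 6)" using inverse_squares_sums by (simp add: add.commute)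
  qed
  \<comment> \<open>The error is O(1/R), by comparison of its tail with the telescoping series of
    1/(r - 1) - 1/r, and s R is O(sqrt R).\<close>
  have err: "(\<lambda>R. ((s R - h R) - afun t) * s R) \<longlonglongrightarrow> 0"
  proof -
    have tail: "\<bar>(s R - h R) - afun t\<bar> \<le> 2 / real R" if R: "R \<ge> 1" for R
    proof -
      have nn: "1 / real R \<ge> 0" by simp
      have "((\<lambda>r. 1 / (real r - t) - 1 / real r) has_sum (afun t - (s R - h R))) ({1..} - {1..R})"
        unfolding e_sum by (rule has_sum_Diff[OF afun_has_sum has_sum_finite]) auto
      moreover have "{1..} - {1..R} = {Suc R..}" using R by auto
      ultimately have 1: "((\<lambda>r. 1 / (real r - t) - 1 / real r) has_sum (afun t - (s R - h R))) {Suc R..}" by simp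
      have "((\<lambda>k. 1 / (real k + real R - 1 + 1 - 1) - 1 / (real (Suc k) + real R - 1 + 1 - 1)) has_sum (1 / (real 1 + real R - 1 + 1 - 1))) {1..}"
        by (rule has_sum_telescope, real_asymp, rule summable_on_bigo_inverse_square, simp, real_asymp)
      hence "((\<lambda>k. 1 / (real (k + R) - 1) - 1 / real (k + R)) has_sum (1 / real R)) {1..}" by (simp add: add_ac)
      hence "((\<lambda>k. 1 / (real k - 1) - 1 / real k) has_sum (1 / real R)) ((\<lambda>k. k + R) ` {1..})"
        by (subst has_sum_reindex) (auto simp: inj_on_def o_def)
      moreover have "(\<lambda>k. k + R) ` {1..} = {Suc R..}"
      proof (intro equalityI subsetI)
        fix k assume "k \<in> {Suc R..}"
        hence "k = (k - R) + R" "k - R \<in> {1..}" by auto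
        thus "k \<in> (\<lambda>k. k + R) ` {1..}" by blast
      qed auto
      ultimately have 2: "((\<lambda>k. 1 / (real k - 1) - 1 / real k) has_sum (1 / real R)) {Suc R..}" by simp
      have "norm (afun t - (s R - h R)) \<le> 1 / real R"
      proof (rule norm_infsum_le[where f = "\<lambda>r. 1 / (real r - t) - 1 / real r", OF 1 2])
        fix r assume "r \<in> {Suc R..}"
        hence r: "r \<ge> 1" "real r \<ge> 2" using R by auto
        have d: "real r - t \<ge> real r / 2" "real r - t > 0" using small_denom[OF t r(1)] .
        have "1 / (real r - t) - 1 / real r = t / ((real r - t) * real r)" using d r by (simp add: field_simps)
        hence "norm (1 / (real r - t) - 1 / real r) = \<bar>t\<bar> / ((real r - t) * real r)" using d r by (simp add: abs_mult)
        also have "\<dots> \<le> (1 / 2) / (real r / 2 * real r)" using d r t by (intro frac_le mult_right_mono) auto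
        also have "\<dots> = 1 / (real r * real r)" by simp
        also have "\<dots> \<le> 1 / ((real r - 1) * real r)" using r by (intro divide_left_mono mult_right_mono) auto
        also have "\<dots> = 1 / (real r - 1) - 1 / real r" using r by (simp add: field_simps)
        finally show "norm (1 / (real r - t) - 1 / real r) \<le> 1 / (real r - 1) - 1 / real r" .
      qed
      thus ?thesis using nn by (simp add: abs_minus_commute)
    qed
    have sb: "\<bar>s R\<bar> \<le> 4 * sqrt (real R)" for R
      using sum_shifted_inverse_le_sqrt[of "- t" R] t by (simp add: s_def)
    show ?thesis
    proof (rule Lim_null_comparison)
      show "\<forall>\<^sub>F R in sequentially. norm (((s R - h R) - afun t) * s R) \<le> 2 / real R * (4 * sqrt (real R))"
        using eventually_ge_at_top[of 1]
      proof eventually_elim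
        case (elim R)
        show ?case unfolding real_norm_def abs_mult using tail[OF elim] sb[of R] by (intro mult_mono) auto
      qed
      show "(\<lambda>R. 2 / real R * (4 * sqrt (real R))) \<longlonglongrightarrow> 0" by real_asymp
    qed
  qed
  have D: "((\<lambda>r. 1 / (real r - t) ^ 2) has_sum D) {1..}"
    unfolding D_def by (intro has_sum_infsum inverse_square_shift_summable)
  have "(\<lambda>R. \<Sum>r\<in>{1..R}. (s r - afun t) / (real r - t) - h r / real r) \<longlonglongrightarrow> 0 - afun t ^ 2 / 2 + (D - pi ^ 2 / 6) / 2"
    unfolding part by (intro tendsto_add tendsto_diff tendsto_divide tendsto_power err e_lim sums_lim[OF D] sums_lim[OF z2] tendsto_const) auto
  moreover have "(\<lambda>R. \<Sum>r\<in>{1..R}. (s r - afun t) / (real r - t) - h r / real r) \<longlonglongrightarrow> E"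
    by (rule sums_lim[OF rsum])
  ultimately have "E = - (afun t ^ 2) / 2 + (D - pi ^ 2 / 6) / 2"
    using LIMSEQ_unique by fastforce
  with col show ?thesis by (simp add: D_def)
qed

text \<open>The derivative of the cotangent series. Instead of differentiating termwise, psi(1 + u)
  - psi(1 - u) is differentiated twice over: once as a sum of trigamma values, once through its
  closed form, valid near t.\<close>

lemma csc_square_has_sum:
  assumes t: "t \<noteq> 0" "\<bar>t\<bar> < 1"
  shows "((\<lambda>n. 1 / (real n - t) ^ 2 + 1 / (real n + t) ^ 2) has_sum (theta t ^ 2 - 1 / t ^ 2)) {1..}"
proof -
  have ti: "u \<notin> \<int>" if "u \<noteq> 0" "\<bar>u\<bar> < 1" for u :: real using that by (rule non_Ints_of_small)
  have tn: "1 + t > 0" "1 - t > 0" using t by auto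
  have sn: "sin (pi * t) \<noteq> 0"
  proof
    assume "sin (pi * t) = 0"
    then obtain i :: int where "pi * t = of_int i * pi" by (auto simp: sin_zero_iff_int2)
    hence "t = of_int i" by simp
    thus False using ti[OF t] by simp
  qed
  have dig: "Digamma (1 + u) - Digamma (1 - u) = 1 / u - pi * cot (pi * u)" if u: "u \<noteq> 0" "\<bar>u\<bar> < 1" for u :: real
  proof -
    have 1: "(\<lambda>k. inverse (of_nat (Suc k)) - inverse (w + of_nat k)) sums (Digamma w + euler_mascheroni)"
      if "w \<noteq> 0" for w :: real
      using summable_sums[OF summable_Digamma[OF that]] by (simp add: Digamma_def)
    have "(\<lambda>k. (inverse (of_nat (Suc k)) - inverse ((1 + u) + of_nat k)) - (inverse (of_nat (Suc k)) - inverse ((1 - u) + of_nat k)))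
      sums ((Digamma (1 + u) + euler_mascheroni) - (Digamma (1 - u) + euler_mascheroni))"
      using u by (intro sums_diff 1) auto
    also have "(\<lambda>k. (inverse (of_nat (Suc k)) - inverse ((1 + u) + of_nat k)) - (inverse (of_nat (Suc k)) - inverse ((1 - u) + of_nat k)))
       = (\<lambda>k. 2 * u / (real (Suc k) ^ 2 - u ^ 2))"
    proof
      fix k
      have cancel: "(a - b) - (a - c) = c - b" for a b c :: real by simp
      have e: "real (Suc k) - u = (1 - u) + of_nat k" "real (Suc k) + u = (1 + u) + of_nat k" by auto
      show "(inverse (of_nat (Suc k)) - inverse ((1 + u) + of_nat k)) - (inverse (of_nat (Suc k)) - inverse ((1 - u) + of_nat k))
         = 2 * u / (real (Suc k) ^ 2 - u ^ 2)"
        unfolding inverse_diff_eq[OF ti[OF u]] e(1) e(2) inverse_eq_divide[symmetric] by (rule cancel)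
    qed
    finally have "(\<lambda>k. 2 * u / (real (Suc k) ^ 2 - u ^ 2)) sums (Digamma (1 + u) - Digamma (1 - u))" by simp
    moreover have "(\<lambda>k. 2 * u / (real (Suc k) ^ 2 - u ^ 2)) sums (1 / u - pi * cot (pi * u))"
      using cot_has_sum[OF ti[OF u]] by (intro has_sum_imp_sums) (simp only: has_sum_atLeast_1_iff)
    ultimately show ?thesis by (rule sums_unique2)
  qed
  have np: "1 + t \<notin> \<int>\<^sub>\<le>\<^sub>0" "1 - t \<notin> \<int>\<^sub>\<le>\<^sub>0" using tn by (auto elim!: nonpos_Ints_cases)
  have d1: "((\<lambda>u. Digamma (1 + u) - Digamma (1 - u)) has_field_derivative (Polygamma 1 (1 + t) + Polygamma 1 (1 - t))) (at t)"
    using np by (auto intro!: derivative_eq_intros)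
  have d2: "((\<lambda>u. 1 / u - pi * (cos (pi * u) / sin (pi * u))) has_field_derivative (theta t ^ 2 - 1 / t ^ 2)) (at t)"
  proof -
    have c: "cos (pi * t) * cos (pi * t) = 1 - sin (pi * t) * sin (pi * t)"
      using sin_cos_squared_add[of "pi * t"] by (simp add: power2_eq_square algebra_simps)
    show ?thesis using sn t
      by (auto intro!: derivative_eq_intros simp: theta_def power2_eq_square field_simps c)
  qed
  have ev: "eventually (\<lambda>u. Digamma (1 + u) - Digamma (1 - u) = 1 / u - pi * (cos (pi * u) / sin (pi * u))) (nhds t)"
  proof -
    have "open (ball 0 1 - {0 :: real})" by (intro open_Diff) auto
    moreover have "t \<in> ball 0 1 - {0}" using t by auto
    ultimately have "eventually (\<lambda>u. u \<in> ball 0 1 - {0}) (nhds t)" by (rule eventually_nhds_in_open)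
    thus ?thesis by eventually_elim (use dig in \<open>simp add: cot_def\<close>)
  qed
  have P: "Polygamma 1 (1 + t) + Polygamma 1 (1 - t) = theta t ^ 2 - 1 / t ^ 2"
    by (rule DERIV_unique[OF d1 DERIV_cong_ev[OF refl ev refl, THEN iffD2, OF d2]])
  have pg: "(\<lambda>k. inverse ((w + of_nat k) ^ 2)) sums Polygamma 1 w" if "w \<noteq> 0" for w :: real
    using summable_sums[OF Polygamma_converges'[OF that, of 2]] by (simp add: Polygamma_def numeral_2_eq_2)
  have "(\<lambda>k. inverse (((1 - t) + of_nat k) ^ 2) + inverse (((1 + t) + of_nat k) ^ 2)) sums (Polygamma 1 (1 - t) + Polygamma 1 (1 + t))"
    using tn by (intro sums_add pg) auto
  then have "(\<lambda>k. 1 / (real (Suc k) - t) ^ 2 + 1 / (real (Suc k) + t) ^ 2) sums (theta t ^ 2 - 1 / t ^ 2)"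
  proof -
    have e: "real (Suc k) - t = (1 - t) + of_nat k" "real (Suc k) + t = (1 + t) + of_nat k" for k by auto
    have "(\<lambda>k. 1 / (real (Suc k) - t) ^ 2 + 1 / (real (Suc k) + t) ^ 2) = (\<lambda>k. inverse (((1 - t) + of_nat k) ^ 2) + inverse (((1 + t) + of_nat k) ^ 2))"
      unfolding inverse_eq_divide e ..
    moreover assume "(\<lambda>k. inverse (((1 - t) + of_nat k) ^ 2) + inverse (((1 + t) + of_nat k) ^ 2)) sums (Polygamma 1 (1 - t) + Polygamma 1 (1 + t))"
    ultimately show ?thesis using P by (simp add: add.commute)
  qed
  moreover have "(\<lambda>n. 1 / (real n - t) ^ 2 + 1 / (real n + t) ^ 2) summable_on {1..}"
    by (rule summable_on_bigo_inverse_square) real_asymp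
  ultimately show ?thesis by (intro has_sum_of_sums)
qed

text \<open>Add \<open>alpha_harmonic_has_sum\<close> at y and -y; the last, singly counted term 1/p
  of the star sum gives a cotangent series minus zeta(2). Since \<open>afun\<close> at y and -y is
  Afun y plus and minus (1/y - pi cot(pi y))/2, the squares produce Afun y squared and an elementary
  square, which pi^2 cot^2 = theta^2 - pi^2 removes.\<close>

theorem Afun_harmonic_has_sum:
  assumes y: "y \<noteq> 0" "\<bar>y\<bar> \<le> 1 / 4"
  shows "((\<lambda>p. y ^ 2 / (real p * (real p ^ 2 - y ^ 2)) * star_sum (\<lambda>k. 1 / real k) p) has_sum
    (- (Afun y ^ 2) + (theta y ^ 2 - 1 / y ^ 2) / 4 - pi ^ 2 / 12)) {1..}"
proof -
  have yi: "y \<notin> \<int>" using y by (intro non_Ints_of_small) auto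
  define D where "D = (\<lambda>t. \<Sum>\<^sub>\<infinity>r\<in>{1..}. 1 / (real r - t) ^ 2)"
  have D: "((\<lambda>r. 1 / (real r - t) ^ 2) has_sum D t) {1..}" for t
    unfolding D_def by (intro has_sum_infsum inverse_square_shift_summable)
  have "((\<lambda>n. 1 / (real n - y) ^ 2 + 1 / (real n - (- y)) ^ 2) has_sum (D y + D (- y))) {1..}"
    by (intro has_sum_add D)
  hence DD: "D y + D (- y) = theta y ^ 2 - 1 / y ^ 2"
    using has_sum_unique[OF csc_square_has_sum[of y]] y by fastforce
  have z2: "((\<lambda>r. 1 / real r ^ 2) has_sum pi ^ 2 / 6) {1..}"
  proof (rule has_sum_of_sums)
    show "(\<lambda>r. 1 / real r ^ 2) summable_on {1..}" by (rule summable_on_bigo_inverse_square) simp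
    show "(\<lambda>n. 1 / real (Suc n) ^ 2) sums (pi ^ 2 / 6)" using inverse_squares_sums by (simp add: add.commute)
  qed
  have "((\<lambda>p. ((1 / (real p - y) - 1 / real p) * (\<Sum>k\<in>{1..<p}. 1 / real k) + (1 / (real p - (- y)) - 1 / real p) * (\<Sum>k\<in>{1..<p}. 1 / real k))
      + (1 / (2 * y) * (2 * y / (real p ^ 2 - y ^ 2)) - 1 / real p ^ 2)) has_sum
     (((- (afun y ^ 2) / 2 + (D y - pi ^ 2 / 6) / 2) + (- (afun (- y) ^ 2) / 2 + (D (- y) - pi ^ 2 / 6) / 2))
      + (1 / (2 * y) * (1 / y - pi * cot (pi * y)) - pi ^ 2 / 6))) {1..}"
    unfolding D_def using y
    by (intro has_sum_add has_sum_diff has_sum_cmult_right alpha_harmonic_has_sum cot_has_sum yi z2) auto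
  also have "?this \<longleftrightarrow> ((\<lambda>p. y ^ 2 / (real p * (real p ^ 2 - y ^ 2)) * star_sum (\<lambda>k. 1 / real k) p) has_sum
     (((- (afun y ^ 2) / 2 + (D y - pi ^ 2 / 6) / 2) + (- (afun (- y) ^ 2) / 2 + (D (- y) - pi ^ 2 / 6) / 2))
      + (1 / (2 * y) * (1 / y - pi * cot (pi * y)) - pi ^ 2 / 6))) {1..}"
  proof (rule has_sum_cong)
    fix p :: nat assume "p \<in> {1..}"
    hence p: "p \<ge> 1" "real p \<noteq> 0" by auto
    define H where "H = (\<Sum>k\<in>{1..<p}. 1 / real k)"
    have nz: "real p ^ 2 - y ^ 2 \<noteq> 0" using non_Ints_neq(3)[OF yi] .
    have "1 / (2 * y) * (2 * y / (real p ^ 2 - y ^ 2)) - 1 / real p ^ 2 = y ^ 2 / (real p * (real p ^ 2 - y ^ 2)) * (1 / real p)"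
      using nz p y by (simp add: divide_simps) (simp add: power2_eq_square algebra_simps)
    moreover have "(1 / (real p - y) - 1 / real p) * H + (1 / (real p - (- y)) - 1 / real p) * H = y ^ 2 / (real p * (real p ^ 2 - y ^ 2)) * (2 * H)"
      unfolding Afun_term[OF yi p(1)] by (simp add: algebra_simps)
    ultimately show "((1 / (real p - y) - 1 / real p) * (\<Sum>k\<in>{1..<p}. 1 / real k) + (1 / (real p - (- y)) - 1 / real p) * (\<Sum>k\<in>{1..<p}. 1 / real k))
      + (1 / (2 * y) * (2 * y / (real p ^ 2 - y ^ 2)) - 1 / real p ^ 2) = y ^ 2 / (real p * (real p ^ 2 - y ^ 2)) * star_sum (\<lambda>k. 1 / real k) p"
      unfolding star_sum_def H_def[symmetric] by (simp only: distrib_left)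
  qed
  also have "((- (afun y ^ 2) / 2 + (D y - pi ^ 2 / 6) / 2) + (- (afun (- y) ^ 2) / 2 + (D (- y) - pi ^ 2 / 6) / 2))
      + (1 / (2 * y) * (1 / y - pi * cot (pi * y)) - pi ^ 2 / 6) = - (Afun y ^ 2) + (theta y ^ 2 - 1 / y ^ 2) / 4 - pi ^ 2 / 12"
  proof -
    define C where "C = pi * cot (pi * y)"
    have a: "afun y = Afun y + (1 / y - C) / 2" "afun (- y) = Afun y - (1 / y - C) / 2"
    proof -
      have "afun y + afun (- y) = 2 * Afun y" "afun y - afun (- y) = 1 / y - C"
        using afun_add_minus[OF yi] afun_diff_minus[OF yi] by (simp_all add: C_def)
      note * = this
      have half_sum: "(2 * u + v) / 2 = u + v / 2" and half_diff: "(2 * u - v) / 2 = u - v / 2" for u v :: real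
        by simp_all
      have "afun y = ((afun y + afun (- y)) + (afun y - afun (- y))) / 2" by simp
      also have "\<dots> = Afun y + (1 / y - C) / 2" unfolding * by (rule half_sum)
      finally show "afun y = Afun y + (1 / y - C) / 2" .
      have "afun (- y) = ((afun y + afun (- y)) - (afun y - afun (- y))) / 2" by simp
      also have "\<dots> = Afun y - (1 / y - C) / 2" unfolding * by (rule half_diff)
      finally show "afun (- y) = Afun y - (1 / y - C) / 2" .
    qed
    have "sin (pi * y) \<noteq> 0"
    proof
      assume "sin (pi * y) = 0"
      then obtain i :: int where "pi * y = of_int i * pi" by (auto simp: sin_zero_iff_int2)
      hence "y = of_int i" by simp
      thus False using yi by simp
    qed
    hence ct: "(cot (pi * y)) ^ 2 = 1 / sin (pi * y) ^ 2 - 1"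
      by (simp only: cot_def power_divide cos_squared_eq diff_divide_distrib) simp
    have "C ^ 2 = pi ^ 2 * (cot (pi * y)) ^ 2" by (simp add: C_def power_mult_distrib)
    also have "\<dots> = theta y ^ 2 - pi ^ 2" unfolding ct by (simp add: theta_def power_divide right_diff_distrib)
    finally have C2: "C ^ 2 = theta y ^ 2 - pi ^ 2" .
    define w where "w = 1 / y"
    have "((- (afun y ^ 2) / 2 + (D y - pi ^ 2 / 6) / 2) + (- (afun (- y) ^ 2) / 2 + (D (- y) - pi ^ 2 / 6) / 2))
      + (1 / (2 * y) * (1 / y - pi * cot (pi * y)) - pi ^ 2 / 6) =
      - (Afun y ^ 2) - (w - C) ^ 2 / 4 + (D y + D (- y)) / 2 - pi ^ 2 / 3 + w * (w - C) / 2"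
    proof -
      have "1 / (2 * y) = w / 2" by (simp add: w_def)
      thus ?thesis unfolding a C_def[symmetric]
        by (simp only: w_def[symmetric])
           (simp add: power2_eq_square algebra_simps add_divide_distrib diff_divide_distrib)
    qed
    also have "\<dots> = - (Afun y ^ 2) - C ^ 2 / 4 + w ^ 2 / 4 + (D y + D (- y)) / 2 - pi ^ 2 / 3"
      by (simp add: power2_eq_square algebra_simps add_divide_distrib diff_divide_distrib)
    also have "\<dots> = - (Afun y ^ 2) + (theta y ^ 2 - w ^ 2) / 4 - pi ^ 2 / 12"
    proof -
      have "1 / y ^ 2 = w ^ 2" by (simp add: w_def power_divide)
      thus ?thesis unfolding C2 DD by (simp add: algebra_simps add_divide_distrib diff_divide_distrib)
    qed
    finally show ?thesis by (simp add: w_def power_divide)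
  qed
  finally show ?thesis .
qed

section \<open>Products of partial fractions\<close>

text \<open>The summand of \<open>afun\<close>; for |t| < n it is the sum over i >= 1 of t^i/n^(i +
  1).\<close>

definition al :: "nat \<Rightarrow> real \<Rightarrow> real" where
  "al n t = 1 / (real n - t) - 1 / real n"

text \<open>Twice the odd part of \<open>afun\<close>; near 0 it is the sum of 2 zeta(2 i + 2) t^(2
  i + 1).\<close>

definition cfun :: "real \<Rightarrow> real" where
  "cfun t = 1 / t - pi * cot (pi * t)"

lemma cfun_minus [simp]: "cfun (- t) = - cfun t"
  by (simp add: cfun_def cot_def)

lemma al_has_sum: "((\<lambda>n. al n t) has_sum afun t) {1..}"
  unfolding al_def by (rule afun_has_sum)

lemma afun_eq:
  assumes "t \<notin> \<int>"
  shows "afun t = Afun t + cfun t / 2" "afun (- t) = Afun t - cfun t / 2"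
proof -
  note * = afun_add_minus[OF assms] afun_diff_minus[OF assms, folded cfun_def]
  have half_sum: "(2 * u + v) / 2 = u + v / 2" and half_diff: "(2 * u - v) / 2 = u - v / 2" for u v :: real
    by simp_all
  have "afun t = ((afun t + afun (- t)) + (afun t - afun (- t))) / 2" by simp
  also have "\<dots> = Afun t + cfun t / 2" unfolding * by (rule half_sum)
  finally show "afun t = Afun t + cfun t / 2" .
  have "afun (- t) = ((afun t + afun (- t)) - (afun t - afun (- t))) / 2" by simp
  also have "\<dots> = Afun t - cfun t / 2" unfolding * by (rule half_diff)
  finally show "afun (- t) = Afun t - cfun t / 2" .
qed

definition lt_pairs :: "(nat \<times> nat) set" where
  "lt_pairs = {(m, n). 1 \<le> m \<and> m < n}"

lemma lt_pairs_Sigma1: "lt_pairs = (SIGMA m:{1..}. {m<..})"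
  by (auto simp: lt_pairs_def)

lemma lt_pairs_subset: "lt_pairs \<subseteq> {1..} \<times> {1..}"
  by (auto simp: lt_pairs_def)

lemma product_has_sum:
  fixes f g :: "nat \<Rightarrow> real"
  assumes "(f has_sum a) {1..}" "(g has_sum b) {1..}"
  shows "((\<lambda>(m, n). f m * g n) has_sum (a * b)) ({1..} \<times> {1..})"
proof -
  have nf: "(\<lambda>n. norm (f n)) summable_on {1..}"
    by (rule summable_on_iff_abs_summable_on_real[THEN iffD1, OF has_sum_imp_summable[OF assms(1)]])
  have ng: "(\<lambda>n. norm (g n)) summable_on {1..}"
    by (rule summable_on_iff_abs_summable_on_real[THEN iffD1, OF has_sum_imp_summable[OF assms(2)]])
  define G where "G = (\<Sum>\<^sub>\<infinity>n\<in>{1..}. norm (g n))"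
  have "((\<lambda>n. norm (g n)) has_sum G) {1..}" using ng by (simp add: G_def)
  hence ninner: "((\<lambda>n. norm (f m) * norm (g n)) has_sum norm (f m) * G) {1..}" for m
    by (rule has_sum_cmult_right)
  have nouter: "(\<lambda>m. norm (f m) * G) summable_on {1..}"
    by (rule summable_on_cmult_left[OF nf])
  have "(\<lambda>(m, n). norm (f m) * norm (g n)) summable_on {1..} \<times> {1..}"
  proof (rule summable_on_SigmaI[OF _ nouter])
    fix m :: nat
    show "((\<lambda>n. case (m, n) of (m, n) \<Rightarrow> norm (f m) * norm (g n)) has_sum norm (f m) * G) {1..}"
      unfolding prod.case by (rule ninner)
  qed (auto split: prod.split)
  moreover have "(\<lambda>(m, n). norm (f m) * norm (g n)) = (\<lambda>z. norm (case z of (m, n) \<Rightarrow> f m * g n))"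
    by (auto simp: fun_eq_iff abs_mult)
  ultimately have "(\<lambda>z. norm (case z of (m, n) \<Rightarrow> f m * g n)) summable_on {1..} \<times> {1..}"
    by (simp only:)
  hence s: "(\<lambda>(m, n). f m * g n) summable_on {1..} \<times> {1..}"
    by (rule abs_summable_summable)
  have inner: "((\<lambda>n. f m * g n) has_sum f m * b) {1..}" for m
    by (rule has_sum_cmult_right[OF assms(2)])
  have outer: "((\<lambda>m. f m * b) has_sum a * b) {1..}"
    by (rule has_sum_cmult_left[OF assms(1)])
  show ?thesis
  proof (rule has_sum_SigmaI[OF _ outer s])
    fix m :: nat
    show "((\<lambda>n. case (m, n) of (m, n) \<Rightarrow> f m * g n) has_sum f m * b) {1..}"
      unfolding prod.case by (rule inner)
  qed
qed

lemma lt_pairs_rows: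
  fixes f g :: "nat \<Rightarrow> real"
  assumes f: "(f has_sum a) {1..}" and g: "(g has_sum b) {1..}"
    and S: "((\<lambda>(m, n). f m * g n) has_sum S) lt_pairs"
  shows "((\<lambda>m. f m * (b - (\<Sum>k\<in>{1..m}. g k))) has_sum S) {1..}"
proof (rule has_sum_SigmaD[OF S[unfolded lt_pairs_Sigma1]])
  fix m :: nat assume "m \<in> {1..}"
  have "(g has_sum (b - (\<Sum>k\<in>{1..m}. g k))) ({1..} - {1..m})"
    by (rule has_sum_Diff[OF g has_sum_finite]) auto
  moreover have "{1..} - {1..m} = {m<..}" using \<open>m \<in> {1..}\<close> by auto
  ultimately have "(g has_sum (b - (\<Sum>k\<in>{1..m}. g k))) {m<..}" by simp
  from has_sum_cmult_right[OF this, of "f m"]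
  show "((\<lambda>n. case (m, n) of (m, n) \<Rightarrow> f m * g n) has_sum f m * (b - (\<Sum>k\<in>{1..m}. g k))) {m<..}" by simp
qed

lemma lt_pairs_cols:
  fixes f g :: "nat \<Rightarrow> real"
  assumes S: "((\<lambda>(m, n). f m * g n) has_sum S) lt_pairs"
  shows "((\<lambda>n. g n * (\<Sum>k\<in>{1..<n}. f k)) has_sum S) {1..}"
proof -
  have inj: "inj_on prod.swap lt_pairs" by (auto simp: inj_on_def)
  have img: "prod.swap ` lt_pairs = (SIGMA n:{1..}. {1..<n})"
    by (auto simp: lt_pairs_def image_iff)
  have "((\<lambda>(n, m). f m * g n) has_sum S) (prod.swap ` lt_pairs)"
    using S by (subst has_sum_reindex[OF inj]) (auto simp: o_def case_prod_unfold)
  hence "((\<lambda>(n, m). f m * g n) has_sum S) (SIGMA n:{1..}. {1..<n})" by (simp only: img)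
  hence "((\<lambda>n. \<Sum>k\<in>{1..<n}. f k * g n) has_sum S) {1..}"
    by (rule has_sum_SigmaD) auto
  moreover have "(\<Sum>k\<in>{1..<n}. f k * g n) = g n * (\<Sum>k\<in>{1..<n}. f k)" for n
    by (simp add: sum_distrib_left mult.commute)
  ultimately show ?thesis by (simp only:)
qed

text \<open>Generating function of the double zeta values with exponents i + 1 and j + 1, i, j >= 1,
  see \<open>dps_pairsum\<close>.\<close>

definition pairsum :: "real \<Rightarrow> real \<Rightarrow> real" where
  "pairsum u v = infsum (\<lambda>(m, n). al m u * al n v) lt_pairs"

lemma pairsum_has_sum: "((\<lambda>(m, n). al m u * al n v) has_sum pairsum u v) lt_pairs"
  unfolding pairsum_def
  by (rule has_sum_infsum, rule summable_on_subset[OF has_sum_imp_summable[OF product_has_sum[OF al_has_sum al_has_sum]]])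
     (rule lt_pairs_subset)

lemma star_sum_al_split:
  fixes f :: "nat \<Rightarrow> real"
  assumes "n \<ge> 1"
  shows "(\<Sum>k\<in>{1..n}. f k) = (star_sum f n + f n) / 2" "(\<Sum>k\<in>{1..<n}. f k) = (star_sum f n - f n) / 2"
  using star_sum_alt[OF assms, of f] by (simp_all add: star_sum_def)

lemma star_sum_shifted_diff:
  assumes "X \<notin> \<int>" "Y \<notin> \<int>" "n \<ge> 1"
  shows "star_sum (\<lambda>k. al k X) n - star_sum (\<lambda>k. al k Y) n =
    (2 * Afun X - 2 * Afun (real n - X) + 1 / X) - (2 * Afun Y - 2 * Afun (real n - Y) + 1 / Y)"
proof -
  have "star_sum (\<lambda>k. al k Z) n = star_sum (\<lambda>k. 1 / (real k + (- Z))) n + star_sum (\<lambda>k. - (1 / real k)) n" for Z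
    unfolding star_sum_add[symmetric] by (simp add: al_def)
  thus ?thesis using star_sum_shifted_inverse[of "- X" n] star_sum_shifted_inverse[of "- Y" n] assms
      minus_in_Ints_iff[of X] minus_in_Ints_iff[of Y] by simp
qed

text \<open>Both double sums are arranged by the index that carries u, once as rows and once as
  columns. The partial sums at X and at Y each contain a harmonic number; it cancels in their
  difference, which is then expressible by \<open>Afun\<close>.\<close>

lemma pairsum_pair:
  assumes X: "X \<notin> \<int>" and Y: "Y \<notin> \<int>"
  shows "((\<lambda>n. al n u * (Afun X - Afun (real n - X) + 1 / (2 * X) - Afun Y + Afun (real n - Y) - 1 / (2 * Y)
       + (al n X + al n Y) / 2)) has_sum (afun u * afun X - pairsum u X - pairsum Y u)) {1..}"
proof -
  have "((\<lambda>n. al n u * afun X - al n u * (afun X - (\<Sum>k\<in>{1..n}. al k X)) - al n u * (\<Sum>k\<in>{1..<n}. al k Y))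
      has_sum (afun u * afun X - pairsum u X - pairsum Y u)) {1..}"
    by (intro has_sum_diff has_sum_cmult_left al_has_sum
        lt_pairs_rows[OF al_has_sum al_has_sum pairsum_has_sum] lt_pairs_cols[OF pairsum_has_sum])
  also have "?this \<longleftrightarrow> ?thesis"
  proof (rule has_sum_cong)
    fix n :: nat assume "n \<in> {1..}"
    hence n: "n \<ge> 1" by simp
    define P Q where "P = star_sum (\<lambda>k. al k X) n" and "Q = star_sum (\<lambda>k. al k Y) n"
    have PQ: "P - Q = (2 * Afun X - 2 * Afun (real n - X) + 1 / X) - (2 * Afun Y - 2 * Afun (real n - Y) + 1 / Y)"
      unfolding P_def Q_def by (rule star_sum_shifted_diff[OF X Y n])
    have "al n u * afun X - al n u * (afun X - (\<Sum>k\<in>{1..n}. al k X)) - al n u * (\<Sum>k\<in>{1..<n}. al k Y) =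
       al n u * ((P - Q) / 2 + (al n X + al n Y) / 2)"
      unfolding star_sum_al_split[OF n] P_def[symmetric] Q_def[symmetric]
      by (simp add: algebra_simps add_divide_distrib diff_divide_distrib)
    also have "(P - Q) / 2 = Afun X - Afun (real n - X) + 1 / (2 * X) - Afun Y + Afun (real n - Y) - 1 / (2 * Y)"
    proof -
      have "1 / (2 * X) = (1 / X) / 2" "1 / (2 * Y) = (1 / Y) / 2" by simp_all
      thus ?thesis unfolding PQ by (simp only:) (simp add: diff_divide_distrib add_divide_distrib)
    qed
    finally show "al n u * afun X - al n u * (afun X - (\<Sum>k\<in>{1..n}. al k X)) - al n u * (\<Sum>k\<in>{1..<n}. al k Y) =
      al n u * (Afun X - Afun (real n - X) + 1 / (2 * X) - Afun Y + Afun (real n - Y) - 1 / (2 * Y)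
       + (al n X + al n Y) / 2)" .
  qed
  finally show ?thesis .
qed

text \<open>The diagonal contribution belonging to (u, v) and (-u, -v) together, see
  \<open>al_diagonal_has_sum\<close>; thanks to the symmetrisation only cotangents occur.\<close>

definition Dg :: "real \<Rightarrow> real \<Rightarrow> real" where
  "Dg u v = (cfun u - cfun v) / (u - v) - cfun u / u - cfun v / v + pi ^ 2 / 3"

lemma zeta_2_has_sum: "((\<lambda>r. 1 / real r ^ 2) has_sum pi ^ 2 / 6) {1..}"
proof (rule has_sum_of_sums)
  show "(\<lambda>r. 1 / real r ^ 2) summable_on {1..}" by (rule inverse_square_summable)
  show "(\<lambda>n. 1 / real (Suc n) ^ 2) sums (pi ^ 2 / 6)" using inverse_squares_sums by (simp add: add.commute)
qed

lemma al_diagonal_has_sum: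
  assumes u: "u \<notin> \<int>" and v: "v \<notin> \<int>" and uv: "u \<noteq> v"
  shows "((\<lambda>n. al n u * al n v + al n (- u) * al n (- v)) has_sum Dg u v) {1..}"
proof -
  let ?C = "\<lambda>t n. 2 * t / (real n ^ 2 - t ^ 2)"
  have "((\<lambda>n. 1 / (u - v) * (?C u n - ?C v n) - 1 / u * ?C u n - 1 / v * ?C v n + 2 * (1 / real n ^ 2)) has_sum
     (1 / (u - v) * (cfun u - cfun v) - 1 / u * cfun u - 1 / v * cfun v + 2 * (pi ^ 2 / 6))) {1..}"
    unfolding cfun_def
    by (intro has_sum_add has_sum_diff has_sum_cmult_right cot_has_sum zeta_2_has_sum u v)
  also have "?this \<longleftrightarrow> ((\<lambda>n. al n u * al n v + al n (- u) * al n (- v)) has_sum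
     (1 / (u - v) * (cfun u - cfun v) - 1 / u * cfun u - 1 / v * cfun v + 2 * (pi ^ 2 / 6))) {1..}"
  proof (rule has_sum_cong)
    fix n :: nat assume "n \<in> {1..}"
    hence n: "real n \<noteq> 0" by simp
    have nz: "real n - u \<noteq> 0" "real n + u \<noteq> 0" "real n - v \<noteq> 0" "real n + v \<noteq> 0" "u \<noteq> 0" "v \<noteq> 0"
      using non_Ints_neq(1,2)[OF u, of n] non_Ints_neq(1,2)[OF v, of n] non_Ints_nonzero[OF u] non_Ints_nonzero[OF v] by auto
    have p: "al n s * al n t = (1 / (real n - s) - 1 / (real n - t)) / (s - t) - (1 / (real n - s) - 1 / real n) / s
         - (1 / (real n - t) - 1 / real n) / t + 1 / real n ^ 2"
      if "real n - s \<noteq> 0" "real n - t \<noteq> 0" "s \<noteq> 0" "t \<noteq> 0" "s - t \<noteq> 0" for s t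
    proof -
      have 1: "1 / (real n - s) - 1 / (real n - t) = (s - t) * (1 / ((real n - s) * (real n - t)))"
        using that by (simp add: divide_simps)
      have 2: "1 / (real n - s) - 1 / real n = s * (1 / ((real n - s) * real n))" "1 / (real n - t) - 1 / real n = t * (1 / ((real n - t) * real n))"
        using that n by (simp_all add: divide_simps)
      have "al n s * al n t = 1 / ((real n - s) * (real n - t)) - 1 / ((real n - s) * real n) - 1 / ((real n - t) * real n) + 1 / real n ^ 2"
        by (simp add: al_def algebra_simps power2_eq_square)
      thus ?thesis unfolding 1 2 using that by simp
    qed
    have d: "u - v \<noteq> 0" "- u - (- v) \<noteq> 0" using uv by auto
    define i1 i2 i3 i4 d' where "i1 = 1 / (real n - u)" "i2 = 1 / (real n + u)" "i3 = 1 / (real n - v)" "i4 = 1 / (real n + v)"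
      "d' = 1 / (u - v)"
    define u' v' n' where "u' = 1 / u" "v' = 1 / v" "n' = 1 / real n"
    have a: "al n u * al n v = (i1 - i3) * d' - (i1 - n') * u' - (i3 - n') * v' + 1 / real n ^ 2"
      using p[of u v] nz d by (simp add: i1_i2_i3_i4_d'_def u'_v'_n'_def)
    have m: "1 / (- u - (- v)) = - d'" unfolding i1_i2_i3_i4_d'_def by (metis minus_diff_minus minus_divide_right)
    have b: "al n (- u) * al n (- v) = (i2 - i4) * (- d') - (i2 - n') * (- u') - (i4 - n') * (- v') + 1 / real n ^ 2"
      using p[of "- u" "- v"] nz d m by (simp add: i1_i2_i3_i4_d'_def(2,4) u'_v'_n'_def divide_inverse)
    show "1 / (u - v) * (?C u n - ?C v n) - 1 / u * ?C u n - 1 / v * ?C v n + 2 * (1 / real n ^ 2) = al n u * al n v + al n (- u) * al n (- v)"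
      unfolding a b inverse_diff_eq[OF u] inverse_diff_eq[OF v] i1_i2_i3_i4_d'_def[symmetric] u'_v'_n'_def[symmetric]
      by (simp add: algebra_simps)
  qed
  finally show ?thesis by (simp add: Dg_def)
qed

context gen_vars
begin

lemma more_non_Ints: "(x + y) / 2 \<notin> \<int>" "(x - y) / 2 \<notin> \<int>" "- y \<notin> \<int>"
  using xy by (intro non_Ints_of_small; simp)+

text \<open>Generating function of the inner sum in the third part of \<open>S1\<close>, see
  \<open>third_coeff_dps\<close>. The half arguments stem from the powers of 1/2, the four signs
  from selecting odd exponents in x and in y.\<close>

definition E3 :: real where
  "E3 = ((pairsum ((x + y) / 2) x + pairsum y ((x + y) / 2)) + (pairsum (- ((x + y) / 2)) (- x) + pairsum (- y) (- ((x + y) / 2)))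
       - (pairsum ((x - y) / 2) x + pairsum (- y) ((x - y) / 2)) - (pairsum (- ((x - y) / 2)) (- x) + pairsum y (- ((x - y) / 2)))) / (2 * x * y)"

text \<open>In the variables i = n - p and j = n + p this is an antisymmetrised product of inverses
  i^2 - y^2 and j^2 - x^2, and the double sum over n and p becomes one over pairs of equal
  parity.\<close>

definition Kc :: "nat \<Rightarrow> nat \<Rightarrow> real" where
  "Kc n p = 1 / (((real n - real p) ^ 2 - y ^ 2) * ((real n + real p) ^ 2 - x ^ 2))
          - 1 / (((real n - real p) ^ 2 - x ^ 2) * ((real n + real p) ^ 2 - y ^ 2))"

text \<open>The terms left over when \<open>pairsum_pair\<close> is combined for the four signs in
  \<open>E3\<close>: they contain \<open>Afun\<close> at the moving points n - x, n + x, n - y and n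
  + y.\<close>

definition core_row :: "nat \<Rightarrow> real" where
  "core_row n = al n ((x + y) / 2) * (Afun (real n - x) - Afun (real n - y))
      + al n (- ((x + y) / 2)) * (Afun (real n + x) - Afun (real n + y))
      - al n ((x - y) / 2) * (Afun (real n - x) - Afun (real n + y))
      - al n (- ((x - y) / 2)) * (Afun (real n + x) - Afun (real n - y))"

text \<open>By \<open>Afun_diff_has_sum\<close>, (Afun t - Afun t')/(t + t') is a series in p. For t
  = n - X and t' = n - Y the denominators factor through i = n - p and j = n + p, and the series
  becomes a difference of products of simple poles in i and j. The four sign choices assemble these
  into \<open>Kc\<close>.\<close>

lemma core_row_has_sum:
  assumes n: "n \<ge> 1"
  shows "((\<lambda>p. 4 * x * y * Kc n p) has_sum core_row n) {1..}"
proof -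
  have ni: "real n - x \<notin> \<int>" "real n - y \<notin> \<int>" "real n + x \<notin> \<int>" "real n + y \<notin> \<int>" using non_Ints by auto
  have w: "2 * real n - (x + y) \<noteq> 0" "2 * real n + (x + y) \<noteq> 0" "2 * real n - (x - y) \<noteq> 0" "2 * real n + (x - y) \<noteq> 0"
    using non_Ints_neq(1,2)[OF non_Ints(3), of "2 * n"] non_Ints_neq(1,2)[OF non_Ints(4), of "2 * n"] by auto
  have one: "((\<lambda>p. 2 * (t - t') * (real p / ((real p ^ 2 - t ^ 2) * (real p ^ 2 - t' ^ 2)))) has_sum (2 / (t + t') * (Afun t - Afun t'))) {1..}"
    if t: "t \<notin> \<int>" "t' \<notin> \<int>" "t + t' \<noteq> 0" for t t'
  proof -
    have "((\<lambda>p. 2 / (t + t') * (real p * (t ^ 2 - t' ^ 2) / ((real p ^ 2 - t ^ 2) * (real p ^ 2 - t' ^ 2)))) has_sum (2 / (t + t') * (Afun t - Afun t'))) {1..}"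
      by (intro has_sum_cmult_right Afun_diff_has_sum t)
    moreover have "2 / (t + t') * (real p * (t ^ 2 - t' ^ 2) / ((real p ^ 2 - t ^ 2) * (real p ^ 2 - t' ^ 2))) =
        2 * (t - t') * (real p / ((real p ^ 2 - t ^ 2) * (real p ^ 2 - t' ^ 2)))" for p
    proof -
      have "t ^ 2 - t' ^ 2 = (t + t') * (t - t')" by (simp add: power2_eq_square algebra_simps)
      thus ?thesis using t(3) by simp
    qed
    ultimately show ?thesis by simp
  qed
  have q: "((\<lambda>p. 2 * ((real n - x) - (real n - y)) * (real p / ((real p ^ 2 - (real n - x) ^ 2) * (real p ^ 2 - (real n - y) ^ 2)))
       + 2 * ((real n + x) - (real n + y)) * (real p / ((real p ^ 2 - (real n + x) ^ 2) * (real p ^ 2 - (real n + y) ^ 2)))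
       - 2 * ((real n - x) - (real n + y)) * (real p / ((real p ^ 2 - (real n - x) ^ 2) * (real p ^ 2 - (real n + y) ^ 2)))
       - 2 * ((real n + x) - (real n - y)) * (real p / ((real p ^ 2 - (real n + x) ^ 2) * (real p ^ 2 - (real n - y) ^ 2)))) has_sum
     (2 / ((real n - x) + (real n - y)) * (Afun (real n - x) - Afun (real n - y))
      + 2 / ((real n + x) + (real n + y)) * (Afun (real n + x) - Afun (real n + y))
      - 2 / ((real n - x) + (real n + y)) * (Afun (real n - x) - Afun (real n + y))
      - 2 / ((real n + x) + (real n - y)) * (Afun (real n + x) - Afun (real n - y)))) {1..}"
    by (intro has_sum_add has_sum_diff one ni) (use w in \<open>auto simp: algebra_simps\<close>)
  \<comment> \<open>Here \<open>al\<close> at half of w is 2/(2 n - w) - 1/n. The parts -1/n cancel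
    because the four differences of \<open>Afun\<close> values add up to 0 with their signs.\<close>
  have row: "2 / ((real n - x) + (real n - y)) * (Afun (real n - x) - Afun (real n - y))
      + 2 / ((real n + x) + (real n + y)) * (Afun (real n + x) - Afun (real n + y))
      - 2 / ((real n - x) + (real n + y)) * (Afun (real n - x) - Afun (real n + y))
      - 2 / ((real n + x) + (real n - y)) * (Afun (real n + x) - Afun (real n - y)) = core_row n"
  proof -
    have h: "al n (w / 2) = 2 / (2 * real n - w) - 1 / real n" for w
    proof -
      have e: "real n - w / 2 = (2 * real n - w) / 2" by simp
      show ?thesis unfolding al_def e by simp
    qed
    define a b c d where "a = Afun (real n - x)" "b = Afun (real n - y)" "c = Afun (real n + x)" "d = Afun (real n + y)"
    have e: "(real n - x) + (real n - y) = 2 * real n - (x + y)" "(real n + x) + (real n + y) = 2 * real n - (- (x + y))"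
      "(real n - x) + (real n + y) = 2 * real n - (x - y)" "(real n + x) + (real n - y) = 2 * real n - (- (x - y))" by auto
    have m: "- ((x + y) / 2) = (- (x + y)) / 2" "- ((x - y) / 2) = (- (x - y)) / 2" by (rule minus_divide_left)+
    show ?thesis unfolding core_row_def e m h a_b_c_d_def[symmetric]
      by (simp add: left_diff_distrib right_diff_distrib)
  qed
  have "((\<lambda>p. 2 * ((real n - x) - (real n - y)) * (real p / ((real p ^ 2 - (real n - x) ^ 2) * (real p ^ 2 - (real n - y) ^ 2)))
       + 2 * ((real n + x) - (real n + y)) * (real p / ((real p ^ 2 - (real n + x) ^ 2) * (real p ^ 2 - (real n + y) ^ 2)))
       - 2 * ((real n - x) - (real n + y)) * (real p / ((real p ^ 2 - (real n - x) ^ 2) * (real p ^ 2 - (real n + y) ^ 2)))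
       - 2 * ((real n + x) - (real n - y)) * (real p / ((real p ^ 2 - (real n + x) ^ 2) * (real p ^ 2 - (real n - y) ^ 2)))) has_sum core_row n) {1..}"
    using q unfolding row .
  also have "?this \<longleftrightarrow> ?thesis"
  proof (rule has_sum_cong)
    fix p :: nat
    define i j where "i = real n - real p" and "j = real n + real p"
    have inz: "i - x \<noteq> 0" "i + x \<noteq> 0" "i - y \<noteq> 0" "i + y \<noteq> 0"
    proof -
      have i': "i \<in> \<int>" by (simp add: i_def)
      show "i - x \<noteq> 0" "i - y \<noteq> 0" using i' non_Ints by auto
      show "i + x \<noteq> 0" using i' non_Ints(5) by (metis add_eq_0_iff minus_minus minus_in_Ints_iff)
      show "i + y \<noteq> 0" using i' more_non_Ints(3) by (metis add_eq_0_iff minus_minus minus_in_Ints_iff)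
    qed
    have jnz: "j - x \<noteq> 0" "j + x \<noteq> 0" "j - y \<noteq> 0" "j + y \<noteq> 0"
      using denoms[of "n + p"] by (auto simp: j_def algebra_simps)
    have pf: "2 * (t - t') * (real p / ((real p ^ 2 - t ^ 2) * (real p ^ 2 - t' ^ 2))) = 1 / ((i - Y) * (j - X)) - 1 / ((i - X) * (j - Y))"
      if "t = real n - X" "t' = real n - Y" "i - X \<noteq> 0" "i - Y \<noteq> 0" "j - X \<noteq> 0" "j - Y \<noteq> 0" for t t' X Y
    proof -
      have a: "real p ^ 2 - t ^ 2 = - ((i - X) * (j - X))" "real p ^ 2 - t' ^ 2 = - ((i - Y) * (j - Y))"
        by (simp_all add: that(1,2) i_def j_def power2_eq_square algebra_simps)
      have b: "2 * (t - t') * real p = (Y - X) * (j - i)" by (simp add: that(1,2) i_def j_def algebra_simps)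
      have "2 * (t - t') * (real p / ((real p ^ 2 - t ^ 2) * (real p ^ 2 - t' ^ 2))) = (2 * (t - t') * real p) / ((real p ^ 2 - t ^ 2) * (real p ^ 2 - t' ^ 2))" by simp
      also have "\<dots> = 1 / ((i - Y) * (j - X)) - 1 / ((i - X) * (j - Y))"
        unfolding a b using that(3-) by (simp add: divide_simps) (simp add: algebra_simps)
      finally show ?thesis .
    qed
    have f1: "2 * ((real n - x) - (real n - y)) * (real p / ((real p ^ 2 - (real n - x) ^ 2) * (real p ^ 2 - (real n - y) ^ 2))) =
        1 / ((i - y) * (j - x)) - 1 / ((i - x) * (j - y))" by (rule pf) (use inz jnz in auto)
    have f2: "2 * ((real n + x) - (real n + y)) * (real p / ((real p ^ 2 - (real n + x) ^ 2) * (real p ^ 2 - (real n + y) ^ 2))) =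
        1 / ((i - (- y)) * (j - (- x))) - 1 / ((i - (- x)) * (j - (- y)))" by (rule pf) (use inz jnz in auto)
    have f3: "2 * ((real n - x) - (real n + y)) * (real p / ((real p ^ 2 - (real n - x) ^ 2) * (real p ^ 2 - (real n + y) ^ 2))) =
        1 / ((i - (- y)) * (j - x)) - 1 / ((i - x) * (j - (- y)))" by (rule pf) (use inz jnz in auto)
    have f4: "2 * ((real n + x) - (real n - y)) * (real p / ((real p ^ 2 - (real n + x) ^ 2) * (real p ^ 2 - (real n - y) ^ 2))) =
        1 / ((i - y) * (j - (- x))) - 1 / ((i - (- x)) * (j - y))" by (rule pf) (use inz jnz in auto)
    have sq: "2 * t / (k ^ 2 - t ^ 2) = 1 / (k - t) - 1 / (k + t)" if "k - t \<noteq> 0" "k + t \<noteq> 0" for k t :: real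
    proof -
      have "k ^ 2 - t ^ 2 = (k - t) * (k + t)" by (simp add: power2_eq_square algebra_simps)
      thus ?thesis using that by (simp add: divide_simps)
    qed
    have "4 * x * y * Kc n p = 2 * y / (i ^ 2 - y ^ 2) * (2 * x / (j ^ 2 - x ^ 2)) - 2 * x / (i ^ 2 - x ^ 2) * (2 * y / (j ^ 2 - y ^ 2))"
      by (simp add: Kc_def i_def j_def algebra_simps)
    also have "\<dots> = (1 / (i - y) - 1 / (i + y)) * (1 / (j - x) - 1 / (j + x)) - (1 / (i - x) - 1 / (i + x)) * (1 / (j - y) - 1 / (j + y))"
      using inz jnz by (simp add: sq)
    finally have Kc: "4 * x * y * Kc n p = (1 / (i - y) - 1 / (i + y)) * (1 / (j - x) - 1 / (j + x)) - (1 / (i - x) - 1 / (i + x)) * (1 / (j - y) - 1 / (j + y))" .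
    show "2 * ((real n - x) - (real n - y)) * (real p / ((real p ^ 2 - (real n - x) ^ 2) * (real p ^ 2 - (real n - y) ^ 2)))
       + 2 * ((real n + x) - (real n + y)) * (real p / ((real p ^ 2 - (real n + x) ^ 2) * (real p ^ 2 - (real n + y) ^ 2)))
       - 2 * ((real n - x) - (real n + y)) * (real p / ((real p ^ 2 - (real n - x) ^ 2) * (real p ^ 2 - (real n + y) ^ 2)))
       - 2 * ((real n + x) - (real n - y)) * (real p / ((real p ^ 2 - (real n + x) ^ 2) * (real p ^ 2 - (real n - y) ^ 2)))
       = 4 * x * y * Kc n p"
    proof -
      define a b c d a' b' c' d' where "a = 1 / (i - y)" "b = 1 / (i + y)" "c = 1 / (j - x)" "d = 1 / (j + x)"
        "a' = 1 / (i - x)" "b' = 1 / (i + x)" "c' = 1 / (j - y)" "d' = 1 / (j + y)"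
      note defs = this
      have split: "1 / (u * v) = 1 / u * (1 / v)" for u v :: real by simp
      show ?thesis
        unfolding f1 f2 f3 f4 Kc split diff_minus_eq_add defs[symmetric]
        by (simp only: left_diff_distrib right_diff_distrib)
    qed
  qed
  finally show ?thesis .
qed

definition E3_trig :: real where
  "E3_trig = (
     (cfun ((x + y) / 2) * cfun x / 2 - (1 / (2 * x) - 1 / (2 * y)) * cfun ((x + y) / 2) - (Dg ((x + y) / 2) x + Dg ((x + y) / 2) y) / 2)
   - (cfun ((x - y) / 2) * cfun x / 2 - (1 / (2 * x) + 1 / (2 * y)) * cfun ((x - y) / 2) - (Dg ((x - y) / 2) x + Dg ((x - y) / 2) (- y)) / 2))
     / (2 * x * y)"

text \<open>\<open>pairsum_pair\<close> is used for (u, x, y), (-u, -x, -y), (v, x, -y) and (-v, -x,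
  y) with u = (x + y)/2 and v = (x - y)/2. The products of \<open>afun\<close> values leave 2 Afun x
  (Afun u - Afun v), the constants in the rows remove 2 (Afun x - Afun y)(Afun u - Afun v), and only
  Afun y remains as a factor.\<close>

lemma E3_eq:
  assumes core: "(core_row has_sum 4 * x * y * KK) {1..}"
  shows "E3 = Afun y * (Afun ((x + y) / 2) - Afun ((x - y) / 2)) / (x * y) + E3_trig + 2 * KK"
proof -
  define u v where "u = (x + y) / 2" and "v = (x - y) / 2"
  have uv: "u \<notin> \<int>" "v \<notin> \<int>" "- u \<notin> \<int>" "- v \<notin> \<int>"
    using more_non_Ints by (auto simp: u_def v_def)
  define R where "R = (\<lambda>w X Y n. al n w * (Afun X - Afun (real n - X) + 1 / (2 * X) - Afun Y + Afun (real n - Y) - 1 / (2 * Y)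
       + (al n X + al n Y) / 2))"
  have R: "(R w X Y has_sum (afun w * afun X - pairsum w X - pairsum Y w)) {1..}" if "X \<notin> \<int>" "Y \<notin> \<int>" for w X Y
    unfolding R_def by (rule pairsum_pair[OF that])
  have 1: "((\<lambda>n. R u x y n + R (- u) (- x) (- y) n - R v x (- y) n - R (- v) (- x) y n) has_sum
     ((afun u * afun x - pairsum u x - pairsum y u) + (afun (- u) * afun (- x) - pairsum (- u) (- x) - pairsum (- y) (- u))
     - (afun v * afun x - pairsum v x - pairsum (- y) v) - (afun (- v) * afun (- x) - pairsum (- v) (- x) - pairsum y (- v)))) {1..}"
    by (intro has_sum_add has_sum_diff R) (use non_Ints more_non_Ints in auto)
  have c: "((\<lambda>n. al n t - al n (- t)) has_sum cfun t) {1..}" if "t \<notin> \<int>" for t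
    using has_sum_diff[OF al_has_sum[of t] al_has_sum[of "- t"]] afun_diff_minus[OF that] by (simp add: cfun_def)
  have a: "((\<lambda>n. al n t + al n (- t)) has_sum 2 * Afun t) {1..}" if "t \<notin> \<int>" for t
    using has_sum_add[OF al_has_sum[of t] al_has_sum[of "- t"]] afun_add_minus[OF that] by simp
  have neq: "u \<noteq> x" "u \<noteq> y" "v \<noteq> x" "v \<noteq> - y" using xy by (auto simp: u_def v_def)
  have 2: "((\<lambda>n. (Afun x - Afun y) * ((al n u + al n (- u)) - (al n v + al n (- v)))
      + (1 / (2 * x) - 1 / (2 * y)) * (al n u - al n (- u)) - (1 / (2 * x) + 1 / (2 * y)) * (al n v - al n (- v))
      - core_row n
      + (1 / 2) * ((al n u * al n x + al n (- u) * al n (- x)) + (al n u * al n y + al n (- u) * al n (- y))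
         - (al n v * al n x + al n (- v) * al n (- x)) - (al n v * al n (- y) + al n (- v) * al n (- (- y))))) has_sum
     ((Afun x - Afun y) * (2 * Afun u - 2 * Afun v)
      + (1 / (2 * x) - 1 / (2 * y)) * cfun u - (1 / (2 * x) + 1 / (2 * y)) * cfun v
      - 4 * x * y * KK
      + (1 / 2) * (Dg u x + Dg u y - Dg v x - Dg v (- y)))) {1..}"
    by (intro has_sum_add has_sum_diff has_sum_cmult_right a c core al_diagonal_has_sum uv neq non_Ints more_non_Ints)
  have "(\<lambda>n. (Afun x - Afun y) * ((al n u + al n (- u)) - (al n v + al n (- v)))
      + (1 / (2 * x) - 1 / (2 * y)) * (al n u - al n (- u)) - (1 / (2 * x) + 1 / (2 * y)) * (al n v - al n (- v))
      - core_row n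
      + (1 / 2) * ((al n u * al n x + al n (- u) * al n (- x)) + (al n u * al n y + al n (- u) * al n (- y))
         - (al n v * al n x + al n (- v) * al n (- x)) - (al n v * al n (- y) + al n (- v) * al n (- (- y))))) =
     (\<lambda>n. R u x y n + R (- u) (- x) (- y) n - R v x (- y) n - R (- v) (- x) y n)"
  proof
    fix n
    define X Y where "X = 1 / (2 * x)" and "Y = 1 / (2 * y)"
    have m: "1 / (2 * (- x)) = - X" "1 / (2 * (- y)) = - Y" by (simp_all add: X_def Y_def)
    show "(Afun x - Afun y) * ((al n u + al n (- u)) - (al n v + al n (- v)))
      + (1 / (2 * x) - 1 / (2 * y)) * (al n u - al n (- u)) - (1 / (2 * x) + 1 / (2 * y)) * (al n v - al n (- v))
      - core_row n
      + (1 / 2) * ((al n u * al n x + al n (- u) * al n (- x)) + (al n u * al n y + al n (- u) * al n (- y))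
         - (al n v * al n x + al n (- v) * al n (- x)) - (al n v * al n (- y) + al n (- v) * al n (- (- y)))) =
      R u x y n + R (- u) (- x) (- y) n - R v x (- y) n - R (- v) (- x) y n"
      unfolding R_def core_row_def m X_def[symmetric] Y_def[symmetric] u_def[symmetric] v_def[symmetric]
      by (simp add: algebra_simps add_divide_distrib diff_divide_distrib)
  qed
  hence eq: "(afun u * afun x - pairsum u x - pairsum y u) + (afun (- u) * afun (- x) - pairsum (- u) (- x) - pairsum (- y) (- u))
     - (afun v * afun x - pairsum v x - pairsum (- y) v) - (afun (- v) * afun (- x) - pairsum (- v) (- x) - pairsum y (- v)) =
     (Afun x - Afun y) * (2 * Afun u - 2 * Afun v)
      + (1 / (2 * x) - 1 / (2 * y)) * cfun u - (1 / (2 * x) + 1 / (2 * y)) * cfun v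
      - 4 * x * y * KK
      + (1 / 2) * (Dg u x + Dg u y - Dg v x - Dg v (- y))"
    using has_sum_unique[OF 1] 2 by (simp only:)
  have prods: "afun u * afun x + afun (- u) * afun (- x) = 2 * Afun u * Afun x + cfun u * cfun x / 2"
    "afun v * afun x + afun (- v) * afun (- x) = 2 * Afun v * Afun x + cfun v * cfun x / 2"
    unfolding afun_eq[OF uv(1)] afun_eq[OF uv(2)] afun_eq[OF non_Ints(1)] by (simp_all add: field_simps)
  define N where "N = (pairsum u x + pairsum y u) + (pairsum (- u) (- x) + pairsum (- y) (- u))
       - (pairsum v x + pairsum (- y) v) - (pairsum (- v) (- x) + pairsum y (- v))"
  define T where "T = (cfun u * cfun x / 2 - (1 / (2 * x) - 1 / (2 * y)) * cfun u - (Dg u x + Dg u y) / 2)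
   - (cfun v * cfun x / 2 - (1 / (2 * x) + 1 / (2 * y)) * cfun v - (Dg v x + Dg v (- y)) / 2)"
  have N: "N = (afun u * afun x + afun (- u) * afun (- x)) - (afun v * afun x + afun (- v) * afun (- x))
     - ((Afun x - Afun y) * (2 * Afun u - 2 * Afun v)
      + (1 / (2 * x) - 1 / (2 * y)) * cfun u - (1 / (2 * x) + 1 / (2 * y)) * cfun v
      - 4 * x * y * KK
      + (1 / 2) * (Dg u x + Dg u y - Dg v x - Dg v (- y)))"
    unfolding eq[symmetric] N_def by simp
  have "N = 2 * Afun y * (Afun u - Afun v) + T + 4 * x * y * KK"
    unfolding N prods T_def by (simp add: algebra_simps add_divide_distrib diff_divide_distrib)
  moreover have "E3 = N / (2 * x * y)" by (simp add: E3_def N_def u_def v_def)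
  moreover have "E3_trig = T / (2 * x * y)" by (simp add: E3_trig_def T_def u_def v_def)
  ultimately have "E3 = Afun y * (Afun u - Afun v) / (x * y) + E3_trig + 2 * KK"
    using xy by (simp add: add_divide_distrib)
  thus ?thesis by (simp only: u_def v_def)
qed

end

section \<open>Double sums over m < n and their alternating versions\<close>

definition dsum :: "(nat \<Rightarrow> real) \<Rightarrow> (nat \<Rightarrow> real) \<Rightarrow> real" where
  "dsum f g = infsum (\<lambda>(m, n). f m * g n) lt_pairs"

lemma dsum_has_sum:
  fixes f g :: "nat \<Rightarrow> real"
  assumes "(f has_sum a) {1..}" "(g has_sum b) {1..}"
  shows "((\<lambda>(m, n). f m * g n) has_sum dsum f g) lt_pairs"
  unfolding dsum_def
  by (rule has_sum_infsum, rule summable_on_subset[OF has_sum_imp_summable[OF product_has_sum[OF assms]]])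
     (rule lt_pairs_subset)

lemma has_sum_swap_set:
  fixes f :: "nat \<times> nat \<Rightarrow> real"
  assumes "((\<lambda>(m, n). f (n, m)) has_sum S) A"
  shows "(f has_sum S) (prod.swap ` A)"
proof -
  have inj: "inj_on prod.swap A" by (auto simp: inj_on_def)
  show ?thesis using assms by (subst has_sum_reindex[OF inj]) (auto simp: o_def case_prod_unfold prod.swap_def)
qed

lemma diagonal_has_sum_image:
  fixes f :: "nat \<times> nat \<Rightarrow> real"
  assumes "((\<lambda>n. f (n, n)) has_sum S) A"
  shows "(f has_sum S) ((\<lambda>n. (n, n)) ` A)"
proof -
  have inj: "inj_on (\<lambda>n. (n, n)) A" by (auto simp: inj_on_def)
  show ?thesis using assms by (subst has_sum_reindex[OF inj]) (auto simp: o_def)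
qed

lemma square_partition: "{1..} \<times> {1..} = lt_pairs \<union> prod.swap ` lt_pairs \<union> (\<lambda>n. (n, n)) ` {1::nat..}"
  by (auto simp: lt_pairs_def image_iff)

lemma square_has_sum:
  fixes f :: "nat \<times> nat \<Rightarrow> real"
  assumes "(f has_sum a) lt_pairs" "((\<lambda>(m, n). f (n, m)) has_sum b) lt_pairs" "((\<lambda>n. f (n, n)) has_sum c) {1..}"
  shows "(f has_sum (a + b + c)) ({1..} \<times> {1..})"
  unfolding square_partition
  by (intro has_sum_Un_disjoint has_sum_swap_set diagonal_has_sum_image assms) (auto simp: lt_pairs_def)

text \<open>The quasi-shuffle relation: the square splits into m < n, n < m and the
  diagonal.\<close>

lemma dsum_add_swap:
  fixes f g :: "nat \<Rightarrow> real"
  assumes f: "(f has_sum a) {1..}" and g: "(g has_sum b) {1..}" and d: "((\<lambda>n. f n * g n) has_sum c) {1..}"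
  shows "dsum f g + dsum g f + c = a * b"
proof -
  have 1: "((\<lambda>(m, n). f m * g n) has_sum dsum f g) lt_pairs" by (rule dsum_has_sum[OF f g])
  have 2: "((\<lambda>(m, n). (\<lambda>(m, n). f m * g n) (n, m)) has_sum dsum g f) lt_pairs"
    using dsum_has_sum[OF g f] by (simp add: mult.commute)
  have 3: "((\<lambda>n. (\<lambda>(m, n). f m * g n) (n, n)) has_sum c) {1..}" using d by simp
  from square_has_sum[OF 1 2 3] product_has_sum[OF f g] show ?thesis by (rule has_sum_unique)
qed

lemma dsum_star_sum:
  fixes f g :: "nat \<Rightarrow> real"
  assumes f: "(f has_sum a) {1..}" and g: "(g has_sum b) {1..}" and d: "((\<lambda>n. f n * g n) has_sum c) {1..}"
  shows "((\<lambda>n. g n * star_sum f n) has_sum (2 * dsum f g + c)) {1..}"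
proof -
  have "((\<lambda>n. 2 * (g n * (\<Sum>k\<in>{1..<n}. f k)) + f n * g n) has_sum (2 * dsum f g + c)) {1..}"
    by (intro has_sum_add has_sum_cmult_right d lt_pairs_cols[OF dsum_has_sum[OF f g]])
  thus ?thesis by (simp add: star_sum_def algebra_simps)
qed

lemma dsum_cmult:
  fixes f g :: "nat \<Rightarrow> real"
  shows "dsum (\<lambda>n. c * f n) (\<lambda>n. d * g n) = c * d * dsum f g"
proof -
  have "(\<lambda>(m, n). (c * f m) * (d * g n)) = (\<lambda>z. (c * d) * (case z of (m, n) \<Rightarrow> f m * g n))"
    by (auto simp: fun_eq_iff)
  thus ?thesis unfolding dsum_def by (simp only: infsum_cmult_right')
qed

lemma alt_mult_alt: "((- 1) ^ n * a) * ((- 1) ^ n * b) = a * (b :: real)"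
proof -
  have "((- 1) ^ n * a) * ((- 1) ^ n * b) = ((- 1) ^ n * (- 1) ^ n) * (a * b)" by (simp only: mult_ac)
  also have "(- 1) ^ n * (- 1) ^ n = (1 :: real)" by (rule minus_one_mult_self)
  finally show ?thesis by simp
qed

abbreviation alt :: "nat \<Rightarrow> real" where "alt n \<equiv> (- 1) ^ n"

definition q :: "real \<Rightarrow> nat \<Rightarrow> real" where
  "q t n = 1 / (real n ^ 2 - t ^ 2)"

text \<open>The sum over n of \<open>q t n\<close>, and for \<open>Qe\<close> its alternating
  version; in t^2 these generate zeta and the barred zeta at 2 i + 2.\<close>

definition Q1 :: "real \<Rightarrow> real" where "Q1 t = cfun t / (2 * t)"
definition Qe :: "real \<Rightarrow> real" where "Qe t = (1 / t - theta t) / (2 * t)"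

lemma q_has_sum:
  assumes "t \<notin> \<int>"
  shows "(q t has_sum Q1 t) {1..}" "((\<lambda>n. alt n * q t n) has_sum Qe t) {1..}"
proof -
  have t: "t \<noteq> 0" using non_Ints_nonzero[OF assms] .
  have "((\<lambda>n. 1 / (2 * t) * (2 * t / (real n ^ 2 - t ^ 2))) has_sum 1 / (2 * t) * cfun t) {1..}"
    unfolding cfun_def by (intro has_sum_cmult_right cot_has_sum assms)
  moreover have "(\<lambda>n. 1 / (2 * t) * (2 * t / (real n ^ 2 - t ^ 2))) = q t" using t by (auto simp: q_def)
  ultimately show "(q t has_sum Q1 t) {1..}" by (simp add: Q1_def)
  have "((\<lambda>n. 1 / (2 * t) * (alt n * (2 * t / (real n ^ 2 - t ^ 2)))) has_sum 1 / (2 * t) * (1 / t - theta t)) {1..}"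
    unfolding theta_def by (intro has_sum_cmult_right csc_has_sum assms)
  moreover have "(\<lambda>n. 1 / (2 * t) * (alt n * (2 * t / (real n ^ 2 - t ^ 2)))) = (\<lambda>n. alt n * q t n)" using t by (auto simp: q_def)
  ultimately show "((\<lambda>n. alt n * q t n) has_sum Qe t) {1..}" by (simp add: Qe_def)
qed

lemma q_even_has_sum:
  assumes "t \<notin> \<int>"
  shows "((\<lambda>n. q t (2 * n)) has_sum (Q1 t + Qe t) / 2) {1..}"
proof -
  have "((\<lambda>n. (1 / 2) * (q t n + alt n * q t n)) has_sum (1 / 2) * (Q1 t + Qe t)) {1..}"
    by (intro has_sum_cmult_right has_sum_add q_has_sum assms)
  also have "?this \<longleftrightarrow> (q t has_sum (1 / 2) * (Q1 t + Qe t)) ((\<lambda>n. 2 * n) ` {1..})"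
  proof (rule has_sum_cong_neutral)
    fix n assume "n \<in> {1..} - (\<lambda>n. 2 * n) ` {1::nat..}"
    hence "odd n" by (auto simp: image_iff elim!: evenE)
    thus "(1 / 2) * (q t n + alt n * q t n) = 0" by simp
  qed auto
  also have "\<dots> \<longleftrightarrow> ((\<lambda>n. q t (2 * n)) has_sum (1 / 2) * (Q1 t + Qe t)) {1..}"
    by (subst has_sum_reindex) (auto simp: inj_on_def o_def)
  finally show ?thesis by simp
qed

definition even_pairs :: "(nat \<times> nat) set" where
  "even_pairs = {z \<in> lt_pairs. even (fst z + snd z)}"

text \<open>The factor (1 + (-1)^(m + n))/2 selects pairs of equal parity and splits the sum into a
  plain and an alternating one.\<close>

lemma even_pairs_has_sum:
  assumes "s \<notin> \<int>" "t \<notin> \<int>"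
  shows "((\<lambda>(m, n). q s m * q t n) has_sum (dsum (q s) (q t) + dsum (\<lambda>n. alt n * q s n) (\<lambda>n. alt n * q t n)) / 2) even_pairs"
proof -
  have "((\<lambda>z. (1 / 2) * ((\<lambda>(m, n). q s m * q t n) z + (\<lambda>(m, n). (alt m * q s m) * (alt n * q t n)) z)) has_sum
      (1 / 2) * (dsum (q s) (q t) + dsum (\<lambda>n. alt n * q s n) (\<lambda>n. alt n * q t n))) lt_pairs"
    by (intro has_sum_cmult_right has_sum_add dsum_has_sum[OF q_has_sum(1) q_has_sum(1)]
        dsum_has_sum[OF q_has_sum(2) q_has_sum(2)] assms)
  also have "?this \<longleftrightarrow> ((\<lambda>(m, n). q s m * q t n) has_sum (1 / 2) * (dsum (q s) (q t) + dsum (\<lambda>n. alt n * q s n) (\<lambda>n. alt n * q t n))) even_pairs"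
    by (rule has_sum_cong_neutral) (auto simp: even_pairs_def uminus_power_if)
  finally show ?thesis by simp
qed

lemma even_pairs_reindex:
  fixes f :: "nat \<Rightarrow> nat \<Rightarrow> real"
  assumes "((\<lambda>(i, j). f i j) has_sum S) even_pairs"
  shows "((\<lambda>(p, n). f (n - p) (n + p)) has_sum S) lt_pairs"
proof -
  have inj: "inj_on (\<lambda>(p, n). (n - p, n + p)) lt_pairs" by (auto simp: inj_on_def lt_pairs_def)
  have img: "(\<lambda>(p, n). (n - p, n + p)) ` lt_pairs = even_pairs"
  proof (intro equalityI subsetI)
    fix z assume "z \<in> even_pairs"
    then obtain i j where z: "z = (i, j)" "1 \<le> i" "i < j" "even (i + j)" by (auto simp: even_pairs_def lt_pairs_def)
    then obtain k where k: "i + j = 2 * k" by (elim evenE)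
    have "(j - k, k) \<in> lt_pairs" "(i, j) = (k - (j - k), k + (j - k))" using z k by (auto simp: lt_pairs_def)
    thus "z \<in> (\<lambda>(p, n). (n - p, n + p)) ` lt_pairs" unfolding z(1) by force
  qed (auto simp: even_pairs_def lt_pairs_def)
  show ?thesis using assms unfolding img[symmetric] by (subst (asm) has_sum_reindex[OF inj]) (auto simp: o_def case_prod_unfold)
qed

context gen_vars
begin

definition Lxy where "Lxy = dsum (q x) (q y)"
definition Lyx where "Lyx = dsum (q y) (q x)"
definition Exy where "Exy = dsum (\<lambda>n. alt n * q x n) (\<lambda>n. alt n * q y n)"
definition Eyx where "Eyx = dsum (\<lambda>n. alt n * q y n) (\<lambda>n. alt n * q x n)"
definition dg where "dg = (Q1 x - Q1 y) / (x ^ 2 - y ^ 2)"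

lemma xy_sq: "x ^ 2 - y ^ 2 \<noteq> 0"
proof -
  have "x ^ 2 - y ^ 2 = (x - y) * (x + y)" by (simp add: power2_eq_square algebra_simps)
  thus ?thesis using xy by simp
qed

lemma sq_denoms: "real n ^ 2 - x ^ 2 \<noteq> 0" "real n ^ 2 - y ^ 2 \<noteq> 0"
proof -
  have "real n ^ 2 - x ^ 2 = (real n - x) * (real n + x)" "real n ^ 2 - y ^ 2 = (real n - y) * (real n + y)"
    by (simp_all add: power2_eq_square algebra_simps)
  thus "real n ^ 2 - x ^ 2 \<noteq> 0" "real n ^ 2 - y ^ 2 \<noteq> 0" using denoms[of n] by simp_all
qed

lemma dg_has_sum: "((\<lambda>n. q x n * q y n) has_sum dg) {1..}"
proof -
  have "((\<lambda>n. (q x n - q y n) / (x ^ 2 - y ^ 2)) has_sum dg) {1..}"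
    unfolding dg_def by (intro has_sum_divide_const has_sum_diff q_has_sum non_Ints)
  also have "?this \<longleftrightarrow> ?thesis"
  proof (rule has_sum_cong)
    fix n
    have nz: "real n ^ 2 - x ^ 2 \<noteq> 0" "real n ^ 2 - y ^ 2 \<noteq> 0" using sq_denoms[of n] by auto
    have "q x n - q y n = (x ^ 2 - y ^ 2) * (q x n * q y n)" using nz by (simp add: q_def divide_simps)
    thus "(q x n - q y n) / (x ^ 2 - y ^ 2) = q x n * q y n" using xy_sq by simp
  qed
  finally show ?thesis .
qed

lemma Lxy_Lyx: "Lxy + Lyx + dg = Q1 x * Q1 y"
  unfolding Lxy_def Lyx_def by (intro dsum_add_swap q_has_sum non_Ints dg_has_sum)

lemma Exy_Eyx: "Exy + Eyx + dg = Qe x * Qe y"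
  unfolding Exy_def Eyx_def
proof (intro dsum_add_swap q_has_sum non_Ints)
  show "((\<lambda>n. alt n * q x n * (alt n * q y n)) has_sum dg) {1..}"
    unfolding alt_mult_alt by (rule dg_has_sum)
qed

text \<open>The contribution of n = p to the sum of \<open>Kc\<close>, where i = 0 and j = 2
  n.\<close>

definition Z0 where "Z0 = (Q1 y + Qe y) / (2 * x ^ 2) - (Q1 x + Qe x) / (2 * y ^ 2)"
definition KK where "KK = (Lyx + Eyx) - (Lxy + Exy) + Z0"

text \<open>\<open>Kc\<close> is symmetric in n and p, so the full sum is twice the triangle p < n
  plus the diagonal. On the triangle, (n - p, n + p) runs through the pairs of equal parity.\<close>

lemma Kc_has_sum: "((\<lambda>(n, p). Kc n p) has_sum KK) ({1..} \<times> {1..})"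
proof -
  define P where "P = ((Lyx + Eyx) - (Lxy + Exy)) / 2"
  have K: "Kc n p = q y (n - p) * q x (n + p) - q x (n - p) * q y (n + p)" if "p \<le> n" for n p
    using that by (simp add: Kc_def q_def of_nat_diff)
  have sym: "Kc n p = Kc p n" for n p
  proof -
    have "(real n - real p) ^ 2 = (real p - real n) ^ 2" by (simp add: power2_eq_square algebra_simps)
    thus ?thesis by (simp add: Kc_def add.commute)
  qed
  have "((\<lambda>(i, j). q y i * q x j - q x i * q y j) has_sum P) even_pairs"
  proof -
    have "((\<lambda>z. (\<lambda>(i, j). q y i * q x j) z - (\<lambda>(i, j). q x i * q y j) z) has_sum
      ((dsum (q y) (q x) + dsum (\<lambda>n. alt n * q y n) (\<lambda>n. alt n * q x n)) / 2
       - (dsum (q x) (q y) + dsum (\<lambda>n. alt n * q x n) (\<lambda>n. alt n * q y n)) / 2)) even_pairs"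
      by (intro has_sum_diff even_pairs_has_sum non_Ints)
    thus ?thesis by (simp add: P_def Lxy_def Lyx_def Exy_def Eyx_def diff_divide_distrib case_prod_unfold)
  qed
  from even_pairs_reindex[OF this]
  have "((\<lambda>(p, n). q y (n - p) * q x (n + p) - q x (n - p) * q y (n + p)) has_sum P) lt_pairs" .
  also have "?this \<longleftrightarrow> ((\<lambda>(p, n). Kc n p) has_sum P) lt_pairs"
    by (rule has_sum_cong) (auto simp: K lt_pairs_def)
  finally have 1: "((\<lambda>(p, n). Kc n p) has_sum P) lt_pairs" .
  have 2: "((\<lambda>(n, p). Kc n p) has_sum P) lt_pairs" using 1 by (subst sym)
  have "((\<lambda>n. 1 / x ^ 2 * q y (2 * n) - 1 / y ^ 2 * q x (2 * n)) has_sum (1 / x ^ 2 * ((Q1 y + Qe y) / 2) - 1 / y ^ 2 * ((Q1 x + Qe x) / 2))) {1..}"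
    by (intro has_sum_diff has_sum_cmult_right q_even_has_sum non_Ints)
  moreover have "1 / x ^ 2 * q y (2 * n) - 1 / y ^ 2 * q x (2 * n) = Kc n n" for n
    by (simp add: K) (simp add: q_def mult.commute)
  ultimately have 3: "((\<lambda>n. Kc n n) has_sum Z0) {1..}"
    by (simp add: Z0_def mult.commute)
  have "((\<lambda>(n, p). Kc n p) has_sum (P + P + Z0)) ({1..} \<times> {1..})"
    by (rule square_has_sum) (use 1 2 3 in auto)
  thus ?thesis by (simp add: P_def KK_def)
qed

lemma core_has_sum: "(core_row has_sum 4 * x * y * KK) {1..}"
proof (rule has_sum_SigmaD)
  have "((\<lambda>z. 4 * x * y * (\<lambda>(n, p). Kc n p) z) has_sum 4 * x * y * KK) ({1..} \<times> {1..})"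
    by (intro has_sum_cmult_right Kc_has_sum)
  thus "((\<lambda>(n, p). 4 * x * y * Kc n p) has_sum 4 * x * y * KK) ({1..} \<times> {1..})" by (simp add: case_prod_unfold)
  fix n :: nat assume "n \<in> {1..}"
  thus "((\<lambda>p. (\<lambda>(n, p). 4 * x * y * Kc n p) (n, p)) has_sum core_row n) {1..}"
    using core_row_has_sum[of n] by simp
qed

lemma E3_formula: "E3 = Afun y * (Afun ((x + y) / 2) - Afun ((x - y) / 2)) / (x * y) + E3_trig + 2 * KK"
  by (rule E3_eq[OF core_has_sum])

definition Ap where "Ap t n = t ^ 2 / (real n * (real n ^ 2 - t ^ 2))" for t :: real and n :: nat
definition LA where "LA = dsum (Ap x) (Ap y)"

text \<open>Partial fractions in n^2 with poles 0, x^2 and y^2; the pole 0 contributes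
  zeta(2).\<close>

lemma Ap_diagonal_has_sum:
  "((\<lambda>n. Ap x n * Ap y n) has_sum (pi ^ 2 / 6 + (y ^ 2 * Q1 x - x ^ 2 * Q1 y) / (x ^ 2 - y ^ 2))) {1..}"
proof -
  have "((\<lambda>n. 1 / real n ^ 2 + (y ^ 2 * q x n - x ^ 2 * q y n) / (x ^ 2 - y ^ 2)) has_sum
     (pi ^ 2 / 6 + (y ^ 2 * Q1 x - x ^ 2 * Q1 y) / (x ^ 2 - y ^ 2))) {1..}"
    by (intro has_sum_add has_sum_divide_const has_sum_diff has_sum_cmult_right zeta_2_has_sum q_has_sum non_Ints)
  also have "?this \<longleftrightarrow> ?thesis"
  proof (rule has_sum_cong)
    fix n :: nat assume "n \<in> {1..}"
    define N a b where "N = real n ^ 2" "a = x ^ 2" "b = y ^ 2"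
    have nz: "N - a \<noteq> 0" "N - b \<noteq> 0" "N \<noteq> 0" "a - b \<noteq> 0" using sq_denoms[of n] xy_sq \<open>n \<in> {1..}\<close> by (auto simp: N_a_b_def)
    have "Ap x n * Ap y n = a * b / (N * (N - a) * (N - b))"
      by (simp add: Ap_def N_a_b_def power2_eq_square)
    moreover have "b * (1 / (N - a)) - a * (1 / (N - b)) = (a - b) * ((a + b - N) / ((N - a) * (N - b)))"
      using nz by (simp add: divide_simps) (simp add: algebra_simps)
    moreover have "1 / N + (a + b - N) / ((N - a) * (N - b)) = a * b / (N * (N - a) * (N - b))"
      using nz by (simp add: divide_simps) (simp add: algebra_simps)
    ultimately show "1 / real n ^ 2 + (y ^ 2 * q x n - x ^ 2 * q y n) / (x ^ 2 - y ^ 2) = Ap x n * Ap y n"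
      using nz unfolding q_def N_a_b_def[symmetric] by simp
  qed
  finally show ?thesis .
qed

text \<open>The star sum \<open>kap\<close> splits into a harmonic one, evaluated by
  \<open>Afun_harmonic_has_sum\<close>, and one with the convergent summands \<open>Ap x\<close>.
  The latter and the alternating star sum in \<open>altstar\<close> become \<open>LA\<close> and
  \<open>Exy\<close> through \<open>dsum_star_sum\<close>.\<close>

lemma fterm_has_sum:
  "(fterm has_sum
     (2 * theta y / y * ((- (Afun y ^ 2) + (theta y ^ 2 - 1 / y ^ 2) / 4 - pi ^ 2 / 12)
        + 2 * LA + (pi ^ 2 / 6 + (y ^ 2 * Q1 x - x ^ 2 * Q1 y) / (x ^ 2 - y ^ 2)))
      + theta x * (2 / x * Qe y - 2 * x * (2 * Exy + dg)))) {1..}"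
proof -
  have As: "(Ap t has_sum Afun t) {1..}" if "t \<notin> \<int>" for t
    unfolding Ap_def using Afun_has_sum[of t] by simp
  have sgn: "((\<lambda>n. (alt n * q x n) * (alt n * q y n)) has_sum dg) {1..}"
    unfolding alt_mult_alt by (rule dg_has_sum)
  have "((\<lambda>p. 2 * theta y / y * (y ^ 2 / (real p * (real p ^ 2 - y ^ 2)) * star_sum (\<lambda>k. 1 / real k) p + Ap y p * star_sum (Ap x) p)
      + theta x * (2 / x * (alt p * q y p) - 2 * x * ((alt p * q y p) * star_sum (\<lambda>n. alt n * q x n) p))) has_sum
     (2 * theta y / y * ((- (Afun y ^ 2) + (theta y ^ 2 - 1 / y ^ 2) / 4 - pi ^ 2 / 12)
        + (2 * LA + (pi ^ 2 / 6 + (y ^ 2 * Q1 x - x ^ 2 * Q1 y) / (x ^ 2 - y ^ 2))))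
      + theta x * (2 / x * Qe y - 2 * x * (2 * Exy + dg)))) {1..}"
    unfolding LA_def Exy_def
    by (intro has_sum_add has_sum_diff has_sum_cmult_right q_has_sum dsum_star_sum[OF As As Ap_diagonal_has_sum]
        dsum_star_sum[OF q_has_sum(2) q_has_sum(2) sgn] Afun_harmonic_has_sum non_Ints) (use xy in auto)
  also have "?this \<longleftrightarrow> (fterm has_sum
     (2 * theta y / y * ((- (Afun y ^ 2) + (theta y ^ 2 - 1 / y ^ 2) / 4 - pi ^ 2 / 12)
        + (2 * LA + (pi ^ 2 / 6 + (y ^ 2 * Q1 x - x ^ 2 * Q1 y) / (x ^ 2 - y ^ 2))))
      + theta x * (2 / x * Qe y - 2 * x * (2 * Exy + dg)))) {1..}"
  proof (rule has_sum_cong)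
    fix p :: nat assume "p \<in> {1..}"
    have k: "kap p = star_sum (\<lambda>k. 1 / real k) p + star_sum (Ap x) p"
    proof -
      have "real k / (real k ^ 2 - x ^ 2) = 1 / real k + Ap x k" if "k \<in> {1..p}" for k
      proof -
        have "real k \<noteq> 0" "real k ^ 2 - x ^ 2 \<noteq> 0" using that sq_denoms[of k] by auto
        thus ?thesis by (simp add: Ap_def divide_simps) (simp add: power2_eq_square algebra_simps)
      qed
      hence "kap p = star_sum (\<lambda>k. 1 / real k + Ap x k) p"
        unfolding kap_def star_sum_def using \<open>p \<in> {1..}\<close> by (auto intro!: arg_cong2[where f="(+)"] sum.cong)
      thus ?thesis by (simp only: star_sum_add)
    qed
    have a: "altstar p = 2 / x - 2 * x * star_sum (\<lambda>n. alt n * q x n) p"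
      by (simp add: altstar_def q_def)
    have c: "y / (real p * (real p ^ 2 - y ^ 2)) = Ap y p / y" using xy by (simp add: Ap_def power2_eq_square)
    have f: "fterm p = 2 * theta y * (y / (real p * (real p ^ 2 - y ^ 2))) * kap p + theta x * alt p * q y p * altstar p"
      by (simp add: fterm_def q_def)
    show "2 * theta y / y * (y ^ 2 / (real p * (real p ^ 2 - y ^ 2)) * star_sum (\<lambda>k. 1 / real k) p + Ap y p * star_sum (Ap x) p)
      + theta x * (2 / x * (alt p * q y p) - 2 * x * ((alt p * q y p) * star_sum (\<lambda>n. alt n * q x n) p)) = fterm p"
      unfolding f c k a Ap_def[symmetric, of y] by (simp add: algebra_simps add_divide_distrib)
  qed
  finally show ?thesis by (simp add: add.assoc)
qed

end

section \<open>Double power series\<close>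

text \<open>A relation instead of a function: it records unconditional convergence at the point
  together with the value, so convolutions and regroupings carry their summability along.\<close>

definition dps :: "(nat \<Rightarrow> nat \<Rightarrow> real) \<Rightarrow> real \<Rightarrow> real \<Rightarrow> real \<Rightarrow> bool" where
  "dps c X Y S \<longleftrightarrow> ((\<lambda>(i, j). c i j * (X ^ i * Y ^ j)) has_sum S) UNIV"

definition ups :: "(nat \<Rightarrow> real) \<Rightarrow> real \<Rightarrow> real \<Rightarrow> bool" where
  "ups c X S \<longleftrightarrow> ((\<lambda>i. c i * X ^ i) has_sum S) UNIV"

lemma has_sum_regroup:
  fixes h :: "'i \<Rightarrow> real"
  assumes h: "(h has_sum S) UNIV" and fin: "\<And>j. finite {i. \<phi> i = j}"
  shows "((\<lambda>j. \<Sum>i | \<phi> i = j. h i) has_sum S) UNIV"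
proof -
  have inj: "inj_on (\<lambda>i. (\<phi> i, i)) UNIV" by (auto simp: inj_on_def)
  have img: "range (\<lambda>i. (\<phi> i, i)) = (SIGMA j:UNIV. {i. \<phi> i = j})" by auto
  have "((\<lambda>(j, i). h i) has_sum S) (SIGMA j:UNIV. {i. \<phi> i = j})"
    unfolding img[symmetric] by (subst has_sum_reindex[OF inj]) (use h in \<open>simp add: o_def\<close>)
  thus ?thesis by (rule has_sum_SigmaD) (use fin in auto)
qed

lemma has_sum_product:
  fixes f :: "'a \<Rightarrow> real" and g :: "'b \<Rightarrow> real"
  assumes f: "(f has_sum a) A" and g: "(g has_sum b) B"
  shows "((\<lambda>(i, j). f i * g j) has_sum (a * b)) (A \<times> B)"
proof -
  have nf: "(\<lambda>n. norm (f n)) summable_on A" and ng: "(\<lambda>n. norm (g n)) summable_on B"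
    by (rule summable_on_iff_abs_summable_on_real[THEN iffD1, OF has_sum_imp_summable], fact)+
  define G where "G = (\<Sum>\<^sub>\<infinity>n\<in>B. norm (g n))"
  have "((\<lambda>n. norm (g n)) has_sum G) B" using ng by (simp add: G_def)
  hence ninner: "((\<lambda>n. norm (f m) * norm (g n)) has_sum norm (f m) * G) B" for m
    by (rule has_sum_cmult_right)
  have nouter: "(\<lambda>m. norm (f m) * G) summable_on A"
    by (rule summable_on_cmult_left[OF nf])
  have "(\<lambda>(m, n). norm (f m) * norm (g n)) summable_on A \<times> B"
  proof (rule summable_on_SigmaI[OF _ nouter])
    fix m
    show "((\<lambda>n. case (m, n) of (m, n) \<Rightarrow> norm (f m) * norm (g n)) has_sum norm (f m) * G) B"
      unfolding prod.case by (rule ninner)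
  qed (auto split: prod.split)
  moreover have "(\<lambda>(m, n). norm (f m) * norm (g n)) = (\<lambda>z. norm (case z of (m, n) \<Rightarrow> f m * g n))"
    by (auto simp: fun_eq_iff abs_mult)
  ultimately have "(\<lambda>z. norm (case z of (m, n) \<Rightarrow> f m * g n)) summable_on A \<times> B"
    by (simp only:)
  hence s: "(\<lambda>(m, n). f m * g n) summable_on A \<times> B"
    by (rule abs_summable_summable)
  have outer: "((\<lambda>m. f m * b) has_sum a * b) A"
    by (rule has_sum_cmult_left[OF f])
  show ?thesis
  proof (rule has_sum_SigmaI[OF _ outer s])
    fix m
    show "((\<lambda>n. case (m, n) of (m, n) \<Rightarrow> f m * g n) has_sum f m * b) B"
      unfolding prod.case by (rule has_sum_cmult_right[OF g])
  qed
qed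

lemma dps_add: "dps c X Y S \<Longrightarrow> dps d X Y T \<Longrightarrow> dps (\<lambda>a b. c a b + d a b) X Y (S + T)"
  unfolding dps_def by (drule (1) has_sum_add) (simp add: case_prod_unfold algebra_simps)

lemma dps_diff: "dps c X Y S \<Longrightarrow> dps d X Y T \<Longrightarrow> dps (\<lambda>a b. c a b - d a b) X Y (S - T)"
  unfolding dps_def by (drule (1) has_sum_diff) (simp add: case_prod_unfold algebra_simps)

lemma dps_cmult: "dps c X Y S \<Longrightarrow> dps (\<lambda>a b. k * c a b) X Y (k * S)"
  unfolding dps_def by (drule has_sum_cmult_right[of _ _ _ k]) (simp add: case_prod_unfold algebra_simps)

lemma dps_uminus: "dps c X Y S \<Longrightarrow> dps (\<lambda>a b. - c a b) X Y (- S)"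
  using dps_cmult[of c X Y S "-1"] by simp

lemma ups_add: "ups c X S \<Longrightarrow> ups d X T \<Longrightarrow> ups (\<lambda>a. c a + d a) X (S + T)"
  unfolding ups_def by (drule (1) has_sum_add) (simp add: algebra_simps)

lemma ups_diff: "ups c X S \<Longrightarrow> ups d X T \<Longrightarrow> ups (\<lambda>a. c a - d a) X (S - T)"
  unfolding ups_def by (drule (1) has_sum_diff) (simp add: algebra_simps)

lemma ups_cmult: "ups c X S \<Longrightarrow> ups (\<lambda>a. k * c a) X (k * S)"
  unfolding ups_def by (drule has_sum_cmult_right[of _ _ _ k]) (simp add: algebra_simps)

lemma finite_sum_pairs [simp]: "finite {(p, q). p + q = (a :: nat)}"
  by (rule finite_subset[of _ "{..a} \<times> {..a}"]) auto

lemma dps_mult_x: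
  assumes u: "ups u X f" and c: "dps c X Y g"
  shows "dps (\<lambda>a b. \<Sum>(p, q) | p + q = a. u p * c q b) X Y (f * g)"
proof -
  have "((\<lambda>(p, (q, b)). (u p * X ^ p) * (c q b * (X ^ q * Y ^ b))) has_sum (f * g)) UNIV"
    using has_sum_product[OF u[unfolded ups_def] c[unfolded dps_def]] by (simp add: case_prod_unfold)
  hence 0: "((\<lambda>z. \<Sum>i | (\<lambda>(p, (q, b)). (p + q, b)) i = z. (\<lambda>(p, (q, b)). (u p * X ^ p) * (c q b * (X ^ q * Y ^ b))) i) has_sum (f * g)) UNIV"
  proof (rule has_sum_regroup)
    fix z :: "nat \<times> nat"
    show "finite {i. (\<lambda>(p, (q, b)). (p + q, b)) i = z}"
      by (rule finite_subset[of _ "{..fst z} \<times> {..fst z} \<times> {snd z}"]) auto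
  qed
  have "(\<Sum>i | (\<lambda>(p, (q, b)). (p + q, b)) i = (a, b). (\<lambda>(p, (q, b)). (u p * X ^ p) * (c q b * (X ^ q * Y ^ b))) i)
      = (\<Sum>(p, q) | p + q = a. u p * c q b) * (X ^ a * Y ^ b)" for a b
  proof -
    have "(\<Sum>i | (\<lambda>(p, (q, b)). (p + q, b)) i = (a, b). (\<lambda>(p, (q, b)). (u p * X ^ p) * (c q b * (X ^ q * Y ^ b))) i)
       = (\<Sum>(p, q) | p + q = a. u p * c q b * (X ^ a * Y ^ b))"
      by (rule sum.reindex_bij_witness[where i = "\<lambda>(p, q). (p, (q, b))" and j = "\<lambda>(p, (q, b)). (p, q)"])
         (auto simp: power_add)
    thus ?thesis by (simp add: sum_distrib_right case_prod_unfold)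
  qed
  then have "(\<lambda>z. \<Sum>i | (\<lambda>(p, (q, b)). (p + q, b)) i = z. (\<lambda>(p, (q, b)). (u p * X ^ p) * (c q b * (X ^ q * Y ^ b))) i) = (\<lambda>(a, b). (\<Sum>(p, q) | p + q = a. u p * c q b) * (X ^ a * Y ^ b))"
    by (intro ext) (simp only: split_paired_all prod.case)
  with 0 show ?thesis unfolding dps_def by (simp only:)
qed

lemma has_sum_UNIV_swap:
  fixes f :: "nat \<times> nat \<Rightarrow> real"
  shows "((\<lambda>(i, j). f (j, i)) has_sum S) UNIV \<longleftrightarrow> (f has_sum S) UNIV"
proof -
  have "(f has_sum S) (range prod.swap) \<longleftrightarrow> ((f \<circ> prod.swap) has_sum S) UNIV"
    by (rule has_sum_reindex) auto
  moreover have "f \<circ> prod.swap = (\<lambda>(i, j). f (j, i))" by (auto simp: fun_eq_iff)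
  ultimately show ?thesis by (simp only: surj_swap)
qed

lemma dps_swap: "dps c X Y S \<longleftrightarrow> dps (\<lambda>a b. c b a) Y X S"
  unfolding dps_def by (subst has_sum_UNIV_swap[symmetric]) (simp add: mult.commute)

lemma dps_mult_y:
  assumes u: "ups u Y f" and c: "dps c X Y g"
  shows "dps (\<lambda>a b. \<Sum>(r, s) | r + s = b. u r * c a s) X Y (f * g)"
  using dps_mult_x[OF u dps_swap[THEN iffD1, OF c]] dps_swap by blast

lemma dps_mult:
  assumes c: "dps c X Y f" and d: "dps d X Y g"
  shows "dps (\<lambda>a b. \<Sum>(p, q, r, s) | p + q = a \<and> r + s = b. c p r * d q s) X Y (f * g)"
proof -
  let ?h = "\<lambda>((p, r), (q, s)). (c p r * (X ^ p * Y ^ r)) * (d q s * (X ^ q * Y ^ s))"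
  have "(?h has_sum (f * g)) UNIV"
    using has_sum_product[OF c[unfolded dps_def] d[unfolded dps_def]] by (simp add: case_prod_unfold)
  hence 0: "((\<lambda>z. \<Sum>i | (\<lambda>((p, r), (q, s)). (p + q, r + s)) i = z. ?h i) has_sum (f * g)) UNIV"
  proof (rule has_sum_regroup)
    fix z :: "nat \<times> nat"
    show "finite {i. (\<lambda>((p, r), (q, s)). (p + q, r + s)) i = z}"
      by (rule finite_subset[of _ "({..fst z} \<times> {..snd z}) \<times> ({..fst z} \<times> {..snd z})"]) auto
  qed
  have "(\<Sum>i | (\<lambda>((p, r), (q, s)). (p + q, r + s)) i = (a, b). ?h i)
      = (\<Sum>(p, q, r, s) | p + q = a \<and> r + s = b. c p r * d q s) * (X ^ a * Y ^ b)" for a b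
  proof -
    have "(\<Sum>i | (\<lambda>((p, r), (q, s)). (p + q, r + s)) i = (a, b). ?h i)
       = (\<Sum>(p, q, r, s) | p + q = a \<and> r + s = b. c p r * d q s * (X ^ a * Y ^ b))"
      by (rule sum.reindex_bij_witness[where i = "\<lambda>(p, q, r, s). ((p, r), (q, s))" and j = "\<lambda>((p, r), (q, s)). (p, q, r, s)"])
         (auto simp: power_add)
    thus ?thesis by (simp add: sum_distrib_right case_prod_unfold)
  qed
  then have "(\<lambda>z. \<Sum>i | (\<lambda>((p, r), (q, s)). (p + q, r + s)) i = z. ?h i) = (\<lambda>(a, b). (\<Sum>(p, q, r, s) | p + q = a \<and> r + s = b. c p r * d q s) * (X ^ a * Y ^ b))"
    by (intro ext) (simp only: split_paired_all prod.case)
  with 0 show ?thesis unfolding dps_def by (simp only:)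
qed

lemma ups_mult:
  assumes u: "ups u X f" and v: "ups v X g"
  shows "ups (\<lambda>a. \<Sum>(p, q) | p + q = a. u p * v q) X (f * g)"
proof -
  have "((\<lambda>(p, q). (u p * X ^ p) * (v q * X ^ q)) has_sum (f * g)) UNIV"
    using has_sum_product[OF u[unfolded ups_def] v[unfolded ups_def]] by simp
  hence "((\<lambda>z. \<Sum>i | (\<lambda>(p, q). p + q) i = z. (\<lambda>(p, q). (u p * X ^ p) * (v q * X ^ q)) i) has_sum (f * g)) UNIV"
  proof (rule has_sum_regroup)
    fix z :: nat
    show "finite {i. (\<lambda>(p, q). p + q) i = z}"
      by (rule finite_subset[of _ "{..z} \<times> {..z}"]) auto
  qed
  moreover have "(\<Sum>i | (\<lambda>(p, q). p + q) i = a. (\<lambda>(p, q). (u p * X ^ p) * (v q * X ^ q)) i)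
      = (\<Sum>(p, q) | p + q = a. u p * v q) * X ^ a" for a
  proof -
    have "(\<Sum>i | (\<lambda>(p, q). p + q) i = a. (\<lambda>(p, q). (u p * X ^ p) * (v q * X ^ q)) i)
       = (\<Sum>(p, q) | p + q = a. u p * v q * X ^ a)"
      by (rule sum.cong) (auto simp: power_add)
    thus ?thesis by (simp add: sum_distrib_right case_prod_unfold)
  qed
  ultimately show ?thesis unfolding ups_def by simp
qed

lemma dps_of_ups_x:
  assumes "ups u X f"
  shows "dps (\<lambda>a b. of_bool (b = 0) * u a) X Y f"
proof -
  have "inj_on (\<lambda>a::nat. (a, 0::nat)) UNIV" by (auto simp: inj_on_def)
  hence "((\<lambda>(a, b). u a * X ^ a) has_sum f) (range (\<lambda>a::nat. (a, 0::nat)))"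
    using assms[unfolded ups_def] by (subst has_sum_reindex) (auto simp: o_def)
  also have "?this \<longleftrightarrow> ?thesis" unfolding dps_def by (rule has_sum_cong_neutral) auto
  finally show ?thesis .
qed

lemma dps_of_ups_y: "ups u Y f \<Longrightarrow> dps (\<lambda>a b. of_bool (a = 0) * u b) X Y f"
  by (subst dps_swap) (rule dps_of_ups_x)

lemma dps_product:
  assumes "ups u X f" "ups v Y g"
  shows "dps (\<lambda>a b. u a * v b) X Y (f * g)"
  using has_sum_product[OF assms[unfolded ups_def]] by (simp add: dps_def mult_ac)

lemma ups_shift_up:
  assumes "ups u X f" "\<And>n. v (Suc n) = u n" "v 0 = 0"
  shows "ups v X (X * f)"
proof -
  have "((\<lambda>n. X * (u n * X ^ n)) has_sum X * f) UNIV"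
    using assms(1) unfolding ups_def by (rule has_sum_cmult_right)
  hence "((\<lambda>n. v n * X ^ n) has_sum X * f) (range Suc)"
    by (subst has_sum_reindex) (auto simp: o_def assms mult_ac)
  also have "?this \<longleftrightarrow> ups v X (X * f)" unfolding ups_def
  proof (rule has_sum_cong_neutral)
    fix n assume "n \<in> UNIV - range Suc"
    hence "n = 0" by (cases n) auto
    thus "v n * X ^ n = 0" by (simp add: assms(3))
  qed auto
  finally show ?thesis .
qed

lemma ups_shift_down:
  assumes "ups u X f" "X \<noteq> 0"
  shows "ups (\<lambda>n. u (Suc n)) X ((f - u 0) / X)"
proof -
  have "((\<lambda>n. u n * X ^ n) has_sum (f - u 0 * X ^ 0)) (UNIV - {0})"
    by (rule has_sum_Diff[OF assms(1)[unfolded ups_def]]) (auto simp: has_sum_finite_iff)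
  also have "UNIV - {0} = range Suc" by (auto simp: image_iff dest: not0_implies_Suc)
  finally have "((\<lambda>n. u (Suc n) * X ^ Suc n) has_sum (f - u 0)) UNIV"
    by (subst (asm) has_sum_reindex) (auto simp: o_def)
  hence "((\<lambda>n. u (Suc n) * X ^ Suc n / X) has_sum (f - u 0) / X) UNIV"
    by (rule has_sum_divide_const)
  thus ?thesis using assms(2) by (simp add: ups_def)
qed

text \<open>An index condition of the form p + q + 1 = a amounts to a factor X, as the sum is empty
  at a = 0.\<close>

lemma dps_shift_up_x:
  assumes "dps c X Y f" "\<And>a b. d (Suc a) b = c a b" "\<And>b. d 0 b = 0"
  shows "dps d X Y (X * f)"
proof -
  have "((\<lambda>z. X * (\<lambda>(a, b). c a b * (X ^ a * Y ^ b)) z) has_sum X * f) UNIV"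
    using assms(1) unfolding dps_def by (rule has_sum_cmult_right)
  hence "((\<lambda>(a, b). d a b * (X ^ a * Y ^ b)) has_sum X * f) (range (\<lambda>(a, b). (Suc a, b)))"
    by (subst has_sum_reindex) (auto simp: o_def assms mult_ac case_prod_unfold inj_on_def prod_eq_iff)
  also have "?this \<longleftrightarrow> dps d X Y (X * f)" unfolding dps_def
  proof (rule has_sum_cong_neutral)
    fix z :: "nat \<times> nat" assume z: "z \<in> UNIV - range (\<lambda>(a, b). (Suc a, b))"
    obtain a b where ab: "z = (a, b)" by force
    have "a = 0" using z unfolding ab by (cases a) (auto simp: image_iff)
    thus "(case z of (a, b) \<Rightarrow> d a b * (X ^ a * Y ^ b)) = 0" by (simp add: ab assms(3))
  qed auto
  finally show ?thesis .
qed

lemma dps_shift_up_y: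
  assumes "dps c X Y f" "\<And>a b. d a (Suc b) = c a b" "\<And>a. d a 0 = 0"
  shows "dps d X Y (Y * f)"
  by (subst dps_swap, rule dps_shift_up_x[OF dps_swap[THEN iffD1, OF assms(1)]]) (auto simp: assms)

text \<open>An index condition of the form r + s = b + 1 amounts to a division by Y, once the
  coefficients at b = 0 have been subtracted; their generating function g must therefore be
  known.\<close>

lemma dps_shift_down_y:
  assumes c: "dps c X Y f" and r: "ups (\<lambda>a. c a 0) X g" and Y: "Y \<noteq> 0"
  shows "dps (\<lambda>a b. c a (Suc b)) X Y ((f - g) / Y)"
proof -
  have "dps (\<lambda>a b. c a b - of_bool (b = 0) * c a 0) X Y (f - g)"
    by (rule dps_diff[OF c dps_of_ups_x[OF r]])
  hence "((\<lambda>(a, b). c a b * (X ^ a * Y ^ b)) has_sum (f - g)) (range (\<lambda>(a, b). (a, Suc b)))"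
    unfolding dps_def
  proof (rule has_sum_cong_neutral[THEN iffD1, rotated -1])
    fix z :: "nat \<times> nat" assume z: "z \<in> UNIV - range (\<lambda>(a, b). (a, Suc b))"
    obtain a b where ab: "z = (a, b)" by force
    have "b = 0" using z unfolding ab by (cases b) (auto simp: image_iff)
    thus "(case z of (a, b) \<Rightarrow> (c a b - of_bool (b = 0) * c a 0) * (X ^ a * Y ^ b)) = 0" by (simp add: ab)
  qed auto
  hence "((\<lambda>(a, b). c a (Suc b) * (X ^ a * Y ^ Suc b)) has_sum (f - g)) UNIV"
    by (subst (asm) has_sum_reindex) (auto simp: o_def case_prod_unfold inj_on_def prod_eq_iff)
  hence "((\<lambda>z. (\<lambda>(a, b). c a (Suc b) * (X ^ a * Y ^ Suc b)) z / Y) has_sum (f - g) / Y) UNIV"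
    by (rule has_sum_divide_const)
  thus ?thesis using Y by (simp add: dps_def case_prod_unfold)
qed

text \<open>The converse of \<open>has_sum_regroup\<close>. Cancellation inside the groups has to be
  excluded, hence the hypothesis on the grouped absolute values.\<close>

lemma has_sum_ungroup:
  fixes h :: "'i \<Rightarrow> real" and \<phi> :: "'i \<Rightarrow> 'j"
  assumes g: "((\<lambda>j. \<Sum>i | \<phi> i = j. h i) has_sum S) UNIV" and fin: "\<And>j. finite {i. \<phi> i = j}"
    and n: "(\<lambda>j. \<Sum>i | \<phi> i = j. \<bar>h i\<bar>) summable_on UNIV"
  shows "(h has_sum S) UNIV"
proof -
  have inj: "inj_on (\<lambda>i. (\<phi> i, i)) UNIV" by (auto simp: inj_on_def)
  have img: "range (\<lambda>i. (\<phi> i, i)) = (SIGMA j:UNIV. {i. \<phi> i = j})" by auto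
  have "(\<lambda>(j, i). \<bar>h i\<bar>) summable_on (SIGMA j:UNIV. {i. \<phi> i = j})"
  proof (rule summable_on_SigmaI[OF _ n])
    fix j show "((\<lambda>i. case (j, i) of (j, i) \<Rightarrow> \<bar>h i\<bar>) has_sum (\<Sum>i | \<phi> i = j. \<bar>h i\<bar>)) {i. \<phi> i = j}"
      unfolding prod.case by (rule has_sum_finite[OF fin])
  qed auto
  moreover have "(\<lambda>(j :: 'j, i). \<bar>h i\<bar>) = (\<lambda>z. norm (case z of (j, i) \<Rightarrow> h i))"
    by (auto simp: fun_eq_iff)
  ultimately have "(\<lambda>z. norm (case z of (j, i) \<Rightarrow> h i)) summable_on (SIGMA j:UNIV. {i. \<phi> i = j})" by (simp only:)
  hence s: "(\<lambda>(j, i). h i) summable_on (SIGMA j:UNIV. {i. \<phi> i = j})" by (rule abs_summable_summable)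
  have "((\<lambda>(j, i). h i) has_sum S) (SIGMA j:UNIV. {i. \<phi> i = j})"
  proof (rule has_sum_SigmaI[OF _ g s])
    fix j show "((\<lambda>i. case (j, i) of (j, i) \<Rightarrow> h i) has_sum (\<Sum>i | \<phi> i = j. h i)) {i. \<phi> i = j}"
      unfolding prod.case by (rule has_sum_finite[OF fin])
  qed
  thus ?thesis unfolding img[symmetric] by (subst (asm) has_sum_reindex[OF inj]) (simp add: o_def)
qed

lemma finite_fibre_sum: "finite {i. (\<lambda>(a, b). a + b) i = (n :: nat)}"
  by (rule finite_subset[of _ "{..n} \<times> {..n}"]) auto

lemma fibre_sum_eq:
  "(\<Sum>i | (\<lambda>(a, b). a + b) i = n. (\<lambda>(a, b). F a b) i) = (\<Sum>b\<le>n. F (n - b) b)" for F :: "nat \<Rightarrow> nat \<Rightarrow> real"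
  by (rule sum.reindex_bij_witness[where i = "\<lambda>b. (n - b, b)" and j = snd]) auto

text \<open>Expansion of f(X + Y) by the binomial theorem. Ungrouping it requires absolute
  convergence at |X| + |Y|.\<close>

lemma dps_binomial:
  assumes c: "ups c (X + Y) f" and n: "(\<lambda>n. \<bar>c n\<bar> * (\<bar>X\<bar> + \<bar>Y\<bar>) ^ n) summable_on UNIV"
  shows "dps (\<lambda>i j. real ((i + j) choose j) * c (i + j)) X Y f"
proof -
  let ?h = "\<lambda>(i, j). real ((i + j) choose j) * c (i + j) * (X ^ i * Y ^ j)"
  have bin: "(\<Sum>b\<le>n. real (n choose b) * (U ^ (n - b) * V ^ b)) = (U + V) ^ n" for U V :: real and n
    by (subst add.commute, subst binomial_ring) (simp add: mult_ac)
  have sum: "(\<Sum>i | (\<lambda>(a, b). a + b) i = n. (\<lambda>(i, j). real ((i + j) choose j) * d (i + j) * (U ^ i * V ^ j)) i) = d n * (U + V) ^ n" for n d U V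
    unfolding fibre_sum_eq bin[symmetric] sum_distrib_left by (intro sum.cong) auto
  have a: "\<bar>?h i\<bar> = (\<lambda>(i, j). real ((i + j) choose j) * \<bar>c (i + j)\<bar> * (\<bar>X\<bar> ^ i * \<bar>Y\<bar> ^ j)) i" for i
    by (cases i) (simp add: abs_mult power_abs)
  have "(?h has_sum f) UNIV"
  proof (rule has_sum_ungroup[where \<phi> = "\<lambda>(a, b). a + b"])
    show "((\<lambda>n. \<Sum>i | (\<lambda>(a, b). a + b) i = n. ?h i) has_sum f) UNIV"
      unfolding sum using c by (simp add: ups_def)
    show "(\<lambda>n. \<Sum>i | (\<lambda>(a, b). a + b) i = n. \<bar>?h i\<bar>) summable_on UNIV"
      unfolding a sum[where d = "\<lambda>n. \<bar>c n\<bar>"] by (rule n)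
  qed (rule finite_fibre_sum)
  thus ?thesis by (simp add: dps_def)
qed

text \<open>Coefficients that depend on a + b only: (X^(n+1) - Y^(n+1))/(X - Y) is the sum of all
  monomials of degree n. The constant terms of f and g cancel, which explains the successor.\<close>

lemma dps_diagonal:
  assumes u: "ups u X f" and v: "ups u Y g" and XY: "0 < Y" "Y < X"
  shows "dps (\<lambda>a b. u (Suc (a + b))) X Y ((f - g) / (X - Y))"
proof -
  let ?h = "\<lambda>(a, b). u (Suc (a + b)) * (X ^ a * Y ^ b)"
  have fib: "(\<Sum>b\<le>n. X ^ (n - b) * Y ^ b) = (X ^ Suc n - Y ^ Suc n) / (X - Y)" for n
  proof -
    have "(\<Sum>p<Suc n. X ^ (n - p) * Y ^ p) * (X - Y) = X ^ Suc n - Y ^ Suc n"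
      using power_diff_sumr2[of Y "Suc n" X] by (simp add: algebra_simps)
    thus ?thesis using XY by (simp add: lessThan_Suc_atMost field_simps)
  qed
  have sum: "(\<Sum>i | (\<lambda>(a, b). a + b) i = n. (\<lambda>(a, b). w (Suc (a + b)) * (X ^ a * Y ^ b)) i) =
      (w (Suc n) * X ^ Suc n - w (Suc n) * Y ^ Suc n) / (X - Y)" for n and w :: "nat \<Rightarrow> real"
  proof -
    have "(\<Sum>i | (\<lambda>(a, b). a + b) i = n. (\<lambda>(a, b). w (Suc (a + b)) * (X ^ a * Y ^ b)) i) = w (Suc n) * (\<Sum>b\<le>n. X ^ (n - b) * Y ^ b)"
      unfolding fibre_sum_eq sum_distrib_left by (intro sum.cong) auto
    thus ?thesis unfolding fib by (simp add: right_diff_distrib)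
  qed
  have tail: "((\<lambda>n. w (Suc n) * Z ^ Suc n) has_sum (F - w 0)) UNIV" if "ups w Z F" for w :: "nat \<Rightarrow> real" and Z F
  proof -
    have "((\<lambda>n. w n * Z ^ n) has_sum (F - w 0 * Z ^ 0)) (UNIV - {0})"
      by (rule has_sum_Diff[OF that[unfolded ups_def]]) (auto simp: has_sum_finite_iff)
    also have "UNIV - {0} = range Suc" by (auto simp: image_iff dest: not0_implies_Suc)
    finally show ?thesis by (subst (asm) has_sum_reindex) (auto simp: o_def)
  qed
  have ab: "\<exists>F. ups (\<lambda>n. \<bar>u n\<bar>) Z F" if "ups u Z G" "Z > 0" for Z G
  proof -
    have "(\<lambda>n. norm (u n * Z ^ n)) summable_on UNIV"
      by (rule summable_on_iff_abs_summable_on_real[THEN iffD1, OF has_sum_imp_summable[OF that(1)[unfolded ups_def]]])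
    thus ?thesis using that(2) by (auto simp: ups_def abs_mult summable_on_def)
  qed
  obtain F1 F2 where F: "ups (\<lambda>n. \<bar>u n\<bar>) X F1" "ups (\<lambda>n. \<bar>u n\<bar>) Y F2" using ab[OF u] ab[OF v] XY by auto
  have a: "\<bar>?h i\<bar> = (\<lambda>(a, b). \<bar>u (Suc (a + b))\<bar> * (X ^ a * Y ^ b)) i" for i
    using XY by (cases i) (simp add: abs_mult power_abs)
  have "(?h has_sum ((f - u 0) - (g - u 0)) / (X - Y)) UNIV"
  proof (rule has_sum_ungroup[where \<phi> = "\<lambda>(a, b). a + b"])
    show "((\<lambda>n. \<Sum>i | (\<lambda>(a, b). a + b) i = n. ?h i) has_sum ((f - u 0) - (g - u 0)) / (X - Y)) UNIV"
      unfolding sum by (intro has_sum_divide_const has_sum_diff tail u v)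
    show "(\<lambda>n. \<Sum>i | (\<lambda>(a, b). a + b) i = n. \<bar>?h i\<bar>) summable_on UNIV"
      unfolding a sum[where w = "\<lambda>n. \<bar>u n\<bar>"]
      by (rule has_sum_imp_summable[OF has_sum_divide_const[OF has_sum_diff[OF tail[OF F(1)] tail[OF F(2)]]]])
  qed (rule finite_fibre_sum)
  thus ?thesis by (simp add: dps_def)
qed

text \<open>Averaging over the sign changes of x and y selects the exponents of parity e in x and d
  in y. For even exponents the point may lie on an axis; this is used at y = 0 for the Euler
  numbers.\<close>

lemma dps_extract:
  fixes c :: "nat \<Rightarrow> nat \<Rightarrow> real" and e d :: nat
  assumes c: "dps c x y s1" "dps c x (- y) s2" "dps c (- x) y s3" "dps c (- x) (- y) s4"
    and nz: "x \<noteq> 0 \<or> e = 0" "y \<noteq> 0 \<or> d = 0" and ed: "e \<le> 1" "d \<le> 1"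
  shows "dps (\<lambda>a b. c (2 * a + e) (2 * b + d)) (x ^ 2) (y ^ 2)
    ((s1 + (- 1) ^ d * s2 + (- 1) ^ e * s3 + (- 1) ^ e * (- 1) ^ d * s4) / (4 * x ^ e * y ^ d))"
proof -
  have nz': "x ^ e \<noteq> 0" "y ^ d \<noteq> 0" using nz by auto
  let ?T = "s1 + (- 1) ^ d * s2 + (- 1) ^ e * s3 + (- 1) ^ e * (- 1) ^ d * s4"
  let ?f = "\<lambda>X Y (i, j). c i j * (X ^ i * Y ^ j)"
  have "((\<lambda>z. ?f x y z + (- 1) ^ d * ?f x (- y) z + (- 1) ^ e * ?f (- x) y z + (- 1) ^ e * (- 1) ^ d * ?f (- x) (- y) z) has_sum ?T) UNIV"
    using c unfolding dps_def by (intro has_sum_add has_sum_cmult_right)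
  moreover have "?f x y z + (- 1) ^ d * ?f x (- y) z + (- 1) ^ e * ?f (- x) y z + (- 1) ^ e * (- 1) ^ d * ?f (- x) (- y) z
     = (if even (fst z + e) \<and> even (snd z + d) then 4 * ?f x y z else 0)" for z
  proof -
    obtain i j where z: "z = (i, j)" by force
    have p: "(- x) ^ i = (- 1) ^ i * x ^ i" "(- y) ^ j = (- 1) ^ j * y ^ j" by (metis power_minus)+
    have "?f x y z + (- 1) ^ d * ?f x (- y) z + (- 1) ^ e * ?f (- x) y z + (- 1) ^ e * (- 1) ^ d * ?f (- x) (- y) z
      = (1 + (- 1) ^ (i + e)) * (1 + (- 1) ^ (j + d)) * ?f x y z"
      unfolding z prod.case p power_add by (simp add: algebra_simps)
    have gen: "(1 + (if P then 1 else - 1)) * (1 + (if Q then 1 else - 1)) * r = (if P \<and> Q then 4 * r else 0)"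
      for P Q and r :: real by simp
    note \<open>?f x y z + (- 1) ^ d * ?f x (- y) z + (- 1) ^ e * ?f (- x) y z + (- 1) ^ e * (- 1) ^ d * ?f (- x) (- y) z
      = (1 + (- 1) ^ (i + e)) * (1 + (- 1) ^ (j + d)) * ?f x y z\<close>
    also have "(1 + (- 1) ^ (i + e)) * (1 + (- 1) ^ (j + d)) * ?f x y z = (if even (fst z + e) \<and> even (snd z + d) then 4 * ?f x y z else 0)"
      unfolding z fst_conv snd_conv minus_one_power_iff
      by (rule gen)
    finally show ?thesis .
  qed
  ultimately have "((\<lambda>z. if even (fst z + e) \<and> even (snd z + d) then 4 * ?f x y z else 0) has_sum ?T) UNIV" by (simp only:)
  also have "?this \<longleftrightarrow> ((\<lambda>z. 4 * ?f x y z) has_sum ?T) (range (\<lambda>(a, b). (2 * a + e, 2 * b + d)))"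
  proof (rule has_sum_cong_neutral)
    fix z :: "nat \<times> nat" assume z: "z \<in> UNIV - range (\<lambda>(a, b). (2 * a + e, 2 * b + d))"
    obtain i j where ij: "z = (i, j)" by force
    have dec: "\<exists>a. i = 2 * a + e" if "even (i + e)" "e \<le> 1" for i e :: nat
      using that by presburger
    have "\<not> (even (i + e) \<and> even (j + d))"
    proof
      assume "even (i + e) \<and> even (j + d)"
      then obtain a b where "i = 2 * a + e" "j = 2 * b + d" using dec ed by metis
      hence "z = (\<lambda>(a, b). (2 * a + e, 2 * b + d)) (a, b)" by (simp add: ij)
      thus False using z by blast
    qed
    thus "(if even (fst z + e) \<and> even (snd z + d) then 4 * ?f x y z else 0) = 0" unfolding ij fst_conv snd_conv by (rule if_not_P)
  qed auto
  also have "\<dots> \<longleftrightarrow> ((\<lambda>(a, b). 4 * (c (2 * a + e) (2 * b + d) * (x ^ (2 * a + e) * y ^ (2 * b + d)))) has_sum ?T) UNIV"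
    by (subst has_sum_reindex) (auto simp: inj_on_def o_def case_prod_unfold prod_eq_iff)
  finally have "((\<lambda>z. (\<lambda>(a, b). 4 * (c (2 * a + e) (2 * b + d) * (x ^ (2 * a + e) * y ^ (2 * b + d)))) z / (4 * x ^ e * y ^ d)) has_sum ?T / (4 * x ^ e * y ^ d)) UNIV"
    by (rule has_sum_divide_const)
  moreover have "(\<lambda>(a, b). 4 * (c (2 * a + e) (2 * b + d) * (x ^ (2 * a + e) * y ^ (2 * b + d)))) z / (4 * x ^ e * y ^ d)
     = (\<lambda>(a, b). c (2 * a + e) (2 * b + d) * ((x ^ 2) ^ a * (y ^ 2) ^ b)) z" for z :: "nat \<times> nat"
  proof -
    obtain a b where z: "z = (a, b)" by force
    have can: "4 * (C * ((p * P) * (r * R))) / (4 * P * R) = C * (p * r)" if "P \<noteq> 0" "R \<noteq> 0" for C p r P R :: real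
      using that by simp
    show ?thesis unfolding z prod.case power_add power_mult by (rule can[OF nz'])
  qed
  ultimately show ?thesis unfolding dps_def by (simp only:)
qed

lemma sum_triple:
  fixes F :: "nat \<Rightarrow> nat \<Rightarrow> nat \<Rightarrow> real"
  shows "(\<Sum>(u, t) | u + t = n. \<Sum>(v, w) | v + w = t. F u v w) = (\<Sum>(u, v, w) | u + v + w = n. F u v w)"
proof -
  have "(\<Sum>(u, t) | u + t = n. \<Sum>(v, w) | v + w = t. F u v w) =
      (\<Sum>z | fst z + snd z = n. \<Sum>(v, w) | v + w = snd z. F (fst z) v w)"
    by (simp add: case_prod_unfold)
  also have "\<dots> = (\<Sum>(z, y)\<in>(SIGMA z:{z. fst z + snd z = n}. {(v, w). v + w = snd z}). (\<lambda>(v, w). F (fst z) v w) y)"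
  proof (rule sum.Sigma)
    show "finite {z. fst z + snd z = n}" by (rule finite_subset[of _ "{..n} \<times> {..n}"]) auto
  qed auto
  also have "\<dots> = (\<Sum>(u, v, w) | u + v + w = n. F u v w)"
    by (rule sum.reindex_bij_witness[where i = "\<lambda>(u, v, w). ((u, v + w), (v, w))" and j = "\<lambda>((u, t), (v, w)). (u, v, w)"]) auto
  finally show ?thesis .
qed

section \<open>Zeta values as coefficients\<close>

text \<open>Fubini with a majorant of product form: coefficients that are themselves infinite sums
  over k are exchanged with the power series in i.\<close>

lemma has_sum_interchange:
  fixes u :: "'i \<Rightarrow> 'k \<Rightarrow> real"
  assumes bnd: "\<And>i k. k \<in> K \<Longrightarrow> \<bar>u i k\<bar> \<le> w k" and w: "w summable_on K" and p: "(\<lambda>i. \<bar>p i\<bar>) summable_on UNIV"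
    and F: "\<And>k. k \<in> K \<Longrightarrow> ((\<lambda>i. u i k * p i) has_sum F k) UNIV"
  shows "((\<lambda>i. infsum (u i) K * p i) has_sum infsum F K) UNIV" "F summable_on K"
proof -
  obtain W P where W: "(w has_sum W) K" and P: "((\<lambda>i. \<bar>p i\<bar>) has_sum P) UNIV"
    using w p by (auto simp: summable_on_def)
  have "(\<lambda>(k, i). w k * \<bar>p i\<bar>) summable_on K \<times> UNIV"
    by (rule has_sum_imp_summable[OF has_sum_product[OF W P]])
  hence "(\<lambda>z. (\<lambda>(k, i). u i k * p i) z) summable_on K \<times> UNIV"
  proof (rule abs_summable_summable[OF summable_on_comparison_test])
    fix z assume "z \<in> K \<times> (UNIV :: 'i set)"
    then obtain k i where z: "z = (k, i)" "k \<in> K" by auto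
    show "norm ((\<lambda>(k, i). u i k * p i) z) \<le> (\<lambda>(k, i). w k * \<bar>p i\<bar>) z"
      unfolding z prod.case real_norm_def abs_mult by (intro mult_right_mono bnd z abs_ge_zero)
  qed auto
  then obtain S where S: "((\<lambda>(k, i). u i k * p i) has_sum S) (K \<times> UNIV)" by (auto simp: summable_on_def)
  have 1: "(F has_sum S) K"
    by (rule has_sum_SigmaD[OF S]) (simp add: F)
  have u: "(u i has_sum infsum (u i) K) K" for i
  proof (rule has_sum_infsum, rule abs_summable_summable, rule summable_on_comparison_test[OF w])
    show "norm (u i k) \<le> w k" if "k \<in> K" for k using bnd[OF that] by simp
  qed auto
  have "((\<lambda>(i, k). u i k * p i) has_sum S) (UNIV \<times> K)"
  proof -
    have inj: "inj_on prod.swap (UNIV \<times> K)" by (auto simp: inj_on_def)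
    have img: "prod.swap ` (UNIV \<times> K) = K \<times> UNIV" by (auto simp: image_iff)
    show ?thesis using S unfolding img[symmetric] by (subst (asm) has_sum_reindex[OF inj]) (simp add: o_def case_prod_unfold)
  qed
  hence "((\<lambda>i. infsum (u i) K * p i) has_sum S) UNIV"
    by (rule has_sum_SigmaD) (simp, intro has_sum_cmult_left u)
  moreover have "S = infsum F K" using infsumI[OF 1] by simp
  ultimately show "((\<lambda>i. infsum (u i) K * p i) has_sum infsum F K) UNIV" by simp
  show "F summable_on K" using 1 by (rule has_sum_imp_summable)
qed

lemma abs_geometric_summable: "\<bar>X\<bar> < 1 \<Longrightarrow> (\<lambda>i. \<bar>X ^ i :: real\<bar>) summable_on UNIV"
proof -
  assume X: "\<bar>X\<bar> < 1"
  have "summable (\<lambda>i. \<bar>X\<bar> ^ i)" by (rule summable_geometric) (use X in simp)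
  hence "(\<lambda>i. \<bar>X\<bar> ^ i) summable_on UNIV" by (subst summable_on_UNIV_nonneg_real_iff) auto
  thus ?thesis by (simp add: power_abs)
qed

lemma abs_geometric_pair_summable:
  assumes "\<bar>X\<bar> < 1" "\<bar>Y\<bar> < (1 :: real)"
  shows "(\<lambda>z :: nat \<times> nat. \<bar>(\<lambda>(i, j). X ^ i * Y ^ j) z\<bar>) summable_on UNIV"
proof -
  obtain A B where "((\<lambda>i. \<bar>X ^ i\<bar>) has_sum A) UNIV" "((\<lambda>i. \<bar>Y ^ i\<bar>) has_sum B) UNIV"
    using abs_geometric_summable[OF assms(1)] abs_geometric_summable[OF assms(2)] by (auto simp: summable_on_def)
  from has_sum_imp_summable[OF has_sum_product[OF this]] show ?thesis
    by (simp add: case_prod_unfold abs_mult)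
qed

lemma geometric_has_sum:
  fixes z :: real
  assumes "\<bar>z\<bar> < 1"
  shows "((\<lambda>i. z ^ i) has_sum 1 / (1 - z)) UNIV"
proof -
  have "(\<lambda>i. z ^ i) summable_on UNIV" by (rule abs_summable_summable) (use abs_geometric_summable[OF assms] in simp)
  moreover have "(\<lambda>i. z ^ i) sums (1 / (1 - z))" by (rule geometric_sums) (use assms in simp)
  ultimately show ?thesis by (metis has_sum_imp_sums has_sum_infsum sums_unique2)
qed

lemma ups_interchange:
  assumes bnd: "\<And>i k. k \<ge> 1 \<Longrightarrow> \<bar>u i k\<bar> \<le> 1 / real k ^ 2" and X: "\<bar>X\<bar> < 1"
    and F: "\<And>k. k \<ge> 1 \<Longrightarrow> ups (\<lambda>i. u i k) X (F k)" and S: "(F has_sum S) {1..}"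
  shows "ups (\<lambda>i. infsum (u i) {1..}) X S"
  unfolding ups_def infsumI[OF S, symmetric]
  by (rule has_sum_interchange(1)[where w = "\<lambda>k. 1 / real k ^ 2"])
     (use assms inverse_square_summable abs_geometric_summable in \<open>auto simp: ups_def\<close>)

lemma dps_interchange:
  assumes u: "\<And>i k. k \<ge> 1 \<Longrightarrow> \<bar>u i k\<bar> \<le> 1 / real k ^ 2" and X: "\<bar>X\<bar> < 1"
    and F: "\<And>k. k \<ge> 1 \<Longrightarrow> ups (\<lambda>i. u i k) X (F k)"
    and v: "\<And>i k. k \<ge> 1 \<Longrightarrow> \<bar>v i k\<bar> \<le> 1 / real k ^ 2" and Y: "\<bar>Y\<bar> < 1"
    and G: "\<And>k. k \<ge> 1 \<Longrightarrow> ups (\<lambda>i. v i k) Y (G k)"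
  shows "dps (\<lambda>i j. dsum (u i) (v j)) X Y (dsum F G)"
proof -
  obtain Z where Z: "((\<lambda>m. 1 / real m ^ 2) has_sum Z) {1..}" using zeta_2_has_sum by blast
  have "((\<lambda>z. infsum ((\<lambda>(i, j) (m, n). u i m * v j n) z) lt_pairs * (\<lambda>(i, j). X ^ i * Y ^ j) z) has_sum
     infsum (\<lambda>(m, n). F m * G n) lt_pairs) UNIV"
  proof (rule has_sum_interchange(1)[where w = "\<lambda>(m, n). 1 / real m ^ 2 * (1 / real n ^ 2)"])
    show "(\<lambda>(m, n). 1 / real m ^ 2 * (1 / real n ^ 2)) summable_on lt_pairs"
      by (rule has_sum_imp_summable[OF dsum_has_sum[OF Z Z]])
    show "(\<lambda>z :: nat \<times> nat. \<bar>(\<lambda>(i, j). X ^ i * Y ^ j) z\<bar>) summable_on UNIV"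
      by (rule abs_geometric_pair_summable[OF X Y])
    fix k assume "k \<in> lt_pairs"
    then obtain m n where k: "k = (m, n)" "m \<ge> 1" "n \<ge> 1" by (auto simp: lt_pairs_def)
    show "\<bar>(\<lambda>(i, j) (m, n). u i m * v j n) z k\<bar> \<le> (\<lambda>(m, n). 1 / real m ^ 2 * (1 / real n ^ 2)) k" for z
      unfolding k(1) by (cases z) (simp only: prod.case abs_mult, intro mult_mono u v k, auto)
    have "((\<lambda>(i, j). (u i m * X ^ i) * (v j n * Y ^ j)) has_sum F m * G n) (UNIV \<times> UNIV)"
      by (rule has_sum_product) (use F[OF k(2)] G[OF k(3)] in \<open>auto simp: ups_def\<close>)
    thus "((\<lambda>z. (\<lambda>(i, j) (m, n). u i m * v j n) z k * (\<lambda>(i, j). X ^ i * Y ^ j) z) has_sum (\<lambda>(m, n). F m * G n) k) UNIV"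
      unfolding k(1) by (simp add: case_prod_unfold mult_ac)
  qed
  thus ?thesis unfolding dps_def dsum_def by (simp add: case_prod_unfold)
qed

lemma mzv_1_eq: "mzv [k] = infsum (\<lambda>n. 1 / real n ^ k) {1..}"
proof -
  have "mzv [k] = infsum (\<lambda>ns. 1 / real (hd ns) ^ k) ((\<lambda>n. [n]) ` {1..})"
    unfolding mzv_def
  proof (rule infsum_cong_neutral)
    fix ns :: "nat list" assume "ns \<in> {ns. length ns = length [k] \<and> sorted_wrt (<) ns \<and> (\<forall>n\<in>set ns. 0 < n)} - (\<lambda>n. [n]) ` {1..}"
    then obtain n where "ns = [n]" by (cases ns) auto
    with \<open>ns \<in> _\<close> show "(\<Prod>i<length [k]. 1 / real (ns ! i) ^ ([k] ! i)) = 0" by auto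
  qed auto
  also have "\<dots> = infsum (\<lambda>n. 1 / real n ^ k) {1..}"
    by (subst infsum_reindex) (auto simp: inj_on_def o_def)
  finally show ?thesis .
qed

lemma mzv_2_eq: "mzv [k, l] = dsum (\<lambda>m. 1 / real m ^ k) (\<lambda>n. 1 / real n ^ l)"
proof -
  have "mzv [k, l] = infsum (\<lambda>ns. 1 / real (ns ! 0) ^ k * (1 / real (ns ! 1) ^ l)) ((\<lambda>(m, n). [m, n]) ` lt_pairs)"
    unfolding mzv_def
  proof (rule infsum_cong_neutral)
    fix ns :: "nat list" assume ns: "ns \<in> {ns. length ns = length [k, l] \<and> sorted_wrt (<) ns \<and> (\<forall>n\<in>set ns. 0 < n)} - (\<lambda>(m, n). [m, n]) ` lt_pairs"
    then obtain m n where mn: "ns = [m, n]" by (cases ns; cases "tl ns") auto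
    with ns have "(m, n) \<in> lt_pairs" by (auto simp: lt_pairs_def)
    with ns mn show "(\<Prod>i<length [k, l]. 1 / real (ns ! i) ^ ([k, l] ! i)) = 0" by auto
  next
    fix ns :: "nat list" assume "ns \<in> {ns. length ns = length [k, l] \<and> sorted_wrt (<) ns \<and> (\<forall>n\<in>set ns. 0 < n)} \<inter> (\<lambda>(m, n). [m, n]) ` lt_pairs"
    show "(\<Prod>i<length [k, l]. 1 / real (ns ! i) ^ ([k, l] ! i)) = 1 / real (ns ! 0) ^ k * (1 / real (ns ! 1) ^ l)"
      by (simp add: lessThan_Suc numeral_2_eq_2)
  qed (auto simp: lt_pairs_def)
  also have "\<dots> = infsum (\<lambda>(m, n). 1 / real m ^ k * (1 / real n ^ l)) lt_pairs"
    by (subst infsum_reindex) (auto simp: inj_on_def o_def case_prod_unfold)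
  finally show ?thesis by (simp add: dsum_def)
qed

lemma zt_has_sum:
  assumes "n \<ge> 2"
  shows "((\<lambda>k. 1 / real k ^ n) has_sum zt n) {1..}"
proof -
  have "(\<lambda>k. 1 / real k ^ n) summable_on {1..}"
  proof (rule summable_on_comparison_test[OF inverse_square_summable[of "{1..}"]])
    fix k :: nat assume "k \<in> {1..}"
    thus "1 / real k ^ n \<le> 1 / real k ^ 2" using assms by (intro divide_left_mono power_increasing) auto
  qed auto
  thus ?thesis using assms by (simp add: zt_def mzv_1_eq)
qed

lemma ztbar_eq:
  assumes "n \<ge> 2"
  shows "ztbar n = infsum (\<lambda>k. (- 1) ^ k / real k ^ n) {1..}"
proof -
  have "((\<lambda>k. 1 / real k ^ n) has_sum zt n) {1..}" by (rule zt_has_sum[OF assms])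
  hence "((\<lambda>k. 2 / 2 ^ n * (1 / real k ^ n)) has_sum 2 / 2 ^ n * zt n) {1..}" by (rule has_sum_cmult_right)
  hence "((\<lambda>k. 2 / real k ^ n) has_sum 2 / 2 ^ n * zt n) ((\<lambda>k. 2 * k) ` {1..})"
    by (subst has_sum_reindex) (auto simp: inj_on_def o_def power_mult_distrib)
  also have "?this \<longleftrightarrow> ((\<lambda>k. if even k then 2 / real k ^ n else 0) has_sum 2 / 2 ^ n * zt n) {1..}"
  proof (rule has_sum_cong_neutral)
    fix k assume "k \<in> {1..} - (\<lambda>k. 2 * k) ` {1 :: nat..}"
    hence "odd k" by (auto simp: image_iff elim!: evenE)
    thus "(if even k then 2 / real k ^ n else 0) = 0" by simp
  qed auto
  finally have "((\<lambda>k. (if even k then 2 / real k ^ n else 0) - 1 / real k ^ n) has_sum 2 / 2 ^ n * zt n - zt n) {1..}"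
    by (intro has_sum_diff zt_has_sum assms)
  moreover have "(\<lambda>k. (if even k then 2 / real k ^ n else 0) - 1 / real k ^ n) = (\<lambda>k. (- 1) ^ k / real k ^ n)"
    by (auto simp: fun_eq_iff diff_divide_distrib[symmetric])
  moreover have "2 powi (1 - int n) = (2 / 2 ^ n :: real)"
    by (simp add: power_int_diff)
  ultimately have "((\<lambda>k. (- 1) ^ k / real k ^ n) has_sum ztbar n) {1..}"
    by (simp add: ztbar_def algebra_simps)
  thus ?thesis by (simp add: infsumI)
qed

lemma inverse_power_le: "k \<ge> 1 \<Longrightarrow> 1 / real k ^ (n + 2) \<le> 1 / real k ^ 2"
  by (intro divide_left_mono power_increasing) auto

text \<open>A geometric series with ratio X/k^d, whose first term has the exponent m; d = 2 serves
  series in t^2, d = 1 those in t.\<close>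

lemma ups_power_step:
  fixes X :: real
  assumes X: "\<bar>X\<bar> < 1" and k: "k \<ge> 1" and d: "d \<ge> 1"
  shows "ups (\<lambda>i. c / real k ^ (d * i + m)) X (c * (real k ^ d / (real k ^ m * (real k ^ d - X))))"
proof -
  have kd: "real k ^ d \<ge> 1" using k by simp
  have "\<bar>X / real k ^ d\<bar> < 1"
  proof -
    have "\<bar>X / real k ^ d\<bar> = \<bar>X\<bar> / real k ^ d" by (simp add: abs_divide)
    also have "\<dots> \<le> \<bar>X\<bar> / 1" using kd k by (intro divide_left_mono) auto
    finally show ?thesis using X by simp
  qed
  from has_sum_cmult_right[OF geometric_has_sum[OF this], of "c / real k ^ m"]
  have "((\<lambda>i. c / real k ^ m * (X / real k ^ d) ^ i) has_sum c / real k ^ m * (1 / (1 - X / real k ^ d))) UNIV" .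
  moreover have "c / real k ^ m * (X / real k ^ d) ^ i = c / real k ^ (d * i + m) * X ^ i" for i
    by (simp add: power_add power_mult power_divide)
  moreover have "c / real k ^ m * (1 / (1 - X / real k ^ d)) = c * (real k ^ d / (real k ^ m * (real k ^ d - X)))"
    using kd X k by (simp add: divide_simps)
  ultimately show ?thesis by (simp add: ups_def)
qed

lemma sq_lt_1: "\<bar>t :: real\<bar> < 1 \<Longrightarrow> \<bar>t ^ 2\<bar> < 1"
  by (simp add: abs_square_less_1)

lemma ups_of_terms:
  assumes t: "\<bar>t\<bar> < 1" and e: "\<And>k. \<bar>e k\<bar> \<le> (1 :: real)"
    and S: "((\<lambda>k. e k * (real k ^ 2 / (real k ^ (m + 2) * (real k ^ 2 - t ^ 2)))) has_sum S) {1..}"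
  shows "ups (\<lambda>i. infsum (\<lambda>k. e k / real k ^ (2 * i + (m + 2))) {1..}) (t ^ 2) S"
proof (rule ups_interchange[OF _ sq_lt_1[OF t] ups_power_step[OF sq_lt_1[OF t], where d = 2] S])
  fix i k :: nat assume k: "k \<ge> 1"
  have "\<bar>e k\<bar> / real k ^ (2 * i + (m + 2)) \<le> 1 / real k ^ (2 * i + (m + 2))"
    by (intro divide_right_mono e) auto
  also have "\<dots> \<le> 1 / real k ^ 2" using inverse_power_le[OF k, of "2 * i + m"] by (simp add: add.assoc)
  finally show "\<bar>e k / real k ^ (2 * i + (m + 2))\<bar> \<le> 1 / real k ^ 2" by (simp add: abs_divide)
qed auto

lemma ups_zt_odd:
  assumes t: "0 < \<bar>t\<bar>" "\<bar>t\<bar> < 1"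
  shows "ups (\<lambda>i. zt (2 * i + 3)) (t ^ 2) (Afun t / t ^ 2)"
proof -
  have "((\<lambda>n. 1 / t ^ 2 * (t ^ 2 / (real n * (real n ^ 2 - t ^ 2)))) has_sum 1 / t ^ 2 * Afun t) {1..}"
    by (intro has_sum_cmult_right Afun_has_sum)
  also have "?this \<longleftrightarrow> ((\<lambda>k. 1 * (real k ^ 2 / (real k ^ (1 + 2) * (real k ^ 2 - t ^ 2)))) has_sum 1 / t ^ 2 * Afun t) {1..}"
    by (rule has_sum_cong) (use t in \<open>auto simp: power3_eq_cube power2_eq_square\<close>)
  finally have "ups (\<lambda>i. infsum (\<lambda>k. 1 / real k ^ (2 * i + (1 + 2))) {1..}) (t ^ 2) (1 / t ^ 2 * Afun t)"
    by (rule ups_of_terms[OF t(2), rotated]) simp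
  moreover have "zt (2 * i + 3) = infsum (\<lambda>k. 1 / real k ^ (2 * i + (1 + 2))) {1..}" for i
    using infsumI[OF zt_has_sum[of "2 * i + 3"]] by (simp add: eval_nat_numeral)
  ultimately show ?thesis by simp
qed

lemma small_non_Ints:
  fixes t :: real
  assumes "0 < \<bar>t\<bar>" "\<bar>t\<bar> < 1"
  shows "t \<notin> \<int>"
proof
  assume "t \<in> \<int>"
  then obtain n :: int where "t = of_int n" by (elim Ints_cases)
  thus False using assms by simp
qed

lemma ups_ztbar_odd:
  assumes t: "0 < \<bar>t\<bar>" "\<bar>t\<bar> < 1"
  shows "ups (\<lambda>i. ztbar (2 * i + 3)) (t ^ 2) (Abar t / t ^ 2)"
proof -
  have "((\<lambda>n. 1 / t ^ 2 * ((- 1) ^ n * (t ^ 2 / (real n * (real n ^ 2 - t ^ 2))))) has_sum 1 / t ^ 2 * Abar t) {1..}"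
    by (intro has_sum_cmult_right Abar_has_sum small_non_Ints[OF t])
  also have "?this \<longleftrightarrow> ((\<lambda>k. (- 1) ^ k * (real k ^ 2 / (real k ^ (1 + 2) * (real k ^ 2 - t ^ 2)))) has_sum 1 / t ^ 2 * Abar t) {1..}"
    by (rule has_sum_cong) (use t in \<open>auto simp: power3_eq_cube power2_eq_square\<close>)
  finally have "ups (\<lambda>i. infsum (\<lambda>k. (- 1) ^ k / real k ^ (2 * i + (1 + 2))) {1..}) (t ^ 2) (1 / t ^ 2 * Abar t)"
    by (rule ups_of_terms[OF t(2), rotated]) simp
  moreover have "ztbar (2 * i + 3) = infsum (\<lambda>k. (- 1) ^ k / real k ^ (2 * i + (1 + 2))) {1..}" for i
    using ztbar_eq[of "2 * i + 3"] by (simp add: eval_nat_numeral)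
  ultimately show ?thesis by simp
qed

lemma ups_zt_even:
  assumes t: "0 < \<bar>t\<bar>" "\<bar>t\<bar> < 1"
  shows "ups (\<lambda>i. zt (2 * i + 2)) (t ^ 2) (Q1 t)"
proof -
  have "(q t has_sum Q1 t) {1..}" by (rule q_has_sum[OF small_non_Ints[OF t]])
  also have "?this \<longleftrightarrow> ((\<lambda>k. 1 * (real k ^ 2 / (real k ^ (0 + 2) * (real k ^ 2 - t ^ 2)))) has_sum Q1 t) {1..}"
    by (rule has_sum_cong) (auto simp: q_def power2_eq_square)
  finally have "ups (\<lambda>i. infsum (\<lambda>k. 1 / real k ^ (2 * i + (0 + 2))) {1..}) (t ^ 2) (Q1 t)"
    by (rule ups_of_terms[OF t(2), rotated]) simp
  moreover have "zt (2 * i + 2) = infsum (\<lambda>k. 1 / real k ^ (2 * i + (0 + 2))) {1..}" for i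
    using infsumI[OF zt_has_sum[of "2 * i + 2"]] by simp
  ultimately show ?thesis by simp
qed

lemma ups_ztbar_even:
  assumes t: "0 < \<bar>t\<bar>" "\<bar>t\<bar> < 1"
  shows "ups (\<lambda>i. ztbar (2 * i + 2)) (t ^ 2) (Qe t)"
proof -
  have "((\<lambda>n. (- 1) ^ n * q t n) has_sum Qe t) {1..}" by (rule q_has_sum[OF small_non_Ints[OF t]])
  also have "?this \<longleftrightarrow> ((\<lambda>k. (- 1) ^ k * (real k ^ 2 / (real k ^ (0 + 2) * (real k ^ 2 - t ^ 2)))) has_sum Qe t) {1..}"
    by (rule has_sum_cong) (auto simp: q_def power2_eq_square)
  finally have "ups (\<lambda>i. infsum (\<lambda>k. (- 1) ^ k / real k ^ (2 * i + (0 + 2))) {1..}) (t ^ 2) (Qe t)"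
    by (rule ups_of_terms[OF t(2), rotated]) simp
  moreover have "ztbar (2 * i + 2) = infsum (\<lambda>k. (- 1) ^ k / real k ^ (2 * i + (0 + 2))) {1..}" for i
    using ztbar_eq[of "2 * i + 2"] by simp
  ultimately show ?thesis by simp
qed

text \<open>The convention -1/2 at index 0 is exactly what completes t^2 Qe t to a multiple of the
  cosecant without a rational part.\<close>

lemma ups_ztbar:
  assumes t: "0 < \<bar>t\<bar>" "\<bar>t\<bar> < 1"
  shows "ups (\<lambda>i. ztbar (2 * i)) (t ^ 2) (- t * theta t / 2)"
proof -
  have "ups (\<lambda>i. if i = 0 then 0 else ztbar (2 * i)) (t ^ 2) (t ^ 2 * Qe t)"
    by (rule ups_shift_up[OF ups_ztbar_even[OF t]]) (auto simp: algebra_simps)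
  moreover have "ups (\<lambda>i. if i = 0 then - 1 / 2 else 0) (t ^ 2) (- 1 / 2)"
    unfolding ups_def by (rule has_sum_finite_neutralI[of "{0}"]) auto
  ultimately have "ups (\<lambda>i. (if i = 0 then 0 else ztbar (2 * i)) + (if i = 0 then - 1 / 2 else 0)) (t ^ 2) (t ^ 2 * Qe t + (- 1 / 2))"
    by (rule ups_add)
  moreover have "(if i = 0 then 0 else ztbar (2 * i)) + (if i = 0 then - 1 / 2 else 0) = ztbar (2 * i)" for i
    by (simp add: ztbar_0)
  moreover have "t ^ 2 * Qe t + (- 1 / 2) = - t * theta t / 2"
    using t by (simp add: Qe_def power2_eq_square field_simps)
  ultimately show ?thesis by simp
qed

text \<open>The convention that zeta(1) is 0 provides the vanishing constant term of
  \<open>Afun\<close>.\<close>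

lemma ups_zt_odd':
  assumes t: "0 < \<bar>t\<bar>" "\<bar>t\<bar> < 1"
  shows "ups (\<lambda>i. zt (2 * i + 1)) (t ^ 2) (Afun t)"
proof -
  have "ups (\<lambda>i. zt (2 * i + 1)) (t ^ 2) (t ^ 2 * (Afun t / t ^ 2))"
    by (rule ups_shift_up[OF ups_zt_odd[OF t]]) (auto simp: zt_def eval_nat_numeral)
  thus ?thesis using t by simp
qed

lemma dps_eq: "dps c X Y S \<Longrightarrow> (\<And>a b. c a b = d a b) \<Longrightarrow> S = T \<Longrightarrow> dps d X Y T"
  by (simp add: dps_def)

section \<open>Binomial kernels with prescribed parities\<close>

lemma ups_full_even:
  assumes "ups c (t ^ 2) f"
  shows "ups (\<lambda>n. if even n then c (n div 2) else 0) t f"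
proof -
  have "((\<lambda>n. (if even n then c (n div 2) else 0) * t ^ n) has_sum f) (range (\<lambda>i. 2 * i))"
    using assms unfolding ups_def by (subst has_sum_reindex) (auto simp: inj_on_def o_def power_mult)
  also have "?this \<longleftrightarrow> ?thesis" unfolding ups_def
    by (rule has_sum_cong_neutral) (auto elim!: evenE)
  finally show ?thesis .
qed

lemma ups_full_odd:
  assumes "ups c (t ^ 2) f"
  shows "ups (\<lambda>n. if odd n then c (n div 2) else 0) t (t * f)"
proof -
  have "((\<lambda>n. t * (c n * (t ^ 2) ^ n)) has_sum t * f) UNIV"
    using assms unfolding ups_def by (rule has_sum_cmult_right)
  moreover have "t * (c n * (t ^ 2) ^ n) = c n * t ^ (2 * n + 1)" for n by (simp add: power_mult)
  ultimately have "((\<lambda>n. c n * t ^ (2 * n + 1)) has_sum t * f) UNIV" by (simp only:)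
  hence "((\<lambda>n. (if odd n then c (n div 2) else 0) * t ^ n) has_sum t * f) (range (\<lambda>i. 2 * i + 1))"
    by (subst has_sum_reindex) (auto simp: inj_on_def o_def)
  also have "?this \<longleftrightarrow> ?thesis" unfolding ups_def
    by (rule has_sum_cong_neutral) (auto elim!: oddE)
  finally show ?thesis .
qed

lemma ups_abs_summable: "ups c t f \<Longrightarrow> (\<lambda>n. \<bar>c n\<bar> * \<bar>t\<bar> ^ n) summable_on UNIV"
  unfolding ups_def
  by (drule has_sum_imp_summable, drule summable_on_iff_abs_summable_on_real[THEN iffD1]) (simp add: abs_mult power_abs)

lemma dps_signs:
  assumes xy: "0 \<le> y" "y \<le> x"
    and f: "ups c (x + y) f1" "ups c (x - y) f2" "ups c (- (x - y)) f3" "ups c (- (x + y)) f4"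
  shows "dps (\<lambda>i j. real ((i + j) choose j) * c (i + j)) x y f1"
    "dps (\<lambda>i j. real ((i + j) choose j) * c (i + j)) x (- y) f2"
    "dps (\<lambda>i j. real ((i + j) choose j) * c (i + j)) (- x) y f3"
    "dps (\<lambda>i j. real ((i + j) choose j) * c (i + j)) (- x) (- y) f4"
proof -
  have s: "(\<lambda>n. \<bar>c n\<bar> * (x + y) ^ n) summable_on UNIV"
    using ups_abs_summable[OF f(1)] xy by simp
  show "dps (\<lambda>i j. real ((i + j) choose j) * c (i + j)) x y f1"
    "dps (\<lambda>i j. real ((i + j) choose j) * c (i + j)) x (- y) f2"
    "dps (\<lambda>i j. real ((i + j) choose j) * c (i + j)) (- x) y f3"
    "dps (\<lambda>i j. real ((i + j) choose j) * c (i + j)) (- x) (- y) f4"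
    by (rule dps_binomial; use f s xy in \<open>simp add: add.commute\<close>)+
qed

text \<open>The even series with coefficients c is expanded at x + y by the binomial theorem. As its
  total degree is even, either both exponents are even or both are odd; half the sum and half the
  difference of the values at x + y and x - y separate the two cases.\<close>

lemma kernel_even:
  assumes xy: "0 < y" "y < x" and f: "ups c ((x + y) ^ 2) fp" "ups c ((x - y) ^ 2) fm"
  shows "dps (\<lambda>a b. real ((2 * a + 2 * b) choose (2 * b)) * c (a + b)) (x ^ 2) (y ^ 2) ((fp + fm) / 2)"
    "dps (\<lambda>a b. real ((2 * a + 2 * b + 2) choose (2 * b + 1)) * c (a + b + 1)) (x ^ 2) (y ^ 2) ((fp - fm) / (2 * x * y))"
proof -
  let ?C = "\<lambda>n. if even n then c (n div 2) else 0"
  have "ups ?C (x + y) fp" "ups ?C (x - y) fm" "ups ?C (- (x - y)) fm" "ups ?C (- (x + y)) fp"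
    using f power2_minus[of "x - y"] power2_minus[of "x + y"] by (auto intro!: ups_full_even simp del: minus_diff_eq minus_add_distrib)
  note d = dps_signs[OF xy[THEN less_imp_le] this]
  have nz0: "x \<noteq> 0" "y \<noteq> 0" using xy by auto
  have nz: "x \<noteq> 0 \<or> e = 0" "y \<noteq> 0 \<or> d = 0" for e d :: nat using xy by auto
  have h: "(2 * m + 2 * n) div 2 = m + n" for m n :: nat by simp
  show "dps (\<lambda>a b. real ((2 * a + 2 * b) choose (2 * b)) * c (a + b)) (x ^ 2) (y ^ 2) ((fp + fm) / 2)"
    by (rule dps_eq[OF dps_extract[OF d nz(1) nz(2), of 0 0]]) (auto simp: h)
  have h': "(2 * a + 1) + (2 * b + 1) = 2 * a + 2 * b + 2" "even (2 * a + 2 * b + 2)" "(2 * a + 2 * b + 2) div 2 = a + b + 1" for a b :: nat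
    by simp_all
  show "dps (\<lambda>a b. real ((2 * a + 2 * b + 2) choose (2 * b + 1)) * c (a + b + 1)) (x ^ 2) (y ^ 2) ((fp - fm) / (2 * x * y))"
    by (rule dps_eq[OF dps_extract[OF d nz(1) nz(2), of 1 1]]) (simp_all only: h' if_True, auto simp: field_simps nz0)
qed

text \<open>The same for the odd series t c(t^2), where exactly one of the two exponents is
  odd.\<close>

lemma kernel_odd:
  assumes xy: "0 < y" "y < x" and f: "ups c ((x + y) ^ 2) fp" "ups c ((x - y) ^ 2) fm"
  shows "dps (\<lambda>a b. real ((2 * a + 2 * b + 1) choose (2 * b + 1)) * c (a + b)) (x ^ 2) (y ^ 2) (((x + y) * fp - (x - y) * fm) / (2 * y))"
    "dps (\<lambda>a b. real ((2 * a + 2 * b + 1) choose (2 * b)) * c (a + b)) (x ^ 2) (y ^ 2) (((x + y) * fp + (x - y) * fm) / (2 * x))"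
proof -
  let ?C = "\<lambda>n. if odd n then c (n div 2) else 0"
  have m: "ups c ((- (x - y)) ^ 2) fm" "ups c ((- (x + y)) ^ 2) fp" using f by (simp_all only: power2_minus)
  note d = dps_signs[OF xy[THEN less_imp_le] ups_full_odd[OF f(1)] ups_full_odd[OF f(2)] ups_full_odd[OF m(1)] ups_full_odd[OF m(2)]]
  have nz0: "x \<noteq> 0" "y \<noteq> 0" using xy by auto
  have nz: "x \<noteq> 0 \<or> e = 0" "y \<noteq> 0 \<or> d = 0" for e d :: nat using xy by auto
  have h: "(2 * a + 0) + (2 * b + 1) = 2 * a + 2 * b + 1" "(2 * a + 1) + (2 * b + 0) = 2 * a + 2 * b + 1" "2 * b + 0 = 2 * b"
    "odd (2 * a + 2 * b + 1)" "(2 * a + 2 * b + 1) div 2 = a + b" for a b :: nat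
    by simp_all
  show "dps (\<lambda>a b. real ((2 * a + 2 * b + 1) choose (2 * b + 1)) * c (a + b)) (x ^ 2) (y ^ 2) (((x + y) * fp - (x - y) * fm) / (2 * y))"
    by (rule dps_eq[OF dps_extract[OF d nz(1) nz(2), of 0 1]]) (simp_all only: h if_True simp_thms, auto simp: field_simps nz0)
  show "dps (\<lambda>a b. real ((2 * a + 2 * b + 1) choose (2 * b)) * c (a + b)) (x ^ 2) (y ^ 2) (((x + y) * fp + (x - y) * fm) / (2 * x))"
    by (rule dps_eq[OF dps_extract[OF d nz(1) nz(2), of 1 0]]) (simp_all only: h if_True simp_thms, auto simp: field_simps nz0)
qed

lemma sum_quad:
  fixes F :: "nat \<Rightarrow> nat \<Rightarrow> nat \<Rightarrow> nat \<Rightarrow> real"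
  shows "(\<Sum>(p, q) | p + q = a. \<Sum>(r, s) | r + s = b. F p q r s) = (\<Sum>(p, q, r, s) | p + q = a \<and> r + s = b. F p q r s)"
proof -
  have "(\<Sum>(p, q) | p + q = a. \<Sum>(r, s) | r + s = b. F p q r s) =
      (\<Sum>z | fst z + snd z = a. \<Sum>(r, s) | r + s = b. F (fst z) (snd z) r s)"
    by (simp add: case_prod_unfold)
  also have "\<dots> = (\<Sum>(z, y)\<in>(SIGMA z:{z. fst z + snd z = a}. {(r, s). r + s = b}). (\<lambda>(r, s). F (fst z) (snd z) r s) y)"
  proof (rule sum.Sigma)
    show "finite {z. fst z + snd z = a}" by (rule finite_subset[of _ "{..a} \<times> {..a}"]) auto
  qed auto
  also have "\<dots> = (\<Sum>(p, q, r, s) | p + q = a \<and> r + s = b. F p q r s)"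
    by (rule sum.reindex_bij_witness[where i = "\<lambda>(p, q, r, s). ((p, q), (r, s))" and j = "\<lambda>((p, q), (r, s)). (p, q, r, s)"]) auto
  finally show ?thesis .
qed

lemma dps_quad:
  assumes "ups u X f" "ups v Y g" "dps K X Y h"
  shows "dps (\<lambda>a b. \<Sum>(p, q, r, s) | p + q = a \<and> r + s = b. u p * (v r * K q s)) X Y (f * (g * h))"
proof -
  have eq: "(\<Sum>(p, q) | p + q = a. u p * (\<Sum>(r, s) | r + s = b. v r * K q s)) =
      (\<Sum>(p, q, r, s) | p + q = a \<and> r + s = b. u p * (v r * K q s))" for a b
    using sum_quad[of "\<lambda>p q r s. u p * (v r * K q s)" b a] by (simp add: sum_distrib_left case_prod_unfold)
  show ?thesis using dps_mult_x[OF assms(1) dps_mult_y[OF assms(2,3)]] unfolding eq .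
qed

lemma dps_triple_x:
  assumes "ups u X f" "ups v X g" "dps K X Y h"
  shows "dps (\<lambda>a b. \<Sum>(p, q, r) | p + q + r = a. u p * (v q * K r b)) X Y (f * (g * h))"
proof -
  have eq: "(\<Sum>(p, q) | p + q = a. u p * (\<Sum>(r, s) | r + s = q. v r * K s b)) =
      (\<Sum>(p, q, r) | p + q + r = a. u p * (v q * K r b))" for a b
    using sum_triple[of "\<lambda>p q r. u p * (v q * K r b)" a] by (simp add: sum_distrib_left case_prod_unfold)
  show ?thesis using dps_mult_x[OF assms(1) dps_mult_x[OF assms(2,3)]] unfolding eq .
qed

lemma dps_triple_y:
  assumes "ups u Y f" "ups v Y g" "dps K X Y h"
  shows "dps (\<lambda>a b. \<Sum>(p, q, r) | p + q + r = b. u p * (v q * K a r)) X Y (f * (g * h))"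
proof -
  have eq: "(\<Sum>(p, q) | p + q = b. u p * (\<Sum>(r, s) | r + s = q. v r * K a s)) =
      (\<Sum>(p, q, r) | p + q + r = b. u p * (v q * K a r))" for a b
    using sum_triple[of "\<lambda>p q r. u p * (v q * K a r)" b] by (simp add: sum_distrib_left case_prod_unfold)
  show ?thesis using dps_mult_y[OF assms(1) dps_mult_y[OF assms(2,3)]] unfolding eq .
qed

section \<open>Euler numbers and the product of two secants\<close>

definition sech_coeff :: "nat \<Rightarrow> real" where
  "sech_coeff n = euler_number n / fact n"

lemma cosh_fps_nth: "fps_nth (fps_const (1 / 2) * (fps_exp 1 + fps_exp (- 1)) :: real fps) n = (if even n then 1 / fact n else 0)"
  by (simp add: uminus_power_if)

lemma sech_fps_mult: "Abs_fps sech_coeff * (fps_const (1 / 2) * (fps_exp 1 + fps_exp (- 1))) = 1"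
proof -
  have "Abs_fps sech_coeff = inverse (fps_const (1 / 2) * (fps_exp 1 + fps_exp (- 1)))"
    by (simp add: fps_eq_iff sech_coeff_def euler_number_def)
  thus ?thesis by (simp only:) (rule inverse_mult_eq_1, simp)
qed

lemma sech_coeff_sum: "(\<Sum>i\<le>n. sech_coeff i * (if even (n - i) then 1 / fact (n - i) else 0)) = of_bool (n = 0)"
proof -
  have "fps_nth (Abs_fps sech_coeff * (fps_const (1 / 2) * (fps_exp 1 + fps_exp (- 1)))) n = fps_nth 1 n"
    by (simp only: sech_fps_mult)
  thus ?thesis unfolding fps_mult_nth[of "Abs_fps sech_coeff"] cosh_fps_nth atLeast0AtMost by (simp add: of_bool_def)
qed

text \<open>In the Cauchy product with cosh, for odd n, an even index i leaves an odd coefficient of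
  cosh and an odd i < n is covered by induction; only the last term remains.\<close>

lemma sech_coeff_odd: "odd n \<Longrightarrow> sech_coeff n = 0"
proof (induction n rule: less_induct)
  case (less n)
  have "(\<Sum>i\<le>n. sech_coeff i * (if even (n - i) then 1 / fact (n - i) else 0)) = (\<Sum>i\<in>{n}. sech_coeff i * (if even (n - i) then 1 / fact (n - i) else 0))"
  proof (rule sum.mono_neutral_right)
    show "\<forall>i\<in>{..n} - {n}. sech_coeff i * (if even (n - i) then 1 / fact (n - i) else 0) = 0"
    proof
      fix i assume "i \<in> {..n} - {n}"
      hence i: "i < n" by auto
      show "sech_coeff i * (if even (n - i) then 1 / fact (n - i) else 0) = 0"
        using less.IH[OF i] less.prems i by (cases "even i") auto
    qed
  qed auto
  thus ?case using sech_coeff_sum[of n] less.prems odd_pos[OF less.prems] by (auto simp: of_bool_def)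
qed

text \<open>From sec t = sech(\<i> t): the coefficients vanish for odd n, and for even n the power
  of \<i> is (-1)^(n div 2).\<close>

definition sec_coeff :: "nat \<Rightarrow> real" where
  "sec_coeff n = (- 1) ^ (n div 2) * sech_coeff n"

lemma sec_has_fps_expansion: "(\<lambda>t::real. 1 / cos t) has_fps_expansion Abs_fps sec_coeff"
proof -
  have "Abs_fps sec_coeff * fps_cos 1 = 1"
  proof (rule fps_ext)
    fix n
    have "fps_nth (Abs_fps sec_coeff * fps_cos 1) n = (\<Sum>i\<le>n. sec_coeff i * fps_nth (fps_cos 1) (n - i))"
      by (simp add: fps_mult_nth atLeast0AtMost)
    also have "\<dots> = (\<Sum>i\<le>n. (- 1) ^ (n div 2) * (sech_coeff i * (if even (n - i) then 1 / fact (n - i) else 0)))"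
    proof (rule sum.cong[OF refl])
      fix i assume "i \<in> {..n}"
      hence i: "i \<le> n" by simp
      show "sec_coeff i * fps_nth (fps_cos 1) (n - i) = (- 1) ^ (n div 2) * (sech_coeff i * (if even (n - i) then 1 / fact (n - i) else 0))"
      proof (cases "even i \<and> even (n - i)")
        case True
        obtain k where k: "i = 2 * k" using True by (elim conjE evenE)
        obtain l where l: "n - i = 2 * l" using True by (elim conjE evenE)
        note kl = k l
        hence n: "n = 2 * k + 2 * l" using i by simp
        have d: "(2 * k + 2 * l) div 2 = k + l" by simp
        show ?thesis unfolding kl(2) unfolding kl(1) unfolding n d by (simp add: sec_coeff_def fps_cos_def power_add)
      qed (auto simp: sec_coeff_def sech_coeff_odd fps_cos_def)
    qed
    also have "\<dots> = (- 1) ^ (n div 2) * of_bool (n = 0)"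
      by (simp only: sum_distrib_left[symmetric] sech_coeff_sum)
    finally show "fps_nth (Abs_fps sec_coeff * fps_cos 1) n = fps_nth 1 n" by (simp add: of_bool_def)
  qed
  hence "inverse (fps_cos 1) = Abs_fps sec_coeff"
    by (metis fps_inverse_unique mult.commute)
  moreover have "(\<lambda>t::real. inverse (cos t)) has_fps_expansion inverse (fps_cos 1)"
    by (intro has_fps_expansion_inverse has_fps_expansion_cos') (simp add: fps_cos_def)
  ultimately show ?thesis by (simp add: inverse_eq_divide)
qed

text \<open>Any positive radius will do, since coefficients are compared in a neighbourhood of
  0.\<close>

lemma sec_has_sum:
  obtains \<delta> where "\<delta> > 0" "\<And>t. \<bar>t\<bar> < \<delta> \<Longrightarrow> ups sec_coeff t (1 / cos t)"
proof -
  define F where "F = Abs_fps sec_coeff"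
  have r: "fps_conv_radius F > 0" and e: "\<forall>\<^sub>F z in nhds 0. eval_fps F z = 1 / cos z"
    using sec_has_fps_expansion by (auto simp: has_fps_expansion_def F_def)
  obtain d where d: "d > 0" "\<And>z. dist z 0 < d \<Longrightarrow> eval_fps F z = 1 / cos z"
    using e unfolding eventually_nhds_metric by blast
  obtain e where e: "0 < ereal e" "ereal e < fps_conv_radius F"
    using ereal_dense2[OF r] by blast
  show ?thesis
  proof (rule that[of "min d e"])
    have "e > 0" using e(1) by simp
    thus "min d e > 0" using d(1) by simp
    fix t :: real assume t: "\<bar>t\<bar> < min d e"
    have "ereal (norm t) < fps_conv_radius F"
      by (rule less_trans[OF _ e(2)]) (use t in simp)
    hence a: "summable (\<lambda>n. norm (fps_nth F n * t ^ n))"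
      unfolding fps_conv_radius_def by (rule abs_summable_in_conv_radius)
    have "(\<lambda>n. fps_nth F n * t ^ n) sums (\<Sum>n. fps_nth F n * t ^ n)"
      by (rule summable_sums[OF summable_norm_cancel[OF a]])
    from norm_summable_imp_has_sum[OF a this]
    have "((\<lambda>n. fps_nth F n * t ^ n) has_sum eval_fps F t) UNIV"
      by (simp add: eval_fps_def)
    thus "ups sec_coeff t (1 / cos t)" using d(2)[of t] t by (simp add: F_def ups_def)
  qed
qed

definition euler_sum :: "nat \<Rightarrow> nat \<Rightarrow> real" where
  "euler_sum a b = (\<Sum>(i, j, r, s) | i + j = 2 * a \<and> r + s = 2 * b.
     (- 1) ^ r * euler_number (i + r) * euler_number (j + s) / (fact i * fact j * fact r * fact s)) * ((- 1) ^ (a + b) * (pi / 2) ^ (2 * a + 2 * b))"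

text \<open>The two secants at x - y and x + y are expanded by \<open>dps_binomial\<close>; the sign
  (-1)^r comes from the -y in the first, and the binomial coefficients split the factorials. The
  product is invariant under both sign changes, so extracting even exponents returns it. The case y
  = 0 is included because it gives the row b = 0.\<close>

lemma dps_euler_sum:
  assumes xy: "0 \<le> y" "y \<le> x"
    and sec: "\<And>t. \<bar>t\<bar> \<le> pi * x \<Longrightarrow> ups sec_coeff t (1 / cos t)"
  shows "dps euler_sum (x ^ 2) (y ^ 2) (1 / (cos (pi * (x + y) / 2) * cos (pi * (x - y) / 2)))"
proof -
  define c where "c n = sec_coeff n * (pi / 2) ^ n" for n
  have c: "ups c t (1 / cos (pi * t / 2))" if "\<bar>t\<bar> \<le> 2 * x" for t
  proof -
    have "\<bar>pi / 2 * t\<bar> \<le> pi * x" using that by (simp add: abs_mult)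
    from sec[OF this] have "ups sec_coeff (pi / 2 * t) (1 / cos (pi * t / 2))" by simp
    thus ?thesis unfolding ups_def c_def power_mult_distrib by (simp only: mult_ac)
  qed
  define P where "P = 1 / (cos (pi * (x + y) / 2) * cos (pi * (x - y) / 2))"
  have cm: "cos (pi * (- t) / 2) = cos (pi * t / 2)" for t
    by simp
  define C where "C i j = real ((i + j) choose j) * c (i + j)" for i j
  define C' where "C' i j = (- 1) ^ j * C i j" for i j
  have u: "ups c (x + y) (1 / cos (pi * (x + y) / 2))" "ups c (x - y) (1 / cos (pi * (x - y) / 2))"
    "ups c (- (x - y)) (1 / cos (pi * (x - y) / 2))" "ups c (- (x + y)) (1 / cos (pi * (x + y) / 2))"
    by (rule c[of "x + y"], use xy in simp, rule c[of "x - y"], use xy in simp,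
        rule c[of "- (x - y)", unfolded cm], use xy in simp, rule c[of "- (x + y)", unfolded cm], use xy in simp)
  note d = dps_signs[OF xy u, folded C_def]
  have m: "dps C' X Y f" if "dps C X (- Y) f" for X Y f
    using that unfolding dps_def C'_def power_minus[of Y] by (simp only: mult_ac)
  have d': "dps C' x y (1 / cos (pi * (x - y) / 2))" "dps C' x (- y) (1 / cos (pi * (x + y) / 2))"
    "dps C' (- x) y (1 / cos (pi * (x + y) / 2))" "dps C' (- x) (- y) (1 / cos (pi * (x - y) / 2))"
    by (rule m[OF d(2)], rule m[of x "- y", unfolded minus_minus, OF d(1)], rule m[OF d(4)],
        rule m[of "- x" "- y", unfolded minus_minus, OF d(3)])
  have P: "1 / cos (pi * (x - y) / 2) * (1 / cos (pi * (x + y) / 2)) = P"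
     "1 / cos (pi * (x + y) / 2) * (1 / cos (pi * (x - y) / 2)) = P" by (simp_all add: P_def)
  note e = dps_mult[OF d'(1) d(1), unfolded P] dps_mult[OF d'(2) d(2), unfolded P]
      dps_mult[OF d'(3) d(3), unfolded P] dps_mult[OF d'(4) d(4), unfolded P]
  show ?thesis unfolding P_def[symmetric]
  proof (rule dps_eq[OF dps_extract[OF e, of 0 0]])
    fix a b :: nat
    show "(\<Sum>(i, j, r, s) | i + j = 2 * a + 0 \<and> r + s = 2 * b + 0. C' i r * C j s) = euler_sum a b"
      unfolding euler_sum_def sum_distrib_right
    proof (rule sum.cong)
      fix z :: "nat \<times> nat \<times> nat \<times> nat" assume "z \<in> {(i, j, r, s). i + j = 2 * a \<and> r + s = 2 * b}"
      then obtain i j r s where z: "z = (i, j, r, s)" and ij: "i + j = 2 * a" and rs: "r + s = 2 * b" by auto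
      have bin: "real ((i + j) choose j) * (e / fact (i + j)) = e / (fact i * fact j)" for i j :: nat and e :: real
        by (simp add: binomial_fact)
      have C: "C i j = (- 1) ^ ((i + j) div 2) * (pi / 2) ^ (i + j) * (euler_number (i + j) / (fact i * fact j))" for i j
        unfolding C_def c_def sec_coeff_def sech_coeff_def bin[symmetric] by (simp only: mult_ac)
      have "C' i r * C j s = (- 1) ^ r * euler_number (i + r) * euler_number (j + s) / (fact i * fact j * fact r * fact s) *
        ((- 1) ^ (a + b) * (pi / 2) ^ (2 * a + 2 * b))"
      \<comment> \<open>For odd i + r the Euler number vanishes. Otherwise j + s is even as well,
        and the two integer halves add up to a + b.\<close>
      proof (cases "even (i + r)")
        case False
        hence "euler_number (i + r) = 0" using sech_coeff_odd[OF False] by (simp add: sech_coeff_def)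
        thus ?thesis unfolding C'_def C by simp
      next
        case True
        have t: "(i + r) + (j + s) = 2 * (a + b)" using ij rs by simp
        obtain k where k: "i + r = 2 * k" using True by (rule evenE)
        have l: "j + s = 2 * (a + b - k)" using t k by simp
        have "(i + r) div 2 + (j + s) div 2 = a + b" using t k unfolding l by simp
        hence sg: "(- 1) ^ ((i + r) div 2) * (- 1) ^ ((j + s) div 2) = (- 1 :: real) ^ (a + b)"
          by (simp only: power_add[symmetric])
        have pw: "(pi / 2) ^ (i + r) * (pi / 2) ^ (j + s) = (pi / 2) ^ (2 * a + 2 * b)"
          unfolding power_add[symmetric] t by simp
        have gen: "(r1 * (s1 * p1 * (e1 / (fi * fr)))) * (s2 * p2 * (e2 / (fj * fs))) =
            r1 * (e1 * e2) / (fi * fj * fr * fs) * ((s1 * s2) * (p1 * p2))" for r1 s1 p1 e1 fi fr s2 p2 e2 fj fs :: real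
          by (simp only: divide_inverse inverse_mult_distrib mult_ac)
        have "C' i r * C j s = (- 1) ^ r * (euler_number (i + r) * euler_number (j + s)) / (fact i * fact j * fact r * fact s) *
           (((- 1) ^ ((i + r) div 2) * (- 1) ^ ((j + s) div 2)) * ((pi / 2) ^ (i + r) * (pi / 2) ^ (j + s)))"
          unfolding C'_def C by (rule gen)
        thus ?thesis unfolding sg pw by (simp only: mult.assoc[of "(- 1) ^ r", symmetric])
      qed
      thus "(case z of (i, j, r, s) \<Rightarrow> C' i r * C j s) = (case z of (i, j, r, s) \<Rightarrow>
          (- 1) ^ r * euler_number (i + r) * euler_number (j + s) / (fact i * fact j * fact r * fact s)) *
          ((- 1) ^ (a + b) * (pi / 2) ^ (2 * a + 2 * b))"
        unfolding z prod.case .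
    qed simp
  qed simp_all
qed

section \<open>Generating functions of the three sums\<close>

lemma dps_0:
  assumes "dps c X 0 S"
  shows "ups (\<lambda>a. c a 0) X S"
proof -
  have "((\<lambda>(a, b). c a b * (X ^ a * 0 ^ b)) has_sum S) UNIV \<longleftrightarrow> ((\<lambda>(a, b). c a b * (X ^ a * 0 ^ b)) has_sum S) (range (\<lambda>a. (a, 0)))"
  proof (rule has_sum_cong_neutral)
    fix z :: "nat \<times> nat" assume z: "z \<in> UNIV - range (\<lambda>a. (a, 0))"
    obtain a b where ab: "z = (a, b)" by force
    have "b \<noteq> 0" using z unfolding ab by auto
    thus "(case z of (a, b) \<Rightarrow> c a b * (X ^ a * 0 ^ b)) = 0" by (simp add: ab)
  qed auto
  hence "((\<lambda>(a, b). c a b * (X ^ a * 0 ^ b)) has_sum S) (range (\<lambda>a. (a, 0)))"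
    using assms unfolding dps_def by blast
  thus ?thesis by (subst (asm) has_sum_reindex) (auto simp: inj_on_def o_def ups_def)
qed

lemma false_sets [simp]: "{(u, v, w). False} = {}" "{(p, q, r, s). False} = {}"
  by auto

lemma zero_pairs: "{(r, s). r + s = (0 :: nat)} = {(0, 0)}"
  by auto

lemma dps_shift_conv:
  assumes u: "ups u Y f" and K: "dps K X Y g" and row: "ups (\<lambda>a. K a 0) X h" and Y: "Y \<noteq> 0"
  shows "dps (\<lambda>a b. \<Sum>(r, s) | r + s = b + 1. u r * K a s) X Y ((f * g - u 0 * h) / Y)"
  using dps_shift_down_y[OF dps_mult_y[OF u K] _ Y] ups_cmult[OF row, of "u 0"] by (simp add: zero_pairs)

lemma sum_pairs_Suc:
  fixes F :: "nat \<Rightarrow> nat \<Rightarrow> real"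
  shows "(\<Sum>(p, q) | p + q = a + 1. F p q) = F 0 (a + 1) + (\<Sum>(p, q) | p + q = a. F (p + 1) q)"
proof -
  have eq: "{(p, q). p + q = a + 1} = insert (0, a + 1) ((\<lambda>(p, q). (p + 1, q)) ` {(p, q). p + q = a})"
  proof (intro equalityI subsetI)
    fix z :: "nat \<times> nat" assume "z \<in> {(p, q). p + q = a + 1}"
    then obtain p q where z: "z = (p, q)" "p + q = a + 1" by auto
    show "z \<in> insert (0, a + 1) ((\<lambda>(p, q). (p + 1, q)) ` {(p, q). p + q = a})"
      using z by (cases p) (auto simp: image_iff)
  qed auto
  have fin: "finite {p :: nat \<times> nat. fst p + snd p = a}"
    using finite_sum_pairs[of a] by (simp add: case_prod_unfold)
  show ?thesis unfolding eq
    by (subst sum.insert) (auto simp: sum.reindex inj_on_def o_def case_prod_unfold intro!: fin)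
qed

lemma arithmetic_geometric_has_sum:
  fixes z :: real
  assumes "\<bar>z\<bar> < 1"
  shows "((\<lambda>a. real a * z ^ a) has_sum (z / (1 - z) ^ 2)) UNIV"
proof -
  have s: "(\<lambda>n. real (Suc n) * z ^ n) sums (1 / (1 - z) ^ 2)"
    using geometric_deriv_sums[of z] assms by simp
  have n: "summable (\<lambda>n. norm (real (Suc n) * z ^ n))"
    using sums_summable[OF geometric_deriv_sums[of "\<bar>z\<bar>"]] assms by (simp add: abs_mult power_abs)
  have "((\<lambda>n. real (Suc n) * z ^ n) has_sum (1 / (1 - z) ^ 2)) UNIV"
    by (rule norm_summable_imp_has_sum[OF n s])
  hence "((\<lambda>n. z * (real (Suc n) * z ^ n)) has_sum z * (1 / (1 - z) ^ 2)) UNIV" by (rule has_sum_cmult_right)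
  hence "((\<lambda>a. real a * z ^ a) has_sum z * (1 / (1 - z) ^ 2)) (range Suc)"
    by (subst has_sum_reindex) (auto simp: o_def mult_ac)
  also have "?this \<longleftrightarrow> ((\<lambda>a. real a * z ^ a) has_sum z * (1 / (1 - z) ^ 2)) UNIV"
  proof (rule has_sum_cong_neutral)
    fix n assume "n \<in> UNIV - range Suc"
    hence "n = 0" by (cases n) auto
    thus "real n * z ^ n = 0" by simp
  qed auto
  finally show ?thesis by simp
qed

context gen_vars
begin

text \<open>The generating functions of the barred values at even arguments, index 0 included, in x
  and in y (\<open>ups_ztbar\<close>).\<close>

abbreviation BX where "BX \<equiv> - x * theta x / 2"
abbreviation BY where "BY \<equiv> - y * theta y / 2"

lemma pos: "0 < \<bar>x\<bar>" "\<bar>x\<bar> < 1" "0 < \<bar>y\<bar>" "\<bar>y\<bar> < 1" "0 < \<bar>x + y\<bar>" "\<bar>x + y\<bar> < 1" "0 < \<bar>x - y\<bar>" "\<bar>x - y\<bar> < 1"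
  using xy by auto

lemma nz: "x \<noteq> 0" "y \<noteq> 0" "x ^ 2 \<noteq> 0" "y ^ 2 \<noteq> 0" using xy by auto

lemmas ups_x = ups_zt_odd[OF pos(1,2)] ups_ztbar_odd[OF pos(1,2)] ups_zt_even[OF pos(1,2)] ups_ztbar_even[OF pos(1,2)]
    ups_ztbar[OF pos(1,2)] ups_zt_odd'[OF pos(1,2)]
lemmas ups_y = ups_zt_odd[OF pos(3,4)] ups_ztbar_odd[OF pos(3,4)] ups_zt_even[OF pos(3,4)] ups_ztbar_even[OF pos(3,4)]
    ups_ztbar[OF pos(3,4)] ups_zt_odd'[OF pos(3,4)]
lemmas ups_p = ups_zt_odd[OF pos(5,6)] ups_ztbar_odd[OF pos(5,6)] ups_zt_even[OF pos(5,6)] ups_ztbar_even[OF pos(5,6)]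
    ups_ztbar[OF pos(5,6)] ups_zt_odd'[OF pos(5,6)]
lemmas ups_m = ups_zt_odd[OF pos(7,8)] ups_ztbar_odd[OF pos(7,8)] ups_zt_even[OF pos(7,8)] ups_ztbar_even[OF pos(7,8)]
    ups_ztbar[OF pos(7,8)] ups_zt_odd'[OF pos(7,8)]

lemma yx: "0 < y" "y < x" using xy by auto

section \<open>The first two sums of \<open>S1\<close>\<close>

lemma S1_first:
  "dps (\<lambda>a b. \<Sum>(p, q)\<in>{(p, q). p + q = a}. 8 * ztbar (2 * q) * mzv [2 * b + 2, 2 * p + 2]) (x ^ 2) (y ^ 2) (8 * (BX * Lyx))"
proof -
  have b: "\<bar>1 / real k ^ (2 * i + 2)\<bar> \<le> 1 / real k ^ 2" if "k \<ge> 1" for i k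
    using inverse_power_le[OF that, of "2 * i"] by simp
  have F: "ups (\<lambda>i. 1 / real k ^ (2 * i + 2)) (t ^ 2) (q t k)" if "k \<ge> 1" "\<bar>t\<bar> < 1" for k t
    using ups_power_step[OF sq_lt_1[OF that(2)] that(1), of 2 1 2] that(1) by (simp add: q_def)
  have "dps (\<lambda>i j. dsum (\<lambda>m. 1 / real m ^ (2 * i + 2)) (\<lambda>n. 1 / real n ^ (2 * j + 2))) (y ^ 2) (x ^ 2) (dsum (q y) (q x))"
    by (rule dps_interchange[OF b sq_lt_1[OF pos(4)] F b sq_lt_1[OF pos(2)] F]) (use pos in auto)
  hence "dps (\<lambda>a b. mzv [2 * b + 2, 2 * a + 2]) (x ^ 2) (y ^ 2) Lyx"
    unfolding mzv_2_eq Lyx_def by (rule dps_swap[THEN iffD1])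
  from dps_cmult[OF dps_mult_x[OF ups_x(5) this], of 8] show ?thesis
  proof (rule dps_eq[OF _ _ refl])
    fix a b :: nat
    show "8 * (\<Sum>(p, q)\<in>{(p, q). p + q = a}. ztbar (2 * p) * mzv [2 * b + 2, 2 * q + 2]) =
        (\<Sum>(p, q)\<in>{(p, q). p + q = a}. 8 * ztbar (2 * q) * mzv [2 * b + 2, 2 * p + 2])"
      unfolding sum_distrib_left by (rule sum.reindex_bij_witness[where i = prod.swap and j = prod.swap]) auto
  qed
qed

lemma S1_second:
  "dps (\<lambda>a b. \<Sum>(r, s)\<in>{(r, s). r + s = b}. 8 * of_bool (a > 0) * ztbar (2 * s) * mzv [2 * a + 1, 2 * r + 3]) (x ^ 2) (y ^ 2) (8 * (BY * (LA / y ^ 2)))"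
proof -
  \<comment> \<open>The condition a > 0 excludes the exponent 1, where the majorant 1/k^2 would
    fail; it also makes the series start at x^2, as \<open>Ap x\<close> does.\<close>
  have b: "\<bar>of_bool (i > 0) / real k ^ (2 * i + 1)\<bar> \<le> 1 / real k ^ 2" if "k \<ge> 1" for i k
    using inverse_power_le[OF that, of "2 * (i - 1) + 1"] by (cases i) (simp_all add: add_ac)
  have b': "\<bar>1 / real k ^ (2 * i + 3)\<bar> \<le> 1 / real k ^ 2" if "k \<ge> 1" for i k
    using inverse_power_le[OF that, of "2 * i + 1"] by (simp add: eval_nat_numeral)
  have F: "ups (\<lambda>i. of_bool (i > 0) / real k ^ (2 * i + 1)) (x ^ 2) (Ap x k)" if "k \<ge> 1" for k
  proof -
    have "ups (\<lambda>i. of_bool (i > 0) / real k ^ (2 * i + 1)) (x ^ 2) (x ^ 2 * (1 * (real k ^ 2 / (real k ^ 3 * (real k ^ 2 - x ^ 2)))))"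
      by (rule ups_shift_up[OF ups_power_step[OF sq_lt_1[OF pos(2)] that, of 2]]) (auto simp: eval_nat_numeral)
    thus ?thesis using that by (simp add: Ap_def power3_eq_cube power2_eq_square)
  qed
  have G: "ups (\<lambda>i. 1 / real k ^ (2 * i + 3)) (y ^ 2) (1 / y ^ 2 * Ap y k)" if "k \<ge> 1" for k
    using ups_power_step[OF sq_lt_1[OF pos(4)] that, of 2 1 3] that nz by (simp add: Ap_def power3_eq_cube power2_eq_square)
  have "dps (\<lambda>i j. dsum (\<lambda>m. of_bool (i > 0) / real m ^ (2 * i + 1)) (\<lambda>n. 1 / real n ^ (2 * j + 3))) (x ^ 2) (y ^ 2) (dsum (Ap x) (\<lambda>k. 1 / y ^ 2 * Ap y k))"
    by (rule dps_interchange[OF b sq_lt_1[OF pos(2)] F b' sq_lt_1[OF pos(4)] G])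
  moreover have "dsum (Ap x) (\<lambda>k. 1 / y ^ 2 * Ap y k) = LA / y ^ 2"
    using dsum_cmult[of 1 "Ap x" "1 / y ^ 2" "Ap y"] by (simp add: LA_def)
  moreover have "dsum (\<lambda>m. of_bool (i > 0) / real m ^ (2 * i + 1)) (\<lambda>n. 1 / real n ^ (2 * j + 3)) = of_bool (i > 0) * mzv [2 * i + 1, 2 * j + 3]" for i j
    using dsum_cmult[of "of_bool (i > 0)" "\<lambda>m. 1 / real m ^ (2 * i + 1)" 1 "\<lambda>n. 1 / real n ^ (2 * j + 3)"] by (simp add: mzv_2_eq)
  ultimately have "dps (\<lambda>a b. of_bool (a > 0) * mzv [2 * a + 1, 2 * b + 3]) (x ^ 2) (y ^ 2) (LA / y ^ 2)" by simp
  from dps_cmult[OF dps_mult_y[OF ups_y(5) this], of 8] show ?thesis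
  proof (rule dps_eq[OF _ _ refl])
    fix a b :: nat
    show "8 * (\<Sum>(r, s)\<in>{(r, s). r + s = b}. ztbar (2 * r) * (of_bool (a > 0) * mzv [2 * a + 1, 2 * s + 3])) =
        (\<Sum>(r, s)\<in>{(r, s). r + s = b}. 8 * of_bool (a > 0) * ztbar (2 * s) * mzv [2 * a + 1, 2 * r + 3])"
      unfolding sum_distrib_left by (rule sum.reindex_bij_witness[where i = prod.swap and j = prod.swap]) auto
  qed
qed

text \<open>The value of the bracket in the first sum of \<open>S2\<close>, with the index raised by
  one to fit \<open>kernel_even\<close>. The weight 2^(-2 n) halves the argument of
  \<open>Afun\<close>, and 4 compensates for (t/2)^2.\<close>

abbreviation W2 :: "real \<Rightarrow> real" where "W2 t \<equiv> 4 * Afun (t / 2) - 8 * Abar t"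

lemma ups_W2:
  assumes t: "0 < \<bar>t\<bar>" "\<bar>t\<bar> < 1"
  shows "ups (\<lambda>n. if n = 0 then 0 else 1 / 2 ^ (2 * (n - 1)) * zt (2 * (n - 1) + 3) - 8 * ztbar (2 * (n - 1) + 3)) (t ^ 2) (W2 t)"
proof -
  have "ups (\<lambda>i. zt (2 * i + 3)) ((t / 2) ^ 2) (Afun (t / 2) / (t / 2) ^ 2)"
    by (rule ups_zt_odd) (use t in auto)
  hence "ups (\<lambda>i. 1 / 2 ^ (2 * i) * zt (2 * i + 3)) (t ^ 2) (4 * Afun (t / 2) / t ^ 2)"
    by (simp add: ups_def power_divide power_mult) (simp add: mult.commute)
  from ups_diff[OF this ups_cmult[OF ups_ztbar_odd[OF t], of 8]]
  have "ups (\<lambda>n. if n = 0 then 0 else 1 / 2 ^ (2 * (n - 1)) * zt (2 * (n - 1) + 3) - 8 * ztbar (2 * (n - 1) + 3)) (t ^ 2)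
     (t ^ 2 * (4 * Afun (t / 2) / t ^ 2 - 8 * (Abar t / t ^ 2)))"
    by (rule ups_shift_up) auto
  moreover have "t ^ 2 * (4 * Afun (t / 2) / t ^ 2 - 8 * (Abar t / t ^ 2)) = W2 t" using t by (simp add: right_diff_distrib)
  ultimately show ?thesis by simp
qed

section \<open>The seven sums of \<open>S2\<close>\<close>

lemma S2_first:
  "dps (\<lambda>a b. \<Sum>(p, q, r, s) \<in> {(p, q, r, s). p + q = a \<and> r + s + 1 = b}.
        (1 / 2 ^ (2 * q + 2 * s) * zt (2 * q + 2 * s + 3) - 8 * ztbar (2 * s + 2 * q + 3))
          * real ((2 + 2 * q + 2 * s) choose (1 + 2 * s)) * zt (2 * r + 3) * ztbar (2 * p)) (x ^ 2) (y ^ 2)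
    (y ^ 2 * (BX * (Afun y / y ^ 2 * ((W2 (x + y) - W2 (x - y)) / (2 * x * y)))))"
proof (rule dps_shift_up_y)
  have K: "dps (\<lambda>q s. (1 / 2 ^ (2 * q + 2 * s) * zt (2 * q + 2 * s + 3) - 8 * ztbar (2 * s + 2 * q + 3)) * real ((2 + 2 * q + 2 * s) choose (1 + 2 * s))) (x ^ 2) (y ^ 2)
     ((W2 (x + y) - W2 (x - y)) / (2 * x * y))"
    by (rule dps_eq[OF kernel_even(2)[OF yx ups_W2[OF pos(5,6)] ups_W2[OF pos(7,8)]] _ refl]) (simp add: algebra_simps)
  show "dps (\<lambda>a b. \<Sum>(p, q, r, s) | p + q = a \<and> r + s = b. ztbar (2 * p) * (zt (2 * r + 3) * ((1 / 2 ^ (2 * q + 2 * s) * zt (2 * q + 2 * s + 3) - 8 * ztbar (2 * s + 2 * q + 3)) * real ((2 + 2 * q + 2 * s) choose (1 + 2 * s))))) (x ^ 2) (y ^ 2)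
      (BX * (Afun y / y ^ 2 * ((W2 (x + y) - W2 (x - y)) / (2 * x * y))))"
    by (rule dps_quad[OF ups_x(5) ups_y(1) K])
qed (auto intro!: sum.cong)

lemma S2_second:
  "dps (\<lambda>a b. \<Sum>(u, v, w) \<in> {(u, v, w). u + v + w + 1 = a}.
        8 * real ((2 * w + 2 * b + 2) choose (2 * b + 1)) * zt (2 * u + 3) * ztbar (2 * v) * ztbar (2 * b + 2 * w + 3)) (x ^ 2) (y ^ 2)
    (x ^ 2 * (8 * (Afun x / x ^ 2 * (BX * ((Abar (x + y) - Abar (x - y)) / (2 * x * y))))))"
proof (rule dps_shift_up_x)
  have W: "ups (\<lambda>n. if n = 0 then 0 else ztbar (2 * (n - 1) + 3)) (t ^ 2) (Abar t)" if t: "0 < \<bar>t\<bar>" "\<bar>t\<bar> < 1" for t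
  proof -
    have "ups (\<lambda>n. if n = 0 then 0 else ztbar (2 * (n - 1) + 3)) (t ^ 2) (t ^ 2 * (Abar t / t ^ 2))"
      by (rule ups_shift_up[OF ups_ztbar_odd[OF t]]) auto
    thus ?thesis using t by simp
  qed
  have K: "dps (\<lambda>w b. real ((2 * w + 2 * b + 2) choose (2 * b + 1)) * ztbar (2 * b + 2 * w + 3)) (x ^ 2) (y ^ 2)
     ((Abar (x + y) - Abar (x - y)) / (2 * x * y))"
    by (rule dps_eq[OF kernel_even(2)[OF yx W[OF pos(5,6)] W[OF pos(7,8)]] _ refl]) (simp add: algebra_simps)
  show "dps (\<lambda>a b. 8 * (\<Sum>(u, v, w) | u + v + w = a. zt (2 * u + 3) * (ztbar (2 * v) * (real ((2 * w + 2 * b + 2) choose (2 * b + 1)) * ztbar (2 * b + 2 * w + 3))))) (x ^ 2) (y ^ 2)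
      (8 * (Afun x / x ^ 2 * (BX * ((Abar (x + y) - Abar (x - y)) / (2 * x * y)))))"
    by (rule dps_cmult[OF dps_triple_x[OF ups_x(1) ups_x(5) K]])
qed (auto simp: sum_distrib_left intro!: sum.cong)

lemma S2_third:
  "dps (\<lambda>a b. \<Sum>(p, q) \<in> {(p, q). p + q + 2 = a}. 8 * zt (2 * p + 3) * zt (2 * q + 3) * ztbar (2 * b + 2)) (x ^ 2) (y ^ 2)
     (x ^ 2 * (x ^ 2 * (8 * (Afun x / x ^ 2 * (Afun x / x ^ 2) * Qe y))))"
proof (rule dps_shift_up_x, rule dps_shift_up_x)
  show "dps (\<lambda>a b. 8 * ((\<Sum>(p, q) | p + q = a. zt (2 * p + 3) * zt (2 * q + 3)) * ztbar (2 * b + 2))) (x ^ 2) (y ^ 2) (8 * (Afun x / x ^ 2 * (Afun x / x ^ 2) * Qe y))"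
    by (rule dps_cmult[OF dps_product[OF ups_mult[OF ups_x(1) ups_x(1)] ups_y(4)]])
  show "(\<Sum>(p, q) \<in> {(p, q). p + q + 1 = Suc a}. 8 * zt (2 * p + 3) * zt (2 * q + 3) * ztbar (2 * b + 2)) =
      8 * ((\<Sum>(p, q) | p + q = a. zt (2 * p + 3) * zt (2 * q + 3)) * ztbar (2 * b + 2))" for a b
    by (auto simp: sum_distrib_left sum_distrib_right intro!: sum.cong)
qed auto

lemma S2_fourth:
  "dps (\<lambda>a b. \<Sum>(r, s) \<in> {(r, s). r + s = b}. 8 * zt (2 * a + 1) * zt (2 * r + 3) * ztbar (2 * s)) (x ^ 2) (y ^ 2)
     (8 * (Afun x * (Afun y / y ^ 2 * BY)))"
  by (rule dps_eq[OF dps_cmult[OF dps_product[OF ups_x(6) ups_mult[OF ups_y(1) ups_y(5)]]] _ refl])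
     (auto simp: sum_distrib_left intro!: sum.cong)

lemma S2_fifth:
  "dps (\<lambda>a b. \<Sum>(u, v, w) \<in> {(u, v, w). u + v + w + 1 = b}.
        4 * of_bool (a = 0) * zt (2 * u + 3) * zt (2 * v + 3) * ztbar (2 * w)) (x ^ 2) (y ^ 2)
     (y ^ 2 * (4 * (Afun y / y ^ 2 * (Afun y / y ^ 2 * BY))))"
proof (rule dps_shift_up_y)
  show "dps (\<lambda>a b. 4 * (\<Sum>(u, v, w) | u + v + w = b. zt (2 * u + 3) * (zt (2 * v + 3) * (of_bool (a = 0) * ztbar (2 * w))))) (x ^ 2) (y ^ 2)
     (4 * (Afun y / y ^ 2 * (Afun y / y ^ 2 * BY)))"
    by (rule dps_cmult[OF dps_triple_y[OF ups_y(1) ups_y(1) dps_of_ups_y[OF ups_y(5)]]])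
qed (auto simp: sum_distrib_left intro!: sum.cong)

lemma dps_zt_odd: "dps (\<lambda>q s. real ((2 * q + 2 * s) choose (2 * s)) * zt (2 * q + 2 * s + 1)) (x ^ 2) (y ^ 2) ((Afun (x + y) + Afun (x - y)) / 2)"
  by (rule dps_eq[OF kernel_even(1)[OF yx ups_p(6) ups_m(6)] _ refl]) (simp add: algebra_simps)

text \<open>The condition p + q + 1 = a is a factor x^2, and r + s = b + 1 a division by y^2. The
  row to be subtracted first has r = s = 0, where the barred value is -1/2.\<close>

lemma S2_sixth:
  "dps (\<lambda>a b. \<Sum>(p, q, r, s) \<in> {(p, q, r, s). p + q + 1 = a \<and> r + s = b + 1}.
        8 * real ((2 * q + 2 * s) choose (2 * s)) * ztbar (2 * r) * zt (2 * p + 3) * zt (2 * q + 2 * s + 1)) (x ^ 2) (y ^ 2)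
    (x ^ 2 * (8 * ((Afun x / x ^ 2 * (BY * ((Afun (x + y) + Afun (x - y)) / 2)) - Afun x / x ^ 2 * (- 1 / 2 * Afun x)) / y ^ 2)))"
proof (rule dps_shift_up_x)
  let ?K = "\<lambda>q s. real ((2 * q + 2 * s) choose (2 * s)) * zt (2 * q + 2 * s + 1)"
  let ?c = "\<lambda>a b. \<Sum>(p, q, r, s) | p + q = a \<and> r + s = b. zt (2 * p + 3) * (ztbar (2 * r) * ?K q s)"
  have c: "dps ?c (x ^ 2) (y ^ 2) (Afun x / x ^ 2 * (BY * ((Afun (x + y) + Afun (x - y)) / 2)))"
    by (rule dps_quad[OF ups_x(1) ups_y(5) dps_zt_odd])
  have "?c a 0 = (\<Sum>(p, q) | p + q = a. zt (2 * p + 3) * (- 1 / 2 * zt (2 * q + 1)))" for a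
    by (rule sum.reindex_bij_witness[where i = "\<lambda>(p, q). (p, q, 0, 0)" and j = "\<lambda>(p, q, r, s). (p, q)"]) (auto simp: ztbar_0)
  hence row: "ups (\<lambda>a. ?c a 0) (x ^ 2) (Afun x / x ^ 2 * (- 1 / 2 * Afun x))"
    using ups_mult[OF ups_x(1) ups_cmult[OF ups_x(6), of "- 1 / 2"]] by simp
  show "dps (\<lambda>a b. 8 * ?c a (Suc b)) (x ^ 2) (y ^ 2)
     (8 * ((Afun x / x ^ 2 * (BY * ((Afun (x + y) + Afun (x - y)) / 2)) - Afun x / x ^ 2 * (- 1 / 2 * Afun x)) / y ^ 2))"
    by (rule dps_cmult[OF dps_shift_down_y[OF c row nz(4)]])
qed (auto simp: sum_distrib_left intro!: sum.cong)

lemma S2_seventh: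
  "dps (\<lambda>a b. \<Sum>(u, v, w) \<in> {(u, v, w). u + v + w = b}.
        8 * real ((2 * a + 2 * v) choose (2 * v)) * ztbar (2 * u) * zt (2 * w + 3) * zt (2 * a + 2 * v + 1)) (x ^ 2) (y ^ 2)
    (8 * (BY * (Afun y / y ^ 2 * ((Afun (x + y) + Afun (x - y)) / 2))))"
proof (rule dps_eq[OF dps_cmult[OF dps_triple_y[OF ups_y(5) ups_y(1) dps_zt_odd]] _ refl])
  fix a b :: nat
  show "8 * (\<Sum>(p, q, r)\<in>{(p, q, r). p + q + r = b}. ztbar (2 * p) * (zt (2 * q + 3) * (real ((2 * a + 2 * r) choose (2 * r)) * zt (2 * a + 2 * r + 1)))) =
    (\<Sum>(u, v, w) \<in> {(u, v, w). u + v + w = b}.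
        8 * real ((2 * a + 2 * v) choose (2 * v)) * ztbar (2 * u) * zt (2 * w + 3) * zt (2 * a + 2 * v + 1))"
    unfolding sum_distrib_left
    by (rule sum.reindex_bij_witness[where i = "\<lambda>(u, v, w). (u, w, v)" and j = "\<lambda>(u, v, w). (u, w, v)"]) auto
qed

section \<open>The sums of \<open>S3\<close> without Euler numbers\<close>

lemma S3_h3: "dps (\<lambda>a b. 2 * ztbar (2 * a + 2 * b + 4)) (x ^ 2) (y ^ 2) (2 * ((Qe x - Qe y) / (x ^ 2 - y ^ 2)))"
proof (rule dps_eq[OF dps_cmult[OF dps_diagonal[OF ups_x(4) ups_y(4)]] _ refl])
  show "2 * ztbar (2 * Suc (a + b) + 2) = 2 * ztbar (2 * a + 2 * b + 4)" for a b
    by (intro arg_cong[where f = "\<lambda>n. 2 * ztbar n"]) simp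
qed (use xy in \<open>auto intro: power_strict_mono\<close>)

text \<open>The term p = 0 contains the binomial coefficient (2 b over 2 b + 1) = 0. Without it the
  condition p + q = a + 1 is an ordinary convolution.\<close>

lemma S3_h4:
  "dps (\<lambda>a b. \<Sum>(p, q) \<in> {(p, q). p + q = a + 1}.
          4 / 2 ^ (2 * p + 2 * b) * real ((2 * p + 2 * b) choose (2 * b + 1)) * zt (2 * p + 2 * b + 2) * ztbar (2 * q)) (x ^ 2) (y ^ 2)
    (4 * (BX * ((Q1 ((x + y) / 2) - Q1 ((x - y) / 2)) / (2 * x * y))))"
proof -
  have c: "ups (\<lambda>n. 1 / 2 ^ (2 * n) * zt (2 * n + 2)) (t ^ 2) (Q1 (t / 2))" if "0 < \<bar>t\<bar>" "\<bar>t\<bar> < 1" for t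
    using ups_zt_even[of "t / 2"] that by (simp add: ups_def power_divide power_mult)
  have K: "dps (\<lambda>p b. 1 / 2 ^ (2 * p + 2 * b + 2) * real ((2 * p + 2 * b + 2) choose (2 * b + 1)) * zt (2 * p + 2 * b + 4)) (x ^ 2) (y ^ 2)
     ((Q1 ((x + y) / 2) - Q1 ((x - y) / 2)) / (2 * x * y))"
  proof (rule dps_eq[OF kernel_even(2)[OF yx c[OF pos(5,6)] c[OF pos(7,8)]] _ refl])
    fix p b :: nat
    have i: "2 * (p + b + 1) = 2 * p + 2 * b + 2" "2 * p + 2 * b + 2 + 2 = 2 * p + 2 * b + 4" by simp_all
    show "real ((2 * p + 2 * b + 2) choose (2 * b + 1)) * (1 / 2 ^ (2 * (p + b + 1)) * zt (2 * (p + b + 1) + 2)) =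
        1 / 2 ^ (2 * p + 2 * b + 2) * real ((2 * p + 2 * b + 2) choose (2 * b + 1)) * zt (2 * p + 2 * b + 4)"
      unfolding i by (simp only: mult_ac)
  qed
  have s4: "Suc (Suc (Suc (Suc n))) = 4 + n" for n by simp
  show ?thesis
  proof (rule dps_eq[OF dps_cmult[OF dps_mult_x[OF ups_x(5) K]] _ refl])
    fix a b :: nat
    show "4 * (\<Sum>(p, q)\<in>{(p, q). p + q = a}. ztbar (2 * p) * (1 / 2 ^ (2 * q + 2 * b + 2) * real ((2 * q + 2 * b + 2) choose (2 * b + 1)) * zt (2 * q + 2 * b + 4))) =
      (\<Sum>(p, q) \<in> {(p, q). p + q = a + 1}.
          4 / 2 ^ (2 * p + 2 * b) * real ((2 * p + 2 * b) choose (2 * b + 1)) * zt (2 * p + 2 * b + 2) * ztbar (2 * q))"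
      unfolding sum_pairs_Suc sum_distrib_left
      by (subst binomial_eq_0, simp, simp del: binomial_Suc_Suc,
          rule sum.reindex_bij_witness[where i = prod.swap and j = prod.swap]) (auto simp: add_ac s4 simp del: binomial_Suc_Suc)
  qed
qed

lemma S3_h5:
  "dps (\<lambda>a b. \<Sum>(u, v, w) \<in> {(u, v, w). u + v + w = a}.
          8 * real ((2 * u + 2 * b + 1) choose (2 * b + 1)) * ztbar (2 * w) * zt (2 * v + 2) * ztbar (2 * u + 2 * b + 2)) (x ^ 2) (y ^ 2)
    (8 * (BX * (Q1 x * (((x + y) * Qe (x + y) - (x - y) * Qe (x - y)) / (2 * y)))))"
proof -
  have K: "dps (\<lambda>u b. real ((2 * u + 2 * b + 1) choose (2 * b + 1)) * ztbar (2 * u + 2 * b + 2)) (x ^ 2) (y ^ 2)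
     (((x + y) * Qe (x + y) - (x - y) * Qe (x - y)) / (2 * y))"
    by (rule dps_eq[OF kernel_odd(1)[OF yx ups_p(4) ups_m(4)] _ refl]) (simp add: algebra_simps)
  show ?thesis
  proof (rule dps_eq[OF dps_cmult[OF dps_triple_x[OF ups_x(5) ups_x(3) K]] _ refl])
    fix a b :: nat
    show "8 * (\<Sum>(p, q, r)\<in>{(p, q, r). p + q + r = a}. ztbar (2 * p) * (zt (2 * q + 2) * (real ((2 * r + 2 * b + 1) choose (2 * b + 1)) * ztbar (2 * r + 2 * b + 2)))) =
      (\<Sum>(u, v, w) \<in> {(u, v, w). u + v + w = a}.
          8 * real ((2 * u + 2 * b + 1) choose (2 * b + 1)) * ztbar (2 * w) * zt (2 * v + 2) * ztbar (2 * u + 2 * b + 2))"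
      unfolding sum_distrib_left
      by (rule sum.reindex_bij_witness[where i = "\<lambda>(u, v, w). (w, v, u)" and j = "\<lambda>(u, v, w). (w, v, u)"]) auto
  qed
qed

text \<open>The generating function of a zeta(2 a + 2), obtained from the sum of x^2/(k^2 - x^2)^2.
  It is needed for the row b = 0 of the next convolution, where the difference of binomials is 1 -
  (2 a + 1).\<close>

definition Dz where "Dz = (theta x ^ 2 - 1 / x ^ 2 - 2 * Q1 x) / 4"

lemma ups_Dz: "ups (\<lambda>a. real a * zt (2 * a + 2)) (x ^ 2) Dz"
proof -
  have X: "\<bar>x ^ 2\<bar> < 1" by (rule sq_lt_1[OF pos(2)])
  define F where "F k = x ^ 2 / (real k ^ 2 - x ^ 2) ^ 2" for k :: nat
  have "(F has_sum Dz) {1..}"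
  proof -
    have "((\<lambda>k. ((1 / (real k - x) ^ 2 + 1 / (real k + x) ^ 2) - 2 * q x k) / 4) has_sum ((theta x ^ 2 - 1 / x ^ 2) - 2 * Q1 x) / 4) {1..}"
      by (intro has_sum_divide_const has_sum_diff has_sum_cmult_right q_has_sum non_Ints csc_square_has_sum) (use pos in auto)
    also have "?this \<longleftrightarrow> (F has_sum ((theta x ^ 2 - 1 / x ^ 2) - 2 * Q1 x) / 4) {1..}"
    proof (rule has_sum_cong)
      fix k :: nat
      define u v where "u = real k - x" and "v = real k + x"
      have uv: "u \<noteq> 0" "v \<noteq> 0" using denoms[of k] by (auto simp: u_def v_def)
      have e: "real k ^ 2 - x ^ 2 = u * v" "x = (v - u) / 2" by (simp_all add: u_def v_def power2_eq_square algebra_simps)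
      have "((1 / u ^ 2 + 1 / v ^ 2) - 2 * (1 / (u * v))) / 4 = ((v - u) / 2) ^ 2 / (u * v) ^ 2"
        using uv by (simp add: divide_simps power2_eq_square) (simp add: algebra_simps)
      thus "((1 / (real k - x) ^ 2 + 1 / (real k + x) ^ 2) - 2 * q x k) / 4 = F k"
        unfolding F_def q_def e(1) u_def[symmetric] v_def[symmetric] e(2)[symmetric] .
    qed
    finally show ?thesis by (simp add: Dz_def)
  qed
  moreover have "((\<lambda>a. infsum (\<lambda>k. 1 / real k ^ (2 * a + 2)) {1..} * (real a * (x ^ 2) ^ a)) has_sum infsum F {1..}) UNIV"
  proof (rule has_sum_interchange(1)[where w = "\<lambda>k. 1 / real k ^ 2"])
    show "\<bar>1 / real k ^ (2 * a + 2)\<bar> \<le> 1 / real k ^ 2" if "k \<in> {1..}" for a k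
      using inverse_power_le[of k "2 * a"] that by simp
    have "(\<lambda>a. real a * (x ^ 2) ^ a) summable_on UNIV"
      by (rule has_sum_imp_summable[OF arithmetic_geometric_has_sum[OF X]])
    thus "(\<lambda>a. \<bar>real a * (x ^ 2) ^ a\<bar>) summable_on UNIV" by (simp add: abs_mult power_abs)
    fix k :: nat assume "k \<in> {1..}"
    hence k: "real k ^ 2 \<ge> 1" by simp
    have z: "\<bar>x ^ 2 / real k ^ 2\<bar> < 1"
    proof -
      have "x ^ 2 / real k ^ 2 \<le> x ^ 2 / 1" using k \<open>k \<in> {1..}\<close> by (intro divide_left_mono) auto
      thus ?thesis using X by simp
    qed
    have "((\<lambda>a. 1 / real k ^ 2 * (real a * (x ^ 2 / real k ^ 2) ^ a)) has_sum 1 / real k ^ 2 * ((x ^ 2 / real k ^ 2) / (1 - x ^ 2 / real k ^ 2) ^ 2)) UNIV"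
      by (intro has_sum_cmult_right arithmetic_geometric_has_sum z)
    moreover have "1 / real k ^ 2 * (real a * (x ^ 2 / real k ^ 2) ^ a) = 1 / real k ^ (2 * a + 2) * (real a * (x ^ 2) ^ a)" for a
      by (simp add: power_divide power_add power_mult power2_eq_square)
    moreover have "1 / real k ^ 2 * ((x ^ 2 / real k ^ 2) / (1 - x ^ 2 / real k ^ 2) ^ 2) = F k"
    proof -
      define K where "K = real k ^ 2"
      have "K \<noteq> 0" "K - x ^ 2 \<noteq> 0" using k \<open>k \<in> {1..}\<close> sq_denoms[of k] by (auto simp: K_def)
      hence "1 / K * ((x ^ 2 / K) / ((K - x ^ 2) / K) ^ 2) = x ^ 2 / (K - x ^ 2) ^ 2"
        by (simp add: power_divide power2_eq_square)
      moreover have "1 - x ^ 2 / K = (K - x ^ 2) / K" using \<open>K \<noteq> 0\<close> by (simp add: diff_divide_distrib)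
      ultimately show ?thesis by (simp add: F_def K_def)
    qed
    ultimately show "((\<lambda>a. 1 / real k ^ (2 * a + 2) * (real a * (x ^ 2) ^ a)) has_sum F k) UNIV" by (simp only:)
  qed (rule inverse_square_summable)
  moreover have "infsum (\<lambda>k. 1 / real k ^ (2 * a + 2)) {1..} = zt (2 * a + 2)" for a
    using infsumI[OF zt_has_sum[of "2 * a + 2"]] by simp
  ultimately show ?thesis by (simp add: ups_def infsumI mult_ac)
qed

lemma S3_h6:
  "dps (\<lambda>a b. \<Sum>(r, s) \<in> {(r, s). r + s = b + 1}.
          4 * (real ((2 * a + 2 * r + 1) choose (2 * a + 1)) - real ((2 * a + 2 * r + 1) choose (2 * r + 1)))
            * zt (2 * a + 2 * r + 2) * ztbar (2 * s)) (x ^ 2) (y ^ 2)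
    (4 * ((BY * (((x + y) * Q1 (x + y) + (x - y) * Q1 (x - y)) / (2 * x) - ((x + y) * Q1 (x + y) - (x - y) * Q1 (x - y)) / (2 * y)) - Dz) / y ^ 2))"
proof -
  let ?K = "\<lambda>a r. (real ((2 * a + 2 * r + 1) choose (2 * a + 1)) - real ((2 * a + 2 * r + 1) choose (2 * r + 1))) * zt (2 * a + 2 * r + 2)"
  have sym: "(2 * a + 2 * r + 1) choose (2 * r) = (2 * a + 2 * r + 1) choose (2 * a + 1)" for a r :: nat
    using binomial_symmetric[of "2 * r" "2 * a + 2 * r + 1"] by simp
  have K: "dps ?K (x ^ 2) (y ^ 2) (((x + y) * Q1 (x + y) + (x - y) * Q1 (x - y)) / (2 * x) - ((x + y) * Q1 (x + y) - (x - y) * Q1 (x - y)) / (2 * y))"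
    by (rule dps_eq[OF dps_diff[OF kernel_odd(2)[OF yx ups_p(3) ups_m(3)] kernel_odd(1)[OF yx ups_p(3) ups_m(3)]] _ refl])
       (unfold sym, simp only: distrib_left left_diff_distrib)
  have "?K a 0 = - 2 * (real a * zt (2 * a + 2))" for a by simp
  hence row: "ups (\<lambda>a. ?K a 0) (x ^ 2) (- 2 * Dz)" using ups_cmult[OF ups_Dz, of "- 2"] by (simp only:)
  show ?thesis
  proof (rule dps_eq[OF dps_cmult[OF dps_shift_conv[OF ups_y(5) K row nz(4)], of 4]])
    fix a b :: nat
    show "4 * (\<Sum>(r, s)\<in>{(r, s). r + s = b + 1}. ztbar (2 * r) * ?K a s) = (\<Sum>(r, s) \<in> {(r, s). r + s = b + 1}.
          4 * (real ((2 * a + 2 * r + 1) choose (2 * a + 1)) - real ((2 * a + 2 * r + 1) choose (2 * r + 1)))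
            * zt (2 * a + 2 * r + 2) * ztbar (2 * s))"
      unfolding sum_distrib_left by (rule sum.reindex_bij_witness[where i = prod.swap and j = prod.swap]) auto
  qed (simp add: ztbar_0)
qed

text \<open>The zeta value depends on a + r alone, so \<open>dps_diagonal\<close> applies; a zero is
  put in front of the even zeta values so that the diagonal begins at zeta(2).\<close>

lemma S3_h7:
  "dps (\<lambda>a b. \<Sum>(r, s) \<in> {(r, s). r + s = b + 1}. 4 * zt (2 * a + 2 * r + 2) * ztbar (2 * s)) (x ^ 2) (y ^ 2)
    (4 * ((BY * ((x ^ 2 * Q1 x - y ^ 2 * Q1 y) / (x ^ 2 - y ^ 2)) + Q1 x / 2) / y ^ 2))"
proof -
  have c: "ups (\<lambda>n. if n = 0 then 0 else zt (2 * n)) (t ^ 2) (t ^ 2 * Q1 t)" if "0 < \<bar>t\<bar>" "\<bar>t\<bar> < 1" for t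
    by (rule ups_shift_up[OF ups_zt_even[OF that]]) auto
  have K: "dps (\<lambda>a r. zt (2 * a + 2 * r + 2)) (x ^ 2) (y ^ 2) ((x ^ 2 * Q1 x - y ^ 2 * Q1 y) / (x ^ 2 - y ^ 2))"
    by (rule dps_eq[OF dps_diagonal[OF c[OF pos(1,2)] c[OF pos(3,4)]] _ refl]) (use xy in \<open>auto simp: algebra_simps power_strict_mono\<close>)
  have row: "ups (\<lambda>a. zt (2 * a + 2 * 0 + 2)) (x ^ 2) (Q1 x)" using ups_x(3) by simp
  show ?thesis
  proof (rule dps_eq[OF dps_cmult[OF dps_shift_conv[OF ups_y(5) K row nz(4)], of 4]])
    fix a b :: nat
    show "4 * (\<Sum>(r, s)\<in>{(r, s). r + s = b + 1}. ztbar (2 * r) * zt (2 * a + 2 * s + 2)) =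
        (\<Sum>(r, s) \<in> {(r, s). r + s = b + 1}. 4 * zt (2 * a + 2 * r + 2) * ztbar (2 * s))"
      unfolding sum_distrib_left by (rule sum.reindex_bij_witness[where i = prod.swap and j = prod.swap]) auto
  qed (simp add: ztbar_0)
qed

lemma S3_h8:
  "dps (\<lambda>a b. \<Sum>(u, v, w) \<in> {(u, v, w). u + v + w = b}.
          4 * of_bool (a = 0) * zt (2 * u + 2) * zt (2 * v + 2) * ztbar (2 * w)) (x ^ 2) (y ^ 2) (4 * (Q1 y * (Q1 y * BY)))"
  by (rule dps_eq[OF dps_cmult[OF dps_triple_y[OF ups_y(3) ups_y(3) dps_of_ups_y[OF ups_y(5)]]] _ refl])
     (auto simp: sum_distrib_left intro!: sum.cong)

lemma zt_2: "zt 2 = pi ^ 2 / 6"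
  by (rule has_sum_unique[OF zt_has_sum[OF order_refl] zeta_2_has_sum])

lemma zt_2': "zt (Suc (Suc 0)) = pi ^ 2 / 6"
  by (metis zt_2 numeral_2_eq_2)

lemma S3_h9:
  "dps (\<lambda>a b. \<Sum>(r, s) \<in> {(r, s). r + s = b + 1}. 8 * of_bool (a = 0) * zt (2 * r + 2) * ztbar (2 * s)) (x ^ 2) (y ^ 2)
     (8 * ((BY * Q1 y + pi ^ 2 / 12) / y ^ 2))"
proof -
  have row: "ups (\<lambda>a. of_bool (a = 0) * zt (2 * 0 + 2)) (x ^ 2) (pi ^ 2 / 6)"
    unfolding ups_def by (rule has_sum_finite_neutralI[of "{0}"]) (auto simp: zt_2')
  show ?thesis
  proof (rule dps_eq[OF dps_cmult[OF dps_shift_conv[OF ups_y(5) dps_of_ups_y[OF ups_y(3)] row nz(4)], of 8]])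
    fix a b :: nat
    show "8 * (\<Sum>(r, s)\<in>{(r, s). r + s = b + 1}. ztbar (2 * r) * (of_bool (a = 0) * zt (2 * s + 2))) =
        (\<Sum>(r, s) \<in> {(r, s). r + s = b + 1}. 8 * of_bool (a = 0) * zt (2 * r + 2) * ztbar (2 * s))"
      unfolding sum_distrib_left by (rule sum.reindex_bij_witness[where i = prod.swap and j = prod.swap]) auto
  qed (simp add: ztbar_0)
qed

lemma S3_h10: "dps (\<lambda>a b. 8 * of_bool (a = 0) * zt 2 * ztbar (2 * b + 2)) (x ^ 2) (y ^ 2) (8 * zt 2 * Qe y)"
  by (rule dps_eq[OF dps_cmult[OF dps_of_ups_y[OF ups_y(4)]] _ refl]) simp

end

section \<open>The third sum of \<open>S1\<close>\<close>

definition third_coeff :: "nat \<Rightarrow> nat \<Rightarrow> real" where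
  "third_coeff a b = (\<Sum>(i, j) | i + j = 2 * a + 2 * b.
     (1 / 2 ^ i * real ((i + 1) choose (2 * b + 1)) + 1 / 2 ^ j * real ((j + 1) choose (2 * a + 1))) * mzv [i + 2, j + 2])"

text \<open>The coefficients of \<open>pairsum\<close>; they vanish on the axes because each factor
  \<open>al\<close> begins with the first power of its variable.\<close>

definition shifted_mzv :: "nat \<Rightarrow> nat \<Rightarrow> real" where
  "shifted_mzv i j = of_bool (i > 0 \<and> j > 0) * mzv [i + 1, j + 1]"

lemma shifted_mzv_eq: "shifted_mzv i j = of_bool (i > 0 \<and> j > 0) * mzv [i - 1 + 2, j - 1 + 2]"
  by (cases i; cases j) (simp_all add: shifted_mzv_def)

lemma pairsum_eq_dsum: "pairsum u v = dsum (\<lambda>m. al m u) (\<lambda>n. al n v)"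
  by (simp add: pairsum_def dsum_def)

lemma dps_pairsum:
  assumes u: "\<bar>u\<bar> < 1" and v: "\<bar>v\<bar> < 1"
  shows "dps shifted_mzv u v (pairsum u v)"
proof -
  have b: "\<bar>of_bool (i > 0) / real k ^ (i + 1)\<bar> \<le> 1 / real k ^ 2" if "k \<ge> 1" for i k
    using inverse_power_le[OF that, of "i - 1"] by (cases i) (simp_all add: add_ac)
  have F: "ups (\<lambda>i. of_bool (i > 0) / real k ^ (i + 1)) t (al k t)" if "k \<ge> 1" "\<bar>t\<bar> < 1" for k t
  proof -
    have "ups (\<lambda>i. of_bool (i > 0) / real k ^ (i + 1)) t (t * (1 * (real k ^ 1 / (real k ^ 2 * (real k ^ 1 - t)))))"
      by (rule ups_shift_up[OF ups_power_step[OF that(2,1), of 1]]) (auto simp: eval_nat_numeral)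
    moreover have "t * (1 * (real k ^ 1 / (real k ^ 2 * (real k ^ 1 - t)))) = al k t"
    proof -
      have "real k \<noteq> 0" "real k - t \<noteq> 0" using that by auto
      thus ?thesis by (simp add: al_def power2_eq_square divide_simps)
    qed
    ultimately show ?thesis by simp
  qed
  have "dps (\<lambda>i j. dsum (\<lambda>m. of_bool (i > 0) / real m ^ (i + 1)) (\<lambda>n. of_bool (j > 0) / real n ^ (j + 1))) u v (dsum (\<lambda>k. al k u) (\<lambda>k. al k v))"
    by (rule dps_interchange[OF b u F[OF _ u] b v F[OF _ v]])
  moreover have "dsum (\<lambda>m. of_bool (i > 0) / real m ^ (i + 1)) (\<lambda>n. of_bool (j > 0) / real n ^ (j + 1)) = shifted_mzv i j" for i j
    using dsum_cmult[of "of_bool (i > 0)" "\<lambda>m. 1 / real m ^ (i + 1)" "of_bool (j > 0)" "\<lambda>n. 1 / real n ^ (j + 1)"]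
    by (simp add: mzv_2_eq shifted_mzv_def of_bool_conj)
  ultimately show ?thesis by (simp add: pairsum_eq_dsum)
qed

text \<open>The first variable is U + V while the second is U itself, so powers of U are collected
  from two sources. Triples (p, l, j) are ungrouped from (p + l, j) and regrouped by (p + j,
  l).\<close>

lemma dps_subst:
  assumes c: "dps c (U + V) U S" and n: "(\<lambda>z. \<bar>(\<lambda>(i, j). c i j * ((\<bar>U\<bar> + \<bar>V\<bar>) ^ i * \<bar>U\<bar> ^ j)) z\<bar>) summable_on UNIV"
  shows "dps (\<lambda>k l. \<Sum>(p, j) | p + j = k. real ((p + l) choose l) * c (p + l) j) U V S"
proof -
  let ?h = "\<lambda>(p, l, j). real ((p + l) choose l) * c (p + l) j * (U ^ (p + j) * V ^ l)"
  let ?\<phi> = "\<lambda>(p, l, j). (p + l, j) :: nat \<times> nat"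
  let ?\<psi> = "\<lambda>(p, l, j). (p + j, l) :: nat \<times> nat"
  have bin: "(\<Sum>b\<le>n. real (n choose b) * (U ^ (n - b) * V ^ b)) = (U + V) ^ n" for U V :: real and n
    by (subst add.commute, subst binomial_ring) (simp add: mult_ac)
  have sum: "(\<Sum>i | ?\<phi> i = (n, j). (\<lambda>(p, l, j). real ((p + l) choose l) * d (p + l) j * (A ^ (p + j) * B ^ l)) i) =
      d n j * ((A + B) ^ n * A ^ j)" for n j A B and d :: "nat \<Rightarrow> nat \<Rightarrow> real"
  proof -
    have "(\<Sum>i | ?\<phi> i = (n, j). (\<lambda>(p, l, j). real ((p + l) choose l) * d (p + l) j * (A ^ (p + j) * B ^ l)) i) =
        (\<Sum>l\<le>n. d n j * A ^ j * (real (n choose l) * (A ^ (n - l) * B ^ l)))"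
      by (rule sum.reindex_bij_witness[where i = "\<lambda>l. (n - l, l, j)" and j = "\<lambda>(p, l, j). l"]) (auto simp: power_add)
    also have "\<dots> = d n j * A ^ j * (A + B) ^ n" by (simp only: sum_distrib_left[symmetric] bin)
    finally show ?thesis by (simp only: mult_ac)
  qed
  have a: "\<bar>?h i\<bar> = (\<lambda>(p, l, j). real ((p + l) choose l) * \<bar>c (p + l) j\<bar> * (\<bar>U\<bar> ^ (p + j) * \<bar>V\<bar> ^ l)) i" for i
    by (cases i) (simp add: abs_mult power_abs)
  have "(?h has_sum S) UNIV"
  proof (rule has_sum_ungroup[where \<phi> = ?\<phi>])
    have "(\<lambda>z. \<Sum>i | ?\<phi> i = z. ?h i) = (\<lambda>(i, j). c i j * ((U + V) ^ i * U ^ j))"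
      by (rule ext) (simp only: split_paired_all prod.case sum)
    thus "((\<lambda>z. \<Sum>i | ?\<phi> i = z. ?h i) has_sum S) UNIV" using c unfolding dps_def by (simp only:)
    have "(\<lambda>z. \<Sum>i | ?\<phi> i = z. \<bar>?h i\<bar>) = (\<lambda>(i, j). \<bar>c i j\<bar> * ((\<bar>U\<bar> + \<bar>V\<bar>) ^ i * \<bar>U\<bar> ^ j))"
      unfolding a by (rule ext) (simp only: split_paired_all prod.case sum[where d = "\<lambda>i j. \<bar>c i j\<bar>"])
    thus "(\<lambda>z. \<Sum>i | ?\<phi> i = z. \<bar>?h i\<bar>) summable_on UNIV" using n by (simp add: case_prod_unfold abs_mult power_abs)
    show "finite {i. ?\<phi> i = z}" for z
      by (rule finite_subset[of _ "{..fst z} \<times> {..fst z} \<times> {snd z}"]) auto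
  qed
  hence "((\<lambda>z. \<Sum>i | ?\<psi> i = z. ?h i) has_sum S) UNIV"
  proof (rule has_sum_regroup)
    show "finite {i. ?\<psi> i = z}" for z
      by (rule finite_subset[of _ "{..fst z} \<times> {snd z} \<times> {..fst z}"]) auto
  qed
  moreover have "(\<Sum>i | ?\<psi> i = (k, l). ?h i) = (\<Sum>(p, j) | p + j = k. real ((p + l) choose l) * c (p + l) j) * (U ^ k * V ^ l)" for k l
    unfolding sum_distrib_right
    by (rule sum.reindex_bij_witness[where i = "\<lambda>(p, j). (p, l, j)" and j = "\<lambda>(p, l, j). (p, j)"]) auto
  hence "(\<lambda>z. \<Sum>i | ?\<psi> i = z. ?h i) = (\<lambda>(k, l). (\<Sum>(p, j) | p + j = k. real ((p + l) choose l) * c (p + l) j) * (U ^ k * V ^ l))"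
    by (intro ext) (simp only: split_paired_all prod.case)
  ultimately show ?thesis unfolding dps_def by (simp only:)
qed

lemma dps_pairsum_subst:
  assumes UV: "\<bar>U\<bar> + \<bar>V\<bar> < 1"
  shows "dps (\<lambda>k l. \<Sum>(p, j) | p + j = k. real ((p + l) choose l) * (shifted_mzv (p + l) j / 2 ^ (p + l))) U V (pairsum ((U + V) / 2) U)"
    "dps (\<lambda>k l. \<Sum>(p, j) | p + j = k. real ((p + l) choose l) * (shifted_mzv j (p + l) / 2 ^ (p + l))) U V (pairsum U ((U + V) / 2))"
proof -
  have uv: "\<bar>(U + V) / 2\<bar> < 1" "\<bar>U\<bar> < 1" "\<bar>(\<bar>U\<bar> + \<bar>V\<bar>) / 2\<bar> < 1" "\<bar>\<bar>U\<bar>\<bar> < 1" using UV by auto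
  have pw: "shifted_mzv i j * ((X / 2) ^ i * Y ^ j) = shifted_mzv i j / 2 ^ i * (X ^ i * Y ^ j)" for i j X Y
    by (simp add: power_divide)
  have pw': "shifted_mzv j i * ((X / 2) ^ i * Y ^ j) = shifted_mzv j i / 2 ^ i * (X ^ i * Y ^ j)" for i j X Y
    by (simp add: power_divide)
  have ab: "(\<lambda>z. \<bar>(\<lambda>(i, j). c i j * (X ^ i * Y ^ j)) z\<bar>) summable_on UNIV" if "dps c X Y S" for c X Y S
    using summable_on_iff_abs_summable_on_real[THEN iffD1, OF has_sum_imp_summable[OF that[unfolded dps_def]]] by simp
  have 1: "dps (\<lambda>i j. shifted_mzv i j / 2 ^ i) X Y (pairsum (X / 2) Y)" if "\<bar>X / 2\<bar> < 1" "\<bar>Y\<bar> < 1" for X Y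
    using dps_pairsum[OF that] unfolding dps_def pw .
  have 2: "dps (\<lambda>i j. shifted_mzv j i / 2 ^ i) X Y (pairsum Y (X / 2))" if "\<bar>X / 2\<bar> < 1" "\<bar>Y\<bar> < 1" for X Y
    using dps_pairsum[OF that(2,1)] unfolding dps_swap[of shifted_mzv] unfolding dps_def pw' .
  show "dps (\<lambda>k l. \<Sum>(p, j) | p + j = k. real ((p + l) choose l) * (shifted_mzv (p + l) j / 2 ^ (p + l))) U V (pairsum ((U + V) / 2) U)"
    by (rule dps_subst[OF 1[OF uv(1,2)] ab[OF 1[OF uv(3,4)]]])
  show "dps (\<lambda>k l. \<Sum>(p, j) | p + j = k. real ((p + l) choose l) * (shifted_mzv j (p + l) / 2 ^ (p + l))) U V (pairsum U ((U + V) / 2))"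
    by (rule dps_subst[OF 2[OF uv(1,2)] ab[OF 2[OF uv(3,4)]]])
qed

text \<open>With i = p + 2 b, the indices i < 2 b may be added since their binomial coefficient is
  0; j is lowered by one, the value j = 0 having coefficient 0.\<close>

lemma third_sum_reindex:
  fixes F :: "nat \<Rightarrow> nat \<Rightarrow> real"
  shows "(\<Sum>(p, j) | p + j = 2 * a + 1. real ((p + (2 * b + 1)) choose (2 * b + 1)) * (of_bool (p + (2 * b + 1) > 0 \<and> j > 0) * F (p + 2 * b) (j - 1) / 2 ^ (p + (2 * b + 1)))) =
    (\<Sum>(i, j) | i + j = 2 * a + 2 * b. 1 / 2 ^ (i + 1) * real ((i + 1) choose (2 * b + 1)) * F i j)"
  (is "sum ?f ?S = sum ?g ?T")
proof -
  have "sum ?f ?S = sum ?f {(p, j). p + j = 2 * a + 1 \<and> j > 0}"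
    by (rule sum.mono_neutral_right) auto
  also have "\<dots> = (\<Sum>(p, j) | p + j = 2 * a. 1 / 2 ^ (p + 2 * b + 1) * real ((p + 2 * b + 1) choose (2 * b + 1)) * F (p + 2 * b) j)"
    by (rule sum.reindex_bij_witness[where i = "\<lambda>(p, j). (p, j + 1)" and j = "\<lambda>(p, j). (p, j - 1)"])
       (auto simp: add.assoc simp del: binomial_Suc_Suc)
  also have "\<dots> = sum ?g {(i, j). i + j = 2 * a + 2 * b \<and> i \<ge> 2 * b}"
    by (rule sum.reindex_bij_witness[where i = "\<lambda>(i, j). (i - 2 * b, j)" and j = "\<lambda>(p, j). (p + 2 * b, j)"])
       (auto simp del: binomial_Suc_Suc)
  also have "\<dots> = sum ?g ?T"
    by (rule sum.mono_neutral_left) (auto simp: binomial_eq_0 simp del: binomial_Suc_Suc)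
  finally show ?thesis .
qed

context gen_vars
begin

text \<open>The two binomial terms come from \<open>pairsum\<close> with the mean (X + Y)/2 in its
  first and in its second place. Taking the part odd in both x and y of their sum produces the eight
  values in \<open>E3\<close>.\<close>

lemma third_coeff_dps: "dps third_coeff (x ^ 2) (y ^ 2) E3"
proof -
  define c1 where "c1 = (\<lambda>k l. \<Sum>(p, j) | p + j = k. real ((p + l) choose l) * (shifted_mzv (p + l) j / 2 ^ (p + l)))"
  define c2 where "c2 = (\<lambda>k l. \<Sum>(p, j) | p + j = l. real ((p + k) choose k) * (shifted_mzv j (p + k) / 2 ^ (p + k)))"
  have 1: "dps c1 X Y (pairsum ((X + Y) / 2) X)" and 2: "dps c2 X Y (pairsum Y ((X + Y) / 2))" if "\<bar>X\<bar> + \<bar>Y\<bar> < 1" for X Y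
    unfolding c1_def c2_def using dps_pairsum_subst(1)[OF that] dps_pairsum_subst(2)[of Y X] that
    by (auto simp: add.commute dps_swap[of _ X Y])
  have s: "\<bar>x\<bar> + \<bar>y\<bar> < 1" "\<bar>x\<bar> + \<bar>- y\<bar> < 1" "\<bar>- x\<bar> + \<bar>y\<bar> < 1" "\<bar>- x\<bar> + \<bar>- y\<bar> < 1" using xy by auto
  have nz: "x \<noteq> 0 \<or> 1 = (0 :: nat)" "y \<noteq> 0 \<or> 1 = (0 :: nat)" using xy by auto
  define e where "e = (\<lambda>X Y. pairsum ((X + Y) / 2) X + pairsum Y ((X + Y) / 2))"
  have d: "dps (\<lambda>k l. c1 k l + c2 k l) X Y (e X Y)" if "\<bar>X\<bar> + \<bar>Y\<bar> < 1" for X Y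
    unfolding e_def by (rule dps_add[OF 1[OF that] 2[OF that]])
  have "dps (\<lambda>a b. c1 (2 * a + 1) (2 * b + 1) + c2 (2 * a + 1) (2 * b + 1)) (x ^ 2) (y ^ 2)
      ((e x y + (- 1) ^ 1 * e x (- y) + (- 1) ^ 1 * e (- x) y + (- 1) ^ 1 * (- 1) ^ 1 * e (- x) (- y)) / (4 * x ^ 1 * y ^ 1))"
    by (rule dps_extract[OF d[OF s(1)] d[OF s(2)] d[OF s(3)] d[OF s(4)] nz]) simp_all
  moreover have "(e x y + (- 1) ^ 1 * e x (- y) + (- 1) ^ 1 * e (- x) y + (- 1) ^ 1 * (- 1) ^ 1 * e (- x) (- y)) / (4 * x ^ 1 * y ^ 1) = E3 / 2"
  proof -
    have m: "(x + - y) / 2 = (x - y) / 2" "(- x + y) / 2 = - ((x - y) / 2)" "(- x + - y) / 2 = - ((x + y) / 2)" by (simp_all add: field_simps)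
    show ?thesis unfolding e_def E3_def m by (simp add: algebra_simps)
  qed
  ultimately have D: "dps (\<lambda>a b. c1 (2 * a + 1) (2 * b + 1) + c2 (2 * a + 1) (2 * b + 1)) (x ^ 2) (y ^ 2) (E3 / 2)" by (simp only:)
  show ?thesis
  proof (rule dps_eq[OF dps_cmult[OF D, of 2]])
    fix a b :: nat
    have c1: "c1 (2 * a + 1) (2 * b + 1) = (\<Sum>(i, j) | i + j = 2 * a + 2 * b. 1 / 2 ^ (i + 1) * real ((i + 1) choose (2 * b + 1)) * mzv [i + 2, j + 2])"
      unfolding third_sum_reindex[symmetric] c1_def shifted_mzv_eq
      by (rule sum.cong) (simp_all del: binomial_Suc_Suc)
    have "c2 (2 * a + 1) (2 * b + 1) = (\<Sum>(i, j) | i + j = 2 * b + 2 * a. 1 / 2 ^ (i + 1) * real ((i + 1) choose (2 * a + 1)) * mzv [j + 2, i + 2])"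
      unfolding third_sum_reindex[where F = "\<lambda>i j. mzv [j + 2, i + 2]", symmetric] c2_def shifted_mzv_eq
      by (rule sum.cong) (auto simp del: binomial_Suc_Suc)
    also have "\<dots> = (\<Sum>(i, j) | i + j = 2 * a + 2 * b. 1 / 2 ^ (j + 1) * real ((j + 1) choose (2 * a + 1)) * mzv [i + 2, j + 2])"
      by (rule sum.reindex_bij_witness[where i = prod.swap and j = prod.swap]) (auto simp del: binomial_Suc_Suc)
    finally have c2: "c2 (2 * a + 1) (2 * b + 1) = \<dots>" .
    have h: "1 / 2 ^ (i + 1) * C = 1 / 2 * (1 / 2 ^ i * C)" for i :: nat and C :: real by simp
    show "2 * (c1 (2 * a + 1) (2 * b + 1) + c2 (2 * a + 1) (2 * b + 1)) = third_coeff a b"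
      unfolding c1 c2 third_coeff_def sum.distrib[symmetric] sum_distrib_left h
      by (rule sum.cong) (auto simp: algebra_simps simp del: binomial_Suc_Suc)
  qed simp
qed

text \<open>The inner sum depends on a and u through a - u only, so the summation over u is a
  convolution in a of the barred values with \<open>third_coeff\<close>.\<close>

lemma S1_third:
  "dps (\<lambda>a b. \<Sum>(u, i, j) \<in> {(u, i, j). 2 * u + i + j = 2 * a + 2 * b}.
        2 * (1 / 2 ^ i * real (binom (i + 1) (2 * int b + 1))
             + 1 / 2 ^ j * real (binom (j + 1) (2 * int a + 1 - 2 * int u)))
          * ztbar (2 * u) * mzv [i + 2, j + 2]) (x ^ 2) (y ^ 2) (2 * (BX * E3))"
proof (rule dps_eq[OF dps_cmult[OF dps_mult_x[OF ups_x(5) third_coeff_dps], of 2] _ refl])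
  fix a b :: nat
  let ?f = "\<lambda>(u, i, j). 2 * (1 / 2 ^ i * real (binom (i + 1) (2 * int b + 1))
             + 1 / 2 ^ j * real (binom (j + 1) (2 * int a + 1 - 2 * int u)))
          * ztbar (2 * u) * mzv [i + 2, j + 2]"
  let ?S = "{(u, i, j). 2 * u + i + j = 2 * a + 2 * b}"
  have fin: "finite ?S"
    by (rule finite_subset[of _ "{..a + b} \<times> {..2 * (a + b)} \<times> {..2 * (a + b)}"]) auto
  \<comment> \<open>For u > a both binomials vanish: the second has a negative lower index, and i <=
    2 b - 2 puts the lower index of the first above i + 1.\<close>
  have "sum ?f ?S = sum ?f {(u, i, j). u \<le> a \<and> i + j = 2 * (a - u) + 2 * b}"
  proof (rule sum.mono_neutral_right[OF fin])
    show "\<forall>z\<in>?S - {(u, i, j). u \<le> a \<and> i + j = 2 * (a - u) + 2 * b}. ?f z = 0"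
    proof
      fix z assume z: "z \<in> ?S - {(u, i, j). u \<le> a \<and> i + j = 2 * (a - u) + 2 * b}"
      obtain u i j where zz: "z = (u, i, j)" by (cases z) auto
      have u: "u > a" and s: "2 * u + i + j = 2 * a + 2 * b" using z unfolding zz by auto
      have "binom (j + 1) (2 * int a + 1 - 2 * int u) = 0" using u by (simp add: binom_def)
      moreover have "binom (i + 1) (2 * int b + 1) = 0"
      proof -
        have "nat (2 * int b + 1) = 2 * b + 1" by simp
        moreover have "i + 1 < 2 * b + 1" using u s by simp
        ultimately show ?thesis unfolding binom_def by (simp add: binomial_eq_0 del: binomial_Suc_Suc)
      qed
      ultimately show "?f z = 0" unfolding zz by simp
    qed
  qed auto
  also have "\<dots> = (\<Sum>(z, w)\<in>(SIGMA z:{(p, q). p + q = a}. {(i, j). i + j = 2 * snd z + 2 * b}).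
     2 * (ztbar (2 * fst z) * ((1 / 2 ^ fst w * real ((fst w + 1) choose (2 * b + 1)) + 1 / 2 ^ snd w * real ((snd w + 1) choose (2 * snd z + 1))) * mzv [fst w + 2, snd w + 2])))"
  proof (rule sum.reindex_bij_witness[where i = "\<lambda>((p, q), (i, j)). (p, i, j)" and j = "\<lambda>(u, i, j). ((u, a - u), (i, j))"])
    fix z assume z: "z \<in> {(u, i, j). u \<le> a \<and> i + j = 2 * (a - u) + 2 * b}"
    obtain u i j where zz: "z = (u, i, j)" by (cases z) auto
    have u: "u \<le> a" using z unfolding zz by auto
    have "nat (2 * int b + 1) = 2 * b + 1" "nat (2 * int a + 1 - 2 * int u) = 2 * (a - u) + 1" "\<not> 2 * int a + 1 - 2 * int u < 0" using u by auto
    thus "(\<lambda>(z, w). 2 * (ztbar (2 * fst z) * ((1 / 2 ^ fst w * real ((fst w + 1) choose (2 * b + 1)) + 1 / 2 ^ snd w * real ((snd w + 1) choose (2 * snd z + 1))) * mzv [fst w + 2, snd w + 2])))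
        ((\<lambda>(u, i, j). ((u, a - u), (i, j))) z) = ?f z"
      unfolding zz by (simp add: binom_def del: binomial_Suc_Suc)
  qed auto
  also have "\<dots> = (\<Sum>z\<in>{(p, q). p + q = a}. \<Sum>w\<in>{(i, j). i + j = 2 * snd z + 2 * b}.
     2 * (ztbar (2 * fst z) * ((1 / 2 ^ fst w * real ((fst w + 1) choose (2 * b + 1)) + 1 / 2 ^ snd w * real ((snd w + 1) choose (2 * snd z + 1))) * mzv [fst w + 2, snd w + 2])))"
    by (rule sum.Sigma[symmetric]) auto
  also have "\<dots> = 2 * (\<Sum>(p, q) | p + q = a. ztbar (2 * p) * third_coeff q b)"
    unfolding third_coeff_def sum_distrib_left by (auto simp: sum_distrib_left case_prod_unfold intro!: sum.cong simp del: binomial_Suc_Suc)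
  finally show "2 * (\<Sum>(p, q) | p + q = a. ztbar (2 * p) * third_coeff q b) = sum ?f ?S" by simp
qed

end

section \<open>The trigonometric identity\<close>

lemma pi_half_power: "(\<i> * complex_of_real pi / 2) ^ (2 * k) = complex_of_real ((- 1) ^ k * (pi / 2) ^ (2 * k))"
proof -
  have "(\<i> * complex_of_real pi / 2) ^ (2 * k) = ((\<i> * complex_of_real pi / 2) ^ 2) ^ k" by (rule power_mult)
  also have "(\<i> * complex_of_real pi / 2) ^ 2 = complex_of_real (- ((pi / 2) ^ 2))"
    by (simp add: power_mult_distrib power_divide)
  also have "complex_of_real (- ((pi / 2) ^ 2)) ^ k = complex_of_real ((- 1) ^ k * (pi / 2) ^ (2 * k))"
    unfolding of_real_power[symmetric] power_mult power_minus[of "(pi / 2) ^ 2"] ..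
  finally show ?thesis .
qed

definition S3_rest :: "nat \<Rightarrow> nat \<Rightarrow> real" where
  "S3_rest a b = (2 * ztbar (2 * a + 2 * b + 4)
     + (\<Sum>(p, q) \<in> {(p, q). p + q = a + 1}.
          4 / 2 ^ (2 * p + 2 * b) * real ((2 * p + 2 * b) choose (2 * b + 1)) * zt (2 * p + 2 * b + 2) * ztbar (2 * q))
     + (\<Sum>(u, v, w) \<in> {(u, v, w). u + v + w = a}.
          8 * real ((2 * u + 2 * b + 1) choose (2 * b + 1)) * ztbar (2 * w) * zt (2 * v + 2) * ztbar (2 * u + 2 * b + 2))
     + (\<Sum>(r, s) \<in> {(r, s). r + s = b + 1}.
          4 * (real ((2 * a + 2 * r + 1) choose (2 * a + 1)) - real ((2 * a + 2 * r + 1) choose (2 * r + 1)))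
            * zt (2 * a + 2 * r + 2) * ztbar (2 * s))
     - (\<Sum>(r, s) \<in> {(r, s). r + s = b + 1}. 4 * zt (2 * a + 2 * r + 2) * ztbar (2 * s))
     - (\<Sum>(u, v, w) \<in> {(u, v, w). u + v + w = b}.
          4 * of_bool (a = 0) * zt (2 * u + 2) * zt (2 * v + 2) * ztbar (2 * w))
     + (\<Sum>(r, s) \<in> {(r, s). r + s = b + 1}. 8 * of_bool (a = 0) * zt (2 * r + 2) * ztbar (2 * s))
     - 8 * of_bool (a = 0) * zt 2 * ztbar (2 * b + 2))"

definition S3_real :: "nat \<Rightarrow> nat \<Rightarrow> real" where
  "S3_real a b = - (3 * zt 2 * euler_sum a (Suc b)) + 3 * zt 2 * (\<Sum>(t, c) | t + c = b. zt (2 * t + 2) * euler_sum a c) + S3_rest a b"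

text \<open>Only even powers of \<i> pi/2 occur, and their signs are those built into
  \<open>euler_sum\<close>.\<close>

lemma S3_eq: "S3 a b = complex_of_real (S3_real a b)"
proof -
  let ?E = "\<lambda>(i, j, r, s). (- 1) ^ r * euler_number (i + r) * euler_number (j + s) / (fact i * fact j * fact r * fact s)"
  let ?Q = "\<lambda>n. {(i, j, r, s). i + j = 2 * a \<and> r + s = 2 * n}"
  have 1: "(\<Sum>(i, j, r, s) \<in> {(i, j, r, s). i + j = 2 * a \<and> r + s = 2 * b + 2}.
        3 * of_real (zt 2)
          * of_real ((- 1) ^ r * euler_number (i + r) * euler_number (j + s)
                     / (fact i * fact j * fact r * fact s))
          * (\<i> * of_real pi / 2) ^ (2 * a + 2 * b + 2)) = complex_of_real (3 * zt 2 * euler_sum a (Suc b))"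
  proof -
    have e: "2 * a + 2 * b + 2 = 2 * (a + Suc b)" "2 * b + 2 = 2 * Suc b" by simp_all
    have e': "2 * (a + Suc b) = 2 * a + 2 * Suc b" by simp
    show ?thesis unfolding e pi_half_power euler_sum_def unfolding e'
      by (simp only: sum_distrib_left sum_distrib_right of_real_sum of_real_mult of_real_numeral case_prod_unfold mult.assoc)
  qed
  have 2: "(\<Sum>(i, j, r, s, t) \<in> {(i, j, r, s, t). i + j = 2 * a \<and> r + s + 2 * t = 2 * b}.
        3 * of_real (zt 2)
          * of_real ((- 1) ^ r * euler_number (i + r) * euler_number (j + s)
                     / (fact i * fact j * fact r * fact s))
          * (\<i> * of_real pi / 2) ^ (2 * a + 2 * b - 2 * t) * of_real (zt (2 * t + 2))) =
      complex_of_real (3 * zt 2 * (\<Sum>(t, c) | t + c = b. zt (2 * t + 2) * euler_sum a c))" (is "sum ?f ?S = _")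
  proof -
    let ?g = "\<lambda>z w. 3 * zt 2 * (zt (2 * fst z + 2) * (?E w * ((- 1) ^ (a + snd z) * (pi / 2) ^ (2 * a + 2 * snd z))))"
    have "sum ?f ?S = (\<Sum>(z, w) \<in> (SIGMA z:{(t, c). t + c = b}. ?Q (snd z)). complex_of_real (?g z w))"
    proof (rule sum.reindex_bij_witness[where i = "\<lambda>((t, c), (i, j, r, s)). (i, j, r, s, t)" and j = "\<lambda>(i, j, r, s, t). ((t, b - t), (i, j, r, s))"])
      fix z assume z: "z \<in> ?S"
      obtain i j r s t where zz: "z = (i, j, r, s, t)" by (cases z) auto
      have t: "t \<le> b" using z unfolding zz by auto
      have e: "2 * a + 2 * b - 2 * t = 2 * (a + (b - t))" using t by simp
      have e': "2 * (a + (b - t)) = 2 * a + 2 * (b - t)" by simp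
      show "(\<lambda>(z, w). complex_of_real (?g z w)) ((\<lambda>(i, j, r, s, t). ((t, b - t), (i, j, r, s))) z) = ?f z"
        unfolding zz prod.case fst_conv snd_conv e pi_half_power unfolding e'
        by (simp only: of_real_mult of_real_numeral mult_ac)
    qed auto
    also have "\<dots> = (\<Sum>z\<in>{(t, c). t + c = b}. \<Sum>w\<in>?Q (snd z). complex_of_real (?g z w))"
    proof (rule sum.Sigma[symmetric])
      show "\<forall>z\<in>{(t, c). t + c = b}. finite (?Q (snd z))"
      proof
        fix z :: "nat \<times> nat"
        show "finite (?Q (snd z))"
          by (rule finite_subset[of _ "{..2 * a} \<times> {..2 * a} \<times> {..2 * snd z} \<times> {..2 * snd z}"]) auto
      qed
    qed auto
    also have "\<dots> = complex_of_real (3 * zt 2 * (\<Sum>(t, c) | t + c = b. zt (2 * t + 2) * euler_sum a c))"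
      unfolding euler_sum_def
      by (simp only: sum_distrib_left sum_distrib_right of_real_sum case_prod_unfold)
    finally show ?thesis .
  qed
  show ?thesis unfolding S3_def 1 2 S3_real_def S3_rest_def by (simp only: of_real_add of_real_minus)
qed

lemma half_angle:
  fixes c s :: real
  assumes "s \<noteq> 0" "c \<noteq> 0" "s ^ 2 + c ^ 2 = 1"
  shows "1 / (2 * s * c) + (c ^ 2 - s ^ 2) / (2 * s * c) = c / s"
proof -
  have "1 / (2 * s * c) + (c ^ 2 - s ^ 2) / (2 * s * c) = (1 + (c ^ 2 - s ^ 2)) / (2 * s * c)" by (rule add_divide_distrib[symmetric])
  also have "1 + (c ^ 2 - s ^ 2) = 2 * c ^ 2" using assms(3) by linarith
  also have "2 * c ^ 2 / (2 * s * c) = c / s" using assms(1,2) by (simp add: power2_eq_square)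
  finally show ?thesis .
qed

text \<open>In terms of the half angles the trigonometric functions are rational, and the two identities
  become consequences of the Pythagorean relations.\<close>

lemma trig_identities:
  fixes \<alpha> \<beta> :: real
  assumes nz: "sin \<alpha> \<noteq> 0" "cos \<alpha> \<noteq> 0" "sin \<beta> \<noteq> 0" "cos \<beta> \<noteq> 0" "sin (\<alpha> + \<beta>) \<noteq> 0" "sin (\<alpha> - \<beta>) \<noteq> 0"
  defines "Tx \<equiv> 1 / sin (\<alpha> + \<beta>)" and "Ty \<equiv> 1 / sin (\<alpha> - \<beta>)" and "Cx \<equiv> cot (\<alpha> + \<beta>)" and "Cy \<equiv> cot (\<alpha> - \<beta>)"
    and "Tp \<equiv> 1 / sin (2 * \<alpha>)" and "Tm \<equiv> 1 / sin (2 * \<beta>)" and "Cp \<equiv> cot (2 * \<alpha>)" and "Cm \<equiv> cot (2 * \<beta>)"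
    and "P \<equiv> 1 / (cos \<alpha> * cos \<beta>)" and "P0 \<equiv> 1 / (cos ((\<alpha> + \<beta>) / 2) * cos ((\<alpha> + \<beta>) / 2))"
  shows "Tx * (Cp + Cm + Tp + Tm) / 4 + Ty * (Cp - Cm) / 2 - Cx * Tx + Tx ^ 2 - P0 / 2 + P / 4 = 0"
    "- Ty / 2 + Cx * Tx * (Cm - Cp + Tp - Tm) / 4 + Cx * Cy * Tx / 2 - Cy ^ 2 * Ty / 2 + P * Cy / 4 - Tx ^ 2 * Ty / 2 + Ty ^ 3 / 2 = 0"
proof -
  define s c S C where "s = sin \<alpha>" "c = cos \<alpha>" "S = sin \<beta>" "C = cos \<beta>"
  note defs = this
  have py: "s ^ 2 + c ^ 2 = 1" "S ^ 2 + C ^ 2 = 1" by (simp_all add: defs)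
  have nz': "s \<noteq> 0" "c \<noteq> 0" "S \<noteq> 0" "C \<noteq> 0" using nz by (simp_all add: defs)
  \<comment> \<open>The sines of the sum and the difference of the two angles; \<open>k\<close> and
    \<open>k'\<close> below are the cosines.\<close>
  define u v where "u = s * C + c * S" and "v = s * C - c * S"
  have uv: "sin (\<alpha> + \<beta>) = u" "sin (\<alpha> - \<beta>) = v" by (simp_all add: u_def v_def sin_add sin_diff defs)
  have uv0: "u \<noteq> 0" "v \<noteq> 0" using nz uv by auto
  have uvp: "u * v = s ^ 2 - S ^ 2"
    using py unfolding u_def v_def by algebra
  have Cx: "Cx = (c * C - s * S) / u" "Cy = (c * C + s * S) / v"
    by (simp_all add: Cx_def Cy_def cot_def uv cos_add cos_diff defs)
  have d: "sin (2 * \<alpha>) = 2 * s * c" "sin (2 * \<beta>) = 2 * S * C" "cos (2 * \<alpha>) = c ^ 2 - s ^ 2" "cos (2 * \<beta>) = C ^ 2 - S ^ 2"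
    by (simp_all add: sin_double cos_double defs)
  have T: "Tp = 1 / (2 * s * c)" "Tm = 1 / (2 * S * C)" "Cp = (c ^ 2 - s ^ 2) / (2 * s * c)" "Cm = (C ^ 2 - S ^ 2) / (2 * S * C)"
    by (simp_all add: Tp_def Tm_def Cp_def Cm_def cot_def d)
  have h: "Tp + Cp = c / s" "Tm + Cm = C / S" unfolding T using half_angle nz' py by auto
  have h': "Tp - Cp = s / c" "Tm - Cm = S / C"
    using half_angle[of c s] half_angle[of C S] nz' py unfolding T by (simp_all add: add.commute mult.commute mult.left_commute diff_divide_distrib)
  have P0: "P0 = 2 / (1 + (c * C - s * S))"
  proof -
    define w where "w = (\<alpha> + \<beta>) / 2"
    have "cos (2 * w) = 2 * cos w ^ 2 - 1" by (rule cos_double_cos)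
    moreover have "2 * w = \<alpha> + \<beta>" by (simp add: w_def)
    hence "cos (2 * w) = c * C - s * S" by (simp only: cos_add defs)
    ultimately have "1 + (c * C - s * S) = 2 * (cos w * cos w)" by (simp add: power2_eq_square)
    thus ?thesis by (simp add: P0_def w_def)
  qed
  define k k' where "k = c * C - s * S" and "k' = c * C + s * S"
  have ku: "k ^ 2 + u ^ 2 = 1" "k' ^ 2 + v ^ 2 = 1" using py unfolding k_def u_def k'_def v_def by algebra+
  have P0': "P0 / 2 = (1 - k) / u ^ 2"
  proof -
    have e: "u ^ 2 = (1 + k) * (1 - k)" using ku by (simp add: power2_eq_square algebra_simps)
    moreover have "1 + k \<noteq> 0" "1 - k \<noteq> 0" using e uv0 by auto
    ultimately show ?thesis unfolding P0 k_def[symmetric] e by (simp add: divide_simps)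
  qed
  have Px: "P = 1 / (c * C)" by (simp add: P_def defs)
  have Txy: "Tx = 1 / u" "Ty = 1 / v" by (simp_all add: Tx_def Ty_def uv)
  have Cd: "Cp - Cm = - (v * k') / (2 * s * c * S * C)"
  proof -
    have "Cp - Cm = ((c ^ 2 - s ^ 2) * (S * C) - (C ^ 2 - S ^ 2) * (s * c)) / (2 * s * c * S * C)"
      unfolding T using nz' by (simp add: divide_simps)
    also have "(c ^ 2 - s ^ 2) * (S * C) - (C ^ 2 - S ^ 2) * (s * c) = - (v * k')"
      unfolding v_def k'_def by (simp add: power2_eq_square algebra_simps)
    finally show ?thesis .
  qed
  show "Tx * (Cp + Cm + Tp + Tm) / 4 + Ty * (Cp - Cm) / 2 - Cx * Tx + Tx ^ 2 - P0 / 2 + P / 4 = 0"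
  proof -
    have "Cp + Cm + Tp + Tm = c / s + C / S" using h by linarith
    also have "\<dots> = u / (s * S)" using nz' by (simp add: u_def divide_simps)
    finally have 1: "Tx * (Cp + Cm + Tp + Tm) / 4 = 1 / (4 * (s * S))" using uv0 by (simp add: Txy)
    have 2: "Ty * (Cp - Cm) / 2 = - k' / (4 * (s * c * S * C))" unfolding Cd Txy using uv0 by simp
    have 3: "- (Cx * Tx) + Tx ^ 2 - P0 / 2 = 0"
      unfolding P0' Cx Txy k_def[symmetric] by (simp add: power2_eq_square diff_divide_distrib)
    have 4: "1 / (4 * (s * S)) - k' / (4 * (s * c * S * C)) + 1 / (c * C) / 4 = 0"
      using nz' unfolding k'_def by (simp add: divide_simps)
    show ?thesis using 1 2 3 4 unfolding Px by linarith
  qed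
  show "- Ty / 2 + Cx * Tx * (Cm - Cp + Tp - Tm) / 4 + Cx * Cy * Tx / 2 - Cy ^ 2 * Ty / 2 + P * Cy / 4 - Tx ^ 2 * Ty / 2 + Ty ^ 3 / 2 = 0"
  proof -
    have "Cm - Cp + Tp - Tm = s / c - S / C" using h' by linarith
    also have "\<dots> = v / (c * C)" using nz' by (simp add: v_def divide_simps)
    finally have 1: "Cx * Tx * (Cm - Cp + Tp - Tm) / 4 = k * v / (4 * u ^ 2 * (c * C))"
      by (simp add: Txy Cx k_def power2_eq_square)
    have 2: "- (Cy ^ 2 * Ty) / 2 + Ty ^ 3 / 2 - Ty / 2 = 0"
    proof -
      have "- (Cy ^ 2 * Ty) / 2 + Ty ^ 3 / 2 - Ty / 2 = (1 - k' ^ 2 - v ^ 2) / (2 * v ^ 3)"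
        unfolding Cx Txy k'_def[symmetric] using uv0 by (simp add: divide_simps power3_eq_cube power2_eq_square; simp add: algebra_simps)
      thus ?thesis using ku by simp
    qed
    \<comment> \<open>The product formula 2 K = k + k' brings the numerator into a form that the
      Pythagorean relations for (k, u) and (k', v) annihilate.\<close>
    define K where "K = c * C"
    have K: "K \<noteq> 0" "2 * K = k + k'" using nz' by (simp_all add: K_def k_def k'_def)
    have "k * v / (4 * u ^ 2 * K) + k / u * (k' / v) * (1 / u) / 2 + 1 / K * (k' / v) / 4 - (1 / u) ^ 2 * (1 / v) / 2
      = (k * v ^ 2 + k * k' * (2 * K) + k' * u ^ 2 - 2 * K) / (4 * u ^ 2 * v * K)"
      using uv0 K(1) by (simp add: divide_simps power2_eq_square; simp add: algebra_simps)
    also have "k * v ^ 2 + k * k' * (2 * K) + k' * u ^ 2 - 2 * K = 0"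
      unfolding K(2) using ku by algebra
    finally have 3: "k * v / (4 * u ^ 2 * K) + k / u * (k' / v) * (1 / u) / 2 + 1 / K * (k' / v) / 4 - (1 / u) ^ 2 * (1 / v) / 2 = 0" by simp
    have 4: "- Ty / 2 = - (Ty / 2)" by simp
    show ?thesis using 2 3 unfolding 1 Px K_def[symmetric] unfolding Cx Txy k_def[symmetric] k'_def[symmetric]
      by (simp add: algebra_simps)
  qed
qed

text \<open>With i, j and e standing for 1/x, 1/y and 1/(x^2 - y^2) the claim is polynomial. The
  difference of the two sides is j^2 times \<open>I1\<close> plus j times \<open>I2\<close> plus a
  remainder \<open>W\<close> that vanishes by the relations among x, y, i, j and e alone.\<close>

lemma trig_remainder:
  fixes x y i j e Tx Ty cx cy cp cm sp sm P P0 pi2 :: real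
  assumes xi: "x * i = 1" and yj: "y * j = 1" and e: "e * (x ^ 2 - y ^ 2) = 1" and pi2: "Ty ^ 2 = (j - cy) ^ 2 + pi2"
    and I1: "Tx * (4 * x * e - (cp + cm + sp + sm)) / 4 + Ty * (- 2 * y * e - cp + cm) / 2 - (i - cx) * Tx + Tx ^ 2 - pi2 * P0 / 2 + pi2 * P / 4 = 0"
      (is "?E1 = 0")
    and I2: "- pi2 * Ty / 2 + (i - cx) * Tx * (cp - cm - sp + sm) / 4 + (i - cx) * (j - cy) * Tx / 2 - (j - cy) ^ 2 * Ty / 2 + pi2 * P * (j - cy) / 4
       - Tx ^ 2 * Ty / 2 + Ty ^ 3 / 2 = 0"
      (is "?E2 = 0")
  shows "i * (Ty * j * (cx - cp / 2 - cm / 2) - Tx * j / 2 * (sp - sm))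
    + 2 * Ty * j * ((Ty ^ 2 - j ^ 2) / 4 - pi2 / 12 + (pi2 / 6 + (y ^ 2 * cx * i - x ^ 2 * cy * j) * e / 2))
    + Tx * i * j * (j - Ty)
    - Tx * e * (cx - x * cy * j)
    - Tx * ((i - Tx) * (j - Ty) * j / 2 - cx * cy * j / 2 + (cy + j - Ty) * j * i / 2 - (cx + i - Tx) * j ^ 2 / 2)
    - Tx * j / 2 * ((cp + sp) * cx / 2 - (cm + sm) * cx / 2 - (i - j) * (cp + sp) / 2 + (i + j) * (cm + sm) / 2 - 2 * y * cx * e + 2 * x * cy * e)
    = - (pi2 / 2 * (P - P0) * j ^ 2) + pi2 / 2 * P * cy * j / 2 + ((i - Tx) * i - (j - Ty) * j) * e
    - Tx * cx * (sp - sm) * j / 2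
    + (- (Ty * j) * ((cp + cm) * i - (cp - cm) * j) / 2 - j ^ 2 * (Tx ^ 2 - i ^ 2 - cx * i))
    - (- (Ty * j) * (x * cx - y * cy) * e + cx * i * j ^ 2)
    + Ty * cy ^ 2 * j / 2
    + (2 * pi2 * j ^ 2 / 3 - 2 * Ty * cy * j ^ 2)
    - 2 * pi2 / 3 * (j - Ty) * j"
    (is "?L = ?R")
proof -
  \<comment> \<open>All terms containing e, including those that j^2 times \<open>I1\<close> brings
    in.\<close>
  define W where "W = Ty * j * (y ^ 2 * cx * i - x ^ 2 * cy * j) * e - Tx * e * cx + Tx * e * x * cy * j + Tx * j * y * cx * e - Tx * j * x * cy * e
    - ((i - Tx) * i - (j - Ty) * j) * e - Ty * j * (x * cx - y * cy) * e - j ^ 2 * (Tx * x * e - Ty * y * e)"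
  have W: "W = - (Ty * cx * i * j) - Ty * cy * j ^ 2 + i ^ 2 * j ^ 2 - Tx * i * j ^ 2"
  proof -
    have e2: "e * (1 - x ^ 2 * j ^ 2) = - (j ^ 2)" using yj e by algebra
    have e3: "e * (i ^ 2 - j ^ 2) = - (i ^ 2 * j ^ 2)" using xi yj e by algebra
    have e4: "e * (i - x * j ^ 2) = - (i * j ^ 2)" using xi yj e by algebra
    have e5: "e * (y * i - x * j) = - (i * j)" using xi yj e by algebra
    have "W = Ty * cx * (e * (y * i - x * j)) + Ty * cy * (e * (1 - x ^ 2 * j ^ 2)) - e * (i ^ 2 - j ^ 2) + Tx * (e * (i - x * j ^ 2))"
      unfolding W_def using yj by algebra
    thus ?thesis unfolding e2 e3 e4 e5 by (simp add: algebra_simps)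
  qed
  have pi2': "pi2 = Ty ^ 2 - (j - cy) ^ 2" using pi2 by simp
  have "?L - ?R = j ^ 2 * ?E1 + j * ?E2 + (W - (- (Ty * cx * i * j) - Ty * cy * j ^ 2 + i ^ 2 * j ^ 2 - Tx * i * j ^ 2))"
    unfolding W_def pi2'
    by (simp add: algebra_simps power2_eq_square power3_eq_cube add_divide_distrib diff_divide_distrib)
  thus ?thesis unfolding I1 I2 W by simp
qed

text \<open>The variable is a square, so only positive X are available and a one-sided limit is
  used: -c(0) is X times a series bounded by M for all 0 < X < R.\<close>

lemma ups_zero_0:
  assumes \<rho>: "\<rho> > 0" and c: "\<And>X. 0 < X \<Longrightarrow> X < \<rho> \<Longrightarrow> ups c X 0"
  shows "c 0 = 0"
proof -
  define R where "R = \<rho> / 2"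
  have R: "0 < R" "R < \<rho>" using \<rho> by (simp_all add: R_def)
  have "ups (\<lambda>n. c (Suc n)) R ((0 - c 0) / R)" by (rule ups_shift_down[OF c[OF R]]) (use R in simp)
  from ups_abs_summable[OF this] obtain M where M: "((\<lambda>n. \<bar>c (Suc n)\<bar> * R ^ n) has_sum M) UNIV" using R by (auto simp: summable_on_def)
  have bound: "\<bar>c 0\<bar> \<le> X * M" if X: "0 < X" "X < R" for X
  proof -
    have "ups (\<lambda>n. c (Suc n)) X ((0 - c 0) / X)" by (rule ups_shift_down[OF c]) (use X R in auto)
    hence s: "((\<lambda>n. c (Suc n) * X ^ n) has_sum (- c 0 / X)) UNIV" by (simp add: ups_def)
    have le: "\<bar>c (Suc n)\<bar> * X ^ n \<le> \<bar>c (Suc n)\<bar> * R ^ n" for n using X by (intro mult_left_mono power_mono) auto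
    have "- c 0 / X \<le> M"
      by (rule has_sum_mono[OF s M]) (metis (no_types) abs_ge_self dual_order.trans le less_imp_le mult_right_mono X(1) zero_le_power)
    moreover have "c 0 / X \<le> M"
    proof (rule has_sum_mono[OF _ M])
      show "((\<lambda>n. - (c (Suc n) * X ^ n)) has_sum c 0 / X) UNIV" using has_sum_cmult_right[OF s, of "- 1"] by simp
      show "- (c (Suc n) * X ^ n) \<le> \<bar>c (Suc n)\<bar> * R ^ n" for n
      proof -
        have "- (c (Suc n) * X ^ n) = (- c (Suc n)) * X ^ n" by simp
        also have "\<dots> \<le> \<bar>c (Suc n)\<bar> * X ^ n" using X by (intro mult_right_mono) auto
        finally show ?thesis using le[of n] by (rule order_trans)
      qed
    qed
    ultimately have "- c 0 \<le> X * M" "c 0 \<le> X * M" using X by (simp_all add: field_simps)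
    thus ?thesis by simp
  qed
  have "((\<lambda>X. X * M) \<longlongrightarrow> 0 * M) (at_right 0)" by (intro tendsto_intros)
  moreover have "\<forall>\<^sub>F X in at_right 0. \<bar>c 0\<bar> \<le> X * M"
    using bound R(1) unfolding eventually_at_right_field by blast
  ultimately have "\<bar>c 0\<bar> \<le> 0 * M"
    by (rule tendsto_lowerbound) simp
  thus ?thesis by simp
qed

lemma ups_zero:
  assumes \<rho>: "\<rho> > 0" and c: "\<And>X. 0 < X \<Longrightarrow> X < \<rho> \<Longrightarrow> ups c X 0"
  shows "c n = 0"
  using c
proof (induction n arbitrary: c)
  case 0
  show ?case by (rule ups_zero_0[OF \<rho> 0])
next
  case (Suc n)
  have "c 0 = 0" by (rule ups_zero_0[OF \<rho> Suc.prems])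
  hence "ups (\<lambda>n. c (Suc n)) X 0" if "0 < X" "X < \<rho>" for X
    using ups_shift_down[OF Suc.prems[OF that]] that by simp
  thus ?case by (rule Suc.IH)
qed

text \<open>For fixed x the inner sums r(b) are the coefficients of a series in y^2 that vanishes on
  the interval 0 < y^2 < x^2, hence each r(b) is 0. Then x varies, and for each b the series in x^2
  vanishes too.\<close>

lemma dps_zero:
  assumes \<delta>: "\<delta> > 0" and c: "\<And>x y. 0 < y \<Longrightarrow> y < x \<Longrightarrow> x < \<delta> \<Longrightarrow> dps c (x ^ 2) (y ^ 2) 0"
  shows "c a b = 0"
proof -
  have row: "ups (\<lambda>a. c a b) (x ^ 2) 0" if x: "0 < x" "x < \<delta>" for x b
  proof -
    define r where "r b = infsum (\<lambda>a. c a b * (x ^ 2) ^ a) UNIV" for b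
    have r: "ups (\<lambda>a. c a b) (x ^ 2) (r b)" for b
    proof -
      \<comment> \<open>The admissible point y = x/2 gives the summability of every row, after
        division by its fixed positive factor.\<close>
      have "((\<lambda>(i, j). c i j * ((x ^ 2) ^ i * ((x / 2) ^ 2) ^ j)) summable_on UNIV)"
        using c[of "x / 2" x] x unfolding dps_def by (auto intro: has_sum_imp_summable)
      hence "(\<lambda>(i, j). c i j * ((x ^ 2) ^ i * ((x / 2) ^ 2) ^ j)) summable_on range (\<lambda>a. (a, b))"
        by (rule summable_on_subset) simp
      hence "(\<lambda>a. c a b * ((x ^ 2) ^ a * ((x / 2) ^ 2) ^ b)) summable_on UNIV"
        by (subst (asm) summable_on_reindex) (auto simp: inj_on_def o_def)
      hence "(\<lambda>a. c a b * ((x ^ 2) ^ a * ((x / 2) ^ 2) ^ b) * (1 / ((x / 2) ^ 2) ^ b)) summable_on UNIV"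
        by (rule summable_on_cmult_left)
      moreover have "c a b * ((x ^ 2) ^ a * ((x / 2) ^ 2) ^ b) * (1 / ((x / 2) ^ 2) ^ b) = c a b * (x ^ 2) ^ a" for a
      proof -
        have gen: "u * (v * B) * (1 / B) = u * v" if "B \<noteq> 0" for u v B :: real using that by simp
        show ?thesis by (rule gen) (use x in simp)
      qed
      ultimately have "(\<lambda>a. c a b * (x ^ 2) ^ a) summable_on UNIV" by (simp only:)
      thus ?thesis unfolding ups_def r_def by (rule has_sum_infsum)
    qed
    have "ups r Y 0" if Y: "0 < Y" "Y < x ^ 2" for Y
    proof -
      have y: "0 < sqrt Y" "sqrt Y < x" "(sqrt Y) ^ 2 = Y" using Y x by (auto simp: real_less_lsqrt)
      have "dps (\<lambda>b a. c a b) Y (x ^ 2) 0" using c[OF y(1,2) x(2)] y(3) by (simp add: dps_swap[of c])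
      hence "((\<lambda>(b, a). c a b * (Y ^ b * (x ^ 2) ^ a)) has_sum 0) (UNIV \<times> UNIV)" by (simp add: dps_def)
      thus ?thesis unfolding ups_def
      proof (rule has_sum_SigmaD)
        fix b
        have "((\<lambda>a. Y ^ b * (c a b * (x ^ 2) ^ a)) has_sum Y ^ b * r b) UNIV"
          using r[of b] unfolding ups_def by (rule has_sum_cmult_right)
        thus "((\<lambda>a. case (b, a) of (b, a) \<Rightarrow> c a b * (Y ^ b * (x ^ 2) ^ a)) has_sum r b * Y ^ b) UNIV"
          by (simp add: mult_ac)
      qed
    qed
    hence "r b = 0" using ups_zero[of "x ^ 2" r b] x by simp
    thus ?thesis using r[of b] by simp
  qed
  have "ups (\<lambda>a. c a b) X 0" if "0 < X" "X < \<delta> ^ 2" for X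
    using row[of "sqrt X" b] that \<delta> by (simp add: real_less_lsqrt)
  thus ?thesis using ups_zero[of "\<delta> ^ 2" "\<lambda>a. c a b" a] \<delta> by simp
qed

text \<open>The half-angle formula cot u = cot(2 u) + 1/sin(2 u), in the normalisation of
  \<open>cfun\<close>.\<close>

lemma cfun_half:
  assumes "t \<noteq> 0" "sin (pi * t) \<noteq> 0"
  shows "cfun (t / 2) = cfun t + (1 / t - theta t)"
proof -
  define s c where "s = sin (pi * t / 2)" "c = cos (pi * t / 2)"
  have d: "sin (pi * t) = 2 * s * c" "cos (pi * t) = c ^ 2 - s ^ 2"
    using sin_double[of "pi * t / 2"] cos_double[of "pi * t / 2"] by (simp_all add: s_c_def)
  have nz: "s \<noteq> 0" "c \<noteq> 0" using assms(2) unfolding d by auto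
  have "1 / (2 * s * c) + (c ^ 2 - s ^ 2) / (2 * s * c) = c / s"
    by (rule half_angle[OF nz]) (simp add: s_c_def)
  moreover have "cot (pi * t) = (c ^ 2 - s ^ 2) / (2 * s * c)" "cot (pi * (t / 2)) = c / s"
    by (simp_all add: cot_def d) (simp_all add: s_c_def)
  ultimately have h: "pi * (1 / sin (pi * t)) + pi * cot (pi * t) = pi * cot (pi * (t / 2))"
    unfolding d by (simp only: distrib_left[symmetric])
  have "cfun (t / 2) = 2 / t - pi * cot (pi * (t / 2))" by (simp add: cfun_def)
  also have "\<dots> = 2 / t - (pi * (1 / sin (pi * t)) + pi * cot (pi * t))" unfolding h ..
  finally show ?thesis by (simp add: cfun_def theta_def)
qed

context gen_vars
begin

abbreviation "Px \<equiv> 1 / (cos (pi * (x + y) / 2) * cos (pi * (x - y) / 2))"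
abbreviation "P0x \<equiv> 1 / (cos (pi * x / 2) * cos (pi * x / 2))"

lemma sin_nz: "sin (pi * x) \<noteq> 0" "sin (pi * y) \<noteq> 0" "sin (pi * (x + y)) \<noteq> 0" "sin (pi * (x - y)) \<noteq> 0"
proof -
  have "sin (pi * t) > 0" if "0 < t" "t < 1" for t
    by (rule sin_gt_zero) (use that in auto)
  from this[of x] this[of y] this[of "x + y"] this[of "x - y"] show
    "sin (pi * x) \<noteq> 0" "sin (pi * y) \<noteq> 0" "sin (pi * (x + y)) \<noteq> 0" "sin (pi * (x - y)) \<noteq> 0" using xy by auto
qed

text \<open>The identities for the angles pi (x + y)/2 and pi (x - y)/2, whose sum and difference
  are pi x and pi y. Factors pi^2 and pi^3 convert them to theta and pi cot.\<close>

lemma trig_relations: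
  defines "C \<equiv> \<lambda>t. pi * cot (pi * t)"
  shows "theta x * (C (x + y) + C (x - y) + theta (x + y) + theta (x - y)) / 4 + theta y * (C (x + y) - C (x - y)) / 2
      - C x * theta x + theta x ^ 2 - pi ^ 2 * P0x / 2 + pi ^ 2 * Px / 4 = 0"
    "- (pi ^ 2) * theta y / 2 + C x * theta x * (C (x - y) - C (x + y) + theta (x + y) - theta (x - y)) / 4 + C x * C y * theta x / 2
      - C y ^ 2 * theta y / 2 + pi ^ 2 * Px * C y / 4 - theta x ^ 2 * theta y / 2 + theta y ^ 3 / 2 = 0"
    "theta y ^ 2 = C y ^ 2 + pi ^ 2"
proof -
  define \<alpha> \<beta> where "\<alpha> = pi * (x + y) / 2" and "\<beta> = pi * (x - y) / 2"
  have s: "\<alpha> + \<beta> = pi * x" "\<alpha> - \<beta> = pi * y" "2 * \<alpha> = pi * (x + y)" "2 * \<beta> = pi * (x - y)"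
    by (simp_all add: \<alpha>_def \<beta>_def field_simps)
  have nz: "sin \<alpha> \<noteq> 0" "cos \<alpha> \<noteq> 0" "sin \<beta> \<noteq> 0" "cos \<beta> \<noteq> 0"
    using sin_nz(3,4) sin_double[of \<alpha>] sin_double[of \<beta>] unfolding s by auto
  note t = trig_identities[OF nz, unfolded s, OF sin_nz(1,2), unfolded \<alpha>_def \<beta>_def]
  have th: "theta t = pi * (1 / sin (pi * t))" for t by (simp add: theta_def)
  have g1: "(pi * a) * (pi * b + pi * c + pi * d + pi * f) / 4 + (pi * g) * (pi * b - pi * c) / 2 - pi * k * (pi * a) + (pi * a) ^ 2 - pi ^ 2 * l / 2 + pi ^ 2 * m / 4
      = pi ^ 2 * (a * (b + c + d + f) / 4 + g * (b - c) / 2 - k * a + a ^ 2 - l / 2 + m / 4)" for a b c d f g k l m :: real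
    by (simp add: algebra_simps power2_eq_square add_divide_distrib diff_divide_distrib)
  have g2: "- (pi ^ 2) * (pi * g) / 2 + pi * k * (pi * a) * (pi * c - pi * b + pi * d - pi * f) / 4 + pi * k * (pi * n) * (pi * a) / 2
      - (pi * n) ^ 2 * (pi * g) / 2 + pi ^ 2 * m * (pi * n) / 4 - (pi * a) ^ 2 * (pi * g) / 2 + (pi * g) ^ 3 / 2
     = pi ^ 3 * (- g / 2 + k * a * (c - b + d - f) / 4 + k * n * a / 2 - n ^ 2 * g / 2 + m * n / 4 - a ^ 2 * g / 2 + g ^ 3 / 2)" for a b c d f g k m n :: real
    by (simp add: algebra_simps power2_eq_square power3_eq_cube add_divide_distrib diff_divide_distrib)
  show "theta x * (C (x + y) + C (x - y) + theta (x + y) + theta (x - y)) / 4 + theta y * (C (x + y) - C (x - y)) / 2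
      - C x * theta x + theta x ^ 2 - pi ^ 2 * P0x / 2 + pi ^ 2 * Px / 4 = 0"
    unfolding th C_def g1 by (simp only: t(1) mult_zero_right)
  show "- (pi ^ 2) * theta y / 2 + C x * theta x * (C (x - y) - C (x + y) + theta (x + y) - theta (x - y)) / 4 + C x * C y * theta x / 2
      - C y ^ 2 * theta y / 2 + pi ^ 2 * Px * C y / 4 - theta x ^ 2 * theta y / 2 + theta y ^ 3 / 2 = 0"
    unfolding th C_def g2 by (simp only: t(2) mult_zero_right)
  have "(1 / sin (pi * y)) ^ 2 = cot (pi * y) ^ 2 + 1"
    using sin_nz(2) sin_cos_squared_add[of "pi * y"] by (simp add: cot_def power_divide divide_simps add.commute)
  thus "theta y ^ 2 = C y ^ 2 + pi ^ 2"
    unfolding th C_def power_mult_distrib by (simp only: distrib_left mult_1_right)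
qed

text \<open>The quotients 1/(x + y) and 1/(x - y) enter through their sum and difference, which are
  multiples of e, except in f m and g n. These two will cancel against the fourth term of
  \<open>S3\<close>.\<close>

lemma E3_trig_eq:
  fixes f g cx cy i j m n e :: real
  assumes defs: "f = cfun ((x + y) / 2)" "g = cfun ((x - y) / 2)" "cx = cfun x" "cy = cfun y" "i = 1 / x" "j = 1 / y"
    "m = 1 / (x + y)" "n = 1 / (x - y)" "e = 1 / (x ^ 2 - y ^ 2)"
  shows "E3_trig = i * j / 2 * (f * cx / 2 - g * cx / 2 - (i - j) * f / 2 + (i + j) * g / 2 - 2 * y * cx * e + 2 * x * cy * e + 2 * (f * m) - 2 * (g * n))"
proof -
  have nz': "x + y \<noteq> 0" "x - y \<noteq> 0" using xy by auto
  have mn: "n - m = 2 * y * e" "n + m = 2 * x * e"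
  proof -
    have "x ^ 2 - y ^ 2 = (x + y) * (x - y)" by (simp add: power2_eq_square algebra_simps)
    thus "n - m = 2 * y * e" "n + m = 2 * x * e" using nz' unfolding defs by (simp_all add: divide_simps)
  qed
  have u: "1 / ((x + y) / 2 - x) = - 2 * n" "1 / ((x + y) / 2 - y) = 2 * n" "1 / ((x - y) / 2 - x) = - 2 * m" "1 / ((x - y) / 2 - (- y)) = 2 * m"
    "1 / ((x + y) / 2) = 2 * m" "1 / ((x - y) / 2) = 2 * n"
  proof -
    have "(x + y) / 2 - x = - ((x - y) / 2)" "(x + y) / 2 - y = (x - y) / 2" "(x - y) / 2 - x = - ((x + y) / 2)" "(x - y) / 2 - (- y) = (x + y) / 2"
      by (simp_all add: field_simps)
    note e = this
    have h: "1 / (- (d / 2)) = - 2 * (1 / d)" "1 / (d / 2) = 2 * (1 / d)" for d :: real by simp_all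
    show "1 / ((x + y) / 2 - x) = - 2 * n" "1 / ((x + y) / 2 - y) = 2 * n" "1 / ((x - y) / 2 - x) = - 2 * m" "1 / ((x - y) / 2 - (- y)) = 2 * m"
      "1 / ((x + y) / 2) = 2 * m" "1 / ((x - y) / 2) = 2 * n" by (simp_all only: e h defs)
  qed
  have Dg: "Dg s t = (cfun s - cfun t) * (1 / (s - t)) - cfun s * (1 / s) - cfun t * (1 / t) + pi ^ 2 / 3" for s t
    by (simp add: Dg_def)
  have 1: "Dg ((x + y) / 2) x = (f - cx) * (- 2 * n) - f * (2 * m) - cx * i + pi ^ 2 / 3"
    "Dg ((x + y) / 2) y = (f - cy) * (2 * n) - f * (2 * m) - cy * j + pi ^ 2 / 3"
    "Dg ((x - y) / 2) x = (g - cx) * (- 2 * m) - g * (2 * n) - cx * i + pi ^ 2 / 3"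
    unfolding Dg u by (simp_all only: defs)
  have 2: "Dg ((x - y) / 2) (- y) = (g + cy) * (2 * m) - g * (2 * n) - cy * j + pi ^ 2 / 3"
    unfolding Dg u by (simp add: defs)
  have 3: "1 / (2 * x) = i / 2" "1 / (2 * y) = j / 2" by (simp_all add: defs)
  have 4: "a / (2 * x * y) = i * j / 2 * a" for a by (simp add: defs)
  have "E3_trig = i * j / 2 * (f * cx / 2 - g * cx / 2 - (i - j) * f / 2 + (i + j) * g / 2 - cx * (n - m) + cy * (n + m) + 2 * (f * m) - 2 * (g * n))"
    unfolding E3_trig_def 1 2 3 4 defs(1-4)[symmetric] by (simp add: algebra_simps add_divide_distrib diff_divide_distrib)
  thus ?thesis unfolding mn by (simp add: mult_ac)
qed

text \<open>Every summand is reduced to a polynomial in atoms: inverses of x, y, x + y, x - y, x^2 -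
  y^2, values of theta, \<open>cfun\<close> and \<open>Afun\<close>, and the double sums.
  Quasi-shuffle relations leave \<open>Lyx\<close>, \<open>Exy\<close> and \<open>LA\<close>, which
  agree on both sides like the products of \<open>Afun\<close> values; the elementary rest is
  \<open>trig_remainder\<close>.\<close>

lemma gf_identity:
  "- 2 * resolvent V x =
   (8 * (BX * Lyx) - 8 * (BY * (LA / y ^ 2)) - 2 * (BX * E3))
   + (y ^ 2 * (BX * (Afun y / y ^ 2 * ((W2 (x + y) - W2 (x - y)) / (2 * x * y))))
     + x ^ 2 * (8 * (Afun x / x ^ 2 * (BX * ((Abar (x + y) - Abar (x - y)) / (2 * x * y)))))
     - x ^ 2 * (x ^ 2 * (8 * (Afun x / x ^ 2 * (Afun x / x ^ 2) * Qe y)))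
     + 8 * (Afun x * (Afun y / y ^ 2 * BY))
     + y ^ 2 * (4 * (Afun y / y ^ 2 * (Afun y / y ^ 2 * BY)))
     + x ^ 2 * (8 * ((Afun x / x ^ 2 * (BY * ((Afun (x + y) + Afun (x - y)) / 2)) - Afun x / x ^ 2 * (- 1 / 2 * Afun x)) / y ^ 2))
     - 8 * (BY * (Afun y / y ^ 2 * ((Afun (x + y) + Afun (x - y)) / 2))))
   + (- (3 * (pi ^ 2 / 6) * ((Px - P0x) / y ^ 2)) + 3 * (pi ^ 2 / 6) * (Q1 y * Px)
     + (2 * ((Qe x - Qe y) / (x ^ 2 - y ^ 2))
     + 4 * (BX * ((Q1 ((x + y) / 2) - Q1 ((x - y) / 2)) / (2 * x * y)))
     + 8 * (BX * (Q1 x * (((x + y) * Qe (x + y) - (x - y) * Qe (x - y)) / (2 * y))))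
     + 4 * ((BY * (((x + y) * Q1 (x + y) + (x - y) * Q1 (x - y)) / (2 * x) - ((x + y) * Q1 (x + y) - (x - y) * Q1 (x - y)) / (2 * y)) - Dz) / y ^ 2)
     - 4 * ((BY * ((x ^ 2 * Q1 x - y ^ 2 * Q1 y) / (x ^ 2 - y ^ 2)) + Q1 x / 2) / y ^ 2)
     - 4 * (Q1 y * (Q1 y * BY))
     + 8 * ((BY * Q1 y + pi ^ 2 / 12) / y ^ 2)
     - 8 * (pi ^ 2 / 6) * Qe y))"
  (is "_ = (?a1 - ?a2 - ?a3) + (?g1 + ?g2 - ?g3 + ?g4 + ?g5 + ?g6 - ?g7) + (- ?h1 + ?h2 + (?h3 + ?h4 + ?h5 + ?h6 - ?h7 - ?h8 + ?h9 - ?h10))")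
proof -
  define i j e m n where defs: "i = 1 / x" "j = 1 / y" "e = 1 / (x ^ 2 - y ^ 2)" "m = 1 / (x + y)" "n = 1 / (x - y)"
  define Tx Ty cx cy cp cm sp sm where at: "Tx = theta x" "Ty = theta y" "cx = cfun x" "cy = cfun y" "cp = cfun (x + y)" "cm = cfun (x - y)"
    "sp = 1 / (x + y) - theta (x + y)" "sm = 1 / (x - y) - theta (x - y)"
  define a b ap am hp hm where as: "a = Afun x" "b = Afun y" "ap = Afun (x + y)" "am = Afun (x - y)" "hp = Afun ((x + y) / 2)" "hm = Afun ((x - y) / 2)"
  define P P0 pi2 where ps: "P = Px" "P0 = P0x" "pi2 = pi ^ 2"
  have nz': "x + y \<noteq> 0" "x - y \<noteq> 0" using xy by auto
  have xi: "x * i = 1" and yj: "y * j = 1" and ee: "e * (x ^ 2 - y ^ 2) = 1" using nz xy_sq by (simp_all add: defs)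
  have dv: "z / x = i * z" "z / y = j * z" "z / (x ^ 2 - y ^ 2) = e * z" "z / (2 * x) = i * z / 2" "z / (2 * y) = j * z / 2"
    "z / (2 * x * y) = i * j * z / 2" "z / y ^ 2 = j ^ 2 * z" "z / x ^ 2 = i ^ 2 * z" for z
    by (simp_all add: defs power2_eq_square)
  have mn: "n - m = 2 * y * e" "n + m = 2 * x * e"
  proof -
    have "x ^ 2 - y ^ 2 = (x + y) * (x - y)" by (simp add: power2_eq_square algebra_simps)
    thus "n - m = 2 * y * e" "n + m = 2 * x * e" using nz' unfolding defs by (simp_all add: divide_simps)
  qed
  have ff: "cfun ((x + y) / 2) = cp + sp" "cfun ((x - y) / 2) = cm + sm"
    using cfun_half[OF nz'(1) sin_nz(3)] cfun_half[OF nz'(2) sin_nz(4)] by (simp_all add: at)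
  have C: "pi * cot (pi * x) = i - cx" "pi * cot (pi * y) = j - cy" "pi * cot (pi * (x + y)) = m - cp" "pi * cot (pi * (x - y)) = n - cm"
    "theta (x + y) = m - sp" "theta (x - y) = n - sm"
    by (simp_all add: defs at cfun_def)
  have Q: "Q1 x = cx * i / 2" "Q1 y = cy * j / 2" "Qe x = (i - Tx) * i / 2" "Qe y = (j - Ty) * j / 2"
    by (simp_all add: Q1_def Qe_def defs at)
  have Qp: "(x + y) * Q1 (x + y) = cp / 2" "(x - y) * Q1 (x - y) = cm / 2" "(x + y) * Qe (x + y) = sp / 2" "(x - y) * Qe (x - y) = sm / 2"
    "Q1 ((x + y) / 2) = (cp + sp) * m" "Q1 ((x - y) / 2) = (cm + sm) * n"
  proof -
    have q: "t * Q1 t = cfun t / 2" "t * Qe t = (1 / t - theta t) / 2" if "t \<noteq> 0" for t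
      using that by (simp_all add: Q1_def Qe_def)
    have q2: "Q1 (t / 2) = cfun (t / 2) * (1 / t)" for t by (simp add: Q1_def)
    show "(x + y) * Q1 (x + y) = cp / 2" "(x - y) * Q1 (x - y) = cm / 2" "(x + y) * Qe (x + y) = sp / 2" "(x - y) * Qe (x - y) = sm / 2"
      using q[OF nz'(1)] q[OF nz'(2)] by (simp_all only: at)
    show "Q1 ((x + y) / 2) = (cp + sp) * m" "Q1 ((x - y) / 2) = (cm + sm) * n"
      unfolding q2 ff by (simp_all only: defs)
  qed
  have Ab: "Abar (x + y) = hp - ap" "Abar (x - y) = hm - am" by (simp_all add: Abar_def as)
  \<comment> \<open>What the formula for the resolvent leaves after the elementary part of the third
    sum of \<open>S1\<close> has been moved over; \<open>rr\<close> is the elementary part of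
    \<open>S3\<close> apart from the term with \<open>K2\<close>.\<close>
  define tr where "tr = i * (Ty * j * (cx - cp / 2 - cm / 2) - Tx * j / 2 * (sp - sm))
    + 2 * Ty * j * ((Ty ^ 2 - j ^ 2) / 4 - pi2 / 12 + (pi2 / 6 + (y ^ 2 * cx * i - x ^ 2 * cy * j) * e / 2))
    + Tx * i * j * (j - Ty)
    - Tx * e * (cx - x * cy * j)
    - Tx * ((i - Tx) * (j - Ty) * j / 2 - cx * cy * j / 2 + (cy + j - Ty) * j * i / 2 - (cx + i - Tx) * j ^ 2 / 2)
    - Tx * j / 2 * ((cp + sp) * cx / 2 - (cm + sm) * cx / 2 - (i - j) * (cp + sp) / 2 + (i + j) * (cm + sm) / 2 - 2 * y * cx * e + 2 * x * cy * e)"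
  define rr where "rr = - (pi2 / 2 * (P - P0) * j ^ 2) + pi2 / 2 * P * cy * j / 2 + ((i - Tx) * i - (j - Ty) * j) * e
    - Tx * cx * (sp - sm) * j / 2
    + (- (Ty * j) * ((cp + cm) * i - (cp - cm) * j) / 2 - j ^ 2 * (Tx ^ 2 - i ^ 2 - cx * i))
    - (- (Ty * j) * (x * cx - y * cy) * e + cx * i * j ^ 2)
    + Ty * cy ^ 2 * j / 2
    + (2 * pi2 * j ^ 2 / 3 - 2 * Ty * cy * j ^ 2)
    - 2 * pi2 / 3 * (j - Ty) * j"
  have "tr = rr" unfolding tr_def rr_def
  proof (rule trig_remainder[OF xi yj ee])
    note t = trig_relations[unfolded C, folded at(1,2) ps]
    show "Ty ^ 2 = (j - cy) ^ 2 + pi2" using t(3) .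
    have "m - cp + (n - cm) + (m - sp) + (n - sm) = 4 * x * e - (cp + cm + sp + sm)" "m - cp - (n - cm) = - 2 * y * e - cp + cm"
      using mn by linarith+
    thus "Tx * (4 * x * e - (cp + cm + sp + sm)) / 4 + Ty * (- 2 * y * e - cp + cm) / 2 - (i - cx) * Tx + Tx ^ 2 - pi2 * P0 / 2 + pi2 * P / 4 = 0"
      using t(1) by (simp only:)
    have "n - cm - (m - cp) + (m - sp) - (n - sm) = cp - cm - sp + sm" by simp
    thus "- pi2 * Ty / 2 + (i - cx) * Tx * (cp - cm - sp + sm) / 4 + (i - cx) * (j - cy) * Tx / 2 - (j - cy) ^ 2 * Ty / 2 + pi2 * P * (j - cy) / 4
       - Tx ^ 2 * Ty / 2 + Ty ^ 3 / 2 = 0" using t(2) by (simp only:)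
  qed
  have x2: "x ^ 2 * (i ^ 2 * z) = z" "x * (i * z) = z" "i * (x * z) = z" "y ^ 2 * (j ^ 2 * z) = z" "y * (j * z) = z" "j * (y * z) = z"
    "j ^ 2 * (y * z) = j * z" "y * (j ^ 2 * z) = j * z" "x ^ 2 * (i * z) = x * z" "y ^ 2 * (j * z) = y * z" for z
    using xi yj by algebra+
  have BX: "BX * z = - (x * (Tx * z)) / 2" and BY: "BY * z = - (y * (Ty * z)) / 2" for z by (simp_all add: at)
  have a1: "?a1 = - 4 * (x * Tx * Lyx)" unfolding BX by (simp add: mult_ac)
  have yj2: "y * j ^ 2 = j" "j ^ 2 * y = j" using yj by algebra+
  have a2: "?a2 = - 4 * (Ty * j * LA)" unfolding BY dv by (simp add: x2 yj2 mult_ac)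
  have E3: "E3 = i * j * (b * (hp - hm)) + i * j / 2 * ((cp + sp) * cx / 2 - (cm + sm) * cx / 2 - (i - j) * (cp + sp) / 2 + (i + j) * (cm + sm) / 2 - 2 * y * cx * e + 2 * x * cy * e + 2 * ((cp + sp) * m) - 2 * ((cm + sm) * n)) + 2 * KK"
    unfolding E3_formula E3_trig_eq[OF ff(1)[symmetric] ff(2)[symmetric] at(3,4) defs(1,2,4,5,3)] as[symmetric] by (simp add: defs)
  define K1 where "K1 = (cp + sp) * cx / 2 - (cm + sm) * cx / 2 - (i - j) * (cp + sp) / 2 + (i + j) * (cm + sm) / 2 - 2 * y * cx * e + 2 * x * cy * e"
  define K2 where "K2 = (cp + sp) * m - (cm + sm) * n"
  \<comment> \<open>The quasi-shuffle relations eliminate \<open>Lxy\<close> and \<open>Eyx\<close>;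
    their diagonal terms cancel.\<close>
  have KK2: "2 * KK = 4 * Lyx - 4 * Exy + 2 * (Qe x * Qe y) - 2 * (Q1 x * Q1 y) + 2 * Z0"
    using Lxy_Lyx Exy_Eyx unfolding KK_def by (simp add: algebra_simps)
  have a3: "- ?a3 = Tx * j * (b * (hp - hm)) + Tx * j / 2 * K1 + Tx * j * K2 + x * Tx * (2 * KK)"
  proof -
    have e: "E3 = i * (j * (b * (hp - hm)) + j / 2 * K1 + j * K2) + 2 * KK" unfolding E3 K1_def K2_def by (simp add: field_simps power2_eq_square power3_eq_cube)
    have "- ?a3 = x * (Tx * E3)" unfolding BX by simp
    also have "\<dots> = x * (i * (Tx * (j * (b * (hp - hm)) + j / 2 * K1 + j * K2))) + x * Tx * (2 * KK)"
      unfolding e by (simp only: distrib_left mult.left_commute mult.assoc)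
    finally have "- ?a3 = x * (i * (Tx * (j * (b * (hp - hm)) + j / 2 * K1 + j * K2))) + x * Tx * (2 * KK)" .
    thus ?thesis unfolding x2 by (simp add: algebra_simps)
  qed
  have g1: "?g1 = Tx * j * b * ((hp - hm) - 2 * (ap - am))"
  proof -
    have "?g1 = - ((y * j) ^ 2 * ((x * i) * (Tx * j * b * ((4 * hp - 8 * (hp - ap)) - (4 * hm - 8 * (hm - am)))))) / 4"
      unfolding BX dv Ab as[symmetric] by (simp add: power2_eq_square power3_eq_cube mult_ac)
    also have "\<dots> = - (Tx * j * b * ((4 * hp - 8 * (hp - ap)) - (4 * hm - 8 * (hm - am)))) / 4" unfolding xi yj by simp
    finally show ?thesis by (rule trans) (simp add: field_simps power2_eq_square power3_eq_cube)
  qed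
  have g2: "?g2 = - 2 * (Tx * j * a * ((hp - ap) - (hm - am)))"
  proof -
    have "?g2 = - 2 * ((x * i) ^ 3 * (Tx * j * a * ((hp - ap) - (hm - am))))"
      unfolding BX dv Ab as[symmetric] by (simp add: power2_eq_square power3_eq_cube field_simps)
    thus ?thesis by (rule trans) (simp add: xi)
  qed
  have g3: "?g3 = 4 * (a ^ 2 * j ^ 2) - 4 * (a ^ 2 * (Ty * j))"
  proof -
    have "?g3 = 8 * (a * a * ((j - Ty) * j / 2))" unfolding Q as[symmetric] using nz by (simp add: power2_eq_square)
    thus ?thesis by (rule trans) (simp add: field_simps power2_eq_square power3_eq_cube)
  qed
  have g4: "?g4 = - 4 * (a * b * (Ty * j))"
  proof -
    have "?g4 = - 4 * ((y * j) * (a * b * (Ty * j)))"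
      unfolding mult.commute[of _ BY] BY dv as[symmetric] by (simp add: power2_eq_square power3_eq_cube mult_ac)
    thus ?thesis by (rule trans) (simp add: yj)
  qed
  have g5: "?g5 = - 2 * (b ^ 2 * (Ty * j))"
  proof -
    have "?g5 = - 2 * ((y * j) ^ 3 * (b ^ 2 * (Ty * j)))"
      unfolding mult.commute[of _ BY] BY dv as[symmetric] by (simp add: power2_eq_square power3_eq_cube mult_ac)
    thus ?thesis by (rule trans) (simp add: yj)
  qed
  have g6: "?g6 = - 2 * (a * (Ty * j) * (ap + am)) + 4 * (a ^ 2 * j ^ 2)"
  proof -
    have "?g6 = - 2 * ((x * i) ^ 2 * ((y * j) * (a * (Ty * j) * (ap + am)))) + 4 * ((x * i) ^ 2 * (a ^ 2 * j ^ 2))"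
      unfolding BY dv as[symmetric] by (simp add: power2_eq_square power3_eq_cube field_simps)
    thus ?thesis by (rule trans) (simp add: xi yj)
  qed
  have g7: "?g7 = - 2 * (Ty * j * b * (ap + am))"
  proof -
    have "?g7 = - 2 * ((y * j) * (Ty * j * b * (ap + am)))"
      unfolding BY dv as[symmetric] by (simp add: power2_eq_square power3_eq_cube field_simps)
    thus ?thesis by (rule trans) (simp add: yj)
  qed
  have h1: "?h1 = pi2 / 2 * (P - P0) * j ^ 2" unfolding dv ps[symmetric] by simp
  have h2: "?h2 = pi2 / 2 * P * cy * j / 2" unfolding Q ps[symmetric] by simp
  have h3: "?h3 = ((i - Tx) * i - (j - Ty) * j) * e" unfolding Q dv by (simp add: diff_divide_distrib[symmetric])
  have h4: "?h4 = - (Tx * j * K2)" unfolding Qp BX dv K2_def by (simp add: x2 mult_ac)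
  have h5: "?h5 = - (Tx * cx * (sp - sm) * j / 2)"
  proof -
    have "?h5 = 8 * (- (x * (i * (Tx * cx / 2 * (j * (sp / 2 - sm / 2) / 2)))) / 2)"
      unfolding Qp Q BX dv by (simp add: mult_ac)
    thus ?thesis by (rule trans) (unfold x2, (simp add: field_simps power2_eq_square power3_eq_cube))
  qed
  have h6: "?h6 = - (Ty * j) * ((cp + cm) * i - (cp - cm) * j) / 2 - j ^ 2 * (Tx ^ 2 - i ^ 2 - cx * i)"
  proof -
    have Dz: "4 * Dz = Tx ^ 2 - i ^ 2 - cx * i" unfolding Dz_def Q by (simp add: defs at power_divide)
    have "?h6 = - 2 * (j ^ 2 * (y * (Ty * (i * (cp / 2 + cm / 2) / 2 - j * (cp / 2 - cm / 2) / 2)))) - j ^ 2 * (4 * Dz)"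
      unfolding Qp BY dv by (simp add: field_simps power2_eq_square power3_eq_cube)
    thus ?thesis by (rule trans) (unfold x2 Dz, (simp add: field_simps power2_eq_square power3_eq_cube))
  qed
  have h7: "?h7 = - (Ty * j) * (x * cx - y * cy) * e + cx * i * j ^ 2"
  proof -
    have "x ^ 2 * Q1 x - y ^ 2 * Q1 y = (x ^ 2 * (i * cx) - y ^ 2 * (j * cy)) / 2" unfolding Q by (simp add: mult_ac diff_divide_distrib)
    also have "\<dots> = (x * cx - y * cy) / 2" unfolding x2 ..
    finally have xq: "x ^ 2 * Q1 x - y ^ 2 * Q1 y = (x * cx - y * cy) / 2" .
    have "?h7 = - 2 * (j ^ 2 * (y * (Ty * (e * ((x * cx - y * cy) / 2))))) + cx * i * j ^ 2"
      unfolding xq unfolding BY dv Q by (simp add: field_simps power2_eq_square power3_eq_cube)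
    thus ?thesis by (rule trans) (unfold x2, (simp add: field_simps power2_eq_square power3_eq_cube))
  qed
  have h8: "?h8 = - (Ty * cy ^ 2 * j / 2)"
  proof -
    have "?h8 = - 1 / 2 * (y * (j ^ 2 * (Ty * cy ^ 2)))" unfolding Q by (simp add: at power2_eq_square mult_ac)
    thus ?thesis by (rule trans) (unfold x2, simp add: mult_ac)
  qed
  have h9: "?h9 = 2 * pi2 * j ^ 2 / 3 - 2 * Ty * cy * j ^ 2"
  proof -
    have "?h9 = - 2 * (y * (j * (j ^ 2 * (Ty * cy)))) + 2 * pi2 * j ^ 2 / 3" unfolding Q BY dv ps by (simp add: algebra_simps)
    thus ?thesis by (rule trans) (unfold x2, simp add: mult_ac)
  qed
  have h10: "?h10 = 2 * pi2 / 3 * (j - Ty) * j" unfolding Q ps by (simp add: mult_ac)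
  obtain S where S: "(fterm has_sum S) {1..}" and F: "- 2 * resolvent V x = - 2 * (Afun x - Afun y) * w_plus + S + w_minus / x"
    using resolvent_V_eq by blast
  have S': "S = 2 * Ty * j * ((- (b ^ 2) + (Ty ^ 2 - j ^ 2) / 4 - pi2 / 12) + 2 * LA + (pi2 / 6 + (y ^ 2 * cx * i - x ^ 2 * cy * j) * e / 2))
     + Tx * (i * j * (j - Ty) - 2 * x * (2 * Exy) - e * (cx - x * cy * j))"
  proof -
    have d1: "(y ^ 2 * Q1 x - x ^ 2 * Q1 y) / (x ^ 2 - y ^ 2) = (y ^ 2 * cx * i - x ^ 2 * cy * j) * e / 2"
      unfolding Q dv by (simp add: algebra_simps)
    have d2: "2 * x * dg = e * (cx - x * cy * j)"
    proof -
      have "2 * x * dg = e * (x * (i * cx) - x * cy * j)" unfolding dg_def Q dv by (simp add: algebra_simps)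
      thus ?thesis unfolding x2 .
    qed
    have d3: "2 * x * (2 * Exy + dg) = 2 * x * (2 * Exy) + 2 * x * dg" by (simp add: algebra_simps)
    have d5: "2 * Ty / y = 2 * Ty * j" "1 / y ^ 2 = j ^ 2" "2 / x = 2 * i" by (simp_all add: at defs power_divide)
    have d4: "2 / x * Qe y = i * j * (j - Ty)" unfolding Q d5 by (simp add: mult_ac)
    show ?thesis unfolding has_sum_unique[OF S fterm_has_sum] d1 d3 d2 d4 as(2)[symmetric] ps(3)[symmetric] at(1,2)[symmetric] unfolding d5(1,2) by (simp add: algebra_simps)
  qed
  have w1: "w_plus = j * (Ty * (ap + am - 2 * a) + Tx * ((hp - ap) - (hm - am)))"
    unfolding w_plus_def Ab as[symmetric] at(1,2)[symmetric] dv ..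
  have w2: "w_minus / x = i * (Ty * j * (cx - cp / 2 - cm / 2) - Tx * j / 2 * (sp - sm))"
    unfolding w_minus_def cfun_def[symmetric] unfolding at[symmetric] unfolding dv(1,2,5) by (simp add: field_simps power2_eq_square power3_eq_cube)
  have Z: "x * (2 * (Qe x * Qe y) - 2 * (Q1 x * Q1 y) + 2 * Z0) = (i - Tx) * (j - Ty) * j / 2 - cx * cy * j / 2 + (cy + j - Ty) * j * i / 2 - (cx + i - Tx) * j ^ 2 / 2"
  proof -
    have Z0: "2 * Z0 = i ^ 2 * (cy * j / 2 + (j - Ty) * j / 2) - j ^ 2 * (cx * i / 2 + (i - Tx) * i / 2)"
    proof -
      have "z / (2 * x ^ 2) = i ^ 2 * z / 2" "z / (2 * y ^ 2) = j ^ 2 * z / 2" for z by (simp_all add: defs power_divide)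
      thus ?thesis unfolding Z0_def Q by (simp only:) (simp add: field_simps power2_eq_square power3_eq_cube)
    qed
    have "2 * (Qe x * Qe y) - 2 * (Q1 x * Q1 y) + 2 * Z0 = i * ((i - Tx) * (j - Ty) * j / 2 - cx * cy * j / 2 + (cy + j - Ty) * j * i / 2 - (cx + i - Tx) * j ^ 2 / 2)"
      unfolding Z0 Q by (simp add: algebra_simps power2_eq_square add_divide_distrib diff_divide_distrib)
    thus ?thesis by (simp only: x2)
  qed
  \<comment> \<open>Polynomial bookkeeping: \<open>Afun\<close> values and double sums match, the
    terms with \<open>K2\<close> cancel, and only \<open>tr\<close> is left over.\<close>
  have fin: "- 2 * (a - b) * (j * (Ty * (ap + am - 2 * a) + Tx * ((hp - ap) - (hm - am))))
      + (2 * Ty * j * ((- (b ^ 2) + (Ty ^ 2 - j ^ 2) / 4 - pi2 / 12) + 2 * LA + (pi2 / 6 + (y ^ 2 * cx * i - x ^ 2 * cy * j) * e / 2))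
     + Tx * (i * j * (j - Ty) - 2 * x * (2 * Exy) - e * (cx - x * cy * j)))
     + i * (Ty * j * (cx - cp / 2 - cm / 2) - Tx * j / 2 * (sp - sm))
    = - 4 * (x * Tx * Lyx) + 4 * (Ty * j * LA) + (Tx * j * (b * (hp - hm)) + Tx * j / 2 * K1 + Tx * j * K2
       + (Tx * x * (4 * Lyx - 4 * Exy) + Tx * ((i - Tx) * (j - Ty) * j / 2 - cx * cy * j / 2 + (cy + j - Ty) * j * i / 2 - (cx + i - Tx) * j ^ 2 / 2)))
     + (Tx * j * b * ((hp - hm) - 2 * (ap - am)) - 2 * (Tx * j * a * ((hp - ap) - (hm - am))) - (4 * (a ^ 2 * j ^ 2) - 4 * (a ^ 2 * (Ty * j)))
        - 4 * (a * b * (Ty * j)) - 2 * (b ^ 2 * (Ty * j)) + (- 2 * (a * (Ty * j) * (ap + am)) + 4 * (a ^ 2 * j ^ 2)) + 2 * (Ty * j * b * (ap + am)))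
     - Tx * j * K2 + tr"
    unfolding tr_def K1_def[symmetric] by (simp add: algebra_simps power2_eq_square[of a] power2_eq_square[of b])
  have KKx: "x * Tx * (2 * KK) = Tx * x * (4 * Lyx - 4 * Exy) + Tx * ((i - Tx) * (j - Ty) * j / 2 - cx * cy * j / 2 + (cy + j - Ty) * j * i / 2 - (cx + i - Tx) * j ^ 2 / 2)"
    unfolding KK2 Z[symmetric] by (simp add: algebra_simps)
  have "?a1 - ?a2 - ?a3 = - 4 * (x * Tx * Lyx) + 4 * (Ty * j * LA) + (Tx * j * (b * (hp - hm)) + Tx * j / 2 * K1 + Tx * j * K2 + x * Tx * (2 * KK))"
    using a1 a2 a3 by linarith
  moreover have "?g1 + ?g2 - ?g3 + ?g4 + ?g5 + ?g6 - ?g7 = (Tx * j * b * ((hp - hm) - 2 * (ap - am)) - 2 * (Tx * j * a * ((hp - ap) - (hm - am))) - (4 * (a ^ 2 * j ^ 2) - 4 * (a ^ 2 * (Ty * j)))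
        - 4 * (a * b * (Ty * j)) - 2 * (b ^ 2 * (Ty * j)) + (- 2 * (a * (Ty * j) * (ap + am)) + 4 * (a ^ 2 * j ^ 2)) + 2 * (Ty * j * b * (ap + am)))"
    using g1 g2 g3 g4 g5 g6 g7 by linarith
  moreover have "- ?h1 + ?h2 + (?h3 + ?h4 + ?h5 + ?h6 - ?h7 - ?h8 + ?h9 - ?h10) = - (Tx * j * K2) + rr"
    unfolding rr_def using h1 h2 h3 h4 h5 h6 h7 h8 h9 h10 by linarith
  ultimately show ?thesis
    unfolding F S' w1 w2 as(1,2)[symmetric] fin KKx \<open>tr = rr\<close> by linarith
qed

end

section \<open>Comparison of coefficients\<close>

context gen_vars
begin

lemma dps_mzsv: "dps (\<lambda>a b. mzsv (replicate a 2 @ [4] @ replicate b 2)) (x ^ 2) (y ^ 2) (- 2 * resolvent V x)"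
  using mzsv_has_sum by (simp add: dps_def power_mult mult.assoc)

lemma dps_S3:
  assumes sec: "\<And>t. \<bar>t\<bar> \<le> pi * x \<Longrightarrow> ups sec_coeff t (1 / cos t)"
  shows "dps S3_real (x ^ 2) (y ^ 2)
   (- (3 * (pi ^ 2 / 6) * ((Px - P0x) / y ^ 2)) + 3 * (pi ^ 2 / 6) * (Q1 y * Px)
     + (2 * ((Qe x - Qe y) / (x ^ 2 - y ^ 2))
     + 4 * (BX * ((Q1 ((x + y) / 2) - Q1 ((x - y) / 2)) / (2 * x * y)))
     + 8 * (BX * (Q1 x * (((x + y) * Qe (x + y) - (x - y) * Qe (x - y)) / (2 * y))))
     + 4 * ((BY * (((x + y) * Q1 (x + y) + (x - y) * Q1 (x - y)) / (2 * x) - ((x + y) * Q1 (x + y) - (x - y) * Q1 (x - y)) / (2 * y)) - Dz) / y ^ 2)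
     - 4 * ((BY * ((x ^ 2 * Q1 x - y ^ 2 * Q1 y) / (x ^ 2 - y ^ 2)) + Q1 x / 2) / y ^ 2)
     - 4 * (Q1 y * (Q1 y * BY))
     + 8 * ((BY * Q1 y + pi ^ 2 / 12) / y ^ 2)
     - 8 * (pi ^ 2 / 6) * Qe y))"
proof -
  have E: "dps euler_sum (x ^ 2) (y ^ 2) Px"
    by (rule dps_euler_sum[OF _ _ sec]) (use xy in auto)
  \<comment> \<open>The row b = 0 of the Euler sums, to be subtracted because the first sum of
    \<open>S3\<close> runs over r + s = 2 b + 2.\<close>
  have "dps euler_sum (x ^ 2) (0 ^ 2) (1 / (cos (pi * (x + 0) / 2) * cos (pi * (x - 0) / 2)))"
    by (rule dps_euler_sum[OF _ _ sec]) (use xy in auto)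
  hence row: "ups (\<lambda>a. euler_sum a 0) (x ^ 2) P0x" using dps_0[of euler_sum "x ^ 2"] by simp
  have rest: "dps S3_rest (x ^ 2) (y ^ 2) (2 * ((Qe x - Qe y) / (x ^ 2 - y ^ 2))
     + 4 * (BX * ((Q1 ((x + y) / 2) - Q1 ((x - y) / 2)) / (2 * x * y)))
     + 8 * (BX * (Q1 x * (((x + y) * Qe (x + y) - (x - y) * Qe (x - y)) / (2 * y))))
     + 4 * ((BY * (((x + y) * Q1 (x + y) + (x - y) * Q1 (x - y)) / (2 * x) - ((x + y) * Q1 (x + y) - (x - y) * Q1 (x - y)) / (2 * y)) - Dz) / y ^ 2)
     - 4 * ((BY * ((x ^ 2 * Q1 x - y ^ 2 * Q1 y) / (x ^ 2 - y ^ 2)) + Q1 x / 2) / y ^ 2)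
     - 4 * (Q1 y * (Q1 y * BY))
     + 8 * ((BY * Q1 y + pi ^ 2 / 12) / y ^ 2)
     - 8 * zt 2 * Qe y)"
    unfolding S3_rest_def[abs_def]
    by (intro dps_add dps_diff S3_h3 S3_h4 S3_h5 S3_h6 S3_h7 S3_h8 S3_h9 S3_h10)
  have "dps (\<lambda>a b. - (3 * zt 2 * euler_sum a (Suc b)) + 3 * zt 2 * (\<Sum>(t, c) | t + c = b. zt (2 * t + 2) * euler_sum a c) + S3_rest a b) (x ^ 2) (y ^ 2)
     (- (3 * zt 2 * ((Px - P0x) / y ^ 2)) + 3 * zt 2 * (Q1 y * Px) + (2 * ((Qe x - Qe y) / (x ^ 2 - y ^ 2))
     + 4 * (BX * ((Q1 ((x + y) / 2) - Q1 ((x - y) / 2)) / (2 * x * y)))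
     + 8 * (BX * (Q1 x * (((x + y) * Qe (x + y) - (x - y) * Qe (x - y)) / (2 * y))))
     + 4 * ((BY * (((x + y) * Q1 (x + y) + (x - y) * Q1 (x - y)) / (2 * x) - ((x + y) * Q1 (x + y) - (x - y) * Q1 (x - y)) / (2 * y)) - Dz) / y ^ 2)
     - 4 * ((BY * ((x ^ 2 * Q1 x - y ^ 2 * Q1 y) / (x ^ 2 - y ^ 2)) + Q1 x / 2) / y ^ 2)
     - 4 * (Q1 y * (Q1 y * BY))
     + 8 * ((BY * Q1 y + pi ^ 2 / 12) / y ^ 2)
     - 8 * zt 2 * Qe y))"
    by (intro dps_add[OF dps_add[OF dps_uminus[OF dps_cmult[OF dps_shift_down_y[OF E row nz(4)]]] dps_cmult[OF dps_mult_y[OF ups_y(3) E]]] rest])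
  thus ?thesis unfolding S3_real_def[abs_def] zt_2 .
qed

lemma dps_total:
  assumes sec: "\<And>t. \<bar>t\<bar> \<le> pi * x \<Longrightarrow> ups sec_coeff t (1 / cos t)"
  shows "dps (\<lambda>a b. mzsv (replicate a 2 @ [4] @ replicate b 2) - (S1 a b + S2 a b + S3_real a b)) (x ^ 2) (y ^ 2) 0"
proof -
  have 1: "dps S1 (x ^ 2) (y ^ 2) (8 * (BX * Lyx) - 8 * (BY * (LA / y ^ 2)) - 2 * (BX * E3))"
    unfolding S1_def[abs_def] by (intro dps_diff S1_first S1_second S1_third)
  have 2: "dps S2 (x ^ 2) (y ^ 2) (y ^ 2 * (BX * (Afun y / y ^ 2 * ((W2 (x + y) - W2 (x - y)) / (2 * x * y))))
     + x ^ 2 * (8 * (Afun x / x ^ 2 * (BX * ((Abar (x + y) - Abar (x - y)) / (2 * x * y)))))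
     - x ^ 2 * (x ^ 2 * (8 * (Afun x / x ^ 2 * (Afun x / x ^ 2) * Qe y)))
     + 8 * (Afun x * (Afun y / y ^ 2 * BY))
     + y ^ 2 * (4 * (Afun y / y ^ 2 * (Afun y / y ^ 2 * BY)))
     + x ^ 2 * (8 * ((Afun x / x ^ 2 * (BY * ((Afun (x + y) + Afun (x - y)) / 2)) - Afun x / x ^ 2 * (- 1 / 2 * Afun x)) / y ^ 2))
     - 8 * (BY * (Afun y / y ^ 2 * ((Afun (x + y) + Afun (x - y)) / 2))))"
    unfolding S2_def[abs_def]
    by (intro dps_add dps_diff S2_first S2_second S2_third S2_fourth S2_fifth S2_sixth S2_seventh)
  note d = dps_diff[OF dps_mzsv dps_add[OF dps_add[OF 1 2] dps_S3[OF sec]]]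
  show ?thesis by (rule dps_eq[OF d refl], assumption, rule gf_identity[THEN eq_iff_diff_eq_0[THEN iffD1]])
qed

end

theorem theoremA6:
  fixes a b :: nat
  shows "complex_of_real (mzsv (replicate a 2 @ [4] @ replicate b 2))
           = complex_of_real (S1 a b) + complex_of_real (S2 a b) + S3 a b"
proof -
  obtain \<epsilon> where \<epsilon>: "\<epsilon> > 0" "\<And>t. \<bar>t\<bar> < \<epsilon> \<Longrightarrow> ups sec_coeff t (1 / cos t)" by (rule sec_has_sum, rule that, assumption, blast)
  \<comment> \<open>The bound 1/4 is the range of \<open>gen_vars\<close>, and \<epsilon>/pi that of
    the secant series at arguments up to pi x.\<close>
  define \<delta> where "\<delta> = min (1 / 4) (\<epsilon> / pi)"
  have "\<delta> > 0" using \<epsilon>(1) by (simp add: \<delta>_def)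
  moreover have "dps (\<lambda>a b. mzsv (replicate a 2 @ [4] @ replicate b 2) - (S1 a b + S2 a b + S3_real a b)) (x ^ 2) (y ^ 2) 0"
    if small: "0 < y" "y < x" "x < \<delta>" for x y
  proof -
    interpret gen_vars x y by unfold_locales (use small in \<open>auto simp: \<delta>_def\<close>)
    show ?thesis
    proof (rule dps_total)
      fix t assume t: "\<bar>t\<bar> \<le> pi * x"
      have "x < \<epsilon> / pi" using small(3) unfolding \<delta>_def min_less_iff_conj by (rule conjunct2)
      hence "pi * x < \<epsilon>" by (simp add: pos_less_divide_eq mult.commute)
      thus "ups sec_coeff t (1 / cos t)" using t by (intro \<epsilon>(2)) simp
    qed
  qed
  ultimately have "mzsv (replicate a 2 @ [4] @ replicate b 2) - (S1 a b + S2 a b + S3_real a b) = 0"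
    by (rule dps_zero)
  hence "mzsv (replicate a 2 @ [4] @ replicate b 2) = S1 a b + S2 a b + S3_real a b" by simp
  thus ?thesis by (simp only: S3_eq of_real_add)
qed

end
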